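(* Assume all defects $\delta_k$ are zero, let $\pi$ be any permutation of $\{1,\dots,r\}$, and let $B^\pi(x,y)=\sum b_{\alpha\beta}x^\alpha y^\beta$ be the associated Bezoutian of generic multihomogeneous polynomials $f_0,\dots,f_n$ of degree $d$. Then $(b_{\alpha\beta})$ is a square matrix of dimension $$\dim K_0(m^\pi)=\binom{n}{l_1,\dots,l_r}d_1^{l_1}\cdots d_r^{l_r}=\frac{\deg R}{n+1}.$$ Furthermore, $\det(b_{\alpha\beta})=R(f_0,\dots,f_n)$.
   Context: Let $r\ge 1$ and let $l=(l_1,\dots,l_r)$, $d=(d_1,\dots,d_r)$ be vectors of positive integers; put $n=\sum_{k=1}^r l_k$. Let $X=\mathbb{P}^{l_1}\times\cdots\times\mathbb{P}^{l_r}$ over an algebraically closed field of characteristic zero. The defects are $\delta_k=l_k-\lceil l_k/d_k\rceil$. Resultant: $R(f_0,\dots,f_n)$ is the multihomogeneous resultant, the irreducible polynomial with relatively prime integer coefficients (unique up to sign) in the coefficients of multihomogeneous polynomials $f_0,\dots,f_n$, each of multidegree $d=(d_1,\dots,d_r)$ in variable groups of sizes $l_1+1,\dots,l_r+1$, which vanishes iff they have a common root in $X$; $\deg R$ is its total degree in all the coefficients. Weyman term: for $m\in\mathbb{Z}^r$, $K_0(m)=\bigoplus_{p=0}^{n+1}H^{p}(X,m-pd)^{\binom{n+1}{p}}$, where $H^q(X,a)$ is the $q$-th cohomology of $\mathcal{O}_X(a_1,\dots,a_r)$. Degree vectors: for a permutation $\pi$, $m^\pi_k=-l_k+d_k\sum_{j:\,\pi(j)\ge\pi(k)}l_j$;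 the dual permutation is $\pi'(i)=r+1-\pi(i)$. Bezoutian: denote by $x_{i0},\dots,x_{il_i}$ the $i$-th variable group; set $x_{i0}=1$ for all $i$ and still write $f_0,\dots,f_n$ for the dehomogenized polynomials in $x_i=(x_{i1},\dots,x_{il_i})$, $i=1,\dots,r$. Let $y_i=(y_{i1},\dots,y_{il_i})$ be new variables and $\sigma=\pi^{-1}$. Order the $n$ variables as $x_{\sigma(1)1},\dots,x_{\sigma(1)l_{\sigma(1)}},x_{\sigma(2)1},\dots,x_{\sigma(r)l_{\sigma(r)}}$. Form the $(n+1)\times(n+1)$ matrix whose $j$-th column ($j=0,\dots,n$) has as its successive entries $f_j$ with the first $s$ variables in this order replaced by the corresponding $y$ variables, $s=0,1,\dots,n$. Then $B^\pi(x,y)$ is the determinant of this matrix divided by $\prod_{i=1}^r\prod_{j=1}^{l_i}(x_{ij}-y_{ij})$. The matrix $(b_{\alpha\beta})$ has one index $\alpha=(\alpha_{ij})\in\mathbb{Z}_{\ge0}^n$ running over exponents with $\sum_j\alpha_{ij}\le m^{\pi'}_i$ for all $i$, and the other index $\beta=(\beta_{ij})\in\mathbb{Z}_{\ge0}^n$ over exponents with $\sum_j\beta_{ij}\le m^{\pi}_i$ for all $i$. *)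

theory Defs
  imports
    "Jordan_Normal_Form.Determinant"
    "HOL-Computational_Algebra.Computational_Algebra"
    "HOL-Library.Poly_Mapping"
    "HOL-Library.Product_Plus"
    "HOL-Library.FuncSet"
    "HOL-Combinatorics.Permutations"
begin

section \<open>Polynomials in several variables\<close>

text \<open>
  Polynomials are finitely supported maps from exponents to coefficients, with the
  convolution product of \<^theory>\<open>HOL-Library.Poly_Mapping\<close>.
  The variable \<open>x\<^sub>i\<^sub>j\<close> has index \<open>(i, j)\<close>, where \<open>1 \<le> i \<le> r\<close> and \<open>0 \<le> j \<le> l i\<close>.
\<close>

type_synonym var = "nat \<times> nat"
type_synonym expo = "var \<Rightarrow>\<^sub>0 nat"

definition mp_eval :: "('a::zero \<Rightarrow> 'b::comm_semiring_1) \<Rightarrow> ('v \<Rightarrow> 'b)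
    \<Rightarrow> (('v \<Rightarrow>\<^sub>0 nat) \<Rightarrow>\<^sub>0 'a) \<Rightarrow> 'b" where
  "mp_eval \<phi> h p =
     (\<Sum>\<gamma>\<in>Poly_Mapping.keys p.
        \<phi> (Poly_Mapping.lookup p \<gamma>) *
        (\<Prod>v\<in>Poly_Mapping.keys \<gamma>. h v ^ Poly_Mapping.lookup \<gamma> v))"

definition total_deg :: "(('v \<Rightarrow>\<^sub>0 nat) \<Rightarrow>\<^sub>0 'a::zero) \<Rightarrow> nat" where
  "total_deg p =
     Max (insert 0 ((\<lambda>\<gamma>. \<Sum>v\<in>Poly_Mapping.keys \<gamma>. Poly_Mapping.lookup \<gamma> v) ` Poly_Mapping.keys p))"

definition hom_vars :: "nat \<Rightarrow> (nat \<Rightarrow> nat) \<Rightarrow> var set" where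
  "hom_vars r l = (SIGMA i:{1..r}. {0..l i})"

definition mh_expos :: "nat \<Rightarrow> (nat \<Rightarrow> nat) \<Rightarrow> (nat \<Rightarrow> nat) \<Rightarrow> expo set" where
  "mh_expos r l d =
     {\<gamma>. Poly_Mapping.keys \<gamma> \<subseteq> hom_vars r l \<and>
         (\<forall>i\<in>{1..r}. (\<Sum>j=0..l i. Poly_Mapping.lookup \<gamma> (i, j)) = d i)}"

section \<open>The multihomogeneous resultant\<close>

text \<open>
  The coefficient of the monomial with exponent \<open>\<gamma>\<close> in \<open>f\<^sub>j\<close> is the indeterminate with index
  \<open>(j, \<gamma>)\<close>; \<open>coef_ring\<close> is the polynomial ring over the integers in these indeterminates.
\<close>

type_synonym coef_ring = "((nat \<times> expo) \<Rightarrow>\<^sub>0 nat) \<Rightarrow>\<^sub>0 int"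

definition coef_vars :: "nat \<Rightarrow> (nat \<Rightarrow> nat) \<Rightarrow> (nat \<Rightarrow> nat) \<Rightarrow> (nat \<times> expo) set" where
  "coef_vars r l d = {0..\<Sum>k=1..r. l k} \<times> mh_expos r l d"

text \<open>
  Points of the product of projective spaces are given by homogeneous coordinates, which must
  not all vanish within any one of the \<open>r\<close> groups.
\<close>

definition homogeneous_coords :: "nat \<Rightarrow> (nat \<Rightarrow> nat) \<Rightarrow> (var \<Rightarrow> 'k::zero) \<Rightarrow> bool" where
  "homogeneous_coords r l z \<longleftrightarrow> (\<forall>i\<in>{1..r}. \<exists>j\<in>{0..l i}. z (i, j) \<noteq> 0)"

definition is_multires ::
    "'k::field itself \<Rightarrow> nat \<Rightarrow> (nat \<Rightarrow> nat) \<Rightarrow> (nat \<Rightarrow> nat) \<Rightarrow> coef_ring \<Rightarrow> bool" where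
  "is_multires K r l d R \<longleftrightarrow>
     (\<forall>\<mu>\<in>Poly_Mapping.keys R. Poly_Mapping.keys \<mu> \<subseteq> coef_vars r l d) \<and>
     irreducible R \<and>
     Gcd (Poly_Mapping.lookup R ` Poly_Mapping.keys R) = 1 \<and>
     (\<forall>f :: nat \<Rightarrow> expo \<Rightarrow>\<^sub>0 'k.
        (\<forall>j\<in>{0..\<Sum>k=1..r. l k}. Poly_Mapping.keys (f j) \<subseteq> mh_expos r l d) \<longrightarrow>
        (mp_eval of_int (\<lambda>(j, \<gamma>). Poly_Mapping.lookup (f j) \<gamma>) R = 0 \<longleftrightarrow>
         (\<exists>z. homogeneous_coords r l z \<and>
              (\<forall>j\<in>{0..\<Sum>k=1..r. l k}. mp_eval (\<lambda>c. c) z (f j) = 0))))"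

section \<open>The Weyman term\<close>

text \<open>
  The cohomology of \<open>\<O>(a\<^sub>1, \<dots>, a\<^sub>r)\<close> is computed by the (full) Cech complex of the
  standard affine cover by the sets \<open>U I = {x. \<forall>i. x (i, I i) \<noteq> 0}\<close>.  The sections over an
  intersection of such sets are the Laurent polynomials of multidegree \<open>a\<close> in which only the variables that are
  invertible there may have negative exponents.  A cochain is stored as the family of the
  coefficients of its components: the index \<open>(t, e)\<close> stands for the coefficient of
  the monomial with exponent \<open>e\<close> in the component at the tuple \<open>t\<close>.
\<close>

type_synonym lexpo = "var \<Rightarrow>\<^sub>0 int"
type_synonym 'k cochain = "((nat \<Rightarrow> nat) list \<times> lexpo) \<Rightarrow>\<^sub>0 'k"

definition cover_tuples :: "nat \<Rightarrow> (nat \<Rightarrow> nat) \<Rightarrow> nat \<Rightarrow> (nat \<Rightarrow> nat) list set" where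
  "cover_tuples r l p = {t. length t = p + 1 \<and> set t \<subseteq> (\<Pi>\<^sub>E i\<in>{1..r}. {0..l i})}"

definition section_expos ::
    "nat \<Rightarrow> (nat \<Rightarrow> nat) \<Rightarrow> (nat \<Rightarrow> int) \<Rightarrow> (nat \<Rightarrow> nat) list \<Rightarrow> lexpo set" where
  "section_expos r l a t =
     {e. Poly_Mapping.keys e \<subseteq> hom_vars r l \<and>
         (\<forall>i\<in>{1..r}. (\<Sum>j=0..l i. Poly_Mapping.lookup e (i, j)) = a i) \<and>
         (\<forall>i j. Poly_Mapping.lookup e (i, j) < 0 \<longrightarrow> (\<exists>I\<in>set t. I i = j))}"

definition cochains :: "nat \<Rightarrow> (nat \<Rightarrow> nat) \<Rightarrow> (nat \<Rightarrow> int) \<Rightarrow> nat \<Rightarrow> 'k::field cochain set" where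
  "cochains r l a p =
     {c. Poly_Mapping.keys c \<subseteq> (SIGMA t:cover_tuples r l p. section_expos r l a t)}"

definition cech_d :: "'k::field cochain \<Rightarrow> (nat \<Rightarrow> nat) list \<Rightarrow> lexpo \<Rightarrow> 'k" where
  "cech_d c t e = (\<Sum>i<length t. (-1) ^ i * Poly_Mapping.lookup c (take i t @ drop (Suc i) t, e))"

definition cocycles :: "nat \<Rightarrow> (nat \<Rightarrow> nat) \<Rightarrow> (nat \<Rightarrow> int) \<Rightarrow> nat \<Rightarrow> 'k::field cochain set" where
  "cocycles r l a p =
     {c \<in> cochains r l a p. \<forall>t\<in>cover_tuples r l (p + 1). \<forall>e. cech_d c t e = 0}"

definition coboundaries :: "nat \<Rightarrow> (nat \<Rightarrow> nat) \<Rightarrow> (nat \<Rightarrow> int) \<Rightarrow> nat \<Rightarrow> 'k::field cochain set" where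
  "coboundaries r l a p =
     (if p = 0 then {0}
      else {c \<in> cochains r l a p. \<exists>b\<in>cochains r l a (p - 1).
              \<forall>t\<in>cover_tuples r l p. \<forall>e. Poly_Mapping.lookup c (t, e) = cech_d b t e})"

text \<open>
  The dimension of \<open>V / W\<close>, for subspaces \<open>W \<subseteq> V\<close> of a vector space with scalar multiplication \<open>s\<close>:
  the size of a finite set that induces a basis of the quotient.
\<close>

definition quot_dim :: "('k::field \<Rightarrow> 'v::ab_group_add \<Rightarrow> 'v) \<Rightarrow> 'v set \<Rightarrow> 'v set \<Rightarrow> nat" where
  "quot_dim s V W =
     (THE n. \<exists>T. finite T \<and> card T = n \<and> T \<subseteq> V \<and> Modules.module.span s (T \<union> W) = V \<and>
        (\<forall>c. (\<Sum>v\<in>T. s (c v) v) \<in> W \<longrightarrow> (\<forall>v\<in>T. c v = 0)))"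

text \<open>
  An element of \<open>K0_sum Z n d m\<close> is a family of cochains indexed by \<open>(p, i)\<close>: the
  \<open>i\<close>-th copy (\<open>i < n + 1 choose p\<close>) of the \<open>p\<close>-th summand.  The Weyman term
  is the quotient of \<open>K0_sum cocycles\<close> by \<open>K0_sum coboundaries\<close>, that is, the direct sum of the
  cohomology spaces \<open>H\<^sup>p(X, m - p d)\<close> with their multiplicities.
\<close>

definition K0_sum :: "((nat \<Rightarrow> int) \<Rightarrow> nat \<Rightarrow> 'k::field cochain set) \<Rightarrow>
    nat \<Rightarrow> (nat \<Rightarrow> nat) \<Rightarrow> (nat \<Rightarrow> int) \<Rightarrow> ((nat \<times> nat) \<Rightarrow>\<^sub>0 'k cochain) set" where
  "K0_sum Z n d m =
     {z. \<forall>p i. Poly_Mapping.lookup z (p, i) \<in>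
           (if p \<le> n + 1 \<and> i < (n + 1) choose p
            then Z (\<lambda>k. m k - int p * int (d k)) p else {0})}"

definition K0_dim ::
    "'k::field itself \<Rightarrow> nat \<Rightarrow> (nat \<Rightarrow> nat) \<Rightarrow> (nat \<Rightarrow> nat) \<Rightarrow> (nat \<Rightarrow> int) \<Rightarrow> nat" where
  "K0_dim K r l d m =
     quot_dim (\<lambda>c::'k. Poly_Mapping.map (Poly_Mapping.map ((*) c)))
       (K0_sum (cocycles r l) (\<Sum>k=1..r. l k) d m)
       (K0_sum (coboundaries r l) (\<Sum>k=1..r. l k) d m)"

section \<open>Defects and degree vectors\<close>

definition defect :: "(nat \<Rightarrow> nat) \<Rightarrow> (nat \<Rightarrow> nat) \<Rightarrow> nat \<Rightarrow> int" where
  "defect l d k = int (l k) - \<lceil>real (l k) / real (d k)\<rceil>"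

definition deg_vec ::
    "nat \<Rightarrow> (nat \<Rightarrow> nat) \<Rightarrow> (nat \<Rightarrow> nat) \<Rightarrow> (nat \<Rightarrow> nat) \<Rightarrow> nat \<Rightarrow> int" where
  "deg_vec r l d \<pi> k = - int (l k) + int (d k) * (\<Sum>j | j \<in> {1..r} \<and> \<pi> j \<ge> \<pi> k. int (l j))"

definition dual_perm :: "nat \<Rightarrow> (nat \<Rightarrow> nat) \<Rightarrow> nat \<Rightarrow> nat" where
  "dual_perm r \<pi> i = (if i \<in> {1..r} then r + 1 - \<pi> i else i)"

section \<open>The Bezoutian\<close>

text \<open>
  In a polynomial in the variables \<open>x\<close> and \<open>y\<close> the monomial \<open>x\<^sup>\<alpha> y\<^sup>\<beta>\<close> has exponent \<open>(\<alpha>, \<beta>)\<close>.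
\<close>

type_synonym xy_poly = "(expo \<times> expo) \<Rightarrow>\<^sub>0 coef_ring"

definition xvar :: "var \<Rightarrow> xy_poly" where
  "xvar v = Poly_Mapping.single (Poly_Mapping.single v 1, 0) 1"

definition yvar :: "var \<Rightarrow> xy_poly" where
  "yvar v = Poly_Mapping.single (0, Poly_Mapping.single v 1) 1"

definition generic_poly :: "nat \<Rightarrow> (nat \<Rightarrow> nat) \<Rightarrow> (nat \<Rightarrow> nat) \<Rightarrow> nat \<Rightarrow> expo \<Rightarrow>\<^sub>0 coef_ring" where
  "generic_poly r l d j =
     (\<Sum>\<gamma>\<in>mh_expos r l d.
        Poly_Mapping.single \<gamma> (Poly_Mapping.single (Poly_Mapping.single (j, \<gamma>) 1) 1))"

definition var_order :: "nat \<Rightarrow> (nat \<Rightarrow> nat) \<Rightarrow> (nat \<Rightarrow> nat) \<Rightarrow> var list" where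
  "var_order r l \<pi> =
     (let \<sigma> = inv_into {1..r} \<pi> in
      concat (map (\<lambda>t. map (\<lambda>j. (\<sigma> t, j)) [1..<l (\<sigma> t) + 1]) [1..<r + 1]))"

definition mixed_poly ::
    "nat \<Rightarrow> (nat \<Rightarrow> nat) \<Rightarrow> (nat \<Rightarrow> nat) \<Rightarrow> (nat \<Rightarrow> nat) \<Rightarrow> nat \<Rightarrow> nat \<Rightarrow> xy_poly" where
  "mixed_poly r l d \<pi> s j =
     mp_eval (Poly_Mapping.single 0)
       (\<lambda>(i, k). if k = 0 then 1
                 else if (i, k) \<in> set (take s (var_order r l \<pi>)) then yvar (i, k)
                 else xvar (i, k))
       (generic_poly r l d j)"

definition bezoutian ::
    "nat \<Rightarrow> (nat \<Rightarrow> nat) \<Rightarrow> (nat \<Rightarrow> nat) \<Rightarrow> (nat \<Rightarrow> nat) \<Rightarrow> xy_poly" where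
  "bezoutian r l d \<pi> =
     (let n = \<Sum>k=1..r. l k in
      THE B. B * (\<Prod>i=1..r. \<Prod>j=1..l i. xvar (i, j) - yvar (i, j)) =
        det (mat (n + 1) (n + 1) (\<lambda>(s, j). mixed_poly r l d \<pi> s j)))"

definition bez_index :: "nat \<Rightarrow> (nat \<Rightarrow> nat) \<Rightarrow> (nat \<Rightarrow> int) \<Rightarrow> expo set" where
  "bez_index r l m =
     {\<alpha>. Poly_Mapping.keys \<alpha> \<subseteq> (SIGMA i:{1..r}. {1..l i}) \<and>
         (\<forall>i\<in>{1..r}. int (\<Sum>j=1..l i. Poly_Mapping.lookup \<alpha> (i, j)) \<le> m i)}"

text \<open>
  The coefficient matrix depends on an enumeration of its two index sets; a change of the
  enumerations affects the determinant by a sign only.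
\<close>

definition bez_matrix :: "nat \<Rightarrow> (nat \<Rightarrow> nat) \<Rightarrow> (nat \<Rightarrow> nat) \<Rightarrow> (nat \<Rightarrow> nat) \<Rightarrow>
    expo list \<Rightarrow> expo list \<Rightarrow> coef_ring mat" where
  "bez_matrix r l d \<pi> \<alpha>s \<beta>s =
     mat (length \<alpha>s) (length \<beta>s)
       (\<lambda>(i, j). Poly_Mapping.lookup (bezoutian r l d \<pi>) (\<alpha>s ! i, \<beta>s ! j))"

end

theory Submission
  imports Defs "HOL-Library.Product_Lexorder" "HOL-Library.Nat_Bijection" "Jordan_Normal_Form.Char_Poly"
begin

text \<open>
  The Bezoutian is the determinant of a matrix whose rows are the values \<open>f\<^sub>j(x)\<close> and \<open>n\<close> divided differences, so it
  vanishes at a common root \<open>x\<close>. The monomials in \<open>x\<close> are then a kernel vector of the Bezout matrix: its determinant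
  \<open>D\<close> vanishes whenever \<open>R\<close> does, and \<open>R\<close> divides \<open>D\<close> by the Nullstellensatz for an irreducible polynomial.
  Now take one form to be \<open>1\<close> on the affine chart and the others to be products of linear forms, each in a single group of
  variables. The latter have as many common zeros as the Bezout matrix has rows, say \<open>N\<close>, and the Bezoutian is diagonal on
  pairs of zeros; with roots chosen in \<open>\<int>[t]\<close> this shows that \<open>D\<close> is nonzero modulo every prime. Moving the first
  form along a line, one meets \<open>N\<close> members that vanish at one of the zeros, so \<open>R\<close> has degree at least \<open>N\<close> in each
  form. This is the degree of \<open>D\<close>, so \<open>D / R\<close> is a constant, and a unit. The cohomology that occurs besides
  \<open>H\<^sup>0\<close> in \<open>K\<^sub>0\<close> vanishes when the defects do, by contracting homotopies of the Cech complex.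
\<close>

text \<open>Four obstacles shape the proof. A common zero with some \<open>x_i0 = 0\<close> lies
  outside the affine chart and gives no kernel vector; it is moved into the chart along a parameter
  while the forms are corrected to vanish there, and the determinant, a polynomial in the parameter,
  vanishes identically. Divisibility by \<open>R\<close> needs irreducible integer polynomials to be
  prime; this is Gauss's theorem, by induction on the variables, so rings are treated as subsets of
  a type. Modulo a prime the integers do not supply enough distinct roots for a split system,
  whereas the powers of an indeterminate do: the difference of two of them has a coefficient 1.
  Finally, the number of common zeros must equal the number of monomials. Zero defects mean that
  each group has \<open>l k = 1\<close> or \<open>d k = 1\<close>, and then the binomial coefficient
  of \<open>d k * S\<close> over \<open>l k\<close> is \<open>d k ^ l k\<close> times that of
  \<open>S\<close>. With this the monomial count becomes the multinomial number. The entries of the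
  Bezout matrix \<open>B\<close> are never computed: only the product \<open>X * B * Y\<close> is,
  where \<open>X\<close> and \<open>Y\<close> hold the monomials at the zeros.\<close>

section \<open>Unique factorization in polynomial rings over a subring\<close>

definition subring_on :: "'a::comm_ring_1 set \<Rightarrow> bool" where
  "subring_on A \<longleftrightarrow> 1 \<in> A \<and> (\<forall>x\<in>A. \<forall>y\<in>A. x - y \<in> A \<and> x * y \<in> A)"

lemma subring_onD:
  assumes "subring_on A"
  shows "0 \<in> A" "1 \<in> A" "x \<in> A \<Longrightarrow> y \<in> A \<Longrightarrow> x - y \<in> A" "x \<in> A \<Longrightarrow> y \<in> A \<Longrightarrow> x * y \<in> A"
    "x \<in> A \<Longrightarrow> - x \<in> A" "x \<in> A \<Longrightarrow> y \<in> A \<Longrightarrow> x + y \<in> A"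
proof -
  show *: "1 \<in> A" "\<And>x y. x \<in> A \<Longrightarrow> y \<in> A \<Longrightarrow> x - y \<in> A" "x \<in> A \<Longrightarrow> y \<in> A \<Longrightarrow> x * y \<in> A"
    using assms unfolding subring_on_def by auto
  show 0: "0 \<in> A" using *(2)[OF *(1) *(1)] by simp
  have neg: "\<And>x. x \<in> A \<Longrightarrow> - x \<in> A" using *(2)[OF 0] by fastforce
  show "x \<in> A \<Longrightarrow> - x \<in> A" by (rule neg)
  show "x \<in> A \<Longrightarrow> y \<in> A \<Longrightarrow> x + y \<in> A" using *(2)[of x "- y"] neg[of y] by simp
qed

lemma subring_on_sum: "subring_on A \<Longrightarrow> (\<And>i. i \<in> I \<Longrightarrow> f i \<in> A) \<Longrightarrow> sum f I \<in> A"
  by (induction I rule: infinite_finite_induct) (auto intro: subring_onD)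

lemma subring_on_prod: "subring_on A \<Longrightarrow> (\<And>i. i \<in> I \<Longrightarrow> f i \<in> A) \<Longrightarrow> prod f I \<in> A"
  by (induction I rule: infinite_finite_induct) (auto intro: subring_onD)

lemma subring_on_power: "subring_on A \<Longrightarrow> x \<in> A \<Longrightarrow> x ^ n \<in> A"
  by (induction n) (auto intro: subring_onD)

lemma subring_on_prod_list: "subring_on A \<Longrightarrow> (\<And>x. x \<in> set xs \<Longrightarrow> x \<in> A) \<Longrightarrow> prod_list xs \<in> A"
  by (induction xs) (auto intro: subring_onD)

definition dvd_on :: "'a::comm_ring_1 set \<Rightarrow> 'a \<Rightarrow> 'a \<Rightarrow> bool" where
  "dvd_on A a b \<longleftrightarrow> (\<exists>c\<in>A. b = a * c)"

definition prime_on :: "'a::comm_ring_1 set \<Rightarrow> 'a \<Rightarrow> bool" where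
  "prime_on A p \<longleftrightarrow> p \<in> A \<and> p \<noteq> 0 \<and> \<not> dvd_on A p 1 \<and>
     (\<forall>x\<in>A. \<forall>y\<in>A. dvd_on A p (x * y) \<longrightarrow> dvd_on A p x \<or> dvd_on A p y)"

text \<open>Only existence is required: a factorization into prime, not merely irreducible, elements
  is automatically unique.\<close>

definition ufd_on :: "'a::comm_ring_1 set \<Rightarrow> bool" where
  "ufd_on A \<longleftrightarrow> (\<forall>a\<in>A. a \<noteq> 0 \<longrightarrow>
     (\<exists>ps u. (\<forall>p\<in>set ps. prime_on A p) \<and> u \<in> A \<and> dvd_on A u 1 \<and> a = u * prod_list ps))"

definition polys_on :: "'a::comm_ring_1 set \<Rightarrow> 'a poly set" where
  "polys_on A = {p. \<forall>i. coeff p i \<in> A}"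

lemma dvd_on_mult_left: "subring_on A \<Longrightarrow> c \<in> A \<Longrightarrow> dvd_on A a b \<Longrightarrow> dvd_on A a (c * b)"
  unfolding dvd_on_def by (metis mult.left_commute subring_onD(4))

lemma dvd_on_add: "subring_on A \<Longrightarrow> dvd_on A a b \<Longrightarrow> dvd_on A a c \<Longrightarrow> dvd_on A a (b + c)"
  unfolding dvd_on_def by (metis distrib_left subring_onD(6))

lemma dvd_on_diff: "subring_on A \<Longrightarrow> dvd_on A a b \<Longrightarrow> dvd_on A a c \<Longrightarrow> dvd_on A a (b - c)"
  unfolding dvd_on_def by (metis right_diff_distrib subring_onD(3))

lemma dvd_on_zero: "subring_on A \<Longrightarrow> dvd_on A a 0"
  unfolding dvd_on_def by (metis mult_zero_right subring_onD(1))

lemma dvd_on_sum: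
  "subring_on A \<Longrightarrow> (\<And>i. i \<in> I \<Longrightarrow> dvd_on A a (f i)) \<Longrightarrow> dvd_on A a (sum f I)"
  by (induction I rule: infinite_finite_induct) (auto intro: dvd_on_add dvd_on_zero)

lemma dvd_on_trans: "subring_on A \<Longrightarrow> dvd_on A a b \<Longrightarrow> dvd_on A b c \<Longrightarrow> dvd_on A a c"
  unfolding dvd_on_def by (metis mult.assoc subring_onD(4))

lemma subring_on_polys_on:
  assumes "subring_on A" shows "subring_on (polys_on A)"
  unfolding subring_on_def polys_on_def
  by (auto simp: coeff_mult intro!: subring_onD[OF assms] subring_on_sum[OF assms])

lemma const_in_polys_on: "subring_on A \<Longrightarrow> a \<in> A \<Longrightarrow> [:a:] \<in> polys_on A"
  unfolding polys_on_def by (auto simp: coeff_pCons subring_onD split: nat.split)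

lemma smult_in_polys_on: "subring_on A \<Longrightarrow> a \<in> A \<Longrightarrow> p \<in> polys_on A \<Longrightarrow> smult a p \<in> polys_on A"
  unfolding polys_on_def by (auto intro: subring_onD)

lemma monom_in_polys_on: "subring_on A \<Longrightarrow> a \<in> A \<Longrightarrow> monom a n \<in> polys_on A"
  unfolding polys_on_def by (auto intro: subring_onD)

lemma smult_sum_distrib: "smult a (sum f I) = (\<Sum>i\<in>I. smult a (f i))"
  by (induction I rule: infinite_finite_induct) (auto simp: smult_add_right)

lemma dvd_on_const_iff:
  fixes A :: "'a::idom set"
  assumes A: "subring_on A" and F: "F \<in> polys_on A"
  shows "dvd_on (polys_on A) [:p:] F \<longleftrightarrow> (\<forall>i. dvd_on A p (coeff F i))"
proof
  assume "dvd_on (polys_on A) [:p:] F"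
  then show "\<forall>i. dvd_on A p (coeff F i)"
    unfolding dvd_on_def polys_on_def by auto
next
  assume "\<forall>i. dvd_on A p (coeff F i)"
  then obtain g where g: "\<And>i. g i \<in> A" "\<And>i. coeff F i = p * g i"
    unfolding dvd_on_def by metis
  define G where "G = (\<Sum>i\<le>degree F. monom (g i) i)"
  have "G \<in> polys_on A" unfolding G_def
    by (intro subring_on_sum subring_on_polys_on monom_in_polys_on A g)
  moreover have "F = smult p G"
  proof -
    have "F = (\<Sum>i\<le>degree F. monom (coeff F i) i)" by (simp add: poly_as_sum_of_monoms)
    also have "\<dots> = smult p G" unfolding G_def
      by (simp add: g(2) smult_sum_distrib smult_monom)
    finally show ?thesis .
  qed
  ultimately show "dvd_on (polys_on A) [:p:] F" unfolding dvd_on_def by auto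
qed

text \<open>Gauss's argument: if \<open>p\<close> divides neither factor, take in each the first
  coefficient that it does not divide. In the corresponding coefficient of the product every other
  summand is divisible by \<open>p\<close>, so \<open>p\<close> divides the product of these
  two.\<close>

lemma prime_on_const:
  fixes A :: "'a::idom set"
  assumes A: "subring_on A" and p: "prime_on A p"
  shows "prime_on (polys_on A) [:p:]"
proof -
  note PA = subring_on_polys_on[OF A]
  have pA: "p \<in> A" "p \<noteq> 0" using p by (auto simp: prime_on_def)
  have "\<not> dvd_on (polys_on A) [:p:] 1"
  proof
    assume "dvd_on (polys_on A) [:p:] 1"
    then have "dvd_on A p (coeff 1 0)" using dvd_on_const_iff[OF A subring_onD(2)[OF PA]] by blast
    then show False using p by (simp add: prime_on_def)
  qed
  moreover have "dvd_on (polys_on A) [:p:] F \<or> dvd_on (polys_on A) [:p:] G"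
    if F: "F \<in> polys_on A" and G: "G \<in> polys_on A" and FG: "dvd_on (polys_on A) [:p:] (F * G)" for F G
  proof (rule ccontr)
    assume "\<not> ?thesis"
    then have nF: "\<exists>i. \<not> dvd_on A p (coeff F i)" and nG: "\<exists>i. \<not> dvd_on A p (coeff G i)"
      using dvd_on_const_iff[OF A] F G by auto
    define i where "i = (LEAST i. \<not> dvd_on A p (coeff F i))"
    define j where "j = (LEAST i. \<not> dvd_on A p (coeff G i))"
    have i: "\<not> dvd_on A p (coeff F i)" "\<And>k. k < i \<Longrightarrow> dvd_on A p (coeff F k)"
      unfolding i_def using LeastI_ex[OF nF] not_less_Least by blast+
    have j: "\<not> dvd_on A p (coeff G j)" "\<And>k. k < j \<Longrightarrow> dvd_on A p (coeff G k)"
      unfolding j_def using LeastI_ex[OF nG] not_less_Least by blast+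
    have cA: "coeff F k \<in> A" "coeff G k \<in> A" for k using F G by (auto simp: polys_on_def)
    have "dvd_on A p (coeff (F * G) (i + j))"
      using FG dvd_on_const_iff[OF A subring_onD(4)[OF PA F G]] by blast
    moreover have "coeff (F * G) (i + j) = coeff F i * coeff G j +
        (\<Sum>k\<in>{..i+j}-{i}. coeff F k * coeff G (i + j - k))"
      unfolding coeff_mult by (subst sum.remove[of _ i]) auto
    moreover have "dvd_on A p (\<Sum>k\<in>{..i+j}-{i}. coeff F k * coeff G (i + j - k))"
    proof (rule dvd_on_sum[OF A])
      fix k assume "k \<in> {..i+j}-{i}"
      then consider "k < i" | "i + j - k < j" by force
      then show "dvd_on A p (coeff F k * coeff G (i + j - k))"
      proof cases
        case 1 then show ?thesis using dvd_on_mult_left[OF A cA(2) i(2)] by (metis mult.commute)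
      next
        case 2 then show ?thesis using dvd_on_mult_left[OF A cA(1) j(2)] by blast
      qed
    qed
    ultimately have "dvd_on A p (coeff F i * coeff G j)"
      by (auto dest: dvd_on_diff[OF A])
    then show False using p i(1) j(1) cA unfolding prime_on_def by blast
  qed
  ultimately show ?thesis unfolding prime_on_def using pA const_in_polys_on[OF A] by simp
qed

text \<open>Division with remainder over the fraction field, with the denominators, powers of the
  leading coefficient of \<open>H\<close>, multiplied out.\<close>

lemma pseudo_division_on:
  fixes A :: "'a::idom set"
  assumes A: "subring_on A" and H: "H \<in> polys_on A" "H \<noteq> 0"
  shows "K \<in> polys_on A \<Longrightarrow> \<exists>k. \<exists>q\<in>polys_on A. \<exists>s\<in>polys_on A.
    smult (lead_coeff H ^ k) K = q * H + s \<and> (s = 0 \<or> degree s < degree H)"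
\<comment> \<open>The measure separates 0 from the nonzero constants, which have the same
  \<open>degree\<close>.\<close>
proof (induction "if K = 0 then 0 else Suc (degree K)" arbitrary: K rule: less_induct)
  case less
  note PA = subring_on_polys_on[OF A]
  let ?c = "lead_coeff H"
  have c: "?c \<in> A" using H by (auto simp: polys_on_def)
  show ?case
  proof (cases "K = 0 \<or> degree K < degree H")
    case True
    then have "smult (?c ^ 0) K = 0 * H + K \<and> (K = 0 \<or> degree K < degree H)" by simp
    then show ?thesis using less.prems subring_onD(1)[OF PA] by blast
  next
    case False
    define n where "n = degree K - degree H"
    define M where "M = monom (lead_coeff K) n"
    define K' where "K' = smult ?c K - M * H"
    have M: "M \<in> polys_on A" unfolding M_def using less.prems
      by (intro monom_in_polys_on A) (auto simp: polys_on_def)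
    have K': "K' \<in> polys_on A" unfolding K'_def
      by (intro subring_onD[OF PA] smult_in_polys_on A c less.prems M H)
    have dMH: "degree (M * H) = degree K" using False H
      by (subst degree_mult_eq) (auto simp: M_def degree_monom_eq n_def)
    have lMH: "lead_coeff (M * H) = lead_coeff K * ?c" using False
      by (simp add: lead_coeff_mult M_def degree_monom_eq del: coeff_monom)
         (simp add: degree_monom_eq)
    have "coeff K' (degree K) = 0" unfolding K'_def using lMH dMH by simp
    moreover have "degree K' \<le> degree K" unfolding K'_def
      using dMH by (intro degree_diff_le) auto
    ultimately have "K' = 0 \<or> degree K' < degree K"
      by (metis leading_coeff_0_iff le_neq_implies_less)
    then have "(if K' = 0 then 0 else Suc (degree K')) < (if K = 0 then 0 else Suc (degree K))"
      using False by auto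
    from less.hyps[OF this K'] obtain k q s where
      *: "q \<in> polys_on A" "s \<in> polys_on A" "smult (?c ^ k) K' = q * H + s" "s = 0 \<or> degree s < degree H"
      by blast
    have "smult (?c ^ Suc k) K = smult (?c ^ k) (K' + M * H)"
      unfolding K'_def by (simp add: mult.commute)
    also have "\<dots> = (q + smult (?c ^ k) M) * H + s"
      by (simp add: smult_add_right *(3) algebra_simps)
    finally show ?thesis using * M
      by (intro exI[of _ "Suc k"] bexI[of _ "q + smult (?c ^ k) M"] bexI[of _ s] conjI)
        (auto intro!: subring_onD[OF PA] smult_in_polys_on A subring_on_power c)
  qed
qed

text \<open>A nonzero element of least degree in the ideal generated by \<open>F\<close> and
  \<open>G\<close>: a pseudo-remainder lies in the ideal again and has smaller degree, so it is 0.
  This is a greatest common divisor over the fraction field, together with its Bezout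
  identity.\<close>

lemma common_divisor_on:
  fixes A :: "'a::idom set"
  assumes A: "subring_on A" and F: "F \<in> polys_on A" "F \<noteq> 0" and G: "G \<in> polys_on A"
  obtains H x y q q' a where "H \<in> polys_on A" "H \<noteq> 0" "x \<in> polys_on A" "y \<in> polys_on A"
    "q \<in> polys_on A" "q' \<in> polys_on A" "a \<in> A" "a \<noteq> 0"
    "H = x * F + y * G" "smult a F = q * H" "smult a G = q' * H"
proof -
  note PA = subring_on_polys_on[OF A]
  define I where "I = {x * F + y * G | x y. x \<in> polys_on A \<and> y \<in> polys_on A}"
  have FI: "F \<in> I" unfolding I_def using subring_onD(1,2)[OF PA]
    by (intro CollectI exI[of _ 1] exI[of _ 0]) auto
  have GI: "G \<in> I" unfolding I_def using subring_onD(1,2)[OF PA]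
    by (intro CollectI exI[of _ 0] exI[of _ 1]) auto
  have "\<exists>H. (H \<in> I \<and> H \<noteq> 0) \<and> (\<forall>K. K \<in> I \<and> K \<noteq> 0 \<longrightarrow> degree H \<le> degree K)"
    using ex_has_least_nat[of "\<lambda>H. H \<in> I \<and> H \<noteq> 0" F degree] FI F by blast
  then obtain H where H: "H \<in> I" "H \<noteq> 0" and min: "\<And>K. K \<in> I \<Longrightarrow> K \<noteq> 0 \<Longrightarrow> degree H \<le> degree K"
    by blast
  obtain x y where xy: "x \<in> polys_on A" "y \<in> polys_on A" "H = x * F + y * G"
    using H unfolding I_def by auto
  have HP: "H \<in> polys_on A" unfolding xy(3) using xy F G by (intro subring_onD[OF PA]) auto
  have c: "lead_coeff H \<in> A" using HP by (auto simp: polys_on_def)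
  have ex: "\<exists>k. \<exists>q\<in>polys_on A. smult (lead_coeff H ^ k) K = q * H" if K: "K \<in> I" for K
  proof -
    obtain x' y' where xy': "x' \<in> polys_on A" "y' \<in> polys_on A" "K = x' * F + y' * G"
      using K unfolding I_def by auto
    have "K \<in> polys_on A" unfolding xy'(3) using xy' F G by (intro subring_onD[OF PA]) auto
    from pseudo_division_on[OF A HP H(2) this] obtain k q s where
      *: "q \<in> polys_on A" "s \<in> polys_on A" "smult (lead_coeff H ^ k) K = q * H + s"
        "s = 0 \<or> degree s < degree H" by blast
    have "s = (smult (lead_coeff H ^ k) x' - q * x) * F + (smult (lead_coeff H ^ k) y' - q * y) * G"
    proof -
      have "s = smult (lead_coeff H ^ k) K - q * H" using *(3) by simp
      also have "\<dots> = smult (lead_coeff H ^ k) (x' * F + y' * G) - q * (x * F + y * G)"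
        using xy(3) xy'(3) by simp
      finally show ?thesis by (simp add: algebra_simps smult_add_right smult_diff_left)
    qed
    then have "s \<in> I" unfolding I_def
      using xy xy' *(1) A c by (intro CollectI exI conjI)
        (assumption | auto intro!: subring_onD[OF PA] smult_in_polys_on subring_on_power)+
    then have "s = 0" using min *(4) by fastforce
    then show ?thesis using * by auto
  qed
  obtain k q where q: "q \<in> polys_on A" "smult (lead_coeff H ^ k) F = q * H" using ex[OF FI] by blast
  obtain k' q' where q': "q' \<in> polys_on A" "smult (lead_coeff H ^ k') G = q' * H" using ex[OF GI] by blast
  \<comment> \<open>The product of the two denominators serves \<open>F\<close> and \<open>G\<close>
    simultaneously.\<close>
  have "smult (lead_coeff H ^ k' * lead_coeff H ^ k) F = smult (lead_coeff H ^ k') q * H"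
    by (metis q(2) mult_smult_left smult_smult)
  moreover have "smult (lead_coeff H ^ k' * lead_coeff H ^ k) G = smult (lead_coeff H ^ k) q' * H"
    by (metis q'(2) mult_smult_left smult_smult mult.commute)
  moreover have "lead_coeff H ^ k' * lead_coeff H ^ k \<in> A"
    by (intro subring_onD[OF A] subring_on_power[OF A] c)
  moreover have "lead_coeff H ^ k' * lead_coeff H ^ k \<noteq> 0" using H by simp
  ultimately show ?thesis using that HP H(2) xy
      smult_in_polys_on[OF A subring_on_power[OF A c, of k'] q(1)]
      smult_in_polys_on[OF A subring_on_power[OF A c, of k] q'(1)] by blast
qed

text \<open>Each prime factor of the denominator remains prime in the polynomial ring, hence divides
  \<open>q\<close> or \<open>H\<close> and can be cancelled there. What is taken out of
  \<open>H\<close> is collected in \<open>c\<close>; the unit goes into \<open>q\<close>. Only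
  constants move, so degrees are kept.\<close>

lemma clear_denominator_on:
  fixes A :: "'a::idom set"
  assumes A: "subring_on A" and ps: "\<forall>p\<in>set ps. prime_on A p" and u: "u \<in> A" "dvd_on A u 1"
    and F: "F \<in> polys_on A"
  shows "q \<in> polys_on A \<Longrightarrow> H \<in> polys_on A \<Longrightarrow> smult (u * prod_list ps) F = q * H \<Longrightarrow>
    \<exists>q1\<in>polys_on A. \<exists>H1\<in>polys_on A. \<exists>c\<in>A. c \<noteq> 0 \<and> F = q1 * H1 \<and> H = smult c H1 \<and> degree q1 = degree q"
  using ps
proof (induction ps arbitrary: q H)
  case Nil
  obtain w where w: "w \<in> A" "1 = u * w" using u by (auto simp: dvd_on_def)
  then have "w \<noteq> 0" by auto
  have "F = smult w (smult u F)" using w by (simp add: mult.commute)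
  also have "\<dots> = smult w q * H" using Nil by simp
  finally show ?case using Nil w \<open>w \<noteq> 0\<close> subring_onD(2)[OF A]
    by (intro bexI[of _ "smult w q"] bexI[of _ H] bexI[of _ 1]) (auto intro: smult_in_polys_on[OF A])
next
  case (Cons p ps)
  note PA = subring_on_polys_on[OF A]
  have p: "prime_on A p" using Cons.prems by simp
  then have p0: "p \<noteq> 0" "p \<in> A" by (auto simp: prime_on_def)
  let ?K = "smult (u * prod_list ps) F"
  have pl: "prod_list ps \<in> A" using Cons.prems(4)
    by (intro subring_on_prod_list[OF A]) (auto simp: prime_on_def)
  have K: "?K \<in> polys_on A" by (intro smult_in_polys_on A F subring_onD[OF A] u pl)
  have eq: "smult p ?K = q * H" using Cons.prems(3) by (simp add: algebra_simps)
  have "q * H = [:p:] * ?K" unfolding eq[symmetric] by (simp add: mult_ac)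
  then have "dvd_on (polys_on A) [:p:] (q * H)" unfolding dvd_on_def
    using K by blast
  then consider "dvd_on (polys_on A) [:p:] q" | "dvd_on (polys_on A) [:p:] H"
    using prime_on_const[OF A p] Cons.prems unfolding prime_on_def by blast
  then show ?case
  proof cases
    case 1
    then obtain q0 where q0: "q0 \<in> polys_on A" "q = smult p q0" by (auto simp: dvd_on_def)
    have "smult p ?K = smult p (q0 * H)" using eq q0 by simp
    then have "?K = q0 * H" using p0(1) by (metis smult_cancel)
    from Cons.IH[OF q0(1) Cons.prems(2) this] Cons.prems show ?thesis using q0 p0 by auto
  next
    case 2
    then obtain H0 where H0: "H0 \<in> polys_on A" "H = smult p H0" by (auto simp: dvd_on_def)
    have "smult p ?K = smult p (q * H0)" using eq H0 by simp
    then have "?K = q * H0" using p0(1) by (metis smult_cancel)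
    from Cons.IH[OF Cons.prems(1) H0(1) this] Cons.prems obtain q1 H1 c where
      *: "q1\<in>polys_on A" "H1\<in>polys_on A" "c\<in>A" "c \<noteq> 0" "F = q1 * H1" "H0 = smult c H1" "degree q1 = degree q"
      by auto
    then show ?thesis using H0 p0
      by (intro bexI[of _ q1] bexI[of _ H1] bexI[of _ "p * c"]) (auto intro: subring_onD[OF A])
  qed
qed

context
  fixes A :: "'a::idom set"
  assumes A: "subring_on A" and ufd: "ufd_on A"
begin

lemma ufd_onE:
  assumes "a \<in> A" "a \<noteq> 0"
  obtains ps u where "\<forall>p\<in>set ps. prime_on A p" "u \<in> A" "dvd_on A u 1" "a = u * prod_list ps"
  using ufd assms unfolding ufd_on_def by blast

definition primitive_on :: "'a poly \<Rightarrow> bool" where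
  "primitive_on F \<longleftrightarrow> (\<forall>p. prime_on A p \<longrightarrow> \<not> dvd_on (polys_on A) [:p:] F)"

text \<open>Any prime factor of \<open>c\<close> would divide all coefficients of
  \<open>F\<close>.\<close>

lemma primitive_on_unit:
  assumes F: "primitive_on F" "F = smult c H" "H \<in> polys_on A" "c \<in> A" "c \<noteq> 0"
  shows "dvd_on A c 1"
proof -
  obtain ps u where ps: "\<forall>p\<in>set ps. prime_on A p" "u \<in> A" "dvd_on A u 1" "c = u * prod_list ps"
    using ufd_onE assms by metis
  show ?thesis
  proof (cases ps)
    case Nil then show ?thesis using ps by simp
  next
    case (Cons p ps')
    have pl: "prod_list ps' \<in> A" using ps(1) unfolding Cons
      by (intro subring_on_prod_list[OF A]) (auto simp: prime_on_def)
    have "F = [:p:] * smult (u * prod_list ps') H" using assms ps Cons by (simp add: algebra_simps)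
    then have "dvd_on (polys_on A) [:p:] F" unfolding dvd_on_def
      using assms pl ps by (blast intro: smult_in_polys_on[OF A] subring_onD[OF A])
    then show ?thesis using F ps Cons unfolding primitive_on_def by auto
  qed
qed

text \<open>Gauss's lemma in the form needed later: divisibility by a primitive polynomial over the
  fraction field already holds over \<open>A\<close>.\<close>

lemma primitive_on_cancel:
  assumes F: "F \<in> polys_on A" "primitive_on F" and c: "c \<in> A" "c \<noteq> 0" and G: "G \<in> polys_on A"
    and d: "dvd_on (polys_on A) F (smult c G)"
  shows "dvd_on (polys_on A) F G"
proof -
  note PA = subring_on_polys_on[OF A]
  obtain T where T: "T \<in> polys_on A" "smult c G = T * F" using d by (auto simp: dvd_on_def mult.commute)
  obtain ps u where ps: "\<forall>p\<in>set ps. prime_on A p" "u \<in> A" "dvd_on A u 1" "c = u * prod_list ps"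
    using ufd_onE c by metis
  from clear_denominator_on[OF A ps(1-3) G T(1) F(1)] T(2) ps(4) obtain q1 H1 e where
    *: "q1\<in>polys_on A" "H1\<in>polys_on A" "e\<in>A" "e \<noteq> 0" "G = q1 * H1" "F = smult e H1" by blast
  then obtain w where w: "w \<in> A" "1 = e * w" using primitive_on_unit[OF F(2)] by (auto simp: dvd_on_def)
  have "G = smult (e * w) (q1 * H1)" using w(2)[symmetric] *(5) by simp
  then have "G = F * smult w q1" using *(6) by (simp add: mult_ac)
  then show ?thesis unfolding dvd_on_def using smult_in_polys_on[OF A w(1) *(1)] by blast
qed

text \<open>If \<open>F\<close> divides \<open>x * y\<close>, take the common divisor
  \<open>H\<close> of \<open>F\<close> and \<open>x\<close> over the fraction field. Up to constants
  it is \<open>F\<close> or 1, because \<open>F\<close> does not split. In the first case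
  \<open>F\<close> divides \<open>x\<close>; in the second the Bezout identity times
  \<open>y\<close> shows that \<open>F\<close> divides \<open>y\<close>.\<close>

lemma prime_on_polys:
  assumes F: "F \<in> polys_on A" "primitive_on F" "degree F > 0"
    and irr: "\<And>x y. x \<in> polys_on A \<Longrightarrow> y \<in> polys_on A \<Longrightarrow> F = x * y \<Longrightarrow> degree x = 0 \<or> degree y = 0"
  shows "prime_on (polys_on A) F"
proof -
  note PA = subring_on_polys_on[OF A]
  have F0: "F \<noteq> 0" using F by auto
  have const: "\<exists>a\<in>A. P = [:a:]" if "P \<in> polys_on A" "degree P = 0" for P
    using that by (metis (mono_tags, lifting) degree_eq_zeroE mem_Collect_eq polys_on_def coeff_pCons_0)
  have "\<not> dvd_on (polys_on A) F 1"
  proof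
    assume "dvd_on (polys_on A) F 1"
    then obtain c where "1 = F * c" by (auto simp: dvd_on_def)
    then have "F dvd 1" by (metis dvd_triv_left)
    then obtain c where "F * c = 1" by (metis dvdE)
    then have "F \<noteq> 0" "c \<noteq> 0" "degree (F * c) = 0" by auto
    then show False using F(3) by (simp add: degree_mult_eq)
  qed
  moreover have "dvd_on (polys_on A) F x \<or> dvd_on (polys_on A) F y"
    if x: "x \<in> polys_on A" and y: "y \<in> polys_on A" and xy: "dvd_on (polys_on A) F (x * y)" for x y
  proof -
    from common_divisor_on[OF A F(1) F0 x] obtain H \<alpha> \<beta> q q' a where
      H: "H \<in> polys_on A" "H \<noteq> 0" "\<alpha> \<in> polys_on A" "\<beta> \<in> polys_on A"
        "q \<in> polys_on A" "q' \<in> polys_on A" "a \<in> A" "a \<noteq> 0"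
        "H = \<alpha> * F + \<beta> * x" "smult a F = q * H" "smult a x = q' * H" .
    obtain ps u where ps: "\<forall>p\<in>set ps. prime_on A p" "u \<in> A" "dvd_on A u 1" "a = u * prod_list ps"
      using ufd_onE H by metis
    from clear_denominator_on[OF A ps(1-3) F(1) H(5) H(1)] H(10) ps(4) obtain q1 H1 c where
      *: "q1\<in>polys_on A" "H1\<in>polys_on A" "c\<in>A" "c \<noteq> 0" "F = q1 * H1" "H = smult c H1" by blast
    from irr[OF *(1,2,5)] show ?thesis
    proof
      assume "degree q1 = 0"
      then obtain e where e: "e \<in> A" "q1 = [:e:]" using const * by blast
      have "e \<noteq> 0" using F0 e * by auto
      have "F = smult e H1" using * e by simp
      then obtain w where w: "w \<in> A" "1 = e * w"
        using primitive_on_unit[OF F(2) _ *(2) e(1) \<open>e \<noteq> 0\<close>] by (auto simp: dvd_on_def)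
      have "H1 = smult w F" using \<open>F = smult e H1\<close> w by (simp add: mult.commute)
      have "smult a x = q' * smult c (smult w F)" unfolding H(11) *(6) using \<open>H1 = smult w F\<close> by metis
      then have "smult a x = F * smult (c * w) q'" by (simp add: mult_ac)
      then have "dvd_on (polys_on A) F (smult a x)" unfolding dvd_on_def
        using smult_in_polys_on[OF A subring_onD(4)[OF A *(3) w(1)] H(6)] by blast
      then show ?thesis using primitive_on_cancel F x H by blast
    next
      assume "degree H1 = 0"
      then have "degree H = 0" using * by simp
      then obtain h where h: "h \<in> A" "H = [:h:]" using const H by blast
      then have "h \<noteq> 0" using H by auto
      have "smult h y = H * y" using h by simp
      also have "\<dots> = (\<alpha> * y) * F + \<beta> * (x * y)" using H(9) by (simp add: algebra_simps)
      finally have "smult h y = (\<alpha> * y) * F + \<beta> * (x * y)" .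
      moreover have "dvd_on (polys_on A) F ((\<alpha> * y) * F)" unfolding dvd_on_def
        using subring_onD(4)[OF PA H(3) y] by (metis mult.commute)
      moreover have "dvd_on (polys_on A) F (\<beta> * (x * y))"
        using dvd_on_mult_left[OF PA H(4) xy] .
      ultimately have "dvd_on (polys_on A) F (smult h y)" using dvd_on_add[OF PA] by metis
      then show ?thesis using primitive_on_cancel F y h \<open>h \<noteq> 0\<close> by blast
    qed
  qed
  ultimately show ?thesis unfolding prime_on_def using F F0 by blast
qed

lemma prime_on_dvd_prod_list:
  assumes "prime_on A p" "\<forall>q\<in>set ps. q \<in> A" "dvd_on A p (prod_list ps)"
  shows "\<exists>q\<in>set ps. dvd_on A p q"
  using assms(2,3)
proof (induction ps)
  case Nil then show ?case using assms(1) by (simp add: prime_on_def)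
next
  case (Cons q ps)
  have "prod_list ps \<in> A" using Cons.prems(1)
    by (intro subring_on_prod_list[OF A]) auto
  then show ?case using Cons assms(1) unfolding prime_on_def by auto
qed

text \<open>A prime that divides \<open>F\<close> divides its leading coefficient, so it is
  associated to one of \<open>ps\<close>. Dividing it out shortens the factorization of the leading
  coefficient, which makes the process end.\<close>

lemma primitive_part_ex:
  fixes F :: "'a poly"
  assumes "F \<in> polys_on A" "\<forall>p\<in>set ps. prime_on A p" "u \<in> A" "dvd_on A u 1"
    "lead_coeff F = u * prod_list ps"
  shows "\<exists>c\<in>A. \<exists>G\<in>polys_on A. F = smult c G \<and> primitive_on G"
  using assms
proof (induction "length ps" arbitrary: F ps u)
  case 0
  show ?case
  proof (cases "primitive_on F")
    case True then show ?thesis using 0 subring_onD(2)[OF A] by (intro bexI[of _ 1] bexI[of _ F]) auto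
  next
    case False
    then obtain p where p: "prime_on A p" "dvd_on (polys_on A) [:p:] F" unfolding primitive_on_def by blast
    then have "dvd_on A p (lead_coeff F)" using dvd_on_const_iff[OF A] 0 by blast
    then have "dvd_on A p 1" using 0 dvd_on_trans[OF A] by fastforce
    then show ?thesis using p by (simp add: prime_on_def)
  qed
next
  case (Suc n)
  show ?case
  proof (cases "primitive_on F")
    case True then show ?thesis using Suc subring_onD(2)[OF A] by (intro bexI[of _ 1] bexI[of _ F]) auto
  next
    case False
    then obtain p where p: "prime_on A p" "dvd_on (polys_on A) [:p:] F" unfolding primitive_on_def by blast
    then have pA: "p \<in> A" "p \<noteq> 0" "\<not> dvd_on A p 1" by (auto simp: prime_on_def)
    obtain G where G: "G \<in> polys_on A" "F = smult p G" using p by (auto simp: dvd_on_def)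
    have psA: "\<forall>q\<in>set ps. q \<in> A" using Suc by (auto simp: prime_on_def)
    have lG: "lead_coeff F = p * lead_coeff G" using G pA by simp
    have lGA: "lead_coeff G \<in> A" using G by (auto simp: polys_on_def)
    have plA: "prod_list ps \<in> A" using psA
      by (intro subring_on_prod_list[OF A]) auto
    have "dvd_on A p (u * prod_list ps)" using lG Suc lGA by (auto simp: dvd_on_def)
    moreover have "\<not> dvd_on A p u" using pA Suc dvd_on_trans[OF A] by blast
    ultimately have "dvd_on A p (prod_list ps)" using p(1) plA Suc unfolding prime_on_def by blast
    then obtain q where q: "q \<in> set ps" "dvd_on A p q" using prime_on_dvd_prod_list[OF p(1) psA] by blast
    obtain w where w: "w \<in> A" "q = p * w" using q by (auto simp: dvd_on_def)
    have qp: "prime_on A q" using q Suc by auto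
    then have "q \<noteq> 0" by (simp add: prime_on_def)
    \<comment> \<open>Both \<open>p\<close> and \<open>q = p * w\<close> are prime. If
      \<open>q\<close> divided \<open>w\<close>, then \<open>p\<close> would be a unit; so
      \<open>q\<close> divides \<open>p\<close>, and \<open>w\<close> is a unit that can be merged
      into \<open>u\<close>.\<close>
    have "dvd_on A q p \<or> dvd_on A q w"
      using qp w pA subring_onD(2)[OF A] unfolding prime_on_def dvd_on_def by (metis mult.right_neutral)
    moreover have "\<not> dvd_on A q w"
    proof
      assume "dvd_on A q w"
      then obtain z where z: "z \<in> A" "w = q * z" by (auto simp: dvd_on_def)
      then have "q * 1 = q * (p * z)" using w by (simp add: mult_ac)
      then have "1 = p * z" using \<open>q \<noteq> 0\<close> by (metis mult_left_cancel)
      then show False using pA z by (auto simp: dvd_on_def)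
    qed
    ultimately obtain z where z: "z \<in> A" "p = q * z" by (auto simp: dvd_on_def)
    have "p * 1 = p * (w * z)" using z w by (simp add: mult_ac)
    then have wz: "1 = w * z" using pA by (metis mult_left_cancel)
    have "prod_list ps = q * prod_list (remove1 q ps)" using q(1) by (induction ps) auto
    then have "p * lead_coeff G = p * (u * w * prod_list (remove1 q ps))"
      using Suc lG w by (simp add: mult_ac)
    then have lead: "lead_coeff G = (u * w) * prod_list (remove1 q ps)" using pA by simp
    have "dvd_on A (u * w) 1"
    proof -
      obtain u' where "u' \<in> A" "1 = u * u'" using Suc by (auto simp: dvd_on_def)
      then have "1 = (u * w) * (u' * z)" using wz by (metis mult.assoc mult.left_commute mult.right_neutral)
      then show ?thesis unfolding dvd_on_def using \<open>u' \<in> A\<close> z subring_onD(4)[OF A] by blast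
    qed
    moreover have "n = length (remove1 q ps)" using Suc(2) q by (simp add: length_remove1)
    moreover have "\<forall>p\<in>set (remove1 q ps). prime_on A p" using Suc by (meson notin_set_remove1)
    ultimately obtain c G' where "c \<in> A" "G' \<in> polys_on A" "G = smult c G'" "primitive_on G'"
      using Suc(1)[of "remove1 q ps" G "u * w"] G lead Suc w subring_onD(4)[OF A] by blast
    then show ?thesis using G pA by (intro bexI[of _ "p * c"] bexI[of _ G']) (auto intro: subring_onD[OF A])
  qed
qed

text \<open>Gauss's theorem. By induction on the degree: split off the content, then the primitive
  part is constant, a product of two polynomials of smaller degree, or prime.\<close>

lemma ufd_on_polys_on: "ufd_on (polys_on A)"
proof -
  note PA = subring_on_polys_on[OF A]
  let ?fac = "\<lambda>F. \<exists>ps u. (\<forall>p\<in>set ps. prime_on (polys_on A) p) \<and> u \<in> polys_on A \<and>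
      dvd_on (polys_on A) u 1 \<and> F = u * prod_list ps"
  have fac_mult: "?fac (F * G)" if F: "?fac F" and G: "?fac G" for F G
  proof -
    obtain ps u where 1: "\<forall>p\<in>set ps. prime_on (polys_on A) p" "u \<in> polys_on A"
      "dvd_on (polys_on A) u 1" "F = u * prod_list ps" using F by blast
    obtain qs w where 2: "\<forall>p\<in>set qs. prime_on (polys_on A) p" "w \<in> polys_on A"
      "dvd_on (polys_on A) w 1" "G = w * prod_list qs" using G by blast
    obtain u' w' where uw: "u' \<in> polys_on A" "1 = u * u'" "w' \<in> polys_on A" "1 = w * w'"
      using 1(3) 2(3) by (auto simp: dvd_on_def)
    then have "1 = (u * w) * (u' * w')" by (metis mult.assoc mult.left_commute mult.right_neutral)
    then have "dvd_on (polys_on A) (u * w) 1" unfolding dvd_on_def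
      using uw subring_onD(4)[OF PA] by blast
    then show ?thesis using 1 2 subring_onD(4)[OF PA]
      by (intro exI[of _ "ps @ qs"] exI[of _ "u * w"]) (auto simp: mult_ac)
  qed
  have fac_const: "?fac [:a:]" if a: "a \<in> A" "a \<noteq> 0" for a
  proof -
    obtain ps u where ps: "\<forall>p\<in>set ps. prime_on A p" "u \<in> A" "dvd_on A u 1" "a = u * prod_list ps"
      using ufd_onE a by metis
    have pl: "[:prod_list ps:] = prod_list (map (\<lambda>p. [:p:]) ps)" for ps :: "'a list"
    proof (induction ps)
      case (Cons p ps)
      have "[:p * prod_list ps:] = [:p:] * [:prod_list ps:]" by simp
      then show ?case using Cons by simp
    qed (simp add: one_pCons)
    obtain w where "w \<in> A" "1 = u * w" using ps by (auto simp: dvd_on_def)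
    then have "(1::'a poly) = [:u:] * [:w:]" by (simp add: one_pCons mult.commute)
    then have "dvd_on (polys_on A) [:u:] 1" unfolding dvd_on_def
      using const_in_polys_on[OF A \<open>w \<in> A\<close>] by blast
    moreover have "[:a:] = [:u:] * prod_list (map (\<lambda>p. [:p:]) ps)" using ps(4) by (simp flip: pl)
    ultimately show ?thesis using ps prime_on_const[OF A] const_in_polys_on[OF A ps(2)]
      by (intro exI[of _ "map (\<lambda>p. [:p:]) ps"] exI[of _ "[:u:]"]) auto
  qed
  have "?fac F" if "F \<in> polys_on A" "F \<noteq> 0" for F
    using that
  proof (induction "degree F" arbitrary: F rule: less_induct)
    case less
    have "lead_coeff F \<in> A" "lead_coeff F \<noteq> 0" using less by (auto simp: polys_on_def)
    then obtain ps u where ps: "\<forall>p\<in>set ps. prime_on A p" "u \<in> A" "dvd_on A u 1" "lead_coeff F = u * prod_list ps"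
      using ufd_onE by metis
    from primitive_part_ex[OF less.prems(1) ps] obtain c G where
      cG: "c \<in> A" "G \<in> polys_on A" "F = smult c G" "primitive_on G" by blast
    have c0: "c \<noteq> 0" "G \<noteq> 0" using cG less by auto
    have dG: "degree G = degree F" using cG c0 by simp
    have "?fac G"
    proof (cases "degree G = 0")
      case True
      then obtain g where "G = [:g:]" by (meson degree_eq_zeroE)
      moreover have "g = coeff G 0" using \<open>G = [:g:]\<close> by simp
      then have "g \<in> A" using cG(2) unfolding polys_on_def by blast
      ultimately show ?thesis using fac_const[of g] c0 by auto
    next
      case False
      show ?thesis
      proof (cases "\<exists>x\<in>polys_on A. \<exists>y\<in>polys_on A. G = x * y \<and> degree x \<noteq> 0 \<and> degree y \<noteq> 0")
        case True
        then obtain x y where xy: "x \<in> polys_on A" "y \<in> polys_on A" "G = x * y" "degree x \<noteq> 0" "degree y \<noteq> 0"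
          by blast
        then have "degree G = degree x + degree y" using c0 by (simp add: degree_mult_eq)
        then show ?thesis using fac_mult[of x y] less.hyps[of x] less.hyps[of y] xy dG c0 by auto
      next
        case irr: False
        have "prime_on (polys_on A) G" using prime_on_polys[OF cG(2,4)] False irr by blast
        then show ?thesis using subring_onD(2)[OF PA] 
          by (intro exI[of _ "[G]"] exI[of _ 1]) (auto simp: dvd_on_def)
      qed
    qed
    then show ?case using fac_mult[OF fac_const[OF cG(1) c0(1)]] cG(3) by simp
  qed
  then show ?thesis unfolding ufd_on_def by blast
qed

end

text \<open>The map has to be injective and multiplicative on \<open>A\<close> only, which suits the
  evaluation of a univariate polynomial at a new variable.\<close>

lemma ufd_on_image:
  fixes A :: "'a::comm_ring_1 set" and f :: "'a \<Rightarrow> 'b::comm_ring_1"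
  assumes A: "subring_on A" and ufd: "ufd_on A" and inj: "inj_on f A"
    and f: "f 1 = 1" "\<And>x y. x \<in> A \<Longrightarrow> y \<in> A \<Longrightarrow> f (x * y) = f x * f y"
      "\<And>x y. x \<in> A \<Longrightarrow> y \<in> A \<Longrightarrow> f (x - y) = f x - f y"
  shows "ufd_on (f ` A)"
proof -
  have f0: "f 0 = 0" using f(3)[of 0 0] subring_onD(1)[OF A] by simp
  have dvd: "dvd_on (f ` A) (f x) (f y) \<longleftrightarrow> dvd_on A x y" if "x \<in> A" "y \<in> A" for x y
  proof
    assume "dvd_on (f ` A) (f x) (f y)"
    then obtain c where c: "c \<in> A" "f y = f x * f c" by (auto simp: dvd_on_def)
    then have "f y = f (x * c)" using f(2) that by simp
    then have "y = x * c" using inj_onD[OF inj] that c subring_onD(4)[OF A] by blast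
    then show "dvd_on A x y" using c by (auto simp: dvd_on_def)
  next
    assume "dvd_on A x y"
    then show "dvd_on (f ` A) (f x) (f y)" using that f(2) by (auto simp: dvd_on_def)
  qed
  have prime: "prime_on (f ` A) (f p)" if "prime_on A p" for p
  proof -
    have p: "p \<in> A" "p \<noteq> 0" "\<not> dvd_on A p 1" using that by (auto simp: prime_on_def)
    have "f p \<noteq> 0" using inj_onD[OF inj, of p 0] f0 p subring_onD(1)[OF A] by auto
    moreover have "\<not> dvd_on (f ` A) (f p) 1" using dvd[of p 1] p f(1) subring_onD(2)[OF A] by simp
    moreover have "dvd_on (f ` A) (f p) (f x) \<or> dvd_on (f ` A) (f p) (f y)"
      if "x \<in> A" "y \<in> A" "dvd_on (f ` A) (f p) (f x * f y)" for x y
    proof -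
      have "dvd_on A p (x * y)" using that dvd[OF p(1) subring_onD(4)[OF A that(1,2)]] f(2)[of x y] by simp
      then have "dvd_on A p x \<or> dvd_on A p y" using \<open>prime_on A p\<close> that unfolding prime_on_def by blast
      then show ?thesis using dvd[OF p(1)] that by blast
    qed
    ultimately show ?thesis unfolding prime_on_def using p by blast
  qed
  have pl: "f (prod_list ps) = prod_list (map f ps) \<and> prod_list ps \<in> A" if "\<forall>p\<in>set ps. p \<in> A" for ps
    using that by (induction ps) (auto simp: f intro: subring_onD[OF A])
  show ?thesis unfolding ufd_on_def
  proof (intro ballI impI)
    fix b assume "b \<in> f ` A" "b \<noteq> 0"
    then obtain a where a: "a \<in> A" "b = f a" "a \<noteq> 0" using f0 by auto
    then obtain ps u where ps: "\<forall>p\<in>set ps. prime_on A p" "u \<in> A" "dvd_on A u 1" "a = u * prod_list ps"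
      using ufd unfolding ufd_on_def by blast
    then have "b = f u * prod_list (map f ps)" using a f(2) pl[of ps] by (auto simp: prime_on_def)
    moreover have "dvd_on (f ` A) (f u) 1" using dvd[of u 1] ps f(1) subring_onD(2)[OF A] by simp
    ultimately show "\<exists>ps u. (\<forall>p\<in>set ps. prime_on (f ` A) p) \<and> u \<in> f ` A \<and> dvd_on (f ` A) u 1 \<and> b = u * prod_list ps"
      using ps prime by (intro exI[of _ "map f ps"] exI[of _ "f u"]) auto
  qed
qed

lemma ufd_on_int: "ufd_on (UNIV :: int set)"
proof -
  have dvd: "dvd_on UNIV a b \<longleftrightarrow> a dvd b" for a b :: int by (auto simp: dvd_on_def dvd_def)
  have prime: "prime_on UNIV p" if "prime p" for p :: int
    using that by (auto simp: prime_on_def dvd prime_dvd_mult_iff not_prime_unit)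
  show ?thesis unfolding ufd_on_def
  proof (intro ballI impI)
    fix a :: int assume "a \<noteq> 0"
    obtain ps where ps: "mset ps = prime_factorization a" by (metis ex_mset)
    have "a = unit_factor a * prod_list ps"
      by (metis \<open>a \<noteq> 0\<close> prod_mset_prime_factorization prod_mset_prod_list ps unit_factor_mult_normalize)
    moreover have "\<forall>p\<in>set ps. prime p" using ps
      by (metis in_prime_factors_imp_prime set_mset_mset)
    moreover have "unit_factor a dvd 1" using \<open>a \<noteq> 0\<close> by simp
    ultimately show "\<exists>ps u. (\<forall>p\<in>set ps. prime_on UNIV p) \<and> u \<in> UNIV \<and> dvd_on UNIV u 1 \<and> a = u * prod_list ps"
      using dvd prime by blast
  qed
qed

text \<open>An irreducible element is associated to the first prime of its own factorization, since
  the remaining factors must form a unit.\<close>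

lemma ufd_on_irreducible_dvd_mult:
  fixes A :: "'a::idom set"
  assumes A: "subring_on A" and ufd: "ufd_on A" and p: "p \<in> A" "p \<noteq> 0" "\<not> dvd_on A p 1"
    and irr: "\<And>x y. x \<in> A \<Longrightarrow> y \<in> A \<Longrightarrow> p = x * y \<Longrightarrow> dvd_on A x 1 \<or> dvd_on A y 1"
    and x: "x \<in> A" and y: "y \<in> A" and xy: "dvd_on A p (x * y)"
  shows "dvd_on A p x \<or> dvd_on A p y"
proof -
  obtain ps u where ps: "\<forall>p\<in>set ps. prime_on A p" "u \<in> A" "dvd_on A u 1" "p = u * prod_list ps"
    using ufd p unfolding ufd_on_def by blast
  then obtain q qs where ps': "ps = q # qs" using p by (cases ps) auto
  have q: "prime_on A q" using ps ps' by simp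
  have pl: "prod_list qs \<in> A" using ps(1) unfolding ps'
    by (intro subring_on_prod_list[OF A]) (auto simp: prime_on_def)
  have uq: "u * prod_list qs \<in> A" by (intro subring_onD[OF A] ps pl)
  have eq: "p = q * (u * prod_list qs)" using ps ps' by (simp add: mult_ac)
  then have "dvd_on A (u * prod_list qs) 1"
    using irr[of q "u * prod_list qs"] uq q unfolding prime_on_def by blast
  then obtain w where w: "w \<in> A" "1 = u * prod_list qs * w" by (auto simp: dvd_on_def)
  have "q = p * w" using eq w by (metis mult.assoc mult.right_neutral)
  then have pq: "dvd_on A p q" using w by (auto simp: dvd_on_def)
  have "dvd_on A q p" using eq uq by (auto simp: dvd_on_def)
  then have "dvd_on A q (x * y)" using xy dvd_on_trans[OF A] by blast
  then show ?thesis using q x y pq dvd_on_trans[OF A] unfolding prime_on_def by blast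
qed

subsection \<open>Homomorphisms from monoid algebras\<close>

text \<open>The common shape of \<open>mp_eval\<close>, \<open>xy_hom\<close> and
  \<open>pm_map\<close>: coefficients go through \<phi>, exponents through \<chi>. It is a ring
  homomorphism when \<phi> is one and \<chi> turns sums of exponents into products.\<close>

definition pm_hom :: "('a::zero \<Rightarrow> 'b::comm_semiring_1) \<Rightarrow> ('m \<Rightarrow> 'b) \<Rightarrow> ('m \<Rightarrow>\<^sub>0 'a) \<Rightarrow> 'b" where
  "pm_hom \<phi> \<chi> p = (\<Sum>k\<in>Poly_Mapping.keys p. \<phi> (Poly_Mapping.lookup p k) * \<chi> k)"

lemma poly_mapping_sum_single:
  "p = (\<Sum>k\<in>Poly_Mapping.keys p. Poly_Mapping.single k (Poly_Mapping.lookup p k))"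
proof (rule poly_mapping_eqI)
  fix k
  have "(\<Sum>i\<in>Poly_Mapping.keys p. Poly_Mapping.lookup (Poly_Mapping.single i (Poly_Mapping.lookup p i)) k)
      = (\<Sum>i\<in>Poly_Mapping.keys p. if i = k then Poly_Mapping.lookup p i else 0)"
    by (intro sum.cong) (auto simp: lookup_single)
  also have "\<dots> = Poly_Mapping.lookup p k" by (simp add: in_keys_iff)
  finally show "Poly_Mapping.lookup p k = Poly_Mapping.lookup (\<Sum>k\<in>Poly_Mapping.keys p. Poly_Mapping.single k (Poly_Mapping.lookup p k)) k"
    by (simp add: lookup_sum)
qed

lemma pm_hom_superset:
  assumes "finite S" "Poly_Mapping.keys p \<subseteq> S" "\<phi> 0 = 0"
  shows "pm_hom \<phi> \<chi> p = (\<Sum>k\<in>S. \<phi> (Poly_Mapping.lookup p k) * \<chi> k)"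
  unfolding pm_hom_def using assms by (intro sum.mono_neutral_left) (auto simp: in_keys_iff)

lemma pm_hom_single: "\<phi> 0 = 0 \<Longrightarrow> pm_hom \<phi> \<chi> (Poly_Mapping.single k c) = \<phi> c * \<chi> k"
  by (subst pm_hom_superset[of "{k}"]) auto

lemma pm_hom_0 [simp]: "pm_hom \<phi> \<chi> 0 = 0"
  by (simp add: pm_hom_def)

lemma pm_hom_add:
  assumes "comm_ring_hom \<phi>"
  shows "pm_hom \<phi> \<chi> (p + q) = pm_hom \<phi> \<chi> p + pm_hom \<phi> \<chi> q"
proof -
  interpret comm_ring_hom \<phi> by fact
  let ?S = "Poly_Mapping.keys p \<union> Poly_Mapping.keys q"
  show ?thesis
    by (subst (1 2 3) pm_hom_superset[of ?S])
      (auto simp: keys_add lookup_add hom_add distrib_right sum.distrib)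
qed

lemma pm_hom_sum:
  assumes "comm_ring_hom \<phi>"
  shows "pm_hom \<phi> \<chi> (sum f I) = (\<Sum>i\<in>I. pm_hom \<phi> \<chi> (f i))"
  by (induction I rule: infinite_finite_induct) (simp_all add: pm_hom_add[OF assms])

lemma pm_hom_comm_ring_hom:
  assumes \<phi>: "comm_ring_hom (\<phi> :: 'a::comm_ring_1 \<Rightarrow> 'b::comm_ring_1)" and "\<chi> (0::'m::comm_monoid_add) = 1"
    and "\<And>a b. \<chi> (a + b) = \<chi> a * \<chi> b"
  shows "comm_ring_hom (pm_hom \<phi> \<chi>)"
proof
  interpret comm_ring_hom \<phi> by fact
  fix p q :: "'m \<Rightarrow>\<^sub>0 'a"
  show "pm_hom \<phi> \<chi> (p + q) = pm_hom \<phi> \<chi> p + pm_hom \<phi> \<chi> q" by (rule pm_hom_add[OF \<phi>])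
  show "pm_hom \<phi> \<chi> 1 = 1" using assms pm_hom_single[of \<phi> \<chi> 0 1] by simp
  have "p * q = (\<Sum>k\<in>Poly_Mapping.keys p. \<Sum>l\<in>Poly_Mapping.keys q.
      Poly_Mapping.single (k + l) (Poly_Mapping.lookup p k * Poly_Mapping.lookup q l))"
    by (subst (1) poly_mapping_sum_single[of p], subst (1) poly_mapping_sum_single[of q])
      (simp add: sum_product mult_single)
  then have "pm_hom \<phi> \<chi> (p * q) = (\<Sum>k\<in>Poly_Mapping.keys p. \<Sum>l\<in>Poly_Mapping.keys q.
      (\<phi> (Poly_Mapping.lookup p k) * \<chi> k) * (\<phi> (Poly_Mapping.lookup q l) * \<chi> l))"
    by (simp add: pm_hom_sum[OF \<phi>] pm_hom_single hom_mult assms(3) mult_ac)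
  then show "pm_hom \<phi> \<chi> (p * q) = pm_hom \<phi> \<chi> p * pm_hom \<phi> \<chi> q"
    unfolding pm_hom_def by (simp add: sum_product)
  show "pm_hom \<phi> \<chi> 0 = 0" by (simp add: pm_hom_def)
qed

lemma hom_pm_hom:
  assumes "comm_ring_hom f"
  shows "f (pm_hom \<phi> \<chi> p) = pm_hom (\<lambda>c. f (\<phi> c)) (\<lambda>k. f (\<chi> k)) p"
proof -
  interpret comm_ring_hom f by fact
  show ?thesis unfolding pm_hom_def by (simp add: hom_sum hom_mult)
qed

lemma pm_hom_id: "pm_hom (Poly_Mapping.single 0) (\<lambda>k. Poly_Mapping.single k 1) p = p"
  unfolding pm_hom_def by (subst (3) poly_mapping_sum_single) (simp add: mult_single)

lemma comm_ring_hom_single_0: "comm_ring_hom (Poly_Mapping.single (0::'m::comm_monoid_add) :: 'a::comm_ring_1 \<Rightarrow> _)"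
  by unfold_locales (auto simp: single_add mult_single)

lemma comm_ring_hom_comp: "comm_ring_hom f \<Longrightarrow> comm_ring_hom g \<Longrightarrow> comm_ring_hom (\<lambda>x. f (g x))"
proof -
  assume "comm_ring_hom f" "comm_ring_hom g"
  then interpret f: comm_ring_hom f + g: comm_ring_hom g by auto
  show ?thesis by unfold_locales (auto simp: f.hom_add g.hom_add f.hom_mult g.hom_mult)
qed

lemma comm_ring_hom_const_poly: "comm_ring_hom (\<lambda>c::'a::comm_ring_1. [:c:])"
  by unfold_locales (auto simp: one_pCons)

lemma comm_ring_hom_poly: "comm_ring_hom (\<lambda>p. poly p (x::'a::comm_ring_1))"
  by unfold_locales auto

lemma comm_ring_hom_of_int: "comm_ring_hom (of_int :: int \<Rightarrow> 'a::comm_ring_1)"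
  by unfold_locales auto

lemma comm_ring_hom_ident: "comm_ring_hom (\<lambda>x::'a::comm_ring_1. x)"
  by unfold_locales auto

subsection \<open>Evaluation of monomials\<close>

definition mono_ev :: "('v \<Rightarrow> 'b::comm_monoid_mult) \<Rightarrow> ('v \<Rightarrow>\<^sub>0 nat) \<Rightarrow> 'b" where
  "mono_ev h \<gamma> = (\<Prod>v\<in>Poly_Mapping.keys \<gamma>. h v ^ Poly_Mapping.lookup \<gamma> v)"

lemma mono_ev_superset:
  assumes "finite S" "Poly_Mapping.keys \<gamma> \<subseteq> S"
  shows "mono_ev h \<gamma> = (\<Prod>v\<in>S. h v ^ Poly_Mapping.lookup \<gamma> v)"
  unfolding mono_ev_def using assms by (intro prod.mono_neutral_left) (auto simp: in_keys_iff)

lemma mono_ev_0 [simp]: "mono_ev h 0 = 1"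
  by (simp add: mono_ev_def)

lemma mono_ev_add: "mono_ev h (a + b) = mono_ev h a * mono_ev h b"
proof -
  let ?S = "Poly_Mapping.keys a \<union> Poly_Mapping.keys b"
  show ?thesis
    by (subst (1 2 3) mono_ev_superset[of ?S])
      (auto simp: keys_add lookup_add power_add prod.distrib)
qed

lemma mono_ev_single [simp]: "mono_ev h (Poly_Mapping.single v k) = h v ^ k"
  by (subst mono_ev_superset[of "{v}"]) auto

lemma mono_ev_cong: "(\<And>v. v \<in> Poly_Mapping.keys \<gamma> \<Longrightarrow> h v = h' v) \<Longrightarrow> mono_ev h \<gamma> = mono_ev h' \<gamma>"
  unfolding mono_ev_def by (intro prod.cong) auto

lemma hom_mono_ev:
  assumes "comm_ring_hom f" shows "f (mono_ev h \<gamma>) = mono_ev (\<lambda>v. f (h v)) \<gamma>"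
proof -
  interpret comm_ring_hom f by fact
  show ?thesis unfolding mono_ev_def by (simp add: hom_prod hom_power)
qed

lemma mp_eval_eq: "mp_eval \<phi> h p = pm_hom \<phi> (mono_ev h) p"
  by (simp add: mp_eval_def pm_hom_def mono_ev_def)

lemma comm_ring_hom_mp_eval: "comm_ring_hom \<phi> \<Longrightarrow> comm_ring_hom (mp_eval \<phi> h)"
  using pm_hom_comm_ring_hom[of \<phi> "mono_ev h"]
  by (simp add: mono_ev_add mp_eval_eq[abs_def])

lemma hom_mp_eval:
  "comm_ring_hom f \<Longrightarrow> f (mp_eval \<phi> h p) = mp_eval (\<lambda>c. f (\<phi> c)) (\<lambda>v. f (h v)) p"
  by (simp add: mp_eval_eq hom_pm_hom hom_mono_ev)

lemma mp_eval_cong: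
  assumes "\<And>v. v \<in> (\<Union>\<mu>\<in>Poly_Mapping.keys p. Poly_Mapping.keys \<mu>) \<Longrightarrow> h v = h' v"
  shows "mp_eval \<phi> h p = mp_eval \<phi> h' p"
  unfolding mp_eval_eq pm_hom_def
  by (intro sum.cong refl arg_cong2[where f="(*)"] mono_ev_cong assms) auto

definition Var :: "'v \<Rightarrow> ('v \<Rightarrow>\<^sub>0 nat) \<Rightarrow>\<^sub>0 'a::comm_ring_1" where
  "Var v = Poly_Mapping.single (Poly_Mapping.single v 1) 1"

lemma mp_eval_Var [simp]: "comm_ring_hom \<phi> \<Longrightarrow> mp_eval \<phi> h (Var v) = h v"
proof -
  assume "comm_ring_hom \<phi>"
  then interpret comm_ring_hom \<phi> .
  show ?thesis by (simp add: mp_eval_eq Var_def pm_hom_single)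
qed

lemma mp_eval_const [simp]: "comm_ring_hom \<phi> \<Longrightarrow> mp_eval \<phi> h (Poly_Mapping.single 0 c) = \<phi> c"
proof -
  assume "comm_ring_hom \<phi>"
  then interpret comm_ring_hom \<phi> .
  show ?thesis by (simp add: mp_eval_eq pm_hom_single)
qed

lemma mono_ev_Var: "mono_ev Var \<gamma> = Poly_Mapping.single \<gamma> (1::'a::comm_ring_1)"
proof -
  have pow: "Var v ^ k = Poly_Mapping.single (Poly_Mapping.single v k) (1::'a)" for v :: 'b and k
  proof (induction k)
    case (Suc k)
    have "Poly_Mapping.single v (Suc k) = Poly_Mapping.single v 1 + Poly_Mapping.single v k"
      by (metis plus_1_eq_Suc single_add)
    then show ?case using Suc by (simp add: Var_def mult_single)
  qed (simp flip: single_one)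
  have prod: "(\<Prod>v\<in>S. Poly_Mapping.single (g v) (1::'a)) = Poly_Mapping.single (\<Sum>v\<in>S. g v) 1"
    if "finite S" for S :: "'b set" and g :: "'b \<Rightarrow> 'b \<Rightarrow>\<^sub>0 nat"
    using that by (induction S) (auto simp: mult_single)
  show ?thesis unfolding mono_ev_def pow
    by (subst prod) (auto simp: poly_mapping_sum_single[symmetric])
qed

lemma mp_eval_Var_id: "mp_eval (Poly_Mapping.single 0) Var p = p"
  by (simp add: mp_eval_eq mono_ev_Var[abs_def] pm_hom_id)

text \<open>The universal property of the polynomial ring; equality of two homomorphisms is thereby
  checked on constants and variables.\<close>

lemma comm_ring_hom_eq_mp_eval:
  assumes "comm_ring_hom f"
  shows "f p = mp_eval (\<lambda>c. f (Poly_Mapping.single 0 c)) (\<lambda>v. f (Var v)) p"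
  using hom_mp_eval[OF assms, of "Poly_Mapping.single 0" Var p] by (simp add: mp_eval_Var_id)

lemma comm_ring_hom_ext:
  assumes "comm_ring_hom f" "comm_ring_hom g"
    and "\<And>c. f (Poly_Mapping.single 0 c) = g (Poly_Mapping.single 0 c)" "\<And>v. f (Var v) = g (Var v)"
  shows "f p = g p"
  unfolding comm_ring_hom_eq_mp_eval[OF assms(1), of p] comm_ring_hom_eq_mp_eval[OF assms(2), of p]
  by (simp only: assms(3,4))

subsection \<open>Polynomials in a set of variables\<close>

definition polys_in :: "'v set \<Rightarrow> (('v \<Rightarrow>\<^sub>0 nat) \<Rightarrow>\<^sub>0 'a::comm_ring_1) set" where
  "polys_in S = {p. \<forall>\<mu>\<in>Poly_Mapping.keys p. Poly_Mapping.keys \<mu> \<subseteq> S}"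

lemma subring_on_polys_in: "subring_on (polys_in S)"
  unfolding subring_on_def polys_in_def
proof (safe, goal_cases)
  case (1 \<mu> x) then show ?case by auto
next
  case (2 x y \<mu> z)
  then have "\<mu> \<in> Poly_Mapping.keys x \<union> Poly_Mapping.keys y"
    by (auto simp: in_keys_iff lookup_minus)
  then show ?case using 2 by auto
next
  case (3 x y \<mu> z)
  then obtain a b where ab: "\<mu> = a + b" "a \<in> Poly_Mapping.keys x" "b \<in> Poly_Mapping.keys y"
    using keys_mult[of x y] by auto
  have "Poly_Mapping.keys a \<subseteq> S" "Poly_Mapping.keys b \<subseteq> S" using 3 ab by auto
  then have "Poly_Mapping.keys \<mu> \<subseteq> S" unfolding ab(1) using keys_add[of a b] by auto
  then show ?case using 3 by auto
qed

lemma const_in_polys_in: "Poly_Mapping.single 0 c \<in> polys_in S"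
  by (auto simp: polys_in_def)

lemma Var_in_polys_in: "v \<in> S \<Longrightarrow> Var v \<in> polys_in S"
  by (auto simp: polys_in_def Var_def)

lemma mp_eval_in:
  assumes "subring_on A" "p \<in> polys_in S" "\<And>c. \<phi> c \<in> A" "\<And>v. v \<in> S \<Longrightarrow> h v \<in> A"
  shows "mp_eval \<phi> h p \<in> A"
  unfolding mp_eval_def using assms(2)
  by (intro subring_on_sum subring_onD(4) subring_on_prod subring_on_power assms(1,3,4)) (auto simp: polys_in_def)

lemma polys_in_mono: "S \<subseteq> T \<Longrightarrow> polys_in S \<subseteq> polys_in T"
  by (auto simp: polys_in_def)

lemma finite_vars_ex: "\<exists>S. finite S \<and> p \<in> polys_in S"
  by (rule exI[of _ "\<Union>\<mu>\<in>Poly_Mapping.keys p. Poly_Mapping.keys \<mu>"]) (auto simp: polys_in_def)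

lemma mp_eval_cong_polys_in:
  "p \<in> polys_in S \<Longrightarrow> (\<And>v. v \<in> S \<Longrightarrow> h v = h' v) \<Longrightarrow> mp_eval \<phi> h p = mp_eval \<phi> h' p"
  by (rule mp_eval_cong) (auto simp: polys_in_def)

text \<open>Setting the variables outside \<open>S\<close> to 0 is a retraction onto
  \<open>polys_in S\<close> that fixes \<open>x\<close> and \<open>x * y\<close>. Hence divisibility
  among such polynomials means the same inside \<open>polys_in S\<close> as in the whole
  ring.\<close>

lemma polys_in_mult_cancel:
  assumes x: "x \<in> polys_in S" and xy: "x * y \<in> polys_in S"
  shows "\<exists>z\<in>polys_in S. x * y = x * z"
proof -
  let ?\<rho> = "mp_eval (Poly_Mapping.single 0) (\<lambda>v. if v \<in> S then Var v else 0)"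
  interpret comm_ring_hom ?\<rho> by (intro comm_ring_hom_mp_eval comm_ring_hom_single_0)
  have \<rho>: "?\<rho> p = p" if "p \<in> polys_in S" for p
  proof -
    have "?\<rho> p = mp_eval (Poly_Mapping.single 0) Var p" by (rule mp_eval_cong_polys_in[OF that]) simp
    then show ?thesis by (simp only: mp_eval_Var_id)
  qed
  have "x * y = x * ?\<rho> y" using \<rho>[OF xy] \<rho>[OF x] by (simp add: hom_mult)
  moreover have "y \<in> polys_in UNIV" by (auto simp: polys_in_def)
  then have "?\<rho> y \<in> polys_in S"
    by (rule mp_eval_in[OF subring_on_polys_in])
      (auto intro: const_in_polys_in Var_in_polys_in subring_onD[OF subring_on_polys_in])
  ultimately show ?thesis by blast
qed

text \<open>The variable \<open>v\<close> becomes the indeterminate of a univariate polynomial whose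
  coefficients are free of \<open>v\<close>; the inverse is evaluation at
  \<open>Var v\<close>.\<close>

definition as_poly :: "'v \<Rightarrow> (('v \<Rightarrow>\<^sub>0 nat) \<Rightarrow>\<^sub>0 'a::comm_ring_1) \<Rightarrow> (('v \<Rightarrow>\<^sub>0 nat) \<Rightarrow>\<^sub>0 'a) poly" where
  "as_poly v = mp_eval (\<lambda>c. [:Poly_Mapping.single 0 c:]) (\<lambda>w. if w = v then [:0, 1:] else [:Var w:])"

lemma comm_ring_hom_as_poly_const: "comm_ring_hom (\<lambda>c::'a::comm_ring_1. [:Poly_Mapping.single (0::'m::comm_monoid_add) c:])"
  by (rule comm_ring_hom_comp[OF comm_ring_hom_const_poly comm_ring_hom_single_0])

lemma comm_ring_hom_as_poly: "comm_ring_hom (as_poly v)"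
  unfolding as_poly_def by (intro comm_ring_hom_mp_eval comm_ring_hom_as_poly_const)

lemma poly_as_poly: "poly (as_poly v p) (Var v) = p"
proof -
  have "poly (as_poly v p) (Var v) = (\<lambda>x. x) p"
    by (rule comm_ring_hom_ext[OF comm_ring_hom_comp[OF comm_ring_hom_poly comm_ring_hom_as_poly] comm_ring_hom_ident])
      (auto simp: as_poly_def comm_ring_hom_as_poly_const)
  then show ?thesis .
qed

lemma as_poly_in_polys_on:
  assumes "p \<in> polys_in (insert v S)" shows "as_poly v p \<in> polys_on (polys_in S)"
proof -
  note P = subring_on_polys_in[of S]
  note PP = subring_on_polys_on[OF P]
  have "[:0, 1:] \<in> polys_on (polys_in S)"
    using monom_in_polys_on[OF P subring_onD(2)[OF P], of 1] by (simp add: monom_altdef)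
  then show ?thesis unfolding as_poly_def using assms
    by (intro mp_eval_in[OF PP]) (auto intro!: const_in_polys_on P const_in_polys_in Var_in_polys_in)
qed

lemma as_poly_const:
  assumes "p \<in> polys_in S" "v \<notin> S" shows "as_poly v p = [:p:]"
proof -
  have "as_poly v p = mp_eval (\<lambda>c. [:Poly_Mapping.single 0 c:]) (\<lambda>w. [:Var w:]) p"
    unfolding as_poly_def using assms by (intro mp_eval_cong_polys_in[OF assms(1)]) auto
  also have "\<dots> = [:mp_eval (Poly_Mapping.single 0) Var p:]"
    by (simp add: hom_mp_eval[OF comm_ring_hom_const_poly])
  finally show ?thesis by (simp add: mp_eval_Var_id)
qed

lemma as_poly_poly:
  assumes "q \<in> polys_on (polys_in S)" "v \<notin> S" shows "as_poly v (poly q (Var v)) = q"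
proof -
  interpret comm_ring_hom "as_poly v" by (rule comm_ring_hom_as_poly)
  have "as_poly v (poly q (Var v)) = (\<Sum>i\<le>degree q. as_poly v (coeff q i) * as_poly v (Var v) ^ i)"
    by (simp add: poly_altdef hom_sum hom_mult hom_power)
  also have "\<dots> = (\<Sum>i\<le>degree q. monom (coeff q i) i)"
  proof (intro sum.cong refl)
    fix i
    have "as_poly v (coeff q i) = [:coeff q i:]" using assms by (intro as_poly_const) (auto simp: polys_on_def)
    moreover have "as_poly v (Var v :: ('a \<Rightarrow>\<^sub>0 nat) \<Rightarrow>\<^sub>0 'b) = [:0,1:]" by (simp add: as_poly_def comm_ring_hom_as_poly_const)
    ultimately show "as_poly v (coeff q i) * as_poly v (Var v) ^ i = monom (coeff q i) i"
      by (simp add: monom_altdef)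
  qed
  also have "\<dots> = q" by (simp add: poly_as_sum_of_monoms)
  finally show ?thesis .
qed

text \<open>One variable at a time: \<open>polys_in (insert v S)\<close> is the isomorphic image of
  the univariate polynomials over \<open>polys_in S\<close>. The order on the variables serves to
  make the polynomials an integral domain.\<close>

lemma ufd_on_polys_in:
  assumes "finite S" shows "ufd_on (polys_in S :: (('v::linorder \<Rightarrow>\<^sub>0 nat) \<Rightarrow>\<^sub>0 int) set)"
  using assms
proof (induction S)
  case empty
  have "polys_in {} = (Poly_Mapping.single (0::'v \<Rightarrow>\<^sub>0 nat) :: int \<Rightarrow> _) ` UNIV"
  proof (intro equalityI subsetI)
    fix p :: "('v \<Rightarrow>\<^sub>0 nat) \<Rightarrow>\<^sub>0 int" assume "p \<in> polys_in {}"
    then have k: "Poly_Mapping.keys p \<subseteq> {0}" by (auto simp: polys_in_def)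
    have "p = Poly_Mapping.single 0 (Poly_Mapping.lookup p 0)"
      using k by (intro poly_mapping_eqI) (auto simp: lookup_single when_def in_keys_iff)
    then show "p \<in> Poly_Mapping.single 0 ` UNIV" by blast
  qed (auto simp: const_in_polys_in)
  moreover interpret comm_ring_hom "Poly_Mapping.single (0::'v \<Rightarrow>\<^sub>0 nat) :: int \<Rightarrow> _" by (rule comm_ring_hom_single_0)
  have "ufd_on ((Poly_Mapping.single (0::'v \<Rightarrow>\<^sub>0 nat) :: int \<Rightarrow> _) ` UNIV)"
    by (rule ufd_on_image[OF _ ufd_on_int]) (auto simp: subring_on_def hom_mult hom_minus)
  ultimately show ?case by simp
next
  case (insert v S)
  let ?f = "\<lambda>q::(('v \<Rightarrow>\<^sub>0 nat) \<Rightarrow>\<^sub>0 int) poly. poly q (Var v)"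
  note P = subring_on_polys_in[of "insert v S"]
  have "inj_on ?f (polys_on (polys_in S))"
    by (intro inj_onI) (metis as_poly_poly insert.hyps(2))
  then have "ufd_on (?f ` polys_on (polys_in S))"
    by (intro ufd_on_image[OF subring_on_polys_on[OF subring_on_polys_in] ufd_on_polys_on[OF subring_on_polys_in insert.IH]])
      auto
  moreover have "?f ` polys_on (polys_in S) = polys_in (insert v S)"
  proof (intro equalityI subsetI)
    fix p assume "p \<in> ?f ` polys_on (polys_in S)"
    then obtain q where q: "q \<in> polys_on (polys_in S)" "p = poly q (Var v)" by auto
    have "coeff q i \<in> polys_in (insert v S)" for i
      using q polys_in_mono[of S "insert v S"] by (auto simp: polys_on_def)
    then show "p \<in> polys_in (insert v S)" unfolding q(2) poly_altdef
      by (intro subring_on_sum[OF P] subring_onD[OF P] subring_on_power[OF P] Var_in_polys_in) auto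
  next
    fix p :: "('v \<Rightarrow>\<^sub>0 nat) \<Rightarrow>\<^sub>0 int" assume "p \<in> polys_in (insert v S)"
    then show "p \<in> ?f ` polys_on (polys_in S)"
      using as_poly_in_polys_on poly_as_poly by (metis (no_types, lifting) image_eqI)
  qed
  ultimately show ?case by simp
qed

section \<open>Divisibility from vanishing on a hypersurface\<close>

text \<open>The type may contain infinitely many variables, but the three polynomials together
  involve finitely many, and unique factorization is applied in those.\<close>

lemma irreducible_imp_prime_int_polys:
  fixes p :: "('v::linorder \<Rightarrow>\<^sub>0 nat) \<Rightarrow>\<^sub>0 int"
  assumes p: "irreducible p" and xy: "p dvd x * y"
  shows "p dvd x \<or> p dvd y"
proof -
  obtain S1 S2 S3 where S: "finite S1" "p \<in> polys_in S1" "finite S2" "x \<in> polys_in S2" "finite S3" "y \<in> polys_in S3"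
    using finite_vars_ex by metis
  define S where "S = S1 \<union> S2 \<union> S3"
  have fin: "finite S" and inS: "p \<in> polys_in S" "x \<in> polys_in S" "y \<in> polys_in S"
    using S polys_in_mono[of _ S] unfolding S_def by blast+
  note P = subring_on_polys_in[of S]
  have dvd: "dvd_on (polys_in S) a b \<longleftrightarrow> a dvd b" if "a \<in> polys_in S" "b \<in> polys_in S" for a b :: "('v \<Rightarrow>\<^sub>0 nat) \<Rightarrow>\<^sub>0 int"
    using polys_in_mult_cancel[OF that(1)] that(2) by (auto simp: dvd_on_def dvd_def)
  have "dvd_on (polys_in S) p x \<or> dvd_on (polys_in S) p y"
  proof (rule ufd_on_irreducible_dvd_mult[OF P ufd_on_polys_in[OF fin] inS(1) _ _ _ inS(2,3)])
    show "p \<noteq> 0" using p by auto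
    show "\<not> dvd_on (polys_in S) p 1" using p dvd[OF inS(1) subring_onD(2)[OF P]] by (auto simp: irreducible_def)
    show "dvd_on (polys_in S) a 1 \<or> dvd_on (polys_in S) b 1" if "a \<in> polys_in S" "b \<in> polys_in S" "p = a * b" for a b
      using p that dvd subring_onD(2)[OF P] by (auto simp: irreducible_def)
    show "dvd_on (polys_in S) p (x * y)" using dvd[OF inS(1)] xy subring_onD(4)[OF P inS(2,3)] by blast
  qed
  then show ?thesis using dvd inS by blast
qed

lemma map_poly_mp_eval_as_poly:
  fixes p :: "('v \<Rightarrow>\<^sub>0 nat) \<Rightarrow>\<^sub>0 int" and \<psi> :: "'v \<Rightarrow> 'k::field_char_0"
  shows "poly (map_poly (mp_eval of_int \<psi>) (as_poly v p)) x = mp_eval of_int (\<psi>(v := x)) p"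
proof -
  interpret E: comm_ring_hom "mp_eval of_int \<psi> :: (('v \<Rightarrow>\<^sub>0 nat) \<Rightarrow>\<^sub>0 int) \<Rightarrow> 'k"
    by (intro comm_ring_hom_mp_eval comm_ring_hom_of_int)
  interpret map_poly_comm_ring_hom "mp_eval of_int \<psi> :: (('v \<Rightarrow>\<^sub>0 nat) \<Rightarrow>\<^sub>0 int) \<Rightarrow> 'k" ..
  have h: "comm_ring_hom (map_poly (mp_eval of_int \<psi> :: (('v \<Rightarrow>\<^sub>0 nat) \<Rightarrow>\<^sub>0 int) \<Rightarrow> 'k))" ..
  show ?thesis
    by (rule comm_ring_hom_ext[OF comm_ring_hom_comp[OF comm_ring_hom_poly comm_ring_hom_comp[OF h comm_ring_hom_as_poly]]
        comm_ring_hom_mp_eval[OF comm_ring_hom_of_int]])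
      (auto simp: as_poly_def comm_ring_hom_as_poly_const comm_ring_hom_of_int E.map_poly_pCons_hom map_poly_pCons)
qed

lemma mp_eval_nonzero_ex:
  fixes p :: "('v::linorder \<Rightarrow>\<^sub>0 nat) \<Rightarrow>\<^sub>0 int"
  assumes "p \<noteq> 0" shows "\<exists>\<psi> :: 'v \<Rightarrow> 'k::field_char_0. mp_eval of_int \<psi> p \<noteq> 0"
proof -
  obtain S where S: "finite S" "p \<in> polys_in S" using finite_vars_ex by blast
  then show ?thesis using assms
  proof (induction S arbitrary: p)
    case empty
    then have k: "Poly_Mapping.keys p \<subseteq> {0}" by (auto simp: polys_in_def)
    have "p = Poly_Mapping.single 0 (Poly_Mapping.lookup p 0)"
      using k by (intro poly_mapping_eqI) (auto simp: lookup_single when_def in_keys_iff)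
    moreover have "Poly_Mapping.lookup p 0 \<noteq> 0" using calculation empty.prems by force
    ultimately have "mp_eval of_int (\<lambda>_. 0::'k) p \<noteq> 0" using mp_eval_const[OF comm_ring_hom_of_int] by (metis of_int_eq_0_iff)
    then show ?case by blast
  next
    case (insert v S)
    have "as_poly v p \<noteq> 0" using poly_as_poly[of v p] insert.prems by auto
    then obtain i where i: "coeff (as_poly v p) i \<noteq> 0" by (metis leading_coeff_0_iff)
    have "coeff (as_poly v p) i \<in> polys_in S" using as_poly_in_polys_on[OF insert.prems(1)] by (auto simp: polys_on_def)
    from insert.IH[OF this i] obtain \<psi> :: "'v \<Rightarrow> 'k" where "mp_eval of_int \<psi> (coeff (as_poly v p) i) \<noteq> 0" by blast
    then have "coeff (map_poly (mp_eval of_int \<psi>) (as_poly v p)) i \<noteq> 0"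
      by (subst coeff_map_poly) (auto simp: mp_eval_def)
    then have "map_poly (mp_eval of_int \<psi>) (as_poly v p) \<noteq> 0" by auto
    then have "finite {x. poly (map_poly (mp_eval of_int \<psi>) (as_poly v p)) x = 0}" by (rule poly_roots_finite)
    then obtain x where "poly (map_poly (mp_eval of_int \<psi>) (as_poly v p)) x \<noteq> 0"
      using infinite_UNIV_char_0[where 'a='k] by (metis (mono_tags, lifting) mem_Collect_eq UNIV_I ex_new_if_finite)
    then show ?case unfolding map_poly_mp_eval_as_poly by blast
  qed
qed

text \<open>Pick a variable \<open>v\<close> of \<open>R\<close> and compare \<open>R\<close> and
  \<open>D\<close> as polynomials in \<open>v\<close>. Either their common divisor contains
  \<open>R\<close>, or some nonzero \<open>h\<close> free of \<open>v\<close> is a combination of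
  \<open>R\<close> and \<open>D\<close>. In the latter case a point with \<open>h\<close> nonzero is
  completed, by solving for \<open>v\<close>, to a zero of \<open>R\<close>, where \<open>D\<close>
  and therefore \<open>h\<close> vanish.\<close>

theorem irreducible_nullstellensatz:
  fixes R D :: "('v::linorder \<Rightarrow>\<^sub>0 nat) \<Rightarrow>\<^sub>0 int"
  assumes R: "irreducible R" and zero: "\<exists>\<psi> :: 'v \<Rightarrow> 'k::{alg_closed_field, field_char_0}. mp_eval of_int \<psi> R = 0"
    and D: "\<And>\<psi> :: 'v \<Rightarrow> 'k. mp_eval of_int \<psi> R = 0 \<Longrightarrow> mp_eval of_int \<psi> D = 0"
  shows "R dvd D"
proof (rule ccontr)
  assume nd: "\<not> R dvd D"
  have R0: "R \<noteq> 0" using R by auto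
  \<comment> \<open>A prime number is irreducible too, but has no zero over a field of
    characteristic zero; this is what the hypothesis \<open>zero\<close> excludes.\<close>
  have "\<exists>\<mu>\<in>Poly_Mapping.keys R. \<mu> \<noteq> 0"
  proof (rule ccontr)
    assume "\<not> ?thesis"
    then have "R = Poly_Mapping.single 0 (Poly_Mapping.lookup R 0)"
      by (intro poly_mapping_eqI) (auto simp: lookup_single when_def in_keys_iff)
    moreover have "Poly_Mapping.lookup R 0 \<noteq> 0" using calculation R0 by force
    ultimately show False using zero mp_eval_const[OF comm_ring_hom_of_int] by (metis of_int_eq_0_iff)
  qed
  then obtain \<mu> v where v: "\<mu> \<in> Poly_Mapping.keys R" "v \<in> Poly_Mapping.keys \<mu>" by fastforce
  define A :: "(('v \<Rightarrow>\<^sub>0 nat) \<Rightarrow>\<^sub>0 int) set" where "A = polys_in (- {v})"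
  have A: "subring_on A" unfolding A_def by (rule subring_on_polys_in)
  interpret ap: comm_ring_hom "as_poly v :: (('v \<Rightarrow>\<^sub>0 nat) \<Rightarrow>\<^sub>0 int) \<Rightarrow> _" by (rule comm_ring_hom_as_poly)
  interpret ev: comm_ring_hom "\<lambda>p. poly p (Var v :: ('v \<Rightarrow>\<^sub>0 nat) \<Rightarrow>\<^sub>0 int)" by (rule comm_ring_hom_poly)
  have inA: "as_poly v p \<in> polys_on A" for p :: "('v \<Rightarrow>\<^sub>0 nat) \<Rightarrow>\<^sub>0 int"
    unfolding A_def by (rule as_poly_in_polys_on) (auto simp: polys_in_def)
  have constA: "as_poly v a = [:a:]" if "a \<in> A" for a using as_poly_const[of a "-{v}" v] that by (simp add: A_def)
  have polyA: "as_poly v (poly q (Var v)) = q" if "q \<in> polys_on A" for q using as_poly_poly[of q "-{v}" v] that by (simp add: A_def)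
  have apR: "as_poly v R \<noteq> 0" using poly_as_poly[of v R] R0 by auto
  have degR: "degree (as_poly v R) > 0"
  proof (rule ccontr)
    assume "\<not> ?thesis"
    then obtain a where a: "as_poly v R = [:a:]" by (auto elim: degree_eq_zeroE)
    then have "R = a" using poly_as_poly[of v R] by simp
    moreover have "a \<in> A" using inA[of R] a by (metis (mono_tags, lifting) coeff_pCons_0 mem_Collect_eq polys_on_def)
    ultimately show False using v by (auto simp: A_def polys_in_def)
  qed
  from common_divisor_on[OF A inA apR inA[of D]] obtain H x y q q' a where
    H: "H \<in> polys_on A" "H \<noteq> 0" "x \<in> polys_on A" "y \<in> polys_on A"
      "q \<in> polys_on A" "q' \<in> polys_on A" "a \<in> A" "a \<noteq> 0"
      "H = x * as_poly v R + y * as_poly v D" "smult a (as_poly v R) = q * H" "smult a (as_poly v D) = q' * H" .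
  have aR: "a * R = poly q (Var v) * poly H (Var v)"
    using arg_cong[OF H(10), of "\<lambda>p. poly p (Var v)"] by (simp add: poly_as_poly)
  have aD: "a * D = poly q' (Var v) * poly H (Var v)"
    using arg_cong[OF H(11), of "\<lambda>p. poly p (Var v)"] by (simp add: poly_as_poly)
  have "R dvd poly q (Var v) * poly H (Var v)" using aR by (metis dvd_triv_right)
  then have "R dvd poly q (Var v) \<or> R dvd poly H (Var v)" by (rule irreducible_imp_prime_int_polys[OF R])
  then show False
  proof
    \<comment> \<open>Then all of \<open>R\<close> sits in the cofactor \<open>q\<close>, so the
      common divisor \<open>H\<close> is constant in \<open>v\<close>.\<close>
    assume "R dvd poly q (Var v)"
    then obtain w where w: "poly q (Var v) = R * w" by (auto elim: dvdE)
    then have "R * a = R * (w * poly H (Var v))" using aR by (simp add: mult_ac)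
    then have "a = w * poly H (Var v)" using R0 by simp
    then have "[:a:] = as_poly v w * H" using constA[OF H(7)] polyA[OF H(1)] by (metis ap.hom_mult)
    then have "degree (as_poly v w * H) = 0" "as_poly v w \<noteq> 0" using H(8) by (metis degree_pCons_0, force)
    then have "degree H = 0" using H(2) by (simp add: degree_mult_eq)
    then obtain h where h: "H = [:h:]" by (auto elim: degree_eq_zeroE)
    have hA: "h \<in> A" using H(1) h by (metis (mono_tags, lifting) coeff_pCons_0 mem_Collect_eq polys_on_def)
    have heq: "h = poly x (Var v) * R + poly y (Var v) * D"
      using arg_cong[OF H(9), of "\<lambda>p. poly p (Var v)"] h by (simp add: poly_as_poly)
    \<comment> \<open>Where \<open>c\<close> does not vanish, specialization keeps the positive
      degree of \<open>R\<close> in \<open>v\<close>, so a root exists.\<close>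
    define c where "c = lead_coeff (as_poly v R)"
    have cA: "c \<in> A" using inA[of R] by (simp add: c_def polys_on_def)
    have "h * c \<noteq> 0" using h H(2) apR by (auto simp: c_def)
    then obtain \<psi> :: "'v \<Rightarrow> 'k" where \<psi>: "mp_eval of_int \<psi> (h * c) \<noteq> 0" using mp_eval_nonzero_ex by blast
    interpret E: comm_ring_hom "mp_eval of_int \<psi> :: (('v \<Rightarrow>\<^sub>0 nat) \<Rightarrow>\<^sub>0 int) \<Rightarrow> 'k"
      by (intro comm_ring_hom_mp_eval comm_ring_hom_of_int)
    have hc: "mp_eval of_int \<psi> h \<noteq> 0" "mp_eval of_int \<psi> c \<noteq> 0" using \<psi> by (auto simp: E.hom_mult)
    let ?r = "map_poly (mp_eval of_int \<psi>) (as_poly v R)"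
    have "degree ?r = degree (as_poly v R)" using hc(2) unfolding c_def by (intro degree_map_poly) auto
    then have "degree ?r > 0" using degR by simp
    then obtain t where t: "poly ?r t = 0" using alg_closed_imp_poly_has_root by blast
    define \<psi>' where "\<psi>' = \<psi>(v := t)"
    have R': "mp_eval of_int \<psi>' R = 0" using t unfolding map_poly_mp_eval_as_poly \<psi>'_def .
    interpret E': comm_ring_hom "mp_eval of_int \<psi>' :: (('v \<Rightarrow>\<^sub>0 nat) \<Rightarrow>\<^sub>0 int) \<Rightarrow> 'k"
      by (intro comm_ring_hom_mp_eval comm_ring_hom_of_int)
    have "mp_eval of_int \<psi>' h = 0" unfolding heq using R' D[OF R'] by (simp add: E'.hom_add E'.hom_mult)
    moreover have "mp_eval of_int \<psi>' h = mp_eval of_int \<psi> h"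
      using hA unfolding A_def \<psi>'_def by (intro mp_eval_cong_polys_in) auto
    ultimately show False using hc by simp
  next
    \<comment> \<open>Now \<open>R\<close> divides \<open>a * D\<close>, and being prime it divides
      \<open>a\<close>; but \<open>a\<close> is free of \<open>v\<close>.\<close>
    assume "R dvd poly H (Var v)"
    then have "R dvd a * D" unfolding aD by simp
    then have "R dvd a" using irreducible_imp_prime_int_polys[OF R] nd by blast
    then obtain w where w: "a = R * w" by (auto elim: dvdE)
    then have "[:a:] = as_poly v R * as_poly v w" using constA[OF H(7)] by (metis ap.hom_mult)
    then have "degree (as_poly v R * as_poly v w) = 0" "as_poly v w \<noteq> 0" using H(8) by (metis degree_pCons_0, force)
    then show False using degR apR by (simp add: degree_mult_eq)
  qed
qed

lemma mono_ev_fun_upd: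
  "mono_ev (h(v := a)) \<gamma> = mono_ev (h(v := 1)) \<gamma> * a ^ Poly_Mapping.lookup \<gamma> v"
proof (cases "v \<in> Poly_Mapping.keys \<gamma>")
  case True
  have "mono_ev (h(v := b)) \<gamma> = b ^ Poly_Mapping.lookup \<gamma> v *
      (\<Prod>u\<in>Poly_Mapping.keys \<gamma> - {v}. h u ^ Poly_Mapping.lookup \<gamma> u)" for b
    unfolding mono_ev_def by (subst prod.remove[OF _ True]) auto
  then show ?thesis by (simp add: mult.commute)
next
  case False
  then have "mono_ev (h(v := a)) \<gamma> = mono_ev (h(v := 1)) \<gamma>" by (intro mono_ev_cong) auto
  then show ?thesis using False by (simp add: in_keys_iff)
qed

definition xy_hom :: "('a::comm_ring_1 \<Rightarrow> 'b::comm_ring_1) \<Rightarrow> (var \<Rightarrow> 'b) \<Rightarrow> (var \<Rightarrow> 'b)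
    \<Rightarrow> ((expo \<times> expo) \<Rightarrow>\<^sub>0 'a) \<Rightarrow> 'b" where
  "xy_hom \<phi> x y = pm_hom \<phi> (\<lambda>(\<alpha>, \<beta>). mono_ev x \<alpha> * mono_ev y \<beta>)"

lemma comm_ring_hom_xy_hom: "comm_ring_hom \<phi> \<Longrightarrow> comm_ring_hom (xy_hom \<phi> x y)"
  unfolding xy_hom_def by (rule pm_hom_comm_ring_hom) (auto simp: mono_ev_add zero_prod_def mult_ac)

lemma xy_hom_simps:
  assumes "comm_ring_hom \<phi>"
  shows "xy_hom \<phi> x y (Poly_Mapping.single 0 c) = \<phi> c"
    and "xy_hom \<phi> x y (Poly_Mapping.single (\<alpha>, \<beta>) c) = \<phi> c * (mono_ev x \<alpha> * mono_ev y \<beta>)"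
proof -
  interpret comm_ring_hom \<phi> by fact
  show "xy_hom \<phi> x y (Poly_Mapping.single 0 c) = \<phi> c"
    "xy_hom \<phi> x y (Poly_Mapping.single (\<alpha>, \<beta>) c) = \<phi> c * (mono_ev x \<alpha> * mono_ev y \<beta>)"
    by (auto simp: xy_hom_def pm_hom_single zero_prod_def)
qed

lemma xy_hom_xvar:
  fixes \<phi> :: "coef_ring \<Rightarrow> 'b::comm_ring_1"
  assumes "comm_ring_hom \<phi>"
  shows "xy_hom \<phi> x y (xvar v) = x v" "xy_hom \<phi> x y (yvar v) = y v"
proof -
  interpret comm_ring_hom \<phi> by fact
  show "xy_hom \<phi> x y (xvar v) = x v" "xy_hom \<phi> x y (yvar v) = y v"
    by (auto simp: xvar_def yvar_def xy_hom_simps[OF assms])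
qed

subsection \<open>Weighted degrees\<close>

definition wdeg_le :: "('m \<Rightarrow> nat) \<Rightarrow> nat \<Rightarrow> ('m \<Rightarrow>\<^sub>0 'a::zero) \<Rightarrow> bool" where
  "wdeg_le w e p \<longleftrightarrow> (\<forall>m\<in>Poly_Mapping.keys p. w m \<le> e)"

text \<open>An additive function on exponents. The degree in one group of \<open>x\<close>, in one
  group of \<open>y\<close> and in a single variable are all of this kind, so one estimate for
  determinants serves them all.\<close>

definition weight :: "('m::monoid_add \<Rightarrow> nat) \<Rightarrow> bool" where
  "weight w \<longleftrightarrow> w 0 = 0 \<and> (\<forall>a b. w (a + b) = w a + w b)"

lemma wdeg_le_mono: "wdeg_le w e p \<Longrightarrow> e \<le> e' \<Longrightarrow> wdeg_le w e' p"
  by (force simp: wdeg_le_def)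

lemma wdeg_le_0 [simp]: "wdeg_le w e 0" by (simp add: wdeg_le_def)

lemma wdeg_le_add: "wdeg_le w e p \<Longrightarrow> wdeg_le w e q \<Longrightarrow> wdeg_le w e (p + q)"
  using keys_add[of p q] unfolding wdeg_le_def by blast

lemma wdeg_le_sum: "(\<And>i. i \<in> I \<Longrightarrow> wdeg_le w e (f i)) \<Longrightarrow> wdeg_le w e (sum f I)"
  by (induction I rule: infinite_finite_induct) (auto intro: wdeg_le_add)

lemma wdeg_le_mult:
  "weight w \<Longrightarrow> wdeg_le w e p \<Longrightarrow> wdeg_le w e' q \<Longrightarrow> wdeg_le w (e + e') (p * q)"
  using keys_mult[of p q] unfolding wdeg_le_def weight_def by (fastforce intro: add_mono)

lemma wdeg_le_const: "weight w \<Longrightarrow> wdeg_le w 0 (Poly_Mapping.single 0 c)"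
  by (auto simp: wdeg_le_def weight_def)

lemma wdeg_le_1: "weight w \<Longrightarrow> wdeg_le w 0 (1 :: 'm::comm_monoid_add \<Rightarrow>\<^sub>0 'a::comm_ring_1)"
  by (metis single_one wdeg_le_const)

lemma wdeg_le_power:
  "weight w \<Longrightarrow> wdeg_le w e (p :: 'm::comm_monoid_add \<Rightarrow>\<^sub>0 'a::comm_ring_1) \<Longrightarrow> wdeg_le w (k * e) (p ^ k)"
  by (induction k) (auto intro: wdeg_le_1 wdeg_le_mult)

lemma wdeg_le_prod:
  "weight w \<Longrightarrow> (\<And>i. i \<in> I \<Longrightarrow> wdeg_le w (e i) (f i :: 'm::comm_monoid_add \<Rightarrow>\<^sub>0 'a::comm_ring_1)) \<Longrightarrow>
    wdeg_le w (sum e I) (prod f I)"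
  by (induction I rule: infinite_finite_induct) (auto intro: wdeg_le_1 wdeg_le_mult)

lemma wdeg_le_mono_ev:
  assumes "weight w" "\<And>u. u \<in> Poly_Mapping.keys \<gamma> \<Longrightarrow> wdeg_le w (b u) (h u :: 'm::comm_monoid_add \<Rightarrow>\<^sub>0 'a::comm_ring_1)"
  shows "wdeg_le w (\<Sum>u\<in>Poly_Mapping.keys \<gamma>. Poly_Mapping.lookup \<gamma> u * b u) (mono_ev h \<gamma>)"
  unfolding mono_ev_def by (intro wdeg_le_prod wdeg_le_power assms)

lemma wdeg_le_det:
  fixes A :: "('m::comm_monoid_add \<Rightarrow>\<^sub>0 'a::comm_ring_1) mat"
  assumes w: "weight w" and A: "A \<in> carrier_mat m m"
    and e: "\<And>i j. i < m \<Longrightarrow> j < m \<Longrightarrow> wdeg_le w (e i) (A $$ (i, j))"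
  shows "wdeg_le w (\<Sum>i<m. e i) (det A)"
proof -
  have "wdeg_le w (\<Sum>i<m. e i) (signof p * (\<Prod>i = 0..<m. A $$ (i, p i)))" if p: "p permutes {0..<m}" for p
  proof -
    have "wdeg_le w (\<Sum>i\<in>{0..<m}. e i) (\<Prod>i = 0..<m. A $$ (i, p i))"
      using p by (intro wdeg_le_prod w e) (auto dest: permutes_in_image)
    moreover have "wdeg_le w 0 (signof p :: 'm \<Rightarrow>\<^sub>0 'a)"
      using wdeg_le_1[OF w] by (auto simp: sign_def wdeg_le_def)
    ultimately show ?thesis using wdeg_le_mult[OF w] by (metis add_0 lessThan_atLeast0)
  qed
  then show ?thesis using A unfolding det_def' [OF A] by (intro wdeg_le_sum) auto
qed

subsection \<open>The Bezoutian as a determinant of divided differences\<close>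

text \<open>At an exponent of \<open>p\<close> that is maximal in \<open>x v\<close>, raised by one
  in \<open>x v\<close>, only \<open>p * xvar v\<close> contributes to the product, and it
  contributes the coefficient of \<open>p\<close>.\<close>

lemma mult_x_minus_y_cancel:
  assumes "p * (xvar v - yvar v) = 0" shows "p = 0"
proof (rule ccontr)
  assume "p \<noteq> 0"
  let ?s = "Poly_Mapping.single v (1::nat)"
  have "finite ((\<lambda>(\<alpha>, \<beta>). Poly_Mapping.lookup \<alpha> v) ` Poly_Mapping.keys p)" (is "finite ?M") by simp
  moreover have "?M \<noteq> {}" using \<open>p \<noteq> 0\<close> by simp
  ultimately have "Max ?M \<in> ?M" by (rule Max_in)
  then obtain \<alpha> \<beta> where ab: "(\<alpha>, \<beta>) \<in> Poly_Mapping.keys p" "Max ?M = Poly_Mapping.lookup \<alpha> v" by auto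
  have notin: "(\<alpha> + ?s, \<beta>') \<notin> Poly_Mapping.keys p" for \<beta>'
  proof
    assume "(\<alpha> + ?s, \<beta>') \<in> Poly_Mapping.keys p"
    then have "Poly_Mapping.lookup (\<alpha> + ?s) v \<in> ?M" by (force intro!: image_eqI[of _ _ "(\<alpha> + ?s, \<beta>')"])
    then have "Poly_Mapping.lookup (\<alpha> + ?s) v \<le> Poly_Mapping.lookup \<alpha> v" using ab(2) Max_ge[of ?M] by force
    then show False by (simp add: lookup_add)
  qed
  have lx: "Poly_Mapping.lookup (p * xvar v) (\<alpha> + ?s, \<beta>) = Poly_Mapping.lookup p (\<alpha>, \<beta>)"
  proof -
    have "p * xvar v = (\<Sum>k\<in>Poly_Mapping.keys p. Poly_Mapping.single (k + (?s, 0)) (Poly_Mapping.lookup p k))"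
      unfolding xvar_def by (subst poly_mapping_sum_single[of p]) (simp add: sum_distrib_right mult_single)
    then have "Poly_Mapping.lookup (p * xvar v) (\<alpha> + ?s, \<beta>) =
        (\<Sum>k\<in>Poly_Mapping.keys p. if k = (\<alpha>, \<beta>) then Poly_Mapping.lookup p k else 0)"
      by (auto simp: lookup_sum lookup_single when_def prod_eq_iff intro!: sum.cong)
    then show ?thesis using ab(1) by simp
  qed
  have "Poly_Mapping.lookup (p * yvar v) (\<alpha> + ?s, \<beta>) = 0"
  proof -
    have "p * yvar v = (\<Sum>k\<in>Poly_Mapping.keys p. Poly_Mapping.single (k + (0, ?s)) (Poly_Mapping.lookup p k))"
      unfolding yvar_def by (subst poly_mapping_sum_single[of p]) (simp add: sum_distrib_right mult_single)
    then show ?thesis using notin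
      by (auto simp: lookup_sum lookup_single when_def prod_eq_iff intro!: sum.neutral)
  qed
  then have "Poly_Mapping.lookup (p * (xvar v - yvar v)) (\<alpha> + ?s, \<beta>) = Poly_Mapping.lookup p (\<alpha>, \<beta>)"
    using lx by (simp add: right_diff_distrib lookup_minus)
  then show False using assms ab(1) by (simp add: in_keys_iff)
qed

lemma mult_prod_x_minus_y_cancel:
  assumes "finite V" "p * (\<Prod>v\<in>V. xvar v - yvar v) = 0" shows "p = 0"
  using assms
proof (induction V arbitrary: p)
  case (insert v V)
  then have "p * (xvar v - yvar v) * (\<Prod>v\<in>V. xvar v - yvar v) = 0" by (simp add: mult_ac)
  then have "p * (xvar v - yvar v) = 0" by (rule insert.IH)
  then show ?case by (rule mult_x_minus_y_cancel)
qed simp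

locale multihom =
  fixes r n :: nat and l d \<pi> :: "nat \<Rightarrow> nat"
  assumes l_pos: "\<And>k. k \<in> {1..r} \<Longrightarrow> l k > 0"
    and d_pos: "\<And>k. k \<in> {1..r} \<Longrightarrow> d k > 0"
    and n_eq: "n = (\<Sum>k=1..r. l k)"
    and perm: "\<pi> permutes {1..r}"
begin

definition aff_vars :: "var set" where "aff_vars = (SIGMA i:{1..r}. {1..l i})"

abbreviation vs :: "var list" where "vs \<equiv> var_order r l \<pi>"

lemma inv_perm: "t \<in> {1..r} \<Longrightarrow> inv_into {1..r} \<pi> t \<in> {1..r} \<and> \<pi> (inv_into {1..r} \<pi> t) = t"
  using perm by (metis f_inv_into_f inv_into_into permutes_image)

lemma set_vs: "set vs = aff_vars"
proof -
  have "set vs = (\<Union>t\<in>{1..r}. (\<lambda>j. (inv_into {1..r} \<pi> t, j)) ` {1..l (inv_into {1..r} \<pi> t)})"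
    unfolding var_order_def Let_def by (simp add: atLeastLessThanSuc_atLeastAtMost del: upt_Suc)
  also have "\<dots> = (\<Union>i\<in>inv_into {1..r} \<pi> ` {1..r}. (\<lambda>j. (i, j)) ` {1..l i})" by auto
  also have "inv_into {1..r} \<pi> ` {1..r} = {1..r}"
    using perm by (metis bij_betw_imp_surj_on bij_betw_inv_into permutes_imp_bij)
  finally show ?thesis by (auto simp: aff_vars_def)
qed

lemma length_vs: "length vs = n"
proof -
  have "length vs = (\<Sum>t=1..r. l (inv_into {1..r} \<pi> t))"
    unfolding var_order_def Let_def
    by (simp add: length_concat comp_def sum_list_distinct_conv_sum_set atLeastLessThanSuc_atLeastAtMost del: upt_Suc)
  also have "\<dots> = (\<Sum>k=1..r. l k)"
    using bij_betw_inv_into[OF permutes_imp_bij[OF perm]] by (rule sum.reindex_bij_betw)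
  finally show ?thesis by (simp add: n_eq)
qed

lemma card_aff_vars: "card aff_vars = n"
  unfolding aff_vars_def n_eq by (subst card_SigmaI) auto

lemma distinct_vs: "distinct vs"
  by (metis card_aff_vars card_distinct length_vs set_vs)

lemma sorted_vs: "sorted (map (\<pi> \<circ> fst) vs)"
proof -
  have "map (\<pi> \<circ> fst) vs = concat (map (\<lambda>t. map (\<lambda>j. \<pi> (inv_into {1..r} \<pi> t)) [1..<l (inv_into {1..r} \<pi> t) + 1]) [1..<r + 1])"
    unfolding var_order_def Let_def by (simp add: map_concat comp_def del: upt_Suc)
  also have "\<dots> = concat (map (\<lambda>t. replicate (l (inv_into {1..r} \<pi> t)) t) [1..<r + 1])"
    using inv_perm by (intro arg_cong[of _ _ concat] map_cong refl) (auto simp: map_replicate_const simp del: upt_Suc)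
  also have "sorted \<dots>"
  proof -
    have "sorted (concat (map (\<lambda>t. replicate (g t) t) [1..<m + 1]))" for g :: "nat \<Rightarrow> nat" and m
      by (induction m) (auto simp: sorted_append)
    then show ?thesis .
  qed
  finally show ?thesis .
qed

text \<open>The variables are listed by increasing \<pi> of their group. So, outside the group of
  \<open>vs ! s\<close>, comparing \<pi> decides which variables have already been replaced by
  \<open>y\<close> at stage \<open>s\<close>.\<close>

lemma vs_take:
  assumes s: "s < n" and u: "u \<in> aff_vars"
  shows "\<pi> (fst u) < \<pi> (fst (vs ! s)) \<Longrightarrow> u \<in> set (take s vs)"
    and "\<pi> (fst u) > \<pi> (fst (vs ! s)) \<Longrightarrow> u \<notin> set (take s vs)"
proof -
  obtain t where t: "t < n" "u = vs ! t" using u set_vs length_vs by (metis in_set_conv_nth)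
  have mono: "\<pi> (fst (vs ! a)) \<le> \<pi> (fst (vs ! b))" if "a \<le> b" "b < n" for a b
    using sorted_nth_mono[OF sorted_vs that(1)] that length_vs by simp
  show "u \<in> set (take s vs)" if "\<pi> (fst u) < \<pi> (fst (vs ! s))"
  proof -
    have "t < s" using mono[of s t] that t by (metis leD not_le_imp_less)
    then show ?thesis using t s length_vs by (metis in_set_conv_nth length_take min_less_iff_conj nth_take)
  qed
  show "u \<notin> set (take s vs)" if "\<pi> (fst u) > \<pi> (fst (vs ! s))"
  proof
    assume "u \<in> set (take s vs)"
    then obtain t' where "t' < s" "u = vs ! t'" by (metis in_set_conv_nth length_take min_less_iff_conj nth_take)
    then show False using mono[of t' s] that s by simp
  qed
qed

lemma vs_nth_aff: "s < n \<Longrightarrow> vs ! s \<in> aff_vars"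
  using set_vs length_vs nth_mem by metis

text \<open>The point of stage \<open>s\<close> in the affine chart: homogenizing coordinates 1, the
  first \<open>s\<close> variables from \<open>y\<close>, the rest from \<open>x\<close>.\<close>

definition hyb :: "nat \<Rightarrow> (var \<Rightarrow> 'b::comm_ring_1) \<Rightarrow> (var \<Rightarrow> 'b) \<Rightarrow> var \<Rightarrow> 'b" where
  "hyb s x y u = (if snd u = 0 then 1 else if u \<in> set (take s vs) then y u else x u)"

text \<open>The divided difference of a monomial between the stages \<open>s\<close> and
  \<open>s + 1\<close>: the quotient of the power difference in \<open>vs ! s\<close> by
  \<open>x - y\<close>, written as a sum so that it makes sense in every ring and also for
  \<open>x = y\<close>.\<close>

definition dd :: "nat \<Rightarrow> (var \<Rightarrow> 'b::comm_ring_1) \<Rightarrow> (var \<Rightarrow> 'b) \<Rightarrow> expo \<Rightarrow> 'b" where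
  "dd s x y \<gamma> = mono_ev ((hyb s x y)(vs ! s := 1)) \<gamma> *
     (\<Sum>i<Poly_Mapping.lookup \<gamma> (vs ! s). y (vs ! s) ^ (Poly_Mapping.lookup \<gamma> (vs ! s) - Suc i) * x (vs ! s) ^ i)"

lemma hyb_Suc: "s < n \<Longrightarrow> hyb (Suc s) x y = (hyb s x y)(vs ! s := y (vs ! s))"
  and hyb_nth: "s < n \<Longrightarrow> hyb s x y (vs ! s) = x (vs ! s)"
proof -
  assume s: "s < n"
  have nz: "snd (vs ! s) \<noteq> 0" using vs_nth_aff[OF s] by (auto simp: aff_vars_def)
  have tk: "take (Suc s) vs = take s vs @ [vs ! s]" using s length_vs by (simp add: take_Suc_conv_app_nth)
  have ni: "vs ! s \<notin> set (take s vs)" using distinct_take[OF distinct_vs, of "Suc s"] tk by auto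
  show "hyb (Suc s) x y = (hyb s x y)(vs ! s := y (vs ! s))" 
  proof
    fix u show "hyb (Suc s) x y u = ((hyb s x y)(vs ! s := y (vs ! s))) u"
      using nz by (cases "u = vs ! s") (auto simp: hyb_def tk)
  qed
  show "hyb s x y (vs ! s) = x (vs ! s)" using nz ni by (auto simp: hyb_def)
qed

lemma dd_telescope:
  assumes "s < n"
  shows "mono_ev (hyb s x y) \<gamma> - mono_ev (hyb (Suc s) x y) \<gamma> = (x (vs ! s) - y (vs ! s)) * dd s x y \<gamma>"
proof -
  let ?v = "vs ! s" and ?m = "Poly_Mapping.lookup \<gamma> (vs ! s)"
  have "hyb s x y = (hyb s x y)(?v := x ?v)" using hyb_nth[OF assms, of x y] by auto
  then have "mono_ev (hyb s x y) \<gamma> = mono_ev ((hyb s x y)(?v := 1)) \<gamma> * x ?v ^ ?m"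
    using mono_ev_fun_upd[of "hyb s x y" ?v "x ?v" \<gamma>] by simp
  moreover have "mono_ev (hyb (Suc s) x y) \<gamma> = mono_ev ((hyb s x y)(?v := 1)) \<gamma> * y ?v ^ ?m"
    unfolding hyb_Suc[OF assms] by (rule mono_ev_fun_upd)
  moreover have "x ?v ^ ?m - y ?v ^ ?m = (x ?v - y ?v) * (\<Sum>i<?m. y ?v ^ (?m - Suc i) * x ?v ^ i)"
    by (rule power_diff_sumr2)
  ultimately have "mono_ev (hyb s x y) \<gamma> - mono_ev (hyb (Suc s) x y) \<gamma> = mono_ev ((hyb s x y)(?v := 1)) \<gamma> *
      ((x ?v - y ?v) * (\<Sum>i<?m. y ?v ^ (?m - Suc i) * x ?v ^ i))"
    by (simp only: right_diff_distrib[symmetric])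
  then show ?thesis unfolding dd_def by (simp only: mult_ac)
qed

lemma finite_mh_expos: "finite (mh_expos r l d)"
proof -
  let ?M = "\<Sum>i=1..r. d i"
  have sub: "mh_expos r l d \<subseteq> {\<gamma>. Poly_Mapping.keys \<gamma> \<subseteq> hom_vars r l \<and> (\<forall>v. Poly_Mapping.lookup \<gamma> v \<le> ?M)}"
  proof (rule subsetI, rule CollectI, intro conjI allI)
    fix \<gamma> v assume \<gamma>: "\<gamma> \<in> mh_expos r l d"
    then show "Poly_Mapping.keys \<gamma> \<subseteq> hom_vars r l" by (simp add: mh_expos_def)
    show "Poly_Mapping.lookup \<gamma> v \<le> ?M"
    proof (cases "v \<in> Poly_Mapping.keys \<gamma>")
      case True
      then obtain i j where v: "v = (i, j)" "i \<in> {1..r}" "j \<in> {0..l i}" using \<gamma> by (auto simp: mh_expos_def hom_vars_def)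
      have "Poly_Mapping.lookup \<gamma> v \<le> (\<Sum>j=0..l i. Poly_Mapping.lookup \<gamma> (i, j))"
        unfolding v(1) using v(3) by (intro member_le_sum) auto
      also have "\<dots> = d i" using \<gamma> v by (auto simp: mh_expos_def)
      also have "\<dots> \<le> ?M" using v by (intro member_le_sum) auto
      finally show ?thesis .
    qed (simp add: in_keys_iff)
  qed
  have "finite (Poly_Mapping.lookup ` {\<gamma>. Poly_Mapping.keys \<gamma> \<subseteq> hom_vars r l \<and> (\<forall>v. Poly_Mapping.lookup \<gamma> v \<le> ?M)})"
  proof (rule finite_subset)
    show "Poly_Mapping.lookup ` {\<gamma>. Poly_Mapping.keys \<gamma> \<subseteq> hom_vars r l \<and> (\<forall>v. Poly_Mapping.lookup \<gamma> v \<le> ?M)}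
        \<subseteq> {f. \<forall>v. (v \<in> hom_vars r l \<longrightarrow> f v \<in> {..?M}) \<and> (v \<notin> hom_vars r l \<longrightarrow> f v = 0)}"
      by (auto simp: in_keys_iff)
    show "finite {f. \<forall>v. (v \<in> hom_vars r l \<longrightarrow> f v \<in> {..?M}) \<and> (v \<notin> hom_vars r l \<longrightarrow> f v = (0::nat))}"
      by (rule finite_set_of_finite_funs) (auto simp: hom_vars_def)
  qed
  then show ?thesis using finite_imageD[OF _ inj_onI[of _ Poly_Mapping.lookup]] sub
    by (metis (no_types, lifting) finite_subset poly_mapping_eq_iff)
qed

text \<open>A form with coefficients \<open>c\<close> enters only linearly, so \<chi> may be any
  function of the exponent. Evaluation at a point and divided differences are then instances of one
  expression.\<close>

definition ev_form :: "(nat \<times> expo \<Rightarrow> 'b::comm_ring_1) \<Rightarrow> nat \<Rightarrow> (expo \<Rightarrow> 'b) \<Rightarrow> 'b" where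
  "ev_form c j \<chi> = (\<Sum>\<gamma>\<in>mh_expos r l d. c (j, \<gamma>) * \<chi> \<gamma>)"

text \<open>The argument \<open>q\<close> selects the point in the first row. Used are
  \<open>q = 0\<close>, the evaluation at \<open>x\<close>, and \<open>q = n\<close>, the evaluation
  at \<open>y\<close>.\<close>

definition bmat :: "nat \<Rightarrow> (nat \<times> expo \<Rightarrow> 'b::comm_ring_1) \<Rightarrow> (var \<Rightarrow> 'b) \<Rightarrow> (var \<Rightarrow> 'b) \<Rightarrow> 'b mat" where
  "bmat q c x y = mat (n + 1) (n + 1) (\<lambda>(s, j).
     ev_form c j (if s = 0 then mono_ev (hyb q x y) else dd (s - 1) x y))"

lemma bmat_carrier: "bmat q c x y \<in> carrier_mat (n + 1) (n + 1)"
  by (simp add: bmat_def)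

lemma ev_form_diff: "ev_form c j \<chi> - ev_form c j \<chi>' = ev_form c j (\<lambda>\<gamma>. \<chi> \<gamma> - \<chi>' \<gamma>)"
  by (simp add: ev_form_def sum_subtractf right_diff_distrib)

lemma ev_form_mult: "a * ev_form c j \<chi> = ev_form c j (\<lambda>\<gamma>. a * \<chi> \<gamma>)"
  by (simp add: ev_form_def sum_distrib_left mult_ac)

lemma ev_form_telescope:
  assumes "s \<le> n"
  shows "ev_form c j (mono_ev (hyb s x y)) = ev_form c j (mono_ev (hyb 0 x y)) -
    (\<Sum>t<s. (x (vs ! t) - y (vs ! t)) * ev_form c j (dd t x y))"
  using assms
proof (induction s)
  case (Suc s)
  have "ev_form c j (mono_ev (hyb s x y)) - ev_form c j (mono_ev (hyb (Suc s) x y)) =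
      (x (vs ! s) - y (vs ! s)) * ev_form c j (dd s x y)"
    unfolding ev_form_diff ev_form_mult using Suc.prems by (simp add: dd_telescope)
  then show ?case using Suc by (simp add: algebra_simps)
qed simp

lemma sum_nat_shift: "(\<Sum>t\<in>{0..<Suc m}. f t) = f 0 + (\<Sum>t<m. f (Suc t))" for f :: "nat \<Rightarrow> 'b::comm_monoid_add"
  by (metis atLeast0LessThan sum.lessThan_Suc_shift)

text \<open>The row operations that turn the divided differences back into the hybrid evaluations.\<close>

lemma det_hyb:
  "det (mat (n + 1) (n + 1) (\<lambda>(s, j). ev_form c j (mono_ev (hyb s x y)))) =
    (\<Prod>v\<in>aff_vars. - (x v - y v)) * det (bmat 0 c x y)"
proof -
  define L where "L = mat (n + 1) (n + 1) (\<lambda>(s, t). if t = 0 then 1 else if t \<le> s then - (x (vs ! (t - 1)) - y (vs ! (t - 1))) else 0)"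
  have L: "L \<in> carrier_mat (n + 1) (n + 1)" by (simp add: L_def)
  have "mat (n + 1) (n + 1) (\<lambda>(s, j). ev_form c j (mono_ev (hyb s x y))) = L * bmat 0 c x y"
  proof (rule eq_matI)
    fix s j assume "s < dim_row (L * bmat 0 c x y)" "j < dim_col (L * bmat 0 c x y)"
    then have sj: "s < n + 1" "j < n + 1" by (auto simp: L_def bmat_def)
    have "(L * bmat 0 c x y) $$ (s, j) = (\<Sum>t\<in>{0..<Suc n}. L $$ (s, t) * bmat 0 c x y $$ (t, j))"
      using sj by (simp add: L_def bmat_def scalar_prod_def)
    also have "\<dots> = ev_form c j (mono_ev (hyb 0 x y)) + (\<Sum>t<n. (if t < s then - ((x (vs ! t) - y (vs ! t)) * ev_form c j (dd t x y)) else 0))"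
      unfolding sum_nat_shift using sj by (auto simp: L_def bmat_def algebra_simps intro!: sum.cong arg_cong2[where f="(+)"])
    also have "(\<Sum>t<n. (if t < s then - ((x (vs ! t) - y (vs ! t)) * ev_form c j (dd t x y)) else 0)) =
        (\<Sum>t<s. - ((x (vs ! t) - y (vs ! t)) * ev_form c j (dd t x y)))"
      using sj by (intro sum.mono_neutral_cong_right) auto
    also have "ev_form c j (mono_ev (hyb 0 x y)) + \<dots> = ev_form c j (mono_ev (hyb s x y))"
      using ev_form_telescope[of s c j x y] sj by (simp add: sum_negf)
    finally show "mat (n + 1) (n + 1) (\<lambda>(s, j). ev_form c j (mono_ev (hyb s x y))) $$ (s, j) = (L * bmat 0 c x y) $$ (s, j)"
      using sj by simp
  qed (auto simp: L_def bmat_def)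
  then have "det (mat (n + 1) (n + 1) (\<lambda>(s, j). ev_form c j (mono_ev (hyb s x y)))) = det L * det (bmat 0 c x y)"
    using det_mult[OF L bmat_carrier] by simp
  moreover have "det L = (\<Prod>v\<in>aff_vars. - (x v - y v))"
  proof -
    have "det L = prod_list (diag_mat L)" by (rule det_lower_triangular[OF _ L]) (auto simp: L_def)
    also have "\<dots> = (\<Prod>i = 0..<Suc n. L $$ (i, i))"
      using L by (simp add: diag_mat_def prod.distinct_set_conv_list[symmetric] del: upt_Suc)
    also have "\<dots> = (\<Prod>i<n. - (x (vs ! i) - y (vs ! i)))"
      unfolding atLeast0LessThan prod.lessThan_Suc_shift by (auto simp: L_def intro!: prod.cong)
    also have "\<dots> = (\<Prod>v\<in>aff_vars. - (x v - y v))"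
      using bij_betw_nth[OF distinct_vs refl refl] length_vs set_vs
      by (intro prod.reindex_bij_betw) (simp add: atLeast0LessThan)
    finally show ?thesis .
  qed
  ultimately show ?thesis by simp
qed

text \<open>By telescoping, multiples of the divided differences turn the row of values at
  \<open>x\<close> into the row of values at \<open>y\<close>. The row at \<open>y\<close> is free
  of \<open>x\<close> and serves to bound \<open>x\<close>-degrees; the row at \<open>x\<close>
  serves for the \<open>y\<close>-degrees.\<close>

lemma det_bmat_last: "det (bmat n c x y) = det (bmat 0 c x y)"
proof -
  define L where "L = mat (n + 1) (n + 1) (\<lambda>(s, t). if s = t then 1 else if s = 0 then - (x (vs ! (t - 1)) - y (vs ! (t - 1))) else 0)"
  have L: "L \<in> carrier_mat (n + 1) (n + 1)" by (simp add: L_def)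
  have "bmat n c x y = L * bmat 0 c x y"
  proof (rule eq_matI)
    fix s j assume "s < dim_row (L * bmat 0 c x y)" "j < dim_col (L * bmat 0 c x y)"
    then have sj: "s < n + 1" "j < n + 1" by (auto simp: L_def bmat_def)
    have eq: "(L * bmat 0 c x y) $$ (s, j) = (\<Sum>t\<in>{0..<Suc n}. L $$ (s, t) * bmat 0 c x y $$ (t, j))"
      using sj by (simp add: L_def bmat_def scalar_prod_def)
    show "bmat n c x y $$ (s, j) = (L * bmat 0 c x y) $$ (s, j)"
    proof (cases "s = 0")
      case True
      have "(L * bmat 0 c x y) $$ (s, j) = ev_form c j (mono_ev (hyb 0 x y)) + (\<Sum>t<n. - ((x (vs ! t) - y (vs ! t)) * ev_form c j (dd t x y)))"
        unfolding eq sum_nat_shift using sj True by (auto simp: L_def bmat_def algebra_simps intro!: sum.cong arg_cong2[where f="(+)"])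
      also have "\<dots> = ev_form c j (mono_ev (hyb n x y))"
        using ev_form_telescope[of n c j x y] by (simp add: sum_negf)
      finally show ?thesis using True sj by (simp add: bmat_def)
    next
      case False
      have "(\<Sum>t\<in>{0..<Suc n}. L $$ (s, t) * bmat 0 c x y $$ (t, j)) = (\<Sum>t\<in>{0..<Suc n}. if t = s then bmat 0 c x y $$ (t, j) else 0)"
        using False sj by (intro sum.cong) (auto simp: L_def)
      also have "\<dots> = bmat 0 c x y $$ (s, j)" using sj by (subst sum.delta) auto
      also have "\<dots> = bmat n c x y $$ (s, j)" unfolding bmat_def using sj False by simp
      finally show ?thesis using eq by simp
    qed
  qed (auto simp: L_def bmat_def)
  moreover have "det L = 1"
  proof -
    have "upper_triangular L" by (auto simp: L_def)
    then have "det L = prod_list (diag_mat L)" using L by (rule det_upper_triangular)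
    also have "diag_mat L = replicate (n + 1) 1"
      by (rule nth_equalityI) (auto simp: diag_mat_def L_def nth_Cons split: nat.split simp del: upt_Suc)
    finally show ?thesis by simp
  qed
  ultimately show ?thesis using det_mult[OF L bmat_carrier] by simp
qed

definition gen_coef :: "nat \<times> expo \<Rightarrow> xy_poly" where
  "gen_coef = (\<lambda>g. Poly_Mapping.single 0 (Var g))"

lemma generic_poly_lookup: "Poly_Mapping.lookup (generic_poly r l d j) \<gamma> = (if \<gamma> \<in> mh_expos r l d then Var (j, \<gamma>) else 0)"
proof -
  have "Poly_Mapping.lookup (generic_poly r l d j) \<gamma> = (\<Sum>\<gamma>'\<in>mh_expos r l d. if \<gamma>' = \<gamma> then Var (j, \<gamma>') else 0)"
    unfolding generic_poly_def Var_def by (auto simp: lookup_sum lookup_single when_def intro!: sum.cong)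
  then show ?thesis using finite_mh_expos by simp
qed

lemma mixed_poly_eq: "mixed_poly r l d \<pi> s j = ev_form gen_coef j (mono_ev (hyb s xvar yvar))"
proof -
  have h: "(\<lambda>(i, k). if k = 0 then 1 else if (i, k) \<in> set (take s vs) then yvar (i, k) else xvar (i, k)) = hyb s xvar yvar"
    by (auto simp: hyb_def fun_eq_iff)
  have "Poly_Mapping.keys (generic_poly r l d j) \<subseteq> mh_expos r l d"
    by (auto simp: in_keys_iff generic_poly_lookup split: if_splits)
  then show ?thesis
    unfolding mixed_poly_def h mp_eval_eq ev_form_def gen_coef_def
    by (subst pm_hom_superset[OF finite_mh_expos]) (auto simp: generic_poly_lookup)
qed

text \<open>The sign appears because the row operations of \<open>det_hyb\<close> contribute a
  factor \<open>-(x v - y v)\<close> for each of the \<open>n\<close> variables. The quotient is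
  unique since \<open>x v - y v\<close> can be cancelled.\<close>

lemma bezoutian_eq: "bezoutian r l d \<pi> = (-1) ^ n * det (bmat 0 gen_coef xvar yvar)"
proof -
  have prod_eq: "(\<Prod>i=1..r. \<Prod>j=1..l i. xvar (i, j) - yvar (i, j)) = (\<Prod>v\<in>aff_vars. xvar v - yvar v)"
    unfolding aff_vars_def by (subst prod.Sigma) (auto intro!: prod.cong)
  have fin: "finite aff_vars" by (simp add: aff_vars_def)
  have det_eq: "det (mat (n + 1) (n + 1) (\<lambda>(s, j). mixed_poly r l d \<pi> s j)) =
      ((-1) ^ n * det (bmat 0 gen_coef xvar yvar)) * (\<Prod>v\<in>aff_vars. xvar v - yvar v)"
  proof -
    have "(\<Prod>v\<in>aff_vars. - (xvar v - yvar v)) = (-1) ^ n * (\<Prod>v\<in>aff_vars. xvar v - yvar v)"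
      unfolding card_aff_vars[symmetric] by (rule prod_uminus)
    then show ?thesis unfolding mixed_poly_eq det_hyb by (simp add: mult_ac)
  qed
  show ?thesis unfolding bezoutian_def Let_def n_eq[symmetric] det_eq prod_eq
  proof (rule the_equality)
    fix B assume "B * (\<Prod>v\<in>aff_vars. xvar v - yvar v) =
        ((-1) ^ n * det (bmat 0 gen_coef xvar yvar)) * (\<Prod>v\<in>aff_vars. xvar v - yvar v)"
    then have "(B - (-1) ^ n * det (bmat 0 gen_coef xvar yvar)) * (\<Prod>v\<in>aff_vars. xvar v - yvar v) = 0"
      by (simp add: left_diff_distrib)
    from mult_prod_x_minus_y_cancel[OF fin this] show "B = (-1) ^ n * det (bmat 0 gen_coef xvar yvar)" by simp
  qed simp
qed

lemma hom_hyb: "comm_ring_hom f \<Longrightarrow> f (hyb s x y u) = hyb s (\<lambda>v. f (x v)) (\<lambda>v. f (y v)) u"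
proof -
  assume "comm_ring_hom f"
  then interpret comm_ring_hom f .
  show ?thesis by (simp add: hyb_def)
qed

lemma hom_dd:
  assumes "comm_ring_hom f" shows "f (dd s x y \<gamma>) = dd s (\<lambda>v. f (x v)) (\<lambda>v. f (y v)) \<gamma>"
proof -
  interpret comm_ring_hom f by fact
  have "(\<lambda>u. f (((hyb s x y)(vs ! s := 1)) u)) = (hyb s (\<lambda>v. f (x v)) (\<lambda>v. f (y v)))(vs ! s := 1)"
    by (auto simp: hom_hyb[OF assms])
  then show ?thesis by (simp add: dd_def hom_mult hom_sum hom_power hom_mono_ev[OF assms])
qed

lemma hom_det_bmat:
  assumes "comm_ring_hom f"
  shows "f (det (bmat q c x y)) = det (bmat q (\<lambda>g. f (c g)) (\<lambda>v. f (x v)) (\<lambda>v. f (y v)))"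
proof -
  interpret comm_ring_hom f by fact
  have "map_mat f (bmat q c x y) = bmat q (\<lambda>g. f (c g)) (\<lambda>v. f (x v)) (\<lambda>v. f (y v))"
    by (rule eq_matI)
      (auto simp: bmat_def ev_form_def hom_sum hom_mult hom_dd[OF assms] hom_mono_ev[OF assms] hom_hyb[OF assms])
  then show ?thesis by (simp add: hom_det[symmetric])
qed

lemma xy_hom_bezoutian:
  fixes \<phi> :: "coef_ring \<Rightarrow> 'b::comm_ring_1"
  assumes "comm_ring_hom \<phi>"
  shows "xy_hom \<phi> x y (bezoutian r l d \<pi>) = (-1) ^ n * det (bmat 0 (\<lambda>g. \<phi> (Var g)) x y)"
proof -
  interpret comm_ring_hom "xy_hom \<phi> x y :: xy_poly \<Rightarrow> 'b" by (rule comm_ring_hom_xy_hom[OF assms])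
  show ?thesis unfolding bezoutian_eq
    by (simp add: hom_mult hom_power hom_uminus hom_det_bmat[OF comm_ring_hom_xy_hom[OF assms]]
      gen_coef_def xy_hom_simps[OF assms] xy_hom_xvar[OF assms])
qed

end

lemma xy_hom_superset:
  assumes "comm_ring_hom \<phi>" "finite S" "Poly_Mapping.keys p \<subseteq> S"
  shows "xy_hom \<phi> x y p = (\<Sum>(\<alpha>, \<beta>)\<in>S. \<phi> (Poly_Mapping.lookup p (\<alpha>, \<beta>)) * (mono_ev x \<alpha> * mono_ev y \<beta>))"
proof -
  interpret comm_ring_hom \<phi> by fact
  show ?thesis unfolding xy_hom_def using assms(2,3) by (subst pm_hom_superset[of S]) (auto intro!: sum.cong)
qed

definition xweight :: "var set \<Rightarrow> expo \<times> expo \<Rightarrow> nat" where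
  "xweight T m = (\<Sum>u\<in>T. Poly_Mapping.lookup (fst m) u)"

definition yweight :: "var set \<Rightarrow> expo \<times> expo \<Rightarrow> nat" where
  "yweight T m = (\<Sum>u\<in>T. Poly_Mapping.lookup (snd m) u)"

lemma weight_xweight: "weight (xweight T)" "weight (yweight T)"
  by (auto simp: weight_def xweight_def yweight_def lookup_add sum.distrib)

lemma wdeg_le_xvar:
  assumes "finite T"
  shows "wdeg_le (xweight T) (if u \<in> T then 1 else 0) (xvar u)" "wdeg_le (xweight T) 0 (yvar u)"
    "wdeg_le (yweight T) (if u \<in> T then 1 else 0) (yvar u)" "wdeg_le (yweight T) 0 (xvar u)"
  using assms by (auto simp: wdeg_le_def xweight_def yweight_def xvar_def yvar_def lookup_single when_def)

lemma sum_keys_indicator_le: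
  fixes \<gamma> :: "'v \<Rightarrow>\<^sub>0 nat"
  assumes "finite T" "\<And>u. u \<in> Poly_Mapping.keys \<gamma> \<Longrightarrow> b u \<le> (if u \<in> T then 1 else 0)"
  shows "(\<Sum>u\<in>Poly_Mapping.keys \<gamma>. Poly_Mapping.lookup \<gamma> u * b u) \<le> (\<Sum>u\<in>T. Poly_Mapping.lookup \<gamma> u)"
proof -
  have "(\<Sum>u\<in>Poly_Mapping.keys \<gamma>. Poly_Mapping.lookup \<gamma> u * b u) \<le>
      (\<Sum>u\<in>Poly_Mapping.keys \<gamma>. if u \<in> T then Poly_Mapping.lookup \<gamma> u else 0)"
  proof (rule sum_mono)
    fix u assume "u \<in> Poly_Mapping.keys \<gamma>"
    from assms(2)[OF this] show "Poly_Mapping.lookup \<gamma> u * b u \<le> (if u \<in> T then Poly_Mapping.lookup \<gamma> u else 0)"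
      by (auto split: if_splits)
  qed
  also have "\<dots> = (\<Sum>u\<in>Poly_Mapping.keys \<gamma> \<inter> T. Poly_Mapping.lookup \<gamma> u)"
    by (simp add: sum.inter_restrict)
  also have "\<dots> \<le> (\<Sum>u\<in>T. Poly_Mapping.lookup \<gamma> u)" using assms(1) by (intro sum_mono2) auto
  finally show ?thesis .
qed

lemma lookup_single_0_mult:
  fixes q :: "'m::comm_monoid_add \<Rightarrow>\<^sub>0 'a::comm_ring_1"
  shows "Poly_Mapping.lookup (Poly_Mapping.single 0 a * q) k = a * Poly_Mapping.lookup q k"
proof -
  have "Poly_Mapping.single 0 a * q = (\<Sum>k\<in>Poly_Mapping.keys q. Poly_Mapping.single k (a * Poly_Mapping.lookup q k))"
    by (subst poly_mapping_sum_single[of q]) (simp add: sum_distrib_left mult_single)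
  then have "Poly_Mapping.lookup (Poly_Mapping.single 0 a * q) k =
      (\<Sum>i\<in>Poly_Mapping.keys q. if i = k then a * Poly_Mapping.lookup q i else 0)"
    by (auto simp: lookup_sum lookup_single when_def intro!: sum.cong)
  then show ?thesis by (auto simp: in_keys_iff)
qed

definition pm_map :: "('a::comm_ring_1 \<Rightarrow> 'b::comm_ring_1) \<Rightarrow> ('m::comm_monoid_add \<Rightarrow>\<^sub>0 'a) \<Rightarrow> ('m \<Rightarrow>\<^sub>0 'b)" where
  "pm_map \<phi> = pm_hom (\<lambda>c. Poly_Mapping.single 0 (\<phi> c)) (\<lambda>k. Poly_Mapping.single k 1)"

lemma comm_ring_hom_pm_map: "comm_ring_hom \<phi> \<Longrightarrow> comm_ring_hom (pm_map \<phi>)"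
  unfolding pm_map_def
  by (rule pm_hom_comm_ring_hom[OF comm_ring_hom_comp[OF comm_ring_hom_single_0]]) (auto simp: mult_single)

lemma lookup_pm_map:
  assumes "comm_ring_hom \<phi>"
  shows "Poly_Mapping.lookup (pm_map \<phi> p) k = \<phi> (Poly_Mapping.lookup p k)"
proof -
  interpret comm_ring_hom \<phi> by fact
  have "Poly_Mapping.lookup (pm_map \<phi> p) k = (\<Sum>i\<in>Poly_Mapping.keys p. if i = k then \<phi> (Poly_Mapping.lookup p i) else 0)"
    unfolding pm_map_def pm_hom_def
    by (auto simp: lookup_sum mult_single lookup_single when_def intro!: sum.cong)
  then show ?thesis by (auto simp: in_keys_iff)
qed

section \<open>Degree bounds for the Bezoutian, and its vanishing at common roots\<close>

context multihom begin

definition bez_rows :: "expo set" where "bez_rows = bez_index r l (deg_vec r l d (dual_perm r \<pi>))"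
definition bez_cols :: "expo set" where "bez_cols = bez_index r l (deg_vec r l d \<pi>)"

definition grp :: "nat \<Rightarrow> var set" where "grp k = (\<lambda>j. (k, j)) ` {1..l k}"

lemma finite_grp [simp]: "finite (grp k)" by (simp add: grp_def)

lemma sum_grp: "(\<Sum>u\<in>grp k. f u) = (\<Sum>j=1..l k. f (k, j))"
  unfolding grp_def by (subst sum.reindex) (auto simp: inj_on_def)

lemma aff_vars_grp: "u \<in> aff_vars \<longleftrightarrow> fst u \<in> {1..r} \<and> u \<in> grp (fst u)"
  by (cases u) (auto simp: aff_vars_def grp_def)

lemma sum_grp_le: "\<gamma> \<in> mh_expos r l d \<Longrightarrow> k \<in> {1..r} \<Longrightarrow> (\<Sum>u\<in>grp k. Poly_Mapping.lookup \<gamma> u) \<le> d k"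
proof -
  assume "\<gamma> \<in> mh_expos r l d" "k \<in> {1..r}"
  then have "(\<Sum>j=0..l k. Poly_Mapping.lookup \<gamma> (k, j)) = d k" by (auto simp: mh_expos_def)
  then show ?thesis unfolding sum_grp using sum_mono2[of "{0..l k}" "{1..l k}" "\<lambda>j. Poly_Mapping.lookup \<gamma> (k, j)"] by auto
qed

lemma wdeg_le_dd:
  assumes w: "weight w" and v: "v = vs ! s"
    and b: "\<And>u. u \<in> Poly_Mapping.keys \<gamma> \<Longrightarrow> u \<noteq> v \<Longrightarrow> wdeg_le w (b u) (hyb s xvar yvar u)"
    and B: "Poly_Mapping.lookup \<gamma> v \<noteq> 0 \<Longrightarrow> wdeg_le w B (xvar v) \<and> wdeg_le w B (yvar v)"
    and e: "Poly_Mapping.lookup \<gamma> v \<noteq> 0 \<Longrightarrow>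
      (\<Sum>u\<in>Poly_Mapping.keys \<gamma>. Poly_Mapping.lookup \<gamma> u * (if u = v then 0 else b u)) + (Poly_Mapping.lookup \<gamma> v - 1) * B \<le> e"
  shows "wdeg_le w e (dd s xvar yvar \<gamma>)"
proof (cases "Poly_Mapping.lookup \<gamma> v = 0")
  case True
  then show ?thesis by (simp add: dd_def v[symmetric])
next
  case False
  let ?m = "Poly_Mapping.lookup \<gamma> v"
  have "wdeg_le w (\<Sum>u\<in>Poly_Mapping.keys \<gamma>. Poly_Mapping.lookup \<gamma> u * (if u = v then 0 else b u))
      (mono_ev ((hyb s xvar yvar)(v := 1)) \<gamma>)"
    by (rule wdeg_le_mono_ev[OF w]) (auto intro: b wdeg_le_1[OF w])
  moreover have "wdeg_le w ((?m - 1) * B) (\<Sum>i<?m. yvar v ^ (?m - Suc i) * xvar v ^ i)"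
  proof (rule wdeg_le_sum)
    fix i assume "i \<in> {..<?m}"
    then have eq: "(?m - 1) * B = (?m - Suc i) * B + i * B" by (simp flip: add_mult_distrib)
    show "wdeg_le w ((?m - 1) * B) (yvar v ^ (?m - Suc i) * xvar v ^ i)"
      unfolding eq using B[OF False] by (intro wdeg_le_mult wdeg_le_power w) auto
  qed
  ultimately show ?thesis unfolding dd_def v[symmetric]
    using wdeg_le_mult[OF w] e[OF False] wdeg_le_mono by blast
qed

lemma wdeg_le_ev_form:
  assumes "weight w" "\<And>\<gamma>. \<gamma> \<in> mh_expos r l d \<Longrightarrow> wdeg_le w e (\<chi> \<gamma>)"
  shows "wdeg_le w e (ev_form gen_coef j \<chi>)"
  unfolding ev_form_def gen_coef_def
  using wdeg_le_mult[OF assms(1) wdeg_le_const[OF assms(1)] assms(2)] by (intro wdeg_le_sum) auto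

lemma wdeg_le_det_bmat:
  assumes w: "weight w"
    and e0: "\<And>\<gamma>. \<gamma> \<in> mh_expos r l d \<Longrightarrow> wdeg_le w 0 (mono_ev (hyb q xvar yvar) \<gamma>)"
    and e: "\<And>\<gamma> s. \<gamma> \<in> mh_expos r l d \<Longrightarrow> s < n \<Longrightarrow> wdeg_le w (e (fst (vs ! s))) (dd s xvar yvar \<gamma>)"
  shows "wdeg_le w (\<Sum>i=1..r. l i * e i) (det (bmat q gen_coef xvar yvar))"
proof -
  let ?e = "\<lambda>i. if i = 0 then 0 else e (fst (vs ! (i - 1)))"
  have "wdeg_le w (\<Sum>i<n+1. ?e i) (det (bmat q gen_coef xvar yvar))"
  proof (rule wdeg_le_det[OF w bmat_carrier])
    fix i j assume "i < n + 1" "j < n + 1"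
    then show "wdeg_le w (?e i) (bmat q gen_coef xvar yvar $$ (i, j))"
      by (auto simp: bmat_def intro!: wdeg_le_ev_form w e0 e)
  qed
  also have "(\<Sum>i<n+1. ?e i) = (\<Sum>s<n. e (fst (vs ! s)))"
    unfolding Suc_eq_plus1[symmetric] sum.lessThan_Suc_shift by simp
  also have "\<dots> = (\<Sum>u\<in>aff_vars. e (fst u))"
    using bij_betw_nth[OF distinct_vs refl refl] length_vs set_vs
    by (intro sum.reindex_bij_betw) (simp add: atLeast0LessThan)
  also have "\<dots> = (\<Sum>i=1..r. l i * e i)"
    unfolding aff_vars_def by (subst sum.Sigma[symmetric, of _ _ "\<lambda>i j. e i", unfolded case_prod_unfold]) auto
  finally show ?thesis .
qed

lemma keys_hom_var: "\<gamma> \<in> mh_expos r l d \<Longrightarrow> u \<in> Poly_Mapping.keys \<gamma> \<Longrightarrow> snd u \<noteq> 0 \<Longrightarrow> u \<in> aff_vars"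
  by (cases u) (auto simp: mh_expos_def hom_vars_def aff_vars_def)

lemma bezoutian_wdeg:
  assumes w: "weight w" "wdeg_le w e (det (bmat 0 gen_coef xvar yvar))"
  shows "wdeg_le w e (bezoutian r l d \<pi>)"
proof -
  have "bezoutian r l d \<pi> = det (bmat 0 gen_coef xvar yvar) \<or> bezoutian r l d \<pi> = - det (bmat 0 gen_coef xvar yvar)"
    unfolding bezoutian_eq by (cases "even n") auto
  then show ?thesis using w by (auto simp: wdeg_le_def)
qed

text \<open>\<open>Z\<close> marks the groups in whose rows the variables of group \<open>k\<close>
  occur only with weight 0. In other rows the weight is at most \<open>d k\<close>, less one if the
  difference is taken inside group \<open>k\<close>.\<close>

lemma dd_bound_cases:
  assumes \<gamma>: "\<gamma> \<in> mh_expos r l d" and s: "s < n" and k: "k \<in> {1..r}"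
    and w: "weight w" and w1: "\<And>u. wdeg_le w (if u \<in> grp k then 1 else 0) (xvar u)" "\<And>u. wdeg_le w (if u \<in> grp k then 1 else 0) (yvar u)"
    and zero: "Z (fst (vs ! s)) \<Longrightarrow> fst (vs ! s) \<noteq> k"
      "\<And>u. Z (fst (vs ! s)) \<Longrightarrow> u \<in> grp k \<Longrightarrow> wdeg_le w 0 (hyb s xvar yvar u)"
  shows "wdeg_le w (if Z (fst (vs ! s)) then 0 else if fst (vs ! s) = k then d k - 1 else d k) (dd s xvar yvar \<gamma>)"
proof -
  define v where "v = vs ! s"
  have va: "v \<in> aff_vars" using vs_nth_aff[OF s] by (simp add: v_def)
  have v_grp: "v \<in> grp k \<longleftrightarrow> fst v = k" using va by (auto simp: aff_vars_grp) (auto simp: grp_def)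
  have hyb1: "wdeg_le w (if u \<in> grp k then 1 else 0) (hyb s xvar yvar u)" for u
    using w1 wdeg_le_mono[OF wdeg_le_1[OF w]] by (auto simp: hyb_def)
  show ?thesis
  proof (cases "Z (fst v)")
    case True
    have "wdeg_le w 0 (dd s xvar yvar \<gamma>)"
    proof (rule wdeg_le_dd[OF w v_def, where b="\<lambda>_. 0" and B=0])
      show "wdeg_le w 0 (hyb s xvar yvar u)" for u
        using zero(2)[of u] True hyb1[of u] by (cases "u \<in> grp k") (auto simp: v_def)
      show "wdeg_le w 0 (xvar v) \<and> wdeg_le w 0 (yvar v)"
        using w1[of v] zero(1) True v_grp by (auto simp: v_def)
    qed auto
    then show ?thesis using True by (simp add: v_def)
  next
    case False
    have "wdeg_le w (if fst v = k then d k - 1 else d k) (dd s xvar yvar \<gamma>)"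
    proof (rule wdeg_le_dd[OF w v_def, where b="\<lambda>u. if u \<in> grp k then 1 else 0" and B="if v \<in> grp k then 1 else 0"])
      show "wdeg_le w (if u \<in> grp k then 1 else 0) (hyb s xvar yvar u)" for u by (rule hyb1)
      show "wdeg_le w (if v \<in> grp k then 1 else 0) (xvar v) \<and> wdeg_le w (if v \<in> grp k then 1 else 0) (yvar v)"
        using w1 by blast
      assume nz: "Poly_Mapping.lookup \<gamma> v \<noteq> 0"
      have "(\<Sum>u\<in>Poly_Mapping.keys \<gamma>. Poly_Mapping.lookup \<gamma> u * (if u = v then 0 else if u \<in> grp k then 1 else 0))
          \<le> (\<Sum>u\<in>grp k - {v}. Poly_Mapping.lookup \<gamma> u)"
        by (rule sum_keys_indicator_le) auto
      moreover have "(\<Sum>u\<in>grp k - {v}. Poly_Mapping.lookup \<gamma> u) + (if v \<in> grp k then Poly_Mapping.lookup \<gamma> v else 0) \<le> d k"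
        using sum_grp_le[OF \<gamma> k] by (auto simp: sum.remove[of "grp k" v])
      ultimately show "(\<Sum>u\<in>Poly_Mapping.keys \<gamma>. Poly_Mapping.lookup \<gamma> u * (if u = v then 0 else if u \<in> grp k then 1 else 0))
          + (Poly_Mapping.lookup \<gamma> v - 1) * (if v \<in> grp k then 1 else 0) \<le> (if fst v = k then d k - 1 else d k)"
        using nz v_grp by (auto split: if_splits)
    qed
    then show ?thesis using False by (simp add: v_def)
  qed
qed

text \<open>The row bounds add up to the degree vector: the \<open>l k\<close> rows with a
  difference inside group \<open>k\<close> lose one each, which is the term \<open>- l k\<close>.
  The rows on one side of group \<open>k\<close> contribute nothing; the side is reversed for the
  dual permutation.\<close>

lemma deg_vec_eq:
  assumes k: "k \<in> {1..r}"
  shows "int (\<Sum>i=1..r. l i * (if \<pi> i < \<pi> k then 0 else if i = k then d k - 1 else d k)) = deg_vec r l d \<pi> k"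
    and "int (\<Sum>i=1..r. l i * (if \<pi> k < \<pi> i then 0 else if i = k then d k - 1 else d k)) = deg_vec r l d (dual_perm r \<pi>) k"
proof -
  have gen: "int (\<Sum>i=1..r. l i * (if Z i then 0 else if i = k then d k - 1 else d k)) =
      - int (l k) + int (d k) * (\<Sum>j | j \<in> {1..r} \<and> \<not> Z j. int (l j))" if "\<not> Z k" for Z
  proof -
    have "int (\<Sum>i=1..r. l i * (if Z i then 0 else if i = k then d k - 1 else d k)) =
        (\<Sum>i=1..r. (if Z i then 0 else int (d k) * int (l i)) - (if i = k then int (l k) else 0))"
      unfolding of_nat_sum using that d_pos[OF k] by (intro sum.cong) (auto simp: of_nat_diff algebra_simps)
    also have "\<dots> = (\<Sum>i=1..r. if Z i then 0 else int (d k) * int (l i)) - int (l k)"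
      using k by (simp add: sum_subtractf)
    also have "(\<Sum>i=1..r. if Z i then 0 else int (d k) * int (l i)) = int (d k) * (\<Sum>i=1..r. if \<not> Z i then int (l i) else 0)"
      unfolding sum_distrib_left by (intro sum.cong) auto
    also have "(\<Sum>i=1..r. if \<not> Z i then int (l i) else 0) = (\<Sum>j | j \<in> {1..r} \<and> \<not> Z j. int (l j))"
      by (rule sum.inter_filter[symmetric]) simp
    finally show ?thesis by simp
  qed
  show "int (\<Sum>i=1..r. l i * (if \<pi> i < \<pi> k then 0 else if i = k then d k - 1 else d k)) = deg_vec r l d \<pi> k"
    using gen[of "\<lambda>i. \<pi> i < \<pi> k"] by (simp add: deg_vec_def not_less)
  have "{j. j \<in> {1..r} \<and> dual_perm r \<pi> k \<le> dual_perm r \<pi> j} = {j. j \<in> {1..r} \<and> \<not> \<pi> k < \<pi> j}"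
  proof (intro Collect_cong conj_cong refl)
    fix j assume j: "j \<in> {1..r}"
    have "\<pi> j \<in> {1..r}" "\<pi> k \<in> {1..r}" using j k permutes_in_image[OF perm] by blast+
    then show "dual_perm r \<pi> k \<le> dual_perm r \<pi> j \<longleftrightarrow> \<not> \<pi> k < \<pi> j"
      using j k by (auto simp: dual_perm_def)
  qed
  then show "int (\<Sum>i=1..r. l i * (if \<pi> k < \<pi> i then 0 else if i = k then d k - 1 else d k)) = deg_vec r l d (dual_perm r \<pi>) k"
    using gen[of "\<lambda>i. \<pi> k < \<pi> i"] by (simp add: deg_vec_def)
qed

lemma hyb_0: "hyb 0 x y u = (if snd u = 0 then 1 else x u)" by (simp add: hyb_def)

lemma hyb_n: "u \<in> aff_vars \<Longrightarrow> hyb n x y u = y u"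
  using length_vs set_vs by (auto simp: hyb_def aff_vars_def)

text \<open>In rows of groups after \<open>k\<close> in the order all of group \<open>k\<close> is
  already \<open>y\<close>, and in rows of groups before \<open>k\<close> it is still
  \<open>x\<close>. So these rows do not count for the degree in \<open>x\<close> or in
  \<open>y\<close>, respectively.\<close>

lemma bezoutian_keys_aux:
  assumes m: "m \<in> Poly_Mapping.keys (bezoutian r l d \<pi>)" and k: "k \<in> {1..r}"
  shows "int (\<Sum>j=1..l k. Poly_Mapping.lookup (fst m) (k, j)) \<le> deg_vec r l d (dual_perm r \<pi>) k"
    and "int (\<Sum>j=1..l k. Poly_Mapping.lookup (snd m) (k, j)) \<le> deg_vec r l d \<pi> k"
proof -
  have grp_aff: "u \<in> grp k \<Longrightarrow> u \<in> aff_vars \<and> fst u = k" for u using k by (auto simp: aff_vars_grp grp_def)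
  note wx = weight_xweight(1)[of "grp k"] and wy = weight_xweight(2)[of "grp k"]
  have "wdeg_le (xweight (grp k)) (\<Sum>i=1..r. l i * (if \<pi> k < \<pi> i then 0 else if i = k then d k - 1 else d k))
      (det (bmat n gen_coef xvar yvar))"
  proof (rule wdeg_le_det_bmat[OF wx])
    fix \<gamma> assume \<gamma>: "\<gamma> \<in> mh_expos r l d"
    have "wdeg_le (xweight (grp k)) (\<Sum>u\<in>Poly_Mapping.keys \<gamma>. Poly_Mapping.lookup \<gamma> u * 0) (mono_ev (hyb n xvar yvar) \<gamma>)"
    proof (rule wdeg_le_mono_ev[OF wx])
      fix u assume u: "u \<in> Poly_Mapping.keys \<gamma>"
      show "wdeg_le (xweight (grp k)) 0 (hyb n xvar yvar u)"
        using keys_hom_var[OF \<gamma> u] wdeg_le_xvar(2)[of "grp k" u] wdeg_le_1[OF wx] hyb_n[of u xvar yvar]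
        by (cases "snd u = 0") (auto simp: hyb_def[of n _ _ u])
    qed
    then show "wdeg_le (xweight (grp k)) 0 (mono_ev (hyb n xvar yvar) \<gamma>)" by simp
    fix s assume s: "s < n"
    show "wdeg_le (xweight (grp k)) (if \<pi> k < \<pi> (fst (vs ! s)) then 0 else if fst (vs ! s) = k then d k - 1 else d k) (dd s xvar yvar \<gamma>)"
    proof (rule dd_bound_cases[OF \<gamma> s k wx, where Z="\<lambda>i. \<pi> k < \<pi> i"])
      show "wdeg_le (xweight (grp k)) (if u \<in> grp k then 1 else 0) (xvar u)"
        "wdeg_le (xweight (grp k)) (if u \<in> grp k then 1 else 0) (yvar u)" for u
        using wdeg_le_xvar[of "grp k" u] wdeg_le_mono[OF wdeg_le_xvar(2)[of "grp k" u]] by auto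
      fix u assume "\<pi> k < \<pi> (fst (vs ! s))" "u \<in> grp k"
      then show "wdeg_le (xweight (grp k)) 0 (hyb s xvar yvar u)"
        using vs_take(1)[OF s, of u] grp_aff[of u] wdeg_le_xvar(2)[of "grp k" u] wdeg_le_1[OF wx]
        by (auto simp: hyb_def)
    qed auto
  qed
  then have "wdeg_le (xweight (grp k)) (\<Sum>i=1..r. l i * (if \<pi> k < \<pi> i then 0 else if i = k then d k - 1 else d k)) (bezoutian r l d \<pi>)"
    unfolding det_bmat_last by (rule bezoutian_wdeg[OF wx])
  then have "xweight (grp k) m \<le> (\<Sum>i=1..r. l i * (if \<pi> k < \<pi> i then 0 else if i = k then d k - 1 else d k))"
    using m by (simp add: wdeg_le_def)
  then show "int (\<Sum>j=1..l k. Poly_Mapping.lookup (fst m) (k, j)) \<le> deg_vec r l d (dual_perm r \<pi>) k"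
    unfolding deg_vec_eq(2)[OF k, symmetric] by (simp only: xweight_def sum_grp of_nat_le_iff)
  have "wdeg_le (yweight (grp k)) (\<Sum>i=1..r. l i * (if \<pi> i < \<pi> k then 0 else if i = k then d k - 1 else d k))
      (det (bmat 0 gen_coef xvar yvar))"
  proof (rule wdeg_le_det_bmat[OF wy])
    fix \<gamma> assume \<gamma>: "\<gamma> \<in> mh_expos r l d"
    have "wdeg_le (yweight (grp k)) (\<Sum>u\<in>Poly_Mapping.keys \<gamma>. Poly_Mapping.lookup \<gamma> u * 0) (mono_ev (hyb 0 xvar yvar) \<gamma>)"
      by (rule wdeg_le_mono_ev[OF wy]) (auto simp: hyb_0 wdeg_le_xvar wdeg_le_1[OF wy])
    then show "wdeg_le (yweight (grp k)) 0 (mono_ev (hyb 0 xvar yvar) \<gamma>)" by simp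
    fix s assume s: "s < n"
    show "wdeg_le (yweight (grp k)) (if \<pi> (fst (vs ! s)) < \<pi> k then 0 else if fst (vs ! s) = k then d k - 1 else d k) (dd s xvar yvar \<gamma>)"
    proof (rule dd_bound_cases[OF \<gamma> s k wy, where Z="\<lambda>i. \<pi> i < \<pi> k"])
      show "wdeg_le (yweight (grp k)) (if u \<in> grp k then 1 else 0) (xvar u)"
        "wdeg_le (yweight (grp k)) (if u \<in> grp k then 1 else 0) (yvar u)" for u
        using wdeg_le_xvar[of "grp k" u] wdeg_le_mono[OF wdeg_le_xvar(4)[of "grp k" u]] by auto
      fix u assume "\<pi> (fst (vs ! s)) < \<pi> k" "u \<in> grp k"
      then show "wdeg_le (yweight (grp k)) 0 (hyb s xvar yvar u)"
        using vs_take(2)[OF s, of u] grp_aff[of u] wdeg_le_xvar(4)[of "grp k" u] wdeg_le_1[OF wy]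
        by (auto simp: hyb_def)
    qed auto
  qed
  then have "wdeg_le (yweight (grp k)) (\<Sum>i=1..r. l i * (if \<pi> i < \<pi> k then 0 else if i = k then d k - 1 else d k)) (bezoutian r l d \<pi>)"
    by (rule bezoutian_wdeg[OF wy])
  then have "yweight (grp k) m \<le> (\<Sum>i=1..r. l i * (if \<pi> i < \<pi> k then 0 else if i = k then d k - 1 else d k))"
    using m by (simp add: wdeg_le_def)
  then show "int (\<Sum>j=1..l k. Poly_Mapping.lookup (snd m) (k, j)) \<le> deg_vec r l d \<pi> k"
    unfolding deg_vec_eq(1)[OF k, symmetric] by (simp only: yweight_def sum_grp of_nat_le_iff)
qed

text \<open>The degree bounds say nothing about foreign variables; those are excluded by the weight
  that counts a single variable and vanishes on all of \<open>aff_vars\<close>.\<close>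

lemma bezoutian_keys_vars:
  assumes m: "m \<in> Poly_Mapping.keys (bezoutian r l d \<pi>)"
  shows "Poly_Mapping.keys (fst m) \<subseteq> aff_vars" "Poly_Mapping.keys (snd m) \<subseteq> aff_vars"
proof -
  have gen: "wdeg_le w 0 (bezoutian r l d \<pi>)"
    if w: "weight w" and x: "\<And>u. u \<in> aff_vars \<Longrightarrow> wdeg_le w 0 (xvar u)" "\<And>u. u \<in> aff_vars \<Longrightarrow> wdeg_le w 0 (yvar u)" for w
  proof -
    have h: "wdeg_le w 0 (hyb s xvar yvar u)" if "\<gamma> \<in> mh_expos r l d" "u \<in> Poly_Mapping.keys \<gamma>" for \<gamma> u s
      using keys_hom_var[OF that] x wdeg_le_1[OF w] by (auto simp: hyb_def)
    have "wdeg_le w (\<Sum>i=1..r. l i * 0) (det (bmat 0 gen_coef xvar yvar))"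
    proof (rule wdeg_le_det_bmat[OF w])
      fix \<gamma> assume \<gamma>: "\<gamma> \<in> mh_expos r l d"
      have "wdeg_le w (\<Sum>u\<in>Poly_Mapping.keys \<gamma>. Poly_Mapping.lookup \<gamma> u * 0) (mono_ev (hyb 0 xvar yvar) \<gamma>)"
        by (rule wdeg_le_mono_ev[OF w h[OF \<gamma>]])
      then show "wdeg_le w 0 (mono_ev (hyb 0 xvar yvar) \<gamma>)" by simp
      fix s assume s: "s < n"
      show "wdeg_le w 0 (dd s xvar yvar \<gamma>)"
        by (rule wdeg_le_dd[OF w refl, where b="\<lambda>_. 0" and B=0])
          (use h[OF \<gamma>] x vs_nth_aff[OF s] in auto)
    qed
    then show ?thesis using bezoutian_wdeg[OF w] by simp
  qed
  show "Poly_Mapping.keys (fst m) \<subseteq> aff_vars"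
  proof (rule subsetI, rule ccontr)
    fix u assume u: "u \<in> Poly_Mapping.keys (fst m)" "u \<notin> aff_vars"
    have "wdeg_le (xweight {u}) 0 (bezoutian r l d \<pi>)"
    proof (rule gen[OF weight_xweight(1)])
      fix u' assume "u' \<in> aff_vars"
      then show "wdeg_le (xweight {u}) 0 (xvar u')" "wdeg_le (xweight {u}) 0 (yvar u')"
        using wdeg_le_xvar(1)[of "{u}" u'] wdeg_le_xvar(2)[of "{u}" u'] u by (auto split: if_splits)
    qed
    then show False using m u by (auto simp: wdeg_le_def xweight_def in_keys_iff)
  qed
  show "Poly_Mapping.keys (snd m) \<subseteq> aff_vars"
  proof (rule subsetI, rule ccontr)
    fix u assume u: "u \<in> Poly_Mapping.keys (snd m)" "u \<notin> aff_vars"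
    have "wdeg_le (yweight {u}) 0 (bezoutian r l d \<pi>)"
    proof (rule gen[OF weight_xweight(2)])
      fix u' assume "u' \<in> aff_vars"
      then show "wdeg_le (yweight {u}) 0 (xvar u')" "wdeg_le (yweight {u}) 0 (yvar u')"
        using wdeg_le_xvar(3)[of "{u}" u'] wdeg_le_xvar(4)[of "{u}" u'] u by (auto split: if_splits)
    qed
    then show False using m u by (auto simp: wdeg_le_def yweight_def in_keys_iff)
  qed
qed

lemma bezoutian_keys: "Poly_Mapping.keys (bezoutian r l d \<pi>) \<subseteq> bez_rows \<times> bez_cols"
proof
  fix m assume m: "m \<in> Poly_Mapping.keys (bezoutian r l d \<pi>)"
  show "m \<in> bez_rows \<times> bez_cols"
    using bezoutian_keys_aux[OF m] bezoutian_keys_vars[OF m]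
    unfolding bez_rows_def bez_cols_def bez_index_def aff_vars_def by (cases m) auto
qed

lemma finite_bez_index: "finite (bez_index r l m)"
proof -
  let ?M = "\<Sum>i=1..r. nat (m i)"
  have "Poly_Mapping.lookup ` bez_index r l m
        \<subseteq> {f. \<forall>v. (v \<in> aff_vars \<longrightarrow> f v \<in> {..?M}) \<and> (v \<notin> aff_vars \<longrightarrow> f v = 0)}"
  proof (rule image_subsetI, rule CollectI, intro allI conjI impI)
    fix \<alpha> v assume \<alpha>: "\<alpha> \<in> bez_index r l m"
    show "Poly_Mapping.lookup \<alpha> v = 0" if "v \<notin> aff_vars"
      using \<alpha> that by (cases v) (auto simp: bez_index_def aff_vars_def in_keys_iff subset_iff)
    assume "v \<in> aff_vars"
    then obtain i j where v: "v = (i, j)" "i \<in> {1..r}" "j \<in> {1..l i}" by (auto simp: aff_vars_def)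
    have "Poly_Mapping.lookup \<alpha> v \<le> (\<Sum>j=1..l i. Poly_Mapping.lookup \<alpha> (i, j))"
      unfolding v(1) using v(3) by (intro member_le_sum) auto
    also have "\<dots> \<le> nat (m i)" 
    proof -
      have "int (\<Sum>j=1..l i. Poly_Mapping.lookup \<alpha> (i, j)) \<le> m i" using \<alpha> v(2) unfolding bez_index_def by blast
      then show ?thesis by arith
    qed
    also have "\<dots> \<le> ?M" using v by (intro member_le_sum) auto
    finally show "Poly_Mapping.lookup \<alpha> v \<in> {..?M}" by simp
  qed
  moreover have "finite {f. \<forall>v. (v \<in> aff_vars \<longrightarrow> f v \<in> {..?M}) \<and> (v \<notin> aff_vars \<longrightarrow> f v = (0::nat))}"
    by (rule finite_set_of_finite_funs) (auto simp: aff_vars_def)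
  ultimately have "finite (Poly_Mapping.lookup ` bez_index r l m)" by (rule finite_subset)
  then show ?thesis by (rule finite_imageD) (rule inj_onI, rule poly_mapping_eqI, simp)
qed

lemma finite_bez_rows: "finite bez_rows" and finite_bez_cols: "finite bez_cols"
  unfolding bez_rows_def bez_cols_def by (rule finite_bez_index)+

lemma deg_vec_nonneg:
  assumes "k \<in> {1..r}" shows "deg_vec r l d \<pi> k \<ge> 0" "deg_vec r l d (dual_perm r \<pi>) k \<ge> 0"
  by (subst deg_vec_eq[OF assms, symmetric], rule of_nat_0_le_iff)+

lemma zero_in_bez: "0 \<in> bez_rows" "0 \<in> bez_cols"
  by (auto simp: bez_rows_def bez_cols_def bez_index_def deg_vec_nonneg)

abbreviation bez :: "xy_poly" where "bez \<equiv> bezoutian r l d \<pi>"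

lemma det_bmat_eq_sum:
  fixes \<phi> :: "coef_ring \<Rightarrow> 'b::comm_ring_1"
  assumes "comm_ring_hom \<phi>"
  shows "(-1) ^ n * det (bmat 0 (\<lambda>g. \<phi> (Var g)) x y) =
    (\<Sum>\<alpha>\<in>bez_rows. \<Sum>\<beta>\<in>bez_cols. \<phi> (Poly_Mapping.lookup bez (\<alpha>, \<beta>)) * (mono_ev x \<alpha> * mono_ev y \<beta>))"
  unfolding xy_hom_bezoutian[OF assms, symmetric]
  by (subst xy_hom_superset[OF assms _ bezoutian_keys]) (auto simp: finite_bez_rows finite_bez_cols sum.cartesian_product)

text \<open>Specialize \<open>x\<close> to the root but keep \<open>y\<close> indeterminate. The
  first row of the determinant is then 0, and the coefficient of each monomial in \<open>y\<close>
  gives one linear relation.\<close>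

lemma bez_root_vanish:
  fixes \<phi> :: "coef_ring \<Rightarrow> 'b::comm_ring_1"
  assumes \<phi>: "comm_ring_hom \<phi>"
    and z: "\<And>j. j \<le> n \<Longrightarrow> ev_form (\<lambda>g. \<phi> (Var g)) j (mono_ev (hyb 0 z z)) = 0"
    and \<beta>: "\<beta> \<in> bez_cols"
  shows "(\<Sum>\<alpha>\<in>bez_rows. \<phi> (Poly_Mapping.lookup bez (\<alpha>, \<beta>)) * mono_ev z \<alpha>) = 0"
proof -
  let ?c = "Poly_Mapping.single (0::expo) :: 'b \<Rightarrow> _"
  note c = comm_ring_hom_single_0[where 'a='b and 'm=expo]
  note \<phi>' = comm_ring_hom_comp[OF c \<phi>]
  interpret c: comm_ring_hom ?c by (rule c)
  let ?B = "bmat 0 (\<lambda>g. ?c (\<phi> (Var g))) (\<lambda>v. ?c (z v)) Var"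
  have row0: "?B $$ (0, j) = 0" if j: "j < n + 1" for j
  proof -
    have "mono_ev (hyb 0 (\<lambda>v. ?c (z v)) Var) \<gamma> = ?c (mono_ev (hyb 0 z z) \<gamma>)" for \<gamma>
      unfolding hom_mono_ev[OF c] by (rule mono_ev_cong) (simp add: hyb_0)
    then have "ev_form (\<lambda>g. ?c (\<phi> (Var g))) j (mono_ev (hyb 0 (\<lambda>v. ?c (z v)) Var)) = ?c (ev_form (\<lambda>g. \<phi> (Var g)) j (mono_ev (hyb 0 z z)))"
      by (simp add: ev_form_def c.hom_sum c.hom_mult)
    then show ?thesis using j z[of j] by (simp add: bmat_def)
  qed
  have "(\<Prod>i = 0..<n+1. ?B $$ (i, p i)) = 0" if "p permutes {0..<n+1}" for p
    using row0[of "p 0"] permutes_in_image[OF that, of 0] by (intro prod_zero bexI[of _ 0]) auto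
  then have "det ?B = 0" unfolding det_def'[OF bmat_carrier] by (intro sum.neutral) auto
  then have "0 = (\<Sum>\<alpha>\<in>bez_rows. \<Sum>\<beta>\<in>bez_cols. ?c (\<phi> (Poly_Mapping.lookup bez (\<alpha>, \<beta>))) *
      (mono_ev (\<lambda>v. ?c (z v)) \<alpha> * mono_ev Var \<beta>))"
    using det_bmat_eq_sum[OF \<phi>', of "\<lambda>v. ?c (z v)" Var] by simp
  also have "\<dots> = (\<Sum>\<alpha>\<in>bez_rows. \<Sum>\<beta>\<in>bez_cols. Poly_Mapping.single \<beta> (\<phi> (Poly_Mapping.lookup bez (\<alpha>, \<beta>)) * mono_ev z \<alpha>))"
    by (simp add: hom_mono_ev[OF c, symmetric] mono_ev_Var mult_single)
  finally have eq: "(\<Sum>\<alpha>\<in>bez_rows. \<Sum>\<beta>\<in>bez_cols. Poly_Mapping.single \<beta> (\<phi> (Poly_Mapping.lookup bez (\<alpha>, \<beta>)) * mono_ev z \<alpha>)) = 0"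
    by (rule sym)
  have "0 = Poly_Mapping.lookup (\<Sum>\<alpha>\<in>bez_rows. \<Sum>\<beta>\<in>bez_cols. Poly_Mapping.single \<beta> (\<phi> (Poly_Mapping.lookup bez (\<alpha>, \<beta>)) * mono_ev z \<alpha>)) \<beta>"
    unfolding eq by simp
  also have "\<dots> = (\<Sum>\<alpha>\<in>bez_rows. \<Sum>\<beta>'\<in>bez_cols. if \<beta>' = \<beta> then \<phi> (Poly_Mapping.lookup bez (\<alpha>, \<beta>')) * mono_ev z \<alpha> else 0)"
    by (auto simp: lookup_sum lookup_single when_def intro!: sum.cong)
  also have "\<dots> = (\<Sum>\<alpha>\<in>bez_rows. \<phi> (Poly_Mapping.lookup bez (\<alpha>, \<beta>)) * mono_ev z \<alpha>)"
    using \<beta> finite_bez_cols by (intro sum.cong refl) (auto simp: sum.delta)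
  finally show ?thesis by simp
qed

lemma det_bmat_scale:
  "det (bmat q (\<lambda>g. a (fst g) * c g) x y) = (\<Prod>j\<in>{0..<n+1}. a j) * det (bmat q c x y)"
proof -
  have e: "bmat q (\<lambda>g. a (fst g) * c g) x y $$ (i, j) = a j * bmat q c x y $$ (i, j)" if "i < n + 1" "j < n + 1" for i j
    using that by (auto simp: bmat_def ev_form_def sum_distrib_left mult_ac)
  have "det (bmat q (\<lambda>g. a (fst g) * c g) x y) =
      (\<Sum>p\<in>{p. p permutes {0..<n+1}}. signof p * (\<Prod>i = 0..<n+1. a (p i) * bmat q c x y $$ (i, p i)))"
    unfolding det_def'[OF bmat_carrier]
    by (intro sum.cong refl arg_cong2[where f="(*)"] prod.cong e) (auto dest: permutes_in_image)
  also have "\<dots> = (\<Sum>p\<in>{p. p permutes {0..<n+1}}. (\<Prod>j\<in>{0..<n+1}. a j) * (signof p * (\<Prod>i = 0..<n+1. bmat q c x y $$ (i, p i))))"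
  proof (intro sum.cong refl)
    fix p assume "p \<in> {p. p permutes {0..<n+1}}"
    then have "(\<Prod>i = 0..<n+1. a (p i)) = (\<Prod>j\<in>{0..<n+1}. a j)"
      using permutes_imp_bij by (intro prod.reindex_bij_betw) auto
    then show "signof p * (\<Prod>i = 0..<n+1. a (p i) * bmat q c x y $$ (i, p i)) =
        (\<Prod>j\<in>{0..<n+1}. a j) * (signof p * (\<Prod>i = 0..<n+1. bmat q c x y $$ (i, p i)))"
      by (simp add: prod.distrib mult_ac)
  qed
  finally show ?thesis unfolding det_def'[OF bmat_carrier] by (simp add: sum_distrib_left)
qed

end

context multihom begin

lemma ev_form_cong:
  "(\<And>\<gamma>. \<gamma> \<in> mh_expos r l d \<Longrightarrow> c (j, \<gamma>) * \<chi> \<gamma> = c' (j, \<gamma>) * \<chi>' \<gamma>) \<Longrightarrow> ev_form c j \<chi> = ev_form c' j \<chi>'"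
  unfolding ev_form_def by (rule sum.cong) auto

lemma bmat_cong:
  assumes "\<And>j \<gamma>. j \<le> n \<Longrightarrow> c (j, \<gamma>) = c' (j, \<gamma>)"
  shows "bmat q c x y = bmat q c' x y"
  unfolding bmat_def using assms by (intro cong_mat) (auto intro!: ev_form_cong)

text \<open>Multiplying the form \<open>j\<close> by \<open>a j\<close> multiplies column
  \<open>j\<close>. With an indeterminate \<open>a j\<close> this yields the homogeneity of the
  determinant in each form; with all \<open>a j = 1\<close> it says that only the coefficients of
  the forms up to \<open>n\<close> matter.\<close>

lemma hom_bez_scale:
  fixes \<phi> \<phi>' :: "coef_ring \<Rightarrow> 'b::comm_ring_1"
  assumes \<phi>: "comm_ring_hom \<phi>" and \<phi>': "comm_ring_hom \<phi>'"
    and s: "\<And>j \<gamma>. j \<le> n \<Longrightarrow> \<phi>' (Var (j, \<gamma>)) = a j * \<phi> (Var (j, \<gamma>))"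
  shows "\<phi>' (Poly_Mapping.lookup bez m) = (\<Prod>j\<in>{0..<n+1}. a j) * \<phi> (Poly_Mapping.lookup bez m)"
proof -
  define X where "X = (\<lambda>v. Poly_Mapping.single (Poly_Mapping.single v 1, 0) 1 :: (expo \<times> expo) \<Rightarrow>\<^sub>0 'b)"
  define Y where "Y = (\<lambda>v. Poly_Mapping.single (0, Poly_Mapping.single v 1) 1 :: (expo \<times> expo) \<Rightarrow>\<^sub>0 'b)"
  have b: "pm_map \<psi> bez = (-1) ^ n * det (bmat 0 (\<lambda>g. Poly_Mapping.single 0 (\<psi> (Var g))) X Y)"
    if \<psi>: "comm_ring_hom \<psi>" for \<psi> :: "coef_ring \<Rightarrow> 'b"
  proof -
    interpret \<psi>: comm_ring_hom \<psi> by fact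
    interpret h: comm_ring_hom "pm_map \<psi> :: xy_poly \<Rightarrow> _" by (rule comm_ring_hom_pm_map[OF \<psi>])
    have "pm_map \<psi> (xvar v) = X v" "pm_map \<psi> (yvar v) = Y v" for v
      by (auto simp: pm_map_def xvar_def yvar_def X_def Y_def pm_hom_single mult_single zero_prod_def[symmetric])
    moreover have "pm_map \<psi> (gen_coef g) = Poly_Mapping.single 0 (\<psi> (Var g))" for g
      by (auto simp: pm_map_def gen_coef_def pm_hom_single mult_single)
    ultimately show ?thesis unfolding bezoutian_eq
      by (simp add: h.hom_mult h.hom_power h.hom_uminus hom_det_bmat[OF h.comm_ring_hom_axioms])
  qed
  interpret c: comm_ring_hom "Poly_Mapping.single (0::expo\<times>expo) :: 'b \<Rightarrow> _" by (rule comm_ring_hom_single_0)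
  have "pm_map \<phi>' bez = (-1) ^ n * det (bmat 0 (\<lambda>g. Poly_Mapping.single 0 (a (fst g)) * Poly_Mapping.single 0 (\<phi> (Var g))) X Y)"
    unfolding b[OF \<phi>'] by (subst bmat_cong[of _ "\<lambda>g. Poly_Mapping.single 0 (a (fst g)) * Poly_Mapping.single 0 (\<phi> (Var g))"])
      (auto simp: s c.hom_mult)
  also have "\<dots> = Poly_Mapping.single 0 (\<Prod>j\<in>{0..<n+1}. a j) * pm_map \<phi> bez"
    unfolding det_bmat_scale[where a="\<lambda>j. Poly_Mapping.single 0 (a j)" and c="\<lambda>g. Poly_Mapping.single 0 (\<phi> (Var g))"] b[OF \<phi>] c.hom_prod
    by (simp only: mult_ac)
  finally have "Poly_Mapping.lookup (pm_map \<phi>' bez) m = Poly_Mapping.lookup (Poly_Mapping.single 0 (\<Prod>j\<in>{0..<n+1}. a j) * pm_map \<phi> bez) m"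
    by simp
  then show ?thesis by (simp add: lookup_pm_map[OF \<phi>'] lookup_pm_map[OF \<phi>] lookup_single_0_mult)
qed

lemma mono_ev_scale:
  assumes \<gamma>: "\<gamma> \<in> mh_expos r l d"
  shows "mono_ev (\<lambda>v. a (fst v) * z v) \<gamma> = (\<Prod>i=1..r. a i ^ d i) * mono_ev z \<gamma>"
proof -
  have k: "Poly_Mapping.keys \<gamma> \<subseteq> hom_vars r l" using \<gamma> by (simp add: mh_expos_def)
  have fin: "finite (hom_vars r l)" by (simp add: hom_vars_def)
  have "(\<Prod>v\<in>hom_vars r l. a (fst v) ^ Poly_Mapping.lookup \<gamma> v) =
      (\<Prod>i=1..r. \<Prod>j=0..l i. a i ^ Poly_Mapping.lookup \<gamma> (i, j))"
    unfolding hom_vars_def by (subst prod.Sigma) (auto intro!: prod.cong)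
  also have "\<dots> = (\<Prod>i=1..r. a i ^ d i)"
    using \<gamma> by (intro prod.cong refl) (simp add: power_sum[symmetric] mh_expos_def)
  finally show ?thesis
    unfolding mono_ev_superset[OF fin k] by (simp add: power_mult_distrib prod.distrib)
qed

lemma mono_ev_hyb_0_eq:
  assumes \<gamma>: "\<gamma> \<in> mh_expos r l d" and z: "\<And>i. i \<in> {1..r} \<Longrightarrow> z (i, 0) = 1"
  shows "mono_ev (hyb 0 z z) \<gamma> = mono_ev z \<gamma>"
proof (rule mono_ev_cong)
  fix v assume "v \<in> Poly_Mapping.keys \<gamma>"
  then have "v \<in> hom_vars r l" using \<gamma> by (auto simp: mh_expos_def)
  then show "hyb 0 z z v = z v" using z by (auto simp: hyb_0 hom_vars_def)
qed

end

section \<open>The determinant of the Bezout matrix and its vanishing\<close>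

locale bez_square = multihom +
  fixes \<alpha>s \<beta>s :: "expo list"
  assumes rows: "distinct \<alpha>s" "set \<alpha>s = bez_rows" and cols: "distinct \<beta>s" "set \<beta>s = bez_cols"
    and square: "length \<alpha>s = length \<beta>s"
begin

abbreviation N :: nat where "N \<equiv> length \<alpha>s"

definition D :: coef_ring where "D = det (bez_matrix r l d \<pi> \<alpha>s \<beta>s)"

lemma sum_rows: "(\<Sum>\<alpha>\<in>bez_rows. f \<alpha>) = (\<Sum>i<N. f (\<alpha>s ! i))"
  and sum_cols: "(\<Sum>\<alpha>\<in>bez_cols. f \<alpha>) = (\<Sum>i<N. f (\<beta>s ! i))"
  using sum.reindex_bij_betw[OF bij_betw_nth[OF rows(1) refl refl], of f]
    sum.reindex_bij_betw[OF bij_betw_nth[OF cols(1) refl refl], of f] rows cols square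
  by (auto simp: atLeast0LessThan)

lemma hom_D:
  assumes "comm_ring_hom \<phi>"
  shows "\<phi> D = det (mat N N (\<lambda>(i, j). \<phi> (Poly_Mapping.lookup bez (\<alpha>s ! i, \<beta>s ! j))))"
proof -
  interpret comm_ring_hom \<phi> by fact
  have "map_mat \<phi> (bez_matrix r l d \<pi> \<alpha>s \<beta>s) = mat N N (\<lambda>(i, j). \<phi> (Poly_Mapping.lookup bez (\<alpha>s ! i, \<beta>s ! j)))"
    by (rule eq_matI) (auto simp: bez_matrix_def square)
  then show ?thesis by (simp add: D_def hom_det[symmetric])
qed

lemma hom_D_scale:
  fixes \<phi> \<phi>' :: "coef_ring \<Rightarrow> 'b::comm_ring_1"
  assumes \<phi>: "comm_ring_hom \<phi>" and \<phi>': "comm_ring_hom \<phi>'"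
    and s: "\<And>j \<gamma>. j \<le> n \<Longrightarrow> \<phi>' (Var (j, \<gamma>)) = a j * \<phi> (Var (j, \<gamma>))"
  shows "\<phi>' D = (\<Prod>j\<in>{0..<n+1}. a j) ^ N * \<phi> D"
proof -
  have "mat N N (\<lambda>(i, j). \<phi>' (Poly_Mapping.lookup bez (\<alpha>s ! i, \<beta>s ! j))) =
      (\<Prod>j\<in>{0..<n+1}. a j) \<cdot>\<^sub>m mat N N (\<lambda>(i, j). \<phi> (Poly_Mapping.lookup bez (\<alpha>s ! i, \<beta>s ! j)))"
    by (rule eq_matI) (auto simp: hom_bez_scale[OF assms])
  then show ?thesis unfolding hom_D[OF \<phi>] hom_D[OF \<phi>'] by (simp add: det_smult)
qed

lemma hom_D_affine_root:
  fixes \<phi> :: "coef_ring \<Rightarrow> 'b::idom"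
  assumes \<phi>: "comm_ring_hom \<phi>"
    and z: "\<And>j. j \<le> n \<Longrightarrow> ev_form (\<lambda>g. \<phi> (Var g)) j (mono_ev (hyb 0 z z)) = 0"
  shows "\<phi> D = 0"
proof -
  let ?A = "mat N N (\<lambda>(i, j). \<phi> (Poly_Mapping.lookup bez (\<alpha>s ! i, \<beta>s ! j)))"
  let ?v = "vec N (\<lambda>i. mono_ev z (\<alpha>s ! i))"
  \<comment> \<open>The constant monomial has value 1, so the vector of monomials is
    nonzero.\<close>
  obtain i where i: "i < N" "\<alpha>s ! i = 0" using zero_in_bez(1) rows by (metis in_set_conv_nth)
  have "?v $ i = 1" using i by simp
  then have "?v \<noteq> 0\<^sub>v N" using i by (metis index_zero_vec(1) zero_neq_one)
  moreover have "transpose_mat ?A *\<^sub>v ?v = 0\<^sub>v N"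
  proof (rule eq_vecI)
    fix j assume "j < dim_vec (0\<^sub>v N :: 'b vec)"
    then have j: "j < N" by simp
    have "(transpose_mat ?A *\<^sub>v ?v) $ j = (\<Sum>i<N. \<phi> (Poly_Mapping.lookup bez (\<alpha>s ! i, \<beta>s ! j)) * mono_ev z (\<alpha>s ! i))"
      using j by (simp add: scalar_prod_def atLeast0LessThan)
    also have "\<dots> = 0"
    proof -
      have "\<beta>s ! j \<in> bez_cols" using j cols square nth_mem by metis
      then show ?thesis using bez_root_vanish[OF \<phi> z] by (simp add: sum_rows)
    qed
    finally show "(transpose_mat ?A *\<^sub>v ?v) $ j = 0\<^sub>v N $ j" using j by simp
  qed simp
  ultimately have "det (transpose_mat ?A) = 0"
    by (subst det_0_iff_vec_prod_zero[of _ N]) (auto intro!: exI[of _ ?v])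
  then show ?thesis using hom_D[OF \<phi>] det_transpose[of ?A N] by simp
qed

text \<open>A root with a vanishing coordinate 0 has no affine representative. It is shifted by
  \<open>t\<close> in the coordinates 0, and the forms are corrected so as to vanish at the shifted
  point. The determinant of the corrected forms is a polynomial in \<open>t\<close> that is 0 for
  almost all \<open>t\<close>, so also at \<open>t = 0\<close>, where the correction
  disappears.\<close>

lemma mp_eval_D_root:
  fixes c :: "nat \<times> expo \<Rightarrow> 'k::field_char_0"
  assumes z: "homogeneous_coords r l z" and root: "\<And>j. j \<le> n \<Longrightarrow> ev_form c j (mono_ev z) = 0"
  shows "mp_eval of_int c D = 0"
proof -
  obtain I where I: "\<And>i. i \<in> {1..r} \<Longrightarrow> I i \<in> {0..l i} \<and> z (i, I i) \<noteq> 0"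
    using z unfolding homogeneous_coords_def by metis
  define z1 where "z1 = (\<lambda>v. inverse (z (fst v, I (fst v))) * z v)"
  have root1: "ev_form c j (mono_ev z1) = 0" if "j \<le> n" for j
  proof -
    have "ev_form c j (mono_ev z1) = ev_form c j (\<lambda>\<gamma>. (\<Prod>i=1..r. inverse (z (i, I i)) ^ d i) * mono_ev z \<gamma>)"
      unfolding z1_def by (intro ev_form_cong) (simp add: mono_ev_scale[of _ "\<lambda>i. inverse (z (i, I i))"])
    also have "\<dots> = (\<Prod>i=1..r. inverse (z (i, I i)) ^ d i) * ev_form c j (mono_ev z)" by (simp add: ev_form_mult)
    finally show ?thesis using root that by simp
  qed
  have z1_I: "z1 (i, I i) = 1" if "i \<in> {1..r}" for i using I[OF that] by (simp add: z1_def)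
  \<comment> \<open>A monomial of the right multidegree that equals 1 at the normalized root
    \<open>z1\<close>.\<close>
  define \<gamma>0 :: expo where "\<gamma>0 = (\<Sum>i=1..r. Poly_Mapping.single (i, I i) (d i))"
  have \<gamma>0_lookup: "Poly_Mapping.lookup \<gamma>0 (i, j) = (if i \<in> {1..r} \<and> j = I i then d i else 0)" for i j
  proof -
    have "Poly_Mapping.lookup \<gamma>0 (i, j) = (\<Sum>i'=1..r. if i' = i then (if j = I i then d i else 0) else 0)"
      unfolding \<gamma>0_def lookup_sum by (rule sum.cong) (auto simp: lookup_single when_def)
    then show ?thesis by simp
  qed
  have \<gamma>0: "\<gamma>0 \<in> mh_expos r l d"
    unfolding mh_expos_def using I by (auto simp: \<gamma>0_lookup in_keys_iff hom_vars_def split: if_splits)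
  have mono_\<gamma>0: "mono_ev h \<gamma>0 = (\<Prod>i=1..r. h (i, I i) ^ d i)" for h :: "var \<Rightarrow> 'c::comm_ring_1"
  proof -
    have "mono_ev h (\<Sum>i\<in>S. Poly_Mapping.single (i, I i) (d i)) = (\<Prod>i\<in>S. h (i, I i) ^ d i)" if "finite S" for S
      using that by (induction S) (auto simp: mono_ev_add)
    then show ?thesis by (simp add: \<gamma>0_def)
  qed
  define zt :: "var \<Rightarrow> 'k poly" where "zt = (\<lambda>v. if snd v = 0 then [:z1 v, 1:] else [:z1 v:])"
  \<comment> \<open>The corrected form is \<open>f\<close> times the value of
    \<open>\<gamma>0\<close> at \<open>zt\<close>, minus the value of \<open>f\<close> at
    \<open>zt\<close> times the monomial \<open>\<gamma>0\<close>. It vanishes at \<open>zt\<close>,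
    and at \<open>t = 0\<close> it is \<open>f\<close> itself.\<close>
  define C where "C = (\<lambda>g. smult (c g) (mono_ev zt \<gamma>0) - (if snd g = \<gamma>0 then ev_form (\<lambda>g. [:c g:]) (fst g) (mono_ev zt) else 0))"
  define P where "P = mp_eval of_int C D"
  have poly_P: "poly P t = mp_eval of_int (\<lambda>g. poly (C g) t) D" for t
    unfolding P_def by (simp add: hom_mp_eval[OF comm_ring_hom_poly])
  have Pt: "poly P t = 0" if t: "\<And>i. i \<in> {1..r} \<Longrightarrow> z1 (i, 0) + t \<noteq> 0" for t
  proof -
    define w where "w = (\<lambda>v. poly (zt v) t)"
    have w0: "w (i, 0) \<noteq> 0" if "i \<in> {1..r}" for i using t[OF that] by (simp add: w_def zt_def)
    have mono_w: "poly (mono_ev zt \<gamma>) t = mono_ev w \<gamma>" for \<gamma>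
      unfolding w_def by (rule hom_mono_ev[OF comm_ring_hom_poly])
    have Ct: "poly (C g) t = c g * mono_ev w \<gamma>0 - (if snd g = \<gamma>0 then ev_form c (fst g) (mono_ev w) else 0)" for g
      by (simp add: C_def mono_w ev_form_def poly_sum)
    have Fw: "ev_form (\<lambda>g. poly (C g) t) j (mono_ev w) = 0" for j
    proof -
      have "ev_form (\<lambda>g. poly (C g) t) j (mono_ev w) = (\<Sum>\<gamma>\<in>mh_expos r l d. mono_ev w \<gamma>0 * (c (j, \<gamma>) * mono_ev w \<gamma>) -
          (if \<gamma> = \<gamma>0 then ev_form c j (mono_ev w) * mono_ev w \<gamma> else 0))"
        unfolding ev_form_def[of "\<lambda>g. poly (C g) t"] by (intro sum.cong refl) (auto simp: Ct algebra_simps)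
      also have "\<dots> = mono_ev w \<gamma>0 * ev_form c j (mono_ev w) - ev_form c j (mono_ev w) * mono_ev w \<gamma>0"
        using \<gamma>0 by (simp add: sum_subtractf sum_distrib_left[symmetric] finite_mh_expos ev_form_def)
      finally show ?thesis by simp
    qed
    define w1 where "w1 = (\<lambda>v. inverse (w (fst v, 0)) * w v)"
    have "ev_form (\<lambda>g. poly (C g) t) j (mono_ev (hyb 0 w1 w1)) = 0" for j
    proof -
      have "ev_form (\<lambda>g. poly (C g) t) j (mono_ev (hyb 0 w1 w1)) =
          ev_form (\<lambda>g. poly (C g) t) j (\<lambda>\<gamma>. (\<Prod>i=1..r. inverse (w (i, 0)) ^ d i) * mono_ev w \<gamma>)"
      proof (intro ev_form_cong)
        fix \<gamma> assume \<gamma>: "\<gamma> \<in> mh_expos r l d"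
        have "mono_ev (hyb 0 w1 w1) \<gamma> = mono_ev w1 \<gamma>"
          using w0 by (intro mono_ev_hyb_0_eq[OF \<gamma>]) (simp add: w1_def)
        also have "\<dots> = (\<Prod>i=1..r. inverse (w (i, 0)) ^ d i) * mono_ev w \<gamma>"
          unfolding w1_def by (rule mono_ev_scale[OF \<gamma>, of "\<lambda>i. inverse (w (i, 0))"])
        finally show "poly (C (j, \<gamma>)) t * mono_ev (hyb 0 w1 w1) \<gamma> = poly (C (j, \<gamma>)) t * ((\<Prod>i=1..r. inverse (w (i, 0)) ^ d i) * mono_ev w \<gamma>)"
          by simp
      qed
      also have "\<dots> = (\<Prod>i=1..r. inverse (w (i, 0)) ^ d i) * ev_form (\<lambda>g. poly (C g) t) j (mono_ev w)" by (simp add: ev_form_mult)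
      finally show ?thesis using Fw by simp
    qed
    then have "mp_eval of_int (\<lambda>g. poly (C g) t) D = 0"
      by (intro hom_D_affine_root[OF comm_ring_hom_mp_eval[OF comm_ring_hom_of_int], where z=w1])
        (simp add: comm_ring_hom_of_int)
    then show ?thesis using poly_P by simp
  qed
  have "P = 0"
  proof (rule ccontr)
    assume "P \<noteq> 0"
    then have "finite {t. poly P t = 0}" by (rule poly_roots_finite)
    moreover have "finite ((\<lambda>i. - z1 (i, 0)) ` {1..r})" by simp
    moreover have "UNIV \<subseteq> {t. poly P t = 0} \<union> (\<lambda>i. - z1 (i, 0)) ` {1..r}"
    proof
      fix t :: 'k
      show "t \<in> {t. poly P t = 0} \<union> (\<lambda>i. - z1 (i, 0)) ` {1..r}"
      proof (cases "\<exists>i\<in>{1..r}. z1 (i, 0) + t = 0")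
        case True then show ?thesis by (auto simp: add_eq_0_iff)
      next
        case False then show ?thesis using Pt[of t] by auto
      qed
    qed
    ultimately have "finite (UNIV :: 'k set)" by (meson finite_UnI finite_subset)
    then show False using infinite_UNIV_char_0 by blast
  qed
  \<comment> \<open>Only the forms up to \<open>n\<close> are known to vanish at \<open>z1\<close>.
    Other values of \<open>c\<close> may differ, which is why \<open>D\<close> is compared through
    \<open>hom_D_scale\<close> with all factors 1.\<close>
  moreover have "poly (C g) 0 = c g" if "fst g \<le> n" for g
  proof -
    have zt0: "poly (zt v) 0 = z1 v" for v by (simp add: zt_def)
    have m0: "poly (mono_ev zt \<gamma>) 0 = mono_ev z1 \<gamma>" for \<gamma> using hom_mono_ev[OF comm_ring_hom_poly, of zt \<gamma> 0] by (simp add: zt0)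
    have "mono_ev z1 \<gamma>0 = 1" using z1_I by (simp add: mono_\<gamma>0)
    then show ?thesis using root1[OF that] by (simp add: C_def m0 ev_form_def poly_sum)
  qed
  then have "mp_eval of_int (\<lambda>g. poly (C g) 0) D = mp_eval of_int c D"
    by - (subst hom_D_scale[where \<phi>="mp_eval of_int c" and a="\<lambda>_. 1"], auto intro: comm_ring_hom_mp_eval comm_ring_hom_of_int simp: comm_ring_hom_of_int)
  ultimately show ?thesis using poly_P[of 0] by simp
qed

end

lemma coeff_1_linear_power:
  "coeff ([:c, 1:] ^ m) 1 = of_nat m * c ^ (m - 1)" for c :: "'a::comm_ring_1"
proof (induction m)
  case (Suc m)
  have "coeff ([:c, 1:] ^ m) 0 = c ^ m" by (simp add: poly_0_coeff_0[symmetric])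
  then show ?case using Suc by (cases m) (auto simp: algebra_simps coeff_pCons)
qed simp

lemma det_diagonal_mat:
  fixes A :: "'a::comm_ring_1 mat"
  assumes A: "A \<in> carrier_mat m m" and z: "\<And>i j. i < m \<Longrightarrow> j < m \<Longrightarrow> i \<noteq> j \<Longrightarrow> A $$ (i, j) = 0"
  shows "det A = (\<Prod>i\<in>{0..<m}. A $$ (i, i))"
proof -
  have "det A = prod_list (diag_mat A)" using A z by (intro det_upper_triangular[OF _ A]) auto
  then show ?thesis using A by (simp add: diag_mat_def prod.distinct_set_conv_list[symmetric] del: upt_Suc)
qed

section \<open>Products of linear forms and their common zeros\<close>

context multihom begin

text \<open>The multidegree is exact; the zero polynomial counts as having every
  multidegree.\<close>

definition mdeg_le :: "(nat \<Rightarrow> nat) \<Rightarrow> (expo \<Rightarrow>\<^sub>0 'b::comm_ring_1) \<Rightarrow> bool" where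
  "mdeg_le \<delta> p \<longleftrightarrow> (\<forall>\<gamma>\<in>Poly_Mapping.keys p. Poly_Mapping.keys \<gamma> \<subseteq> hom_vars r l \<and>
     (\<forall>i\<in>{1..r}. (\<Sum>j=0..l i. Poly_Mapping.lookup \<gamma> (i, j)) = \<delta> i))"

lemma mdeg_le_mult: "mdeg_le \<delta> p \<Longrightarrow> mdeg_le \<delta>' q \<Longrightarrow> mdeg_le (\<lambda>i. \<delta> i + \<delta>' i) (p * q)"
  unfolding mdeg_le_def
proof (intro ballI)
  fix \<gamma> assume a: "\<forall>\<gamma>\<in>Poly_Mapping.keys p. Poly_Mapping.keys \<gamma> \<subseteq> hom_vars r l \<and>
     (\<forall>i\<in>{1..r}. (\<Sum>j=0..l i. Poly_Mapping.lookup \<gamma> (i, j)) = \<delta> i)"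
    "\<forall>\<gamma>\<in>Poly_Mapping.keys q. Poly_Mapping.keys \<gamma> \<subseteq> hom_vars r l \<and>
     (\<forall>i\<in>{1..r}. (\<Sum>j=0..l i. Poly_Mapping.lookup \<gamma> (i, j)) = \<delta>' i)"
    and "\<gamma> \<in> Poly_Mapping.keys (p * q)"
  then obtain x y where xy: "\<gamma> = x + y" "x \<in> Poly_Mapping.keys p" "y \<in> Poly_Mapping.keys q"
    using keys_mult[of p q] by auto
  then show "Poly_Mapping.keys \<gamma> \<subseteq> hom_vars r l \<and>
     (\<forall>i\<in>{1..r}. (\<Sum>j=0..l i. Poly_Mapping.lookup \<gamma> (i, j)) = \<delta> i + \<delta>' i)"
  proof (intro conjI ballI)
    have "Poly_Mapping.keys x \<subseteq> hom_vars r l" "Poly_Mapping.keys y \<subseteq> hom_vars r l" using a xy by blast+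
    then show "Poly_Mapping.keys \<gamma> \<subseteq> hom_vars r l" unfolding xy(1) using keys_add[of x y] by blast
    fix i assume "i \<in> {1..r}"
    then show "(\<Sum>j=0..l i. Poly_Mapping.lookup \<gamma> (i, j)) = \<delta> i + \<delta>' i"
      using a xy by (simp only: xy(1) lookup_add sum.distrib)
  qed
qed

lemma mdeg_le_prod:
  "finite I \<Longrightarrow> (\<And>a. a \<in> I \<Longrightarrow> mdeg_le (\<delta> a) (f a)) \<Longrightarrow> mdeg_le (\<lambda>i. \<Sum>a\<in>I. \<delta> a i) (prod f I)"
  by (induction I rule: finite_induct) (auto intro: mdeg_le_mult simp: mdeg_le_def[of "\<lambda>_. 0"])

lemma mdeg_le_keys: "mdeg_le d p \<Longrightarrow> Poly_Mapping.keys p \<subseteq> mh_expos r l d"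
  by (auto simp: mdeg_le_def mh_expos_def)

text \<open>Positions of the linear factors in a split form: \<open>d k\<close> of them in group
  \<open>k\<close>.\<close>

definition slots :: "(nat \<times> nat) set" where "slots = (SIGMA k:{1..r}. {..<d k})"

lemma finite_slots: "finite slots" by (simp add: slots_def)

text \<open>A point of the moment curve as a linear form. If the coordinates of group
  \<open>k\<close> are the coefficients of a polynomial of degree at most \<open>l k\<close>, the
  one at \<open>l k\<close> first, its value is that polynomial evaluated at \<open>t\<close>. Zeros
  of such forms thus become polynomials with prescribed roots.\<close>

definition linform :: "nat \<Rightarrow> 'b \<Rightarrow> (expo \<Rightarrow>\<^sub>0 'b::comm_ring_1)" where
  "linform k t = (\<Sum>i=0..l k. Poly_Mapping.single (Poly_Mapping.single (k, i) 1) (t ^ (l k - i)))"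

lemma mdeg_le_linform:
  assumes "k \<in> {1..r}" shows "mdeg_le (\<lambda>i. if i = k then 1 else 0) (linform k t)"
  unfolding mdeg_le_def
proof (intro ballI)
  fix \<gamma> assume "\<gamma> \<in> Poly_Mapping.keys (linform k t)"
  then have "\<gamma> \<in> (\<Union>i\<in>{0..l k}. Poly_Mapping.keys (Poly_Mapping.single (Poly_Mapping.single (k, i) (1::nat)) (t ^ (l k - i))))"
    unfolding linform_def by (rule subsetD[OF keys_sum])
  then obtain i where i: "i \<le> l k" "\<gamma> = Poly_Mapping.single (k, i) 1" by (auto split: if_splits)
  have "(\<Sum>j = 0..l i'. Poly_Mapping.lookup \<gamma> (i', j)) = (if i' = k then 1 else 0)" for i'
  proof -
    have "(\<Sum>j = 0..l i'. Poly_Mapping.lookup \<gamma> (i', j)) = (\<Sum>j = 0..l i'. if j = i then (if i' = k then 1 else 0) else 0)"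
      unfolding i(2) by (rule sum.cong) (auto simp: lookup_single when_def)
    then show ?thesis using i by simp
  qed
  then show "Poly_Mapping.keys \<gamma> \<subseteq> hom_vars r l \<and>
      (\<forall>i\<in>{1..r}. (\<Sum>j = 0..l i. Poly_Mapping.lookup \<gamma> (i, j)) = (if i = k then 1 else 0))"
    using i assms by (auto simp: hom_vars_def)
qed

definition prodform :: "(nat \<times> nat \<Rightarrow> 'b::comm_ring_1) \<Rightarrow> (expo \<Rightarrow>\<^sub>0 'b)" where
  "prodform \<tau> = (\<Prod>ks\<in>slots. linform (fst ks) (\<tau> ks))"

lemma keys_prodform: "Poly_Mapping.keys (prodform \<tau>) \<subseteq> mh_expos r l d"
proof -
  have "mdeg_le (\<lambda>i. \<Sum>ks\<in>slots. if i = fst ks then 1 else 0) (prodform \<tau>)"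
    unfolding prodform_def by (rule mdeg_le_prod[OF finite_slots mdeg_le_linform]) (auto simp: slots_def)
  moreover have "(\<Sum>ks\<in>slots. if i = fst ks then 1 else 0) = d i" if "i \<in> {1..r}" for i
  proof -
    have "(\<Sum>ks\<in>slots. if i = fst ks then 1 else 0) = (\<Sum>k=1..r. \<Sum>s<d k. if i = k then 1 else 0)"
      unfolding slots_def by (subst sum.Sigma) (auto intro!: sum.cong)
    also have "\<dots> = (\<Sum>k=1..r. if i = k then d k else 0)" by (intro sum.cong) auto
    finally show ?thesis using that by simp
  qed
  ultimately show ?thesis unfolding mdeg_le_def mh_expos_def by auto
qed

lemma ev_form_lookup:
  fixes e :: "'b::comm_ring_1 \<Rightarrow> 'c::comm_ring_1"
  assumes "comm_ring_hom e" "Poly_Mapping.keys p \<subseteq> mh_expos r l d" "\<And>\<gamma>. c (j, \<gamma>) = Poly_Mapping.lookup p \<gamma>"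
  shows "ev_form (\<lambda>g. e (c g)) j (mono_ev h) = mp_eval e h p"
proof -
  interpret comm_ring_hom e by fact
  show ?thesis unfolding mp_eval_eq using assms(2,3)
    by (subst pm_hom_superset[OF finite_mh_expos]) (auto simp: ev_form_def)
qed

lemma mp_eval_prodform:
  fixes e :: "'b::comm_ring_1 \<Rightarrow> 'c::comm_ring_1"
  assumes "comm_ring_hom e"
  shows "mp_eval e h (prodform \<tau>) = (\<Prod>ks\<in>slots. \<Sum>i=0..l (fst ks). e (\<tau> ks) ^ (l (fst ks) - i) * h (fst ks, i))"
proof -
  interpret e: comm_ring_hom e by fact
  interpret comm_ring_hom "mp_eval e h" by (rule comm_ring_hom_mp_eval[OF assms])
  have "mp_eval e h (linform k t) = (\<Sum>i=0..l k. e t ^ (l k - i) * h (k, i))" for k t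
    unfolding linform_def hom_sum by (simp add: mp_eval_eq pm_hom_single e.hom_power)
  then show ?thesis by (simp add: prodform_def hom_prod)
qed

text \<open>The monomial in the homogenizing coordinates, which is 1 on the affine chart; it is
  taken as the form \<open>j0\<close> of a split system.\<close>

definition basept :: expo where "basept = (\<Sum>i=1..r. Poly_Mapping.single (i, 0) (d i))"

lemma lookup_basept: "Poly_Mapping.lookup basept (i, j) = (if i \<in> {1..r} \<and> j = 0 then d i else 0)"
proof -
  have "Poly_Mapping.lookup basept (i, j) = (\<Sum>i'=1..r. if i' = i then (if j = 0 then d i else 0) else 0)"
    unfolding basept_def lookup_sum by (rule sum.cong) (auto simp: lookup_single when_def)
  then show ?thesis by simp
qed

lemma basept_mh: "basept \<in> mh_expos r l d"
  unfolding mh_expos_def by (auto simp: lookup_basept in_keys_iff hom_vars_def split: if_splits)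

lemma mono_ev_basept:
  assumes "\<And>i. i \<in> {1..r} \<Longrightarrow> h (i, 0) = 1" shows "mono_ev h basept = (1::'c::comm_ring_1)"
proof -
  have "mono_ev h (\<Sum>i\<in>S. Poly_Mapping.single (i, 0) (d i)) = (\<Prod>i\<in>S. h (i, 0) ^ d i)" if "finite S" for S
    using that by (induction S) (auto simp: mono_ev_add)
  then show ?thesis using assms by (simp add: basept_def)
qed

text \<open>A common zero makes one linear factor of each form vanish. Exactly \<open>l k\<close>
  conditions in group \<open>k\<close> determine the point of that factor space, so these maps index
  the common zeros.\<close>

definition choices :: "nat set \<Rightarrow> (nat \<Rightarrow> nat \<times> nat) set" where
  "choices J = {\<kappa> \<in> J \<rightarrow>\<^sub>E slots. \<forall>k\<in>{1..r}. card {j\<in>J. fst (\<kappa> j) = k} = l k}"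

text \<open>For \<open>x = y\<close> the divided difference is a partial derivative. It is read off
  as the linear coefficient after adding an indeterminate to the coordinate \<open>vs ! s\<close>,
  which makes the product rule a computation with polynomials.\<close>

lemma dd_diag_coeff:
  fixes p :: "var \<Rightarrow> 'b::comm_ring_1"
  assumes s: "s < n"
  shows "dd s p p \<gamma> = coeff (mono_ev (\<lambda>u. if u = vs ! s then [:p u, 1:] else [:hyb 0 p p u:]) \<gamma>) 1"
proof -
  let ?v = "vs ! s" let ?m = "Poly_Mapping.lookup \<gamma> (vs ! s)"
  have h: "hyb s p p = hyb 0 p p" by (auto simp: hyb_def fun_eq_iff)
  have fe: "(\<lambda>u. if u = vs ! s then [:p u, 1:] else [:hyb 0 p p u:]) = ((\<lambda>u. [:hyb 0 p p u:])(?v := [:p ?v, 1:]))" by auto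
  have "(\<lambda>u. [:hyb 0 p p u:])(?v := 1) = (\<lambda>u. [:((hyb 0 p p)(?v := 1)) u:])" by (auto simp: one_pCons)
  then have "mono_ev (\<lambda>u. if u = vs ! s then [:p u, 1:] else [:hyb 0 p p u:]) \<gamma> =
      [:mono_ev ((hyb 0 p p)(?v := 1)) \<gamma>:] * [:p ?v, 1:] ^ ?m"
    unfolding fe mono_ev_fun_upd[of _ ?v "[:p ?v, 1:]"] by (simp add: hom_mono_ev[OF comm_ring_hom_const_poly])
  then have "coeff (mono_ev (\<lambda>u. if u = vs ! s then [:p u, 1:] else [:hyb 0 p p u:]) \<gamma>) 1 =
      mono_ev ((hyb 0 p p)(?v := 1)) \<gamma> * (of_nat ?m * p ?v ^ (?m - 1))"
    using coeff_1_linear_power[of "p ?v" ?m] by simp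
  moreover have "(\<Sum>i<?m. p ?v ^ (?m - Suc i) * p ?v ^ i) = of_nat ?m * p ?v ^ (?m - 1)"
  proof -
    have "(\<Sum>i<?m. p ?v ^ (?m - Suc i) * p ?v ^ i) = (\<Sum>i<?m. p ?v ^ (?m - 1))"
      by (intro sum.cong refl) (simp flip: power_add)
    then show ?thesis by simp
  qed
  ultimately show ?thesis by (simp add: dd_def h)
qed

end

locale split_system = multihom r n l d \<pi> for r n :: nat and l d \<pi> :: "nat \<Rightarrow> nat" +
  fixes j0 :: nat and \<tau> :: "nat \<times> nat \<times> nat \<Rightarrow> 'b::idom"
  assumes j0: "j0 \<le> n" and inj: "inj_on \<tau> (({0..n} - {j0}) \<times> slots)"
begin

definition J :: "nat set" where "J = {0..n} - {j0}"

lemma finite_J: "finite J" by (simp add: J_def)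

definition cf :: "nat \<times> expo \<Rightarrow> 'b" where
  "cf g = Poly_Mapping.lookup (if fst g = j0 then Poly_Mapping.single basept 1 else prodform (\<lambda>ks. \<tau> (fst g, ks))) (snd g)"

definition gpoly :: "(nat \<Rightarrow> nat \<times> nat) \<Rightarrow> nat \<Rightarrow> 'b poly" where
  "gpoly \<kappa> k = (\<Prod>j\<in>{j\<in>J. fst (\<kappa> j) = k}. [:- \<tau> (j, \<kappa> j), 1:])"

text \<open>The common zero selected by \<kappa>: in group \<open>k\<close>, the coefficients of the
  monic polynomial whose roots are the chosen parameters, leading coefficient first. So coordinate 0
  is 1 and the zero lies in the chart.\<close>

definition pt :: "(nat \<Rightarrow> nat \<times> nat) \<Rightarrow> var \<Rightarrow> 'b" where
  "pt \<kappa> v = coeff (gpoly \<kappa> (fst v)) (l (fst v) - snd v)"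

lemma gpoly_degree:
  assumes "\<kappa> \<in> choices J" "k \<in> {1..r}" shows "degree (gpoly \<kappa> k) = l k" "lead_coeff (gpoly \<kappa> k) = 1"
proof -
  have "degree (gpoly \<kappa> k) = (\<Sum>j\<in>{j\<in>J. fst (\<kappa> j) = k}. degree [:- \<tau> (j, \<kappa> j), 1:])"
    unfolding gpoly_def by (rule degree_prod_eq_sum_degree) auto
  also have "\<dots> = l k" using assms by (simp add: choices_def)
  finally show "degree (gpoly \<kappa> k) = l k" .
  show "lead_coeff (gpoly \<kappa> k) = 1" unfolding gpoly_def lead_coeff_prod by simp
qed

lemma poly_gpoly: "poly (gpoly \<kappa> k) t = (\<Prod>j\<in>{j\<in>J. fst (\<kappa> j) = k}. t - \<tau> (j, \<kappa> j))"
  by (simp add: gpoly_def poly_prod)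

lemma pt_0: "\<kappa> \<in> choices J \<Longrightarrow> k \<in> {1..r} \<Longrightarrow> pt \<kappa> (k, 0) = 1"
  using gpoly_degree by (simp add: pt_def)

lemma sum_pt:
  assumes "\<kappa> \<in> choices J" "k \<in> {1..r}"
  shows "(\<Sum>i=0..l k. t ^ (l k - i) * pt \<kappa> (k, i)) = poly (gpoly \<kappa> k) t"
proof -
  have "(\<Sum>i=0..l k. t ^ (l k - i) * pt \<kappa> (k, i)) = (\<Sum>m\<le>l k. coeff (gpoly \<kappa> k) m * t ^ m)"
    by (rule sum.reindex_bij_witness[of _ "\<lambda>m. l k - m" "\<lambda>i. l k - i"]) (auto simp: pt_def mult.commute)
  then show ?thesis using gpoly_degree[OF assms] by (simp add: poly_altdef)
qed

lemma slot_fst: "\<kappa> \<in> choices J \<Longrightarrow> j \<in> J \<Longrightarrow> \<kappa> j \<in> slots \<and> fst (\<kappa> j) \<in> {1..r}"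
proof -
  assume "\<kappa> \<in> choices J" "j \<in> J"
  then have "\<kappa> j \<in> slots" by (auto simp: choices_def)
  then show ?thesis by (auto simp: slots_def)
qed

lemma hyb_pt:
  assumes "\<kappa> \<in> choices J" "k \<in> {1..r}" shows "hyb 0 (pt \<kappa>) y (k, i) = pt \<kappa> (k, i)"
  using pt_0[OF assms] by (simp add: hyb_0)

lemma ev_form_cf:
  assumes "j \<in> J" and e: "comm_ring_hom e"
  shows "ev_form (\<lambda>g. e (cf g)) j (mono_ev h) =
    (\<Prod>ks\<in>slots. \<Sum>i=0..l (fst ks). e (\<tau> (j, ks)) ^ (l (fst ks) - i) * h (fst ks, i))"
proof -
  have "j \<noteq> j0" using assms by (simp add: J_def)
  then have "ev_form (\<lambda>g. e (cf g)) j (mono_ev h) = mp_eval e h (prodform (\<lambda>ks. \<tau> (j, ks)))"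
    by (intro ev_form_lookup e keys_prodform) (simp add: cf_def)
  then show ?thesis by (simp add: mp_eval_prodform[OF e])
qed

lemma ev_form_cf_j0: "ev_form cf j0 \<chi> = \<chi> basept"
proof -
  have "ev_form cf j0 \<chi> = (\<Sum>\<gamma>\<in>mh_expos r l d. if \<gamma> = basept then \<chi> basept else 0)"
    unfolding ev_form_def by (rule sum.cong) (auto simp: cf_def lookup_single when_def)
  then show ?thesis using basept_mh finite_mh_expos by simp
qed

lemma ev_form_cf_pt:
  assumes \<kappa>: "\<kappa> \<in> choices J" and j: "j \<in> J"
  shows "ev_form cf j (mono_ev (hyb 0 (pt \<kappa>) y)) = 0"
proof -
  have "ev_form cf j (mono_ev (hyb 0 (pt \<kappa>) y)) =
      (\<Prod>ks\<in>slots. \<Sum>i=0..l (fst ks). \<tau> (j, ks) ^ (l (fst ks) - i) * hyb 0 (pt \<kappa>) y (fst ks, i))"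
    using ev_form_cf[OF j comm_ring_hom_ident] by simp
  also have "\<dots> = (\<Prod>ks\<in>slots. poly (gpoly \<kappa> (fst ks)) (\<tau> (j, ks)))"
    using sum_pt[OF \<kappa>] hyb_pt[OF \<kappa>] by (intro prod.cong refl) (auto simp: slots_def)
  also have "\<dots> = 0"
  proof (rule prod_zero[OF finite_slots bexI[of _ "\<kappa> j"]])
    show "poly (gpoly \<kappa> (fst (\<kappa> j))) (\<tau> (j, \<kappa> j)) = 0"
      unfolding poly_gpoly using j finite_J by (intro prod_zero) auto
    show "\<kappa> j \<in> slots" using slot_fst[OF \<kappa> j] by simp
  qed
  finally show ?thesis .
qed

lemma ev_form_cf_j0_pt:
  assumes "\<kappa> \<in> choices J" shows "ev_form cf j0 (mono_ev (hyb 0 (pt \<kappa>) y)) = 1"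
  unfolding ev_form_cf_j0 using pt_0[OF assms] by (intro mono_ev_basept) (simp add: hyb_0)

text \<open>The point determines the polynomials \<open>gpoly\<close>, and their roots determine the
  choices, since all parameters are distinct.\<close>

lemma pt_inj:
  assumes \<kappa>: "\<kappa> \<in> choices J" "\<kappa>' \<in> choices J" and eq: "\<And>v. v \<in> aff_vars \<Longrightarrow> pt \<kappa> v = pt \<kappa>' v"
  shows "\<kappa> = \<kappa>'"
proof (rule PiE_ext)
  show "\<kappa> \<in> J \<rightarrow>\<^sub>E slots" "\<kappa>' \<in> J \<rightarrow>\<^sub>E slots" using \<kappa> by (auto simp: choices_def)
  fix j assume j: "j \<in> J"
  define k where "k = fst (\<kappa> j)"
  have k: "k \<in> {1..r}" using slot_fst[OF \<kappa>(1) j] by (simp add: k_def)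
  have "pt \<kappa> (k, i) = pt \<kappa>' (k, i)" if "i \<in> {0..l k}" for i
    using eq[of "(k, i)"] pt_0[OF \<kappa>(1) k] pt_0[OF \<kappa>(2) k] k that by (cases "i = 0") (auto simp: aff_vars_def)
  then have "poly (gpoly \<kappa> k) t = poly (gpoly \<kappa>' k) t" for t
    unfolding sum_pt[OF \<kappa>(1) k, symmetric] sum_pt[OF \<kappa>(2) k, symmetric] by (intro sum.cong) auto
  moreover have "poly (gpoly \<kappa> k) (\<tau> (j, \<kappa> j)) = 0"
    unfolding poly_gpoly using j finite_J by (intro prod_zero) (auto simp: k_def)
  ultimately have "(\<Prod>j'\<in>{j'\<in>J. fst (\<kappa>' j') = k}. \<tau> (j, \<kappa> j) - \<tau> (j', \<kappa>' j')) = 0"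
    by (simp flip: poly_gpoly)
  then obtain j' where j': "j' \<in> J" "\<tau> (j, \<kappa> j) = \<tau> (j', \<kappa>' j')" using finite_J by (auto simp: prod_zero_iff)
  have "(j, \<kappa> j) = (j', \<kappa>' j')"
    using inj_onD[OF inj j'(2)] j j' slot_fst[OF \<kappa>(1) j] slot_fst[OF \<kappa>(2) j'(1)] by (auto simp: J_def)
  then show "\<kappa> j = \<kappa>' j" by (metis Pair_inject)
qed

text \<open>Weighting the divided differences with the differences of the two points telescopes to
  the difference of the values of each form. That is \<open>0 - 0\<close>, or \<open>1 - 1\<close>
  for the form \<open>j0\<close>. As the points differ, this is a nontrivial relation between the
  rows.\<close>

lemma det_bmat_off_diag:
  assumes \<kappa>: "\<kappa> \<in> choices J" "\<kappa>' \<in> choices J" "\<kappa> \<noteq> \<kappa>'"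
  shows "det (bmat 0 cf (pt \<kappa>) (pt \<kappa>')) = 0"
proof -
  let ?B = "bmat 0 cf (pt \<kappa>) (pt \<kappa>')"
  let ?v = "vec (n + 1) (\<lambda>s. if s = 0 then 0 else pt \<kappa> (vs ! (s - 1)) - pt \<kappa>' (vs ! (s - 1)))"
  obtain u where u: "u \<in> aff_vars" "pt \<kappa> u \<noteq> pt \<kappa>' u" using pt_inj[OF \<kappa>(1,2)] \<kappa>(3) by blast
  then obtain s where s: "s < n" "vs ! s = u" using set_vs length_vs by (metis in_set_conv_nth)
  have "?v \<noteq> 0\<^sub>v (n + 1)"
  proof
    assume "?v = 0\<^sub>v (n + 1)"
    then have "?v $ Suc s = 0\<^sub>v (n + 1) $ Suc s" by (rule arg_cong)
    then show False using s u by simp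
  qed
  moreover have "transpose_mat ?B *\<^sub>v ?v = 0\<^sub>v (n + 1)"
  proof (rule eq_vecI)
    fix j assume "j < dim_vec (0\<^sub>v (n + 1) :: 'b vec)"
    then have j: "j < n + 1" by simp
    have "(transpose_mat ?B *\<^sub>v ?v) $ j = (\<Sum>s\<in>{0..<Suc n}. ?B $$ (s, j) * ?v $ s)"
      using j by (simp add: scalar_prod_def bmat_def)
    also have "\<dots> = (\<Sum>s<n. (pt \<kappa> (vs ! s) - pt \<kappa>' (vs ! s)) * ev_form cf j (dd s (pt \<kappa>) (pt \<kappa>')))"
      unfolding sum_nat_shift using j by (auto simp: bmat_def mult.commute intro!: sum.cong)
    also have "\<dots> = ev_form cf j (mono_ev (hyb 0 (pt \<kappa>) (pt \<kappa>'))) - ev_form cf j (mono_ev (hyb n (pt \<kappa>) (pt \<kappa>')))"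
      using ev_form_telescope[of n cf j "pt \<kappa>" "pt \<kappa>'"] by simp
    also have "ev_form cf j (mono_ev (hyb n (pt \<kappa>) (pt \<kappa>'))) = ev_form cf j (mono_ev (hyb 0 (pt \<kappa>') (pt \<kappa>')))"
    proof (rule ev_form_cong)
      fix \<gamma> assume \<gamma>: "\<gamma> \<in> mh_expos r l d"
      have "mono_ev (hyb n (pt \<kappa>) (pt \<kappa>')) \<gamma> = mono_ev (hyb 0 (pt \<kappa>') (pt \<kappa>')) \<gamma>"
      proof (rule mono_ev_cong)
        fix u assume "u \<in> Poly_Mapping.keys \<gamma>"
        then show "hyb n (pt \<kappa>) (pt \<kappa>') u = hyb 0 (pt \<kappa>') (pt \<kappa>') u"
          using keys_hom_var[OF \<gamma>, of u] hyb_n[of u "pt \<kappa>" "pt \<kappa>'"] by (cases "snd u = 0") (auto simp: hyb_0 hyb_def[of n])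
      qed
      then show "cf (j, \<gamma>) * mono_ev (hyb n (pt \<kappa>) (pt \<kappa>')) \<gamma> = cf (j, \<gamma>) * mono_ev (hyb 0 (pt \<kappa>') (pt \<kappa>')) \<gamma>" by simp
    qed
    also have "ev_form cf j (mono_ev (hyb 0 (pt \<kappa>) (pt \<kappa>'))) - ev_form cf j (mono_ev (hyb 0 (pt \<kappa>') (pt \<kappa>'))) = 0"
    proof (cases "j = j0")
      case True then show ?thesis using ev_form_cf_j0_pt \<kappa> by simp
    next
      case False
      then have "j \<in> J" using j by (auto simp: J_def)
      then show ?thesis using ev_form_cf_pt \<kappa> by simp
    qed
    finally show "(transpose_mat ?B *\<^sub>v ?v) $ j = 0\<^sub>v (n + 1) $ j" using j by simp
  qed (simp add: bmat_def)
  ultimately have "det (transpose_mat ?B) = 0"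
    using bmat_carrier[of 0 cf "pt \<kappa>" "pt \<kappa>'"]
    by (subst det_0_iff_vec_prod_zero[of _ "n + 1"]) (auto intro!: exI[of _ ?v] simp del: Suc_eq_plus1)
  then show ?thesis using det_transpose[OF bmat_carrier] by metis
qed

text \<open>In the product rule only the summand survives in which the factor
  \<open>\<kappa> j\<close>, which vanishes at the point, is differentiated.\<close>

lemma ev_form_cf_dd_diag:
  assumes \<kappa>: "\<kappa> \<in> choices J" and j: "j \<in> J" and s: "s < n"
  shows "ev_form cf j (dd s (pt \<kappa>) (pt \<kappa>)) =
    (if fst (vs ! s) = fst (\<kappa> j) then \<tau> (j, \<kappa> j) ^ (l (fst (\<kappa> j)) - snd (vs ! s)) else 0) *
    (\<Prod>ks\<in>slots - {\<kappa> j}. poly (gpoly \<kappa> (fst ks)) (\<tau> (j, ks)))"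
proof -
  let ?v = "vs ! s"
  let ?h = "\<lambda>u. if u = ?v then [:pt \<kappa> u, 1:] else [:hyb 0 (pt \<kappa>) (pt \<kappa>) u:]"
  let ?a = "\<lambda>ks. if fst ?v = fst ks then \<tau> (j, ks) ^ (l (fst ks) - snd ?v) else 0"
  have v: "?v \<in> aff_vars" by (rule vs_nth_aff[OF s])
  have "ev_form cf j (dd s (pt \<kappa>) (pt \<kappa>)) = coeff (ev_form (\<lambda>g. [:cf g:]) j (mono_ev ?h)) 1"
    by (simp add: ev_form_def dd_diag_coeff[OF s] coeff_sum)
  also have "ev_form (\<lambda>g. [:cf g:]) j (mono_ev ?h) =
      (\<Prod>ks\<in>slots. \<Sum>i=0..l (fst ks). [:\<tau> (j, ks):] ^ (l (fst ks) - i) * ?h (fst ks, i))"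
    by (rule ev_form_cf[OF j comm_ring_hom_const_poly])
  \<comment> \<open>Each linear factor becomes its value plus its slope times the
    indeterminate.\<close>
  also have "\<dots> = (\<Prod>ks\<in>slots. [:poly (gpoly \<kappa> (fst ks)) (\<tau> (j, ks)), ?a ks:])"
  proof (intro prod.cong refl)
    fix ks assume ks: "ks \<in> slots"
    then have k: "fst ks \<in> {1..r}" by (auto simp: slots_def)
    let ?t = "\<tau> (j, ks)" let ?k = "fst ks"
    interpret c: comm_ring_hom "\<lambda>c::'b. [:c:]" by (rule comm_ring_hom_const_poly)
    have "[:?t:] ^ (l ?k - i) * ?h (?k, i) = [:?t ^ (l ?k - i) * pt \<kappa> (?k, i):] + (if (?k, i) = ?v then monom (?t ^ (l ?k - i)) 1 else 0)" for i
      using hyb_pt[OF \<kappa> k, of "pt \<kappa>" i] by (auto simp: c.hom_power[symmetric] monom_altdef)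
    then have "(\<Sum>i=0..l ?k. [:?t:] ^ (l ?k - i) * ?h (?k, i)) =
        [:\<Sum>i=0..l ?k. ?t ^ (l ?k - i) * pt \<kappa> (?k, i):] + (\<Sum>i=0..l ?k. if (?k, i) = ?v then monom (?t ^ (l ?k - i)) 1 else 0)"
      by (simp add: sum.distrib c.hom_sum)
    also have "(\<Sum>i=0..l ?k. if (?k, i) = ?v then monom (?t ^ (l ?k - i)) 1 else 0) = monom (?a ks) 1"
    proof (cases "fst ?v = ?k")
      case True
      then have "(\<Sum>i=0..l ?k. if (?k, i) = ?v then monom (?t ^ (l ?k - i)) 1 else 0) =
          (\<Sum>i=0..l ?k. if i = snd ?v then monom (?t ^ (l ?k - snd ?v)) 1 else 0)"
        by (intro sum.cong refl) (auto simp: prod_eq_iff)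
      also have "\<dots> = monom (?a ks) 1" using v True by (cases ?v) (auto simp: aff_vars_def)
      finally show ?thesis .
    next
      case False
      then have "(\<Sum>i=0..l ?k. if (?k, i) = ?v then monom (?t ^ (l ?k - i)) 1 else 0) = 0"
        by (intro sum.neutral) (auto simp: prod_eq_iff)
      then show ?thesis using False by simp
    qed
    finally show "(\<Sum>i=0..l ?k. [:?t:] ^ (l ?k - i) * ?h (?k, i)) = [:poly (gpoly \<kappa> ?k) ?t, ?a ks:]"
      by (simp add: sum_pt[OF \<kappa> k] monom_altdef)
  qed
  also have "coeff \<dots> 1 = ?a (\<kappa> j) * (\<Prod>ks\<in>slots - {\<kappa> j}. poly (gpoly \<kappa> (fst ks)) (\<tau> (j, ks)))"
  proof -
    have z: "poly (gpoly \<kappa> (fst (\<kappa> j))) (\<tau> (j, \<kappa> j)) = 0"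
      unfolding poly_gpoly using j finite_J by (intro prod_zero) auto
    have "coeff (\<Prod>ks\<in>slots - {\<kappa> j}. [:poly (gpoly \<kappa> (fst ks)) (\<tau> (j, ks)), ?a ks:]) 0 =
        (\<Prod>ks\<in>slots - {\<kappa> j}. poly (gpoly \<kappa> (fst ks)) (\<tau> (j, ks)))"
      by (simp add: poly_0_coeff_0[symmetric] poly_prod)
    then show ?thesis using slot_fst[OF \<kappa> j] z
      by (subst prod.remove[OF finite_slots, of "\<kappa> j"]) (auto simp: coeff_mult)
  qed
  finally show ?thesis by (simp add: eq_commute)
qed

context
  fixes G :: "'b set"
  assumes G1: "1 \<in> G" and G_mult: "\<And>a b. a \<in> G \<Longrightarrow> b \<in> G \<Longrightarrow> a * b \<in> G"
    and G_diff: "\<And>a b. a \<in> J \<times> slots \<Longrightarrow> b \<in> J \<times> slots \<Longrightarrow> a \<noteq> b \<Longrightarrow> \<tau> a - \<tau> b \<in> G"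
begin

text \<open>\<open>G\<close> abstracts the property of being nonzero. It will be the nonzero
  elements of a field, or the integer polynomials not divisible by a fixed prime. In both cases the
  complement is an ideal, so it is enough to find a multiple that lies in \<open>G\<close>.\<close>

lemma G_prod: "(\<And>i. i \<in> I \<Longrightarrow> f i \<in> G) \<Longrightarrow> prod f I \<in> G"
  by (induction I rule: infinite_finite_induct) (auto intro: G1 G_mult)

text \<open>The matrix of Lagrange polynomials inverts the Jacobian up to a product of differences.\<close>

lemma det_bmat_diag:
  assumes \<kappa>: "\<kappa> \<in> choices J"
  shows "\<exists>w. w * det (bmat 0 cf (pt \<kappa>) (pt \<kappa>)) \<in> G"
proof -
  let ?B = "bmat 0 cf (pt \<kappa>) (pt \<kappa>)"
  \<comment> \<open>With the root of form \<open>j\<close> left out, \<open>Q j\<close> vanishes at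
    the parameters chosen by the other forms in the same group. Its degree is below
    \<open>l k\<close>, so its coefficients fit the \<open>l k\<close> affine coordinates;
    coordinate 0 has no row in the Jacobian.\<close>
  define Q where "Q j = (\<Prod>j'\<in>{j'\<in>J. fst (\<kappa> j') = fst (\<kappa> j)} - {j}. [:- \<tau> (j', \<kappa> j'), 1:])" for j
  define W where "W = mat (n + 1) (n + 1) (\<lambda>(j, s). if j = j0 then (if s = 0 then 1 else 0)
     else if s = 0 then 0 else if fst (vs ! (s - 1)) = fst (\<kappa> j) then coeff (Q j) (l (fst (\<kappa> j)) - snd (vs ! (s - 1))) else 0)"
  define g where "g j = (\<Prod>ks\<in>slots - {\<kappa> j}. poly (gpoly \<kappa> (fst ks)) (\<tau> (j, ks)))" for j
  have W: "W \<in> carrier_mat (n + 1) (n + 1)" by (simp add: W_def)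
  have degQ: "degree (Q j) < l (fst (\<kappa> j))" if j: "j \<in> J" for j
  proof -
    have "degree (Q j) = card ({j'\<in>J. fst (\<kappa> j') = fst (\<kappa> j)} - {j})"
      unfolding Q_def by (subst degree_prod_eq_sum_degree) auto
    also have "\<dots> = l (fst (\<kappa> j)) - 1" using j \<kappa> slot_fst[OF \<kappa> j] by (subst card_Diff_singleton) (auto simp: choices_def)
    finally show ?thesis using l_pos slot_fst[OF \<kappa> j] by (simp add: less_imp_diff_less)
  qed
  have polyQ: "poly (Q j) t = (\<Prod>j'\<in>{j'\<in>J. fst (\<kappa> j') = fst (\<kappa> j)} - {j}. t - \<tau> (j', \<kappa> j'))" for j t
    by (simp add: Q_def poly_prod)
  have col: "?B $$ (0, j) = (if j = j0 then 1 else 0)" if "j < n + 1" for j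
    using that ev_form_cf_pt[OF \<kappa>, of j] ev_form_cf_j0_pt[OF \<kappa>] by (auto simp: bmat_def J_def)
  have rest: "?B $$ (Suc s, j) = (if j = j0 then 0 else
      (if fst (vs ! s) = fst (\<kappa> j) then \<tau> (j, \<kappa> j) ^ (l (fst (\<kappa> j)) - snd (vs ! s)) else 0) * g j)"
    if sj: "s < n" "j < n + 1" for s j
  proof (cases "j = j0")
    case True
    have "snd (vs ! s) \<noteq> 0" using vs_nth_aff[OF sj(1)] by (auto simp: aff_vars_def)
    then have "Poly_Mapping.lookup basept (vs ! s) = 0" by (cases "vs ! s") (simp add: lookup_basept)
    then show ?thesis using True sj by (simp add: bmat_def ev_form_cf_j0 dd_def)
  next
    case False
    then have "j \<in> J" using sj by (auto simp: J_def)
    then show ?thesis using False sj ev_form_cf_dd_diag[OF \<kappa> _ sj(1)] by (simp add: bmat_def g_def)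
  qed
  have WB: "(W * ?B) $$ (j', j) = (if j' = j then (if j = j0 then 1 else poly (Q j) (\<tau> (j, \<kappa> j)) * g j) else 0)"
    if jj: "j' < n + 1" "j < n + 1" for j' j
  proof -
    have "(W * ?B) $$ (j', j) = (\<Sum>s\<in>{0..<Suc n}. W $$ (j', s) * ?B $$ (s, j))"
      using jj by (simp add: W_def bmat_def scalar_prod_def)
    also have "\<dots> = W $$ (j', 0) * ?B $$ (0, j) + (\<Sum>s<n. W $$ (j', Suc s) * ?B $$ (Suc s, j))"
      by (rule sum_nat_shift)
    finally have eq: "(W * ?B) $$ (j', j) = W $$ (j', 0) * ?B $$ (0, j) + (\<Sum>s<n. W $$ (j', Suc s) * ?B $$ (Suc s, j))" .
    show ?thesis
    proof (cases "j' = j0")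
      case True
      then show ?thesis unfolding eq using jj col[OF jj(2)] by (simp add: W_def)
    next
      case False
      then have j': "j' \<in> J" using jj by (auto simp: J_def)
      have W0: "W $$ (j', 0) = 0" using False jj by (simp add: W_def)
      show ?thesis
      proof (cases "j = j0")
        case True
        then show ?thesis unfolding eq W0 using False jj rest by simp
      next
        case jn: False
        then have j: "j \<in> J" using jj by (auto simp: J_def)
        let ?k = "fst (\<kappa> j')"
        have k: "?k \<in> {1..r}" using slot_fst[OF \<kappa> j'] by simp
        have "(\<Sum>s<n. W $$ (j', Suc s) * ?B $$ (Suc s, j)) =
            (\<Sum>s<n. if fst (vs ! s) = ?k \<and> fst (vs ! s) = fst (\<kappa> j) then coeff (Q j') (l ?k - snd (vs ! s)) * \<tau> (j, \<kappa> j) ^ (l ?k - snd (vs ! s)) * g j else 0)"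
          using jj False jn rest by (intro sum.cong refl) (auto simp: W_def)
        also have "\<dots> = (\<Sum>v\<in>aff_vars. if fst v = ?k \<and> fst v = fst (\<kappa> j) then coeff (Q j') (l ?k - snd v) * \<tau> (j, \<kappa> j) ^ (l ?k - snd v) * g j else 0)"
          using bij_betw_nth[OF distinct_vs refl refl] length_vs set_vs
          by (intro sum.reindex_bij_betw) (simp add: atLeast0LessThan)
        also have "\<dots> = (if ?k = fst (\<kappa> j) then poly (Q j') (\<tau> (j, \<kappa> j)) * g j else 0)"
        proof (cases "?k = fst (\<kappa> j)")
          case True
          have "(\<Sum>v\<in>aff_vars. if fst v = ?k \<and> fst v = fst (\<kappa> j) then coeff (Q j') (l ?k - snd v) * \<tau> (j, \<kappa> j) ^ (l ?k - snd v) * g j else 0)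
              = (\<Sum>v\<in>grp ?k. coeff (Q j') (l ?k - snd v) * \<tau> (j, \<kappa> j) ^ (l ?k - snd v) * g j)"
            using k True by (intro sum.mono_neutral_cong_right) (auto simp: aff_vars_grp, auto simp: aff_vars_def grp_def)
          also have "\<dots> = (\<Sum>i=1..l ?k. coeff (Q j') (l ?k - i) * \<tau> (j, \<kappa> j) ^ (l ?k - i)) * g j"
            unfolding sum_grp by (simp add: sum_distrib_right)
          also have "(\<Sum>i=1..l ?k. coeff (Q j') (l ?k - i) * \<tau> (j, \<kappa> j) ^ (l ?k - i)) = (\<Sum>m<l ?k. coeff (Q j') m * \<tau> (j, \<kappa> j) ^ m)"
            by (rule sum.reindex_bij_witness[of _ "\<lambda>m. l ?k - m" "\<lambda>i. l ?k - i"]) auto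
          also have "\<dots> = poly (Q j') (\<tau> (j, \<kappa> j))"
            unfolding poly_altdef using degQ[OF j'] by (intro sum.mono_neutral_right) (auto simp: coeff_eq_0)
          finally show ?thesis using True by simp
        qed (auto intro: sum.neutral)
        finally have s: "(W * ?B) $$ (j', j) = (if ?k = fst (\<kappa> j) then poly (Q j') (\<tau> (j, \<kappa> j)) * g j else 0)"
          unfolding eq W0 by simp
        have "poly (Q j') (\<tau> (j, \<kappa> j)) = 0" if "?k = fst (\<kappa> j)" "j' \<noteq> j"
          unfolding polyQ using j that finite_J by (intro prod_zero) auto
        then show ?thesis using s jn by auto
      qed
    qed
  qed
  have "det W * det ?B = det (W * ?B)" using det_mult[OF W bmat_carrier] by simp
  also have "\<dots> = (\<Prod>j\<in>{0..<n+1}. (W * ?B) $$ (j, j))"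
    using W bmat_carrier[of 0 cf "pt \<kappa>" "pt \<kappa>"] by (intro det_diagonal_mat) (auto simp: WB simp del: index_mult_mat)
  also have "\<dots> \<in> G"
  proof (rule G_prod)
    fix j assume "j \<in> {0..<n+1}"
    then have jn: "j < n + 1" by simp
    show "(W * ?B) $$ (j, j) \<in> G"
    proof (cases "j = j0")
      case True then show ?thesis using WB[OF jn jn] G1 by simp
    next
      case False
      then have j: "j \<in> J" using jn by (auto simp: J_def)
      have "poly (Q j) (\<tau> (j, \<kappa> j)) \<in> G" unfolding polyQ
        using j slot_fst[OF \<kappa>] by (intro G_prod G_diff) auto
      moreover have "g j \<in> G" unfolding g_def poly_gpoly
        using j slot_fst[OF \<kappa>] by (intro G_prod G_diff) auto
      ultimately show ?thesis using WB[OF jn jn] False G_mult by simp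
    qed
  qed
  finally show ?thesis by blast
qed

end

end

locale bez_split = split_system r n l d \<pi> j0 \<tau> + bez_square r n l d \<pi> \<alpha>s \<beta>s
  for r n :: nat and l d \<pi> :: "nat \<Rightarrow> nat" and j0 :: nat and \<tau> :: "nat \<times> nat \<times> nat \<Rightarrow> 'b::idom"
    and \<alpha>s \<beta>s :: "expo list" +
  assumes card_choices: "card (choices J) = length \<alpha>s"
begin

lemma finite_choices: "finite (choices J)"
  by (rule finite_subset[of _ "J \<rightarrow>\<^sub>E slots"]) (auto simp: choices_def finite_J finite_slots intro!: finite_PiE)

text \<open>Evaluating the Bezoutian at pairs of the \<open>N\<close> common zeros of the forms other than the \<open>j0\<close>-th one
  diagonalizes the Bezout matrix.\<close>

lemma D_multiple_in:
  fixes \<phi> :: "coef_ring \<Rightarrow> 'b"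
  assumes \<phi>: "comm_ring_hom \<phi>" "\<And>g. \<phi> (Var g) = cf g"
    and G1: "1 \<in> G" and G_mult: "\<And>a b. a \<in> G \<Longrightarrow> b \<in> G \<Longrightarrow> a * b \<in> G"
    and G_diff: "\<And>a b. a \<in> J \<times> slots \<Longrightarrow> b \<in> J \<times> slots \<Longrightarrow> a \<noteq> b \<Longrightarrow> \<tau> a - \<tau> b \<in> G"
  shows "\<exists>u. u * \<phi> D \<in> G"
proof -
  obtain \<kappa>s where \<kappa>s: "distinct \<kappa>s" "set \<kappa>s = choices J" using finite_distinct_list[OF finite_choices] by blast
  have len: "length \<kappa>s = N" using \<kappa>s card_choices distinct_card by metis
  have \<kappa>: "\<kappa>s ! a \<in> choices J" if "a < N" for a using that \<kappa>s len nth_mem by metis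
  define B where "B = mat N N (\<lambda>(i, j). \<phi> (Poly_Mapping.lookup bez (\<alpha>s ! i, \<beta>s ! j)))"
  define X where "X = mat N N (\<lambda>(a, i). mono_ev (pt (\<kappa>s ! a)) (\<alpha>s ! i))"
  define Y where "Y = mat N N (\<lambda>(j, a). mono_ev (pt (\<kappa>s ! a)) (\<beta>s ! j))"
  have car: "B \<in> carrier_mat N N" "X \<in> carrier_mat N N" "Y \<in> carrier_mat N N" by (auto simp: B_def X_def Y_def)
  have cfe: "(\<lambda>g. \<phi> (Var g)) = cf" using \<phi>(2) by auto
  have ent: "(X * (B * Y)) $$ (a, a') = (-1) ^ n * det (bmat 0 cf (pt (\<kappa>s ! a)) (pt (\<kappa>s ! a')))"
    if "a < N" "a' < N" for a a'
  proof -
    have BY: "(B * Y) $$ (i, a') = (\<Sum>j<N. \<phi> (Poly_Mapping.lookup bez (\<alpha>s ! i, \<beta>s ! j)) * mono_ev (pt (\<kappa>s ! a')) (\<beta>s ! j))" if "i < N" for i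
      using that \<open>a' < N\<close> by (simp add: B_def Y_def scalar_prod_def atLeast0LessThan)
    have "(X * (B * Y)) $$ (a, a') = (\<Sum>i<N. mono_ev (pt (\<kappa>s ! a)) (\<alpha>s ! i) * (B * Y) $$ (i, a'))"
      using that car by (simp add: X_def scalar_prod_def atLeast0LessThan del: index_mult_mat(1)) (auto intro!: sum.cong simp: scalar_prod_def)
    also have "\<dots> = (\<Sum>i<N. \<Sum>j<N. \<phi> (Poly_Mapping.lookup bez (\<alpha>s ! i, \<beta>s ! j)) *
        (mono_ev (pt (\<kappa>s ! a)) (\<alpha>s ! i) * mono_ev (pt (\<kappa>s ! a')) (\<beta>s ! j)))"
      by (intro sum.cong refl) (simp add: BY sum_distrib_left mult_ac)
    also have "\<dots> = (-1) ^ n * det (bmat 0 cf (pt (\<kappa>s ! a)) (pt (\<kappa>s ! a')))"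
      using det_bmat_eq_sum[OF \<phi>(1), of "pt (\<kappa>s ! a)" "pt (\<kappa>s ! a')"] by (simp add: sum_rows sum_cols cfe)
    finally show ?thesis .
  qed
  have "det X * (det B * det Y) = det (X * (B * Y))"
    using car by (subst det_mult[of _ N]) (auto simp: det_mult[of B N Y])
  also have "\<dots> = (\<Prod>a\<in>{0..<N}. (X * (B * Y)) $$ (a, a))"
  proof (rule det_diagonal_mat)
    show "X * (B * Y) \<in> carrier_mat N N" using car by auto
    fix a a' assume a: "a < N" "a' < N" "a \<noteq> a'"
    then have "\<kappa>s ! a \<noteq> \<kappa>s ! a'" using \<kappa>s(1) len by (simp add: nth_eq_iff_index_eq)
    then show "(X * (B * Y)) $$ (a, a') = 0"
      unfolding ent[OF a(1,2)] using det_bmat_off_diag \<kappa> a by simp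
  qed
  also have "\<dots> = (\<Prod>a\<in>{0..<N}. (-1) ^ n * det (bmat 0 cf (pt (\<kappa>s ! a)) (pt (\<kappa>s ! a))))"
    by (intro prod.cong refl ent) auto
  finally have eq: "det X * (det B * det Y) = (\<Prod>a\<in>{0..<N}. (-1) ^ n * det (bmat 0 cf (pt (\<kappa>s ! a)) (pt (\<kappa>s ! a))))" .
  have "\<exists>w. w * det (bmat 0 cf (pt (\<kappa>s ! a)) (pt (\<kappa>s ! a))) \<in> G" if "a < N" for a
    by (rule det_bmat_diag[OF G1 G_mult G_diff \<kappa>[OF that]])
  then obtain w where w: "\<And>a. a < N \<Longrightarrow> w a * det (bmat 0 cf (pt (\<kappa>s ! a)) (pt (\<kappa>s ! a))) \<in> G" by metis
  \<comment> \<open>\<open>G\<close> need not be closed under negation, so the sign of the Bezoutian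
    is cancelled by a second one in the multiplier.\<close>
  have sq: "(-1) ^ n * (-1) ^ n = (1 :: 'b)" by (simp flip: power_add)
  have "(\<Prod>a\<in>{0..<N}. (-1) ^ n * w a) * (det X * (det B * det Y)) =
      (\<Prod>a\<in>{0..<N}. ((-1) ^ n * (-1) ^ n) * (w a * det (bmat 0 cf (pt (\<kappa>s ! a)) (pt (\<kappa>s ! a)))))"
    unfolding eq prod.distrib[symmetric] by (intro prod.cong refl) (simp only: mult_ac)
  also have "\<dots> \<in> G" unfolding sq using w by (intro G_prod[OF G1 G_mult G_diff]) auto
  finally have "((\<Prod>a\<in>{0..<N}. (-1) ^ n * w a) * det X * det Y) * \<phi> D \<in> G"
    unfolding hom_D[OF \<phi>(1)] B_def[symmetric] by (simp only: mult_ac)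
  then show ?thesis by blast
qed

end

section \<open>Counting monomials and common zeros\<close>

text \<open>The multinomial coefficient as a product of binomial coefficients, with denominators
  cleared. For the element of largest \<open>f\<close> the inner sum runs over everything; removing
  it leaves the other inner sums unchanged.\<close>

lemma prod_choose_ranked:
  fixes f :: "nat \<Rightarrow> int" and l :: "nat \<Rightarrow> nat"
  assumes "finite K" "inj_on f K"
  shows "(\<Prod>k\<in>K. (\<Sum>j\<in>{j\<in>K. f j \<le> f k}. l j) choose l k) * (\<Prod>k\<in>K. fact (l k)) = fact (\<Sum>k\<in>K. l k)"
  using assms
proof (induction K rule: finite_ranking_induct[where f=f])
  case (insert x S)
  show ?case
  proof (cases "x \<in> S")
    case True
    then have "insert x S = S" by auto
    then show ?thesis using insert by simp
  next
    case x: False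
    have lt: "f y < f x" if "y \<in> S" for y
      using insert(2)[OF that] inj_onD[OF insert.prems, of y x] that x by (cases "f y = f x") auto
    have "{j \<in> insert x S. f j \<le> f x} = insert x S" using insert(2) by auto
    moreover have "{j \<in> insert x S. f j \<le> f k} = {j \<in> S. f j \<le> f k}" if "k \<in> S" for k
      using lt[OF that] by auto
    ultimately have "(\<Prod>k\<in>insert x S. (\<Sum>j\<in>{j\<in>insert x S. f j \<le> f k}. l j) choose l k) * (\<Prod>k\<in>insert x S. fact (l k)) =
        ((\<Sum>j\<in>insert x S. l j) choose l x) * fact (l x) *
        ((\<Prod>k\<in>S. (\<Sum>j\<in>{j\<in>S. f j \<le> f k}. l j) choose l k) * (\<Prod>k\<in>S. fact (l k)))"
      using x insert(1) by (simp add: mult_ac)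
    also have "\<dots> = ((l x + (\<Sum>j\<in>S. l j)) choose l x) * fact (l x) * fact (\<Sum>j\<in>S. l j)"
      using insert x by (simp add: inj_on_insert)
    also have "\<dots> = fact (l x + (\<Sum>j\<in>S. l j))"
      using binomial_fact_lemma[of "l x" "l x + (\<Sum>j\<in>S. l j)"] by (simp add: mult_ac)
    finally show ?thesis using x insert(1) by simp
  qed
qed simp

text \<open>Decide which \<open>l x\<close> elements of \<open>J\<close> use group \<open>x\<close>,
  pick one of the \<open>d x\<close> factors for each, and continue with the remaining elements and
  groups. The factorials stay on the left to avoid division.\<close>

lemma card_choices_aux:
  fixes l d :: "nat \<Rightarrow> nat" and J :: "nat set"
  assumes "finite K"
  shows "finite J \<Longrightarrow> card J = (\<Sum>k\<in>K. l k) \<Longrightarrow>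
    card {\<kappa> \<in> J \<rightarrow>\<^sub>E (SIGMA k:K. {..<d k}). \<forall>k\<in>K. card {j\<in>J. fst (\<kappa> j) = k} = l k} * (\<Prod>k\<in>K. fact (l k)) =
      fact (card J) * (\<Prod>k\<in>K. d k ^ l k)"
  using assms
proof (induction K arbitrary: J)
  case empty
  then have "J = {}" by simp
  then show ?case by simp
next
  case (insert x K J)
  let ?C = "\<lambda>J K. {\<kappa> \<in> J \<rightarrow>\<^sub>E (SIGMA k:K. {..<d k}). \<forall>k\<in>K. card {j\<in>J. fst (\<kappa> j) = k} = l k}"
  define As where "As = {A. A \<subseteq> J \<and> card A = l x}"
  have finAs: "finite As" unfolding As_def using insert.prems by simp
  define Z where "Z = (SIGMA A:As. (A \<rightarrow>\<^sub>E {..<d x}) \<times> ?C (J - A) K)"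
  \<comment> \<open>The three components are the set of elements using group \<open>x\<close>, their
    factors inside that group, and the choice on the rest; \<open>H\<close> glues them together
    again.\<close>
  define F where "F = (\<lambda>\<kappa>::nat \<Rightarrow> nat \<times> nat. let A = {j\<in>J. fst (\<kappa> j) = x} in (A, restrict (\<lambda>j. snd (\<kappa> j)) A, restrict \<kappa> (J - A)))"
  define H where "H = (\<lambda>(A, g, \<kappa>'). (\<lambda>j. if j \<in> A then (x, g j) else if j \<in> J then \<kappa>' j else undefined :: nat \<times> nat))"
  have "bij_betw F (?C J (insert x K)) Z"
  proof (rule bij_betw_byWitness[where f'=H])
    show "\<forall>\<kappa>\<in>?C J (insert x K). H (F \<kappa>) = \<kappa>"
      by (auto simp: F_def H_def Let_def fun_eq_iff PiE_def extensional_def prod_eq_iff)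
    show "\<forall>a'\<in>Z. F (H a') = a'"
    proof
      fix a' assume "a' \<in> Z"
      then obtain A g \<kappa>' where a': "a' = (A, g, \<kappa>')" "A \<subseteq> J" "g \<in> A \<rightarrow>\<^sub>E {..<d x}" "\<kappa>' \<in> ?C (J - A) K"
        by (auto simp: Z_def As_def)
      have nx: "fst (\<kappa>' j) \<noteq> x" if "j \<in> J - A" for j using a'(4) that insert.hyps by (auto dest!: PiE_mem)
      have A: "{j\<in>J. fst (H a' j) = x} = A" using a'(2) nx by (auto simp: a'(1) H_def)
      have "restrict (\<lambda>j. snd (H a' j)) A = g" using a'(3) by (auto simp: a'(1) H_def fun_eq_iff PiE_def extensional_def)
      moreover have "restrict (H a') (J - A) = \<kappa>'" using a'(4) by (auto simp: a'(1) H_def fun_eq_iff PiE_def extensional_def)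
      ultimately show "F (H a') = a'" unfolding F_def Let_def A by (simp add: a'(1))
    qed
    show "F ` ?C J (insert x K) \<subseteq> Z"
    proof (rule image_subsetI)
      fix \<kappa> assume \<kappa>: "\<kappa> \<in> ?C J (insert x K)"
      define A where "A = {j\<in>J. fst (\<kappa> j) = x}"
      have m: "\<kappa> j \<in> (SIGMA k:insert x K. {..<d k})" if "j \<in> J" for j using \<kappa> that by auto
      have "A \<in> As" using \<kappa> by (auto simp: As_def A_def)
      moreover have "restrict (\<lambda>j. snd (\<kappa> j)) A \<in> A \<rightarrow>\<^sub>E {..<d x}"
        using m by (fastforce simp: A_def)
      moreover have "restrict \<kappa> (J - A) \<in> ?C (J - A) K"
      proof (rule CollectI, rule conjI)
        have "\<kappa> j \<in> (SIGMA k:K. {..<d k})" if "j \<in> J - A" for j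
          using m[of j] that by (cases "\<kappa> j") (auto simp: A_def)
        then show "restrict \<kappa> (J - A) \<in> (J - A) \<rightarrow>\<^sub>E (SIGMA k:K. {..<d k})" by auto
        show "\<forall>k\<in>K. card {j \<in> J - A. fst (restrict \<kappa> (J - A) j) = k} = l k"
        proof
          fix k assume k: "k \<in> K"
          then have "{j \<in> J - A. fst (restrict \<kappa> (J - A) j) = k} = {j\<in>J. fst (\<kappa> j) = k}"
            using insert.hyps by (auto simp: A_def)
          then show "card {j \<in> J - A. fst (restrict \<kappa> (J - A) j) = k} = l k" using \<kappa> k by simp
        qed
      qed
      ultimately show "F \<kappa> \<in> Z" unfolding F_def Let_def A_def[symmetric] Z_def by simp
    qed
    show "H ` Z \<subseteq> ?C J (insert x K)"
    proof (rule image_subsetI)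
      fix a' assume "a' \<in> Z"
      then obtain A g \<kappa>' where a': "a' = (A, g, \<kappa>')" "A \<subseteq> J" "card A = l x" "g \<in> A \<rightarrow>\<^sub>E {..<d x}" "\<kappa>' \<in> ?C (J - A) K"
        by (auto simp: Z_def As_def)
      have m: "\<kappa>' j \<in> (SIGMA k:K. {..<d k})" if "j \<in> J - A" for j using a'(5) that by (auto dest!: PiE_mem)
      have nx: "fst (\<kappa>' j) \<noteq> x" if "j \<in> J - A" for j using m[OF that] insert.hyps by auto
      have A: "{j\<in>J. fst (H a' j) = x} = A" using a'(2) nx by (auto simp: a'(1) H_def)
      have B: "{j\<in>J. fst (H a' j) = k} = {j\<in>J - A. fst (\<kappa>' j) = k}" if "k \<in> K" for k
        using that insert.hyps a'(2) by (auto simp: a'(1) H_def)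
      have "H a' \<in> J \<rightarrow>\<^sub>E (SIGMA k:insert x K. {..<d k})"
      proof (rule PiE_I)
        fix j assume j: "j \<in> J"
        show "H a' j \<in> (SIGMA k:insert x K. {..<d k})"
        proof (cases "j \<in> A")
          case True
          then have "g j < d x" using a'(4) by auto
          then show ?thesis using True by (simp add: a'(1) H_def)
        next
          case False
          then show ?thesis using m[of j] j by (auto simp: a'(1) H_def)
        qed
      next
        fix j assume "j \<notin> J" then show "H a' j = undefined" using a'(2) by (auto simp: a'(1) H_def)
      qed
      then show "H a' \<in> ?C J (insert x K)" using A B a'(3,5) by auto
    qed
  qed
  then have "card (?C J (insert x K)) = card Z" by (rule bij_betw_same_card)
  also have "\<dots> = (\<Sum>A\<in>As. d x ^ l x * card (?C (J - A) K))"
  proof -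
    have "finite (?C (J - A) K)" for A
      by (rule finite_subset[of _ "(J - A) \<rightarrow>\<^sub>E (SIGMA k:K. {..<d k})"])
        (use insert in \<open>auto intro!: finite_PiE finite_SigmaI\<close>)
    moreover have "finite (A \<rightarrow>\<^sub>E {..<d x})" "card (A \<rightarrow>\<^sub>E {..<d x}) = d x ^ l x" if "A \<in> As" for A
      using that insert.prems finite_subset[of A J] by (auto simp: As_def card_PiE intro!: finite_PiE)
    ultimately show ?thesis unfolding Z_def using finAs
      by (subst card_SigmaI) (auto simp: card_cartesian_product)
  qed
  finally have c: "card (?C J (insert x K)) = (\<Sum>A\<in>As. d x ^ l x * card (?C (J - A) K))" .
  have cJ: "card J = l x + (\<Sum>k\<in>K. l k)" using insert by simp
  have IH: "card (?C (J - A) K) * (\<Prod>k\<in>K. fact (l k)) = fact (\<Sum>k\<in>K. l k) * (\<Prod>k\<in>K. d k ^ l k)" if "A \<in> As" for A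
  proof -
    have "card (J - A) = (\<Sum>k\<in>K. l k)" using that insert.prems cJ finite_subset[of A J] by (auto simp: As_def card_Diff_subset)
    then show ?thesis using insert.IH[of "J - A"] insert.prems by simp
  qed
  have "card (?C J (insert x K)) * (\<Prod>k\<in>insert x K. fact (l k)) =
      (\<Sum>A\<in>As. d x ^ l x * fact (l x) * (card (?C (J - A) K) * (\<Prod>k\<in>K. fact (l k))))"
    unfolding c using insert.hyps by (simp add: sum_distrib_right sum_distrib_left mult_ac)
  also have "\<dots> = (\<Sum>A\<in>As. d x ^ l x * fact (l x) * (fact (\<Sum>k\<in>K. l k) * (\<Prod>k\<in>K. d k ^ l k)))"
    by (intro sum.cong refl) (simp only: IH)
  also have "\<dots> = card As * (d x ^ l x * fact (l x) * (fact (\<Sum>k\<in>K. l k) * (\<Prod>k\<in>K. d k ^ l k)))"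
    by simp
  also have "card As = card J choose l x" unfolding As_def by (rule n_subsets[OF insert.prems(1)])
  also have "(card J choose l x) * (d x ^ l x * fact (l x) * (fact (\<Sum>k\<in>K. l k) * (\<Prod>k\<in>K. d k ^ l k))) =
      ((fact (l x) * fact (\<Sum>k\<in>K. l k)) * (card J choose l x)) * (d x ^ l x * (\<Prod>k\<in>K. d k ^ l k))"
    by (simp only: mult_ac)
  also have "(fact (l x) * fact (\<Sum>k\<in>K. l k)) * (card J choose l x) = fact (card J)"
    using binomial_fact_lemma[of "l x" "card J"] cJ by simp
  finally show ?case using insert.hyps by simp
qed

lemma lookup_Abs_poly_mapping_finite:
  assumes "finite A" "\<And>x. x \<notin> A \<Longrightarrow> f x = 0"
  shows "Poly_Mapping.lookup (Abs_poly_mapping f) = f"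
proof -
  have "{x. f x \<noteq> 0} \<subseteq> A" using assms(2) by auto
  then have "finite {x. f x \<noteq> 0}" using assms(1) finite_subset by blast
  then show ?thesis by simp
qed

definition comps :: "nat \<Rightarrow> nat \<Rightarrow> nat list set" where
  "comps a M = {xs. length xs = a + 1 \<and> sum_list xs = M}"

lemma card_comps: "card (comps a M) = (M + a) choose a"
proof -
  have "card (comps a M) = (M + (a + 1) - 1) choose M" unfolding comps_def by (rule card_length_sum_list)
  also have "\<dots> = (M + a) choose a" using binomial_symmetric[of M "M + a"] by simp
  finally show ?thesis .
qed

context multihom begin

lemma card_choices: "card J = n \<Longrightarrow> finite J \<Longrightarrow>
   card (choices J) * (\<Prod>k=1..r. fact (l k)) = fact n * (\<Prod>k=1..r. d k ^ l k)"
  using card_choices_aux[of "{1..r}" J l d] by (simp add: choices_def slots_def n_eq)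

text \<open>Stars and bars in each group: a slack entry, put first, turns the inequality for the
  degree into an equation.\<close>

lemma card_bez_index:
  assumes m: "\<And>k. k \<in> {1..r} \<Longrightarrow> m k \<ge> 0"
  shows "card (bez_index r l m) = (\<Prod>k=1..r. (nat (m k) + l k) choose l k)"
proof -
  let ?P = "PiE {1..r} (\<lambda>k. comps (l k) (nat (m k)))"
  define F where "F \<alpha> = (\<lambda>k\<in>{1..r}. (nat (m k) - (\<Sum>j=1..l k. Poly_Mapping.lookup \<alpha> (k, j))) #
      map (\<lambda>j. Poly_Mapping.lookup \<alpha> (k, j)) [1..<l k + 1])" for \<alpha> :: expo
  define H where "H xs = Abs_poly_mapping (\<lambda>(k, j). if (k, j) \<in> aff_vars then xs k ! j else 0)" for xs :: "nat \<Rightarrow> nat list"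
  have H: "Poly_Mapping.lookup (H xs) = (\<lambda>(k, j). if (k, j) \<in> aff_vars then xs k ! j else 0)" for xs
    unfolding H_def
  proof (rule lookup_Abs_poly_mapping_finite)
    show "finite aff_vars" by (simp add: aff_vars_def)
    fix v assume "v \<notin> aff_vars"
    then show "(case v of (k, j) \<Rightarrow> if (k, j) \<in> aff_vars then xs k ! j else 0) = 0" by (cases v) simp
  qed
  have sl: "(\<Sum>j=1..l k. f j) = sum_list (map f [1..<l k + 1])" for f :: "nat \<Rightarrow> nat" and k
    by (simp add: sum_list_distinct_conv_sum_set atLeastLessThanSuc_atLeastAtMost del: upt_Suc)
  have comps: "xs = (nat (m k) - (\<Sum>j=1..l k. xs ! j)) # map (\<lambda>j. xs ! j) [1..<l k + 1] \<and> (\<Sum>j=1..l k. xs ! j) \<le> nat (m k)"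
    if xs: "xs \<in> comps (l k) (nat (m k))" for xs k
  proof -
    obtain y ys where y: "xs = y # ys" "length ys = l k" "y + sum_list ys = nat (m k)"
      using xs unfolding comps_def by (cases xs) auto
    have ys: "map (\<lambda>j. xs ! j) [1..<l k + 1] = ys"
      by (rule nth_equalityI) (auto simp: y simp del: upt_Suc)
    then show ?thesis unfolding sl ys using y by simp
  qed
  have le: "(\<Sum>j=1..l k. Poly_Mapping.lookup \<alpha> (k, j)) \<le> nat (m k)" if "\<alpha> \<in> bez_index r l m" "k \<in> {1..r}" for \<alpha> k
  proof -
    have "int (\<Sum>j=1..l k. Poly_Mapping.lookup \<alpha> (k, j)) \<le> m k" using that unfolding bez_index_def by blast
    then show ?thesis by arith
  qed
  have "bij_betw F (bez_index r l m) ?P"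
  proof (rule bij_betw_byWitness[where f'=H])
    show "\<forall>\<alpha>\<in>bez_index r l m. H (F \<alpha>) = \<alpha>"
    proof
      fix \<alpha> assume \<alpha>: "\<alpha> \<in> bez_index r l m"
      have "Poly_Mapping.lookup (H (F \<alpha>)) (k, j) = Poly_Mapping.lookup \<alpha> (k, j)" for k j
      proof (cases "(k, j) \<in> aff_vars")
        case True
        then obtain j' where "j = Suc j'" by (cases j) (auto simp: aff_vars_def)
        then show ?thesis using True unfolding H by (auto simp: F_def aff_vars_def simp del: upt_Suc)
      next
        case False
        then have "(k, j) \<notin> Poly_Mapping.keys \<alpha>" using \<alpha> unfolding bez_index_def aff_vars_def by blast
        then show ?thesis using False unfolding H by (simp add: in_keys_iff)
      qed
      then show "H (F \<alpha>) = \<alpha>" by (intro poly_mapping_eqI) auto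
    qed
    show "\<forall>xs\<in>?P. F (H xs) = xs"
    proof
      fix xs assume xs: "xs \<in> ?P"
      show "F (H xs) = xs"
      proof
        fix k show "F (H xs) k = xs k"
        proof (cases "k \<in> {1..r}")
          case True
          have a: "Poly_Mapping.lookup (H xs) (k, j) = xs k ! j" if "j \<in> {1..l k}" for j
            using that True unfolding H by (auto simp: aff_vars_def)
          have "F (H xs) k = (nat (m k) - (\<Sum>j=1..l k. xs k ! j)) # map (\<lambda>j. xs k ! j) [1..<l k + 1]"
            using True a by (simp add: F_def del: upt_Suc)
          then show ?thesis using comps[of "xs k" k] xs True by (metis PiE_mem)
        next
          case False then show ?thesis using xs by (auto simp: F_def PiE_def extensional_def)
        qed
      qed
    qed
    show "F ` bez_index r l m \<subseteq> ?P"
    proof (rule image_subsetI)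
      fix \<alpha> assume \<alpha>: "\<alpha> \<in> bez_index r l m"
      show "F \<alpha> \<in> ?P"
        unfolding F_def
      proof (rule restrict_PiE_iff[THEN iffD2], rule ballI)
        fix k assume k: "k \<in> {1..r}"
        then show "(nat (m k) - (\<Sum>j=1..l k. Poly_Mapping.lookup \<alpha> (k, j))) #
            map (\<lambda>j. Poly_Mapping.lookup \<alpha> (k, j)) [1..<l k + 1] \<in> comps (l k) (nat (m k))"
          using le[OF \<alpha> k] sl[of "\<lambda>j. Poly_Mapping.lookup \<alpha> (k, j)" k] by (simp add: comps_def del: upt_Suc)
      qed
    qed
    show "H ` ?P \<subseteq> bez_index r l m"
    proof (rule image_subsetI)
      fix xs assume xs: "xs \<in> ?P"
      have "Poly_Mapping.keys (H xs) \<subseteq> (SIGMA i:{1..r}. {1..l i})"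
        by (auto simp: in_keys_iff H aff_vars_def split: if_splits)
      moreover have "int (\<Sum>j = 1..l i. Poly_Mapping.lookup (H xs) (i, j)) \<le> m i" if i: "i \<in> {1..r}" for i
      proof -
        have "(\<Sum>j = 1..l i. Poly_Mapping.lookup (H xs) (i, j)) = (\<Sum>j = 1..l i. xs i ! j)"
          using i by (intro sum.cong) (auto simp: H aff_vars_def)
        also have "\<dots> \<le> nat (m i)" using comps[of "xs i" i] xs i by (metis PiE_mem)
        finally show ?thesis using m[OF i] by linarith
      qed
      ultimately show "H xs \<in> bez_index r l m" unfolding bez_index_def by blast
    qed
  qed
  then have "card (bez_index r l m) = card ?P" by (rule bij_betw_same_card)
  also have "\<dots> = (\<Prod>k=1..r. card (comps (l k) (nat (m k))))" by (rule card_PiE) simp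
  finally show ?thesis by (simp add: card_comps)
qed

end

locale zero_defect = multihom +
  assumes defect_0: "\<And>k. k \<in> {1..r} \<Longrightarrow> defect l d k = 0"
begin

text \<open>If both are at least 2, then \<open>l k / d k\<close> is at most \<open>l k / 2\<close>,
  hence at most \<open>l k - 1\<close>, and the defect is positive.\<close>

lemma one_or_one: "k \<in> {1..r} \<Longrightarrow> l k = 1 \<or> d k = 1"
proof (rule ccontr)
  assume k: "k \<in> {1..r}" and "\<not> (l k = 1 \<or> d k = 1)"
  then have ld: "l k \<ge> 2" "d k \<ge> 2" using l_pos[OF k] d_pos[OF k] by auto
  have "\<lceil>real (l k) / real (d k)\<rceil> \<le> int (l k) - 1"
  proof (rule ceiling_le)
    have "real (l k) / real (d k) \<le> real (l k) / 2" using ld by (intro divide_left_mono) auto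
    also have "\<dots> \<le> real (l k) - 1" using ld by simp
    finally show "real (l k) / real (d k) \<le> real_of_int (int (l k) - 1)" by simp
  qed
  then show False using defect_0[OF k] by (simp add: defect_def)
qed

text \<open>The point where vanishing defects enter the count. A binomial coefficient does not scale
  like a power in general, but it does trivially for \<open>d k = 1\<close>, and it is linear for
  \<open>l k = 1\<close>.\<close>

lemma choose_scale: "k \<in> {1..r} \<Longrightarrow> (d k * S) choose l k = d k ^ l k * (S choose l k)"
  using one_or_one[of k] by auto

lemma prod_choose:
  "(\<Prod>k=1..r. (\<Sum>j | j \<in> {1..r} \<and> \<pi> j \<ge> \<pi> k. l j) choose l k) * (\<Prod>k=1..r. fact (l k)) = fact n"
  "(\<Prod>k=1..r. (\<Sum>j | j \<in> {1..r} \<and> dual_perm r \<pi> j \<ge> dual_perm r \<pi> k. l j) choose l k) * (\<Prod>k=1..r. fact (l k)) = fact n"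
proof -
  have inj: "inj_on \<pi> {1..r}" using perm by (rule permutes_inj_on)
  have 1: "(\<Prod>k=1..r. (\<Sum>j | j \<in> {1..r} \<and> f k \<le> f j. l j) choose l k) * (\<Prod>k=1..r. fact (l k)) = fact n"
    if "inj_on f {1..r}" for f :: "nat \<Rightarrow> nat"
  proof -
    \<comment> \<open>Degree vectors sum over larger values of the permutation, whereas the ranked
      product sums over smaller ones; hence the sign.\<close>
    have "inj_on (\<lambda>k. - int (f k)) {1..r}" by (rule inj_onI) (use inj_onD[OF that] in simp)
    from prod_choose_ranked[OF _ this, of l] show ?thesis by (simp add: n_eq)
  qed
  show "(\<Prod>k=1..r. (\<Sum>j | j \<in> {1..r} \<and> \<pi> j \<ge> \<pi> k. l j) choose l k) * (\<Prod>k=1..r. fact (l k)) = fact n" by (rule 1[OF inj])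
  have "inj_on (dual_perm r \<pi>) {1..r}"
  proof (rule inj_onI)
    fix x y assume xy: "x \<in> {1..r}" "y \<in> {1..r}" "dual_perm r \<pi> x = dual_perm r \<pi> y"
    have "\<pi> x \<in> {1..r}" "\<pi> y \<in> {1..r}" using xy permutes_in_image[OF perm] by blast+
    then have "\<pi> x = \<pi> y" using xy by (auto simp: dual_perm_def)
    then show "x = y" using inj xy by (auto dest: inj_onD)
  qed
  then show "(\<Prod>k=1..r. (\<Sum>j | j \<in> {1..r} \<and> dual_perm r \<pi> j \<ge> dual_perm r \<pi> k. l j) choose l k) * (\<Prod>k=1..r. fact (l k)) = fact n"
    by (rule 1)
qed

text \<open>Adding \<open>l k\<close> to the entry of the degree vector cancels its term
  \<open>- l k\<close> and leaves a multiple of \<open>d k\<close>, to which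
  \<open>choose_scale\<close> applies.\<close>

lemma card_bez_index_deg_vec:
  assumes nn: "\<And>k. k \<in> {1..r} \<Longrightarrow> deg_vec r l d \<rho> k \<ge> 0"
    and pc: "(\<Prod>k=1..r. (\<Sum>j | j \<in> {1..r} \<and> \<rho> j \<ge> \<rho> k. l j) choose l k) * (\<Prod>k=1..r. fact (l k)) = fact n"
  shows "card (bez_index r l (deg_vec r l d \<rho>)) * (\<Prod>k=1..r. fact (l k)) = fact n * (\<Prod>k=1..r. d k ^ l k)"
proof -
  have "nat (deg_vec r l d \<rho> k) + l k = d k * (\<Sum>j | j \<in> {1..r} \<and> \<rho> j \<ge> \<rho> k. l j)" if "k \<in> {1..r}" for k
  proof -
    have "int (nat (deg_vec r l d \<rho> k) + l k) = int (d k * (\<Sum>j | j \<in> {1..r} \<and> \<rho> j \<ge> \<rho> k. l j))"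
      using nn[OF that] by (simp add: deg_vec_def)
    then show ?thesis by (simp only: of_nat_eq_iff)
  qed
  then have "(\<Prod>k=1..r. (nat (deg_vec r l d \<rho> k) + l k) choose l k) =
      (\<Prod>k=1..r. d k ^ l k * ((\<Sum>j | j \<in> {1..r} \<and> \<rho> j \<ge> \<rho> k. l j) choose l k))"
    by (intro prod.cong refl) (simp only: choose_scale)
  moreover have "card (bez_index r l (deg_vec r l d \<rho>)) = (\<Prod>k=1..r. (nat (deg_vec r l d \<rho> k) + l k) choose l k)"
    by (rule card_bez_index) (rule nn)
  ultimately show ?thesis unfolding pc[symmetric] by (simp only: prod.distrib mult_ac)
qed

lemma card_bez:
  "card bez_rows * (\<Prod>k=1..r. fact (l k)) = fact n * (\<Prod>k=1..r. d k ^ l k)"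
  "card bez_cols * (\<Prod>k=1..r. fact (l k)) = fact n * (\<Prod>k=1..r. d k ^ l k)"
  unfolding bez_rows_def bez_cols_def
  by (rule card_bez_index_deg_vec[OF deg_vec_nonneg(2) prod_choose(2)] card_bez_index_deg_vec[OF deg_vec_nonneg(1) prod_choose(1)]; assumption)+

lemma prod_fact_pos: "(\<Prod>k=1..r. fact (l k) :: nat) > 0"
  by (intro prod_pos) auto

lemma card_bez_eq: "card bez_rows = card bez_cols"
  using card_bez prod_fact_pos by (metis mult_right_cancel less_numeral_extra(3))

lemma card_choices_eq: "card J = n \<Longrightarrow> finite J \<Longrightarrow> card (choices J) = card bez_rows"
  using card_choices[of J] card_bez(1) prod_fact_pos by (metis mult_right_cancel less_numeral_extra(3))

end

subsection \<open>The complex of cochains on tuples\<close>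

text \<open>The coboundary \<open>cech_d\<close> for one fixed exponent. The Cech complex is the
  direct sum of such complexes over all monomials.\<close>

definition lcech :: "('v list \<Rightarrow> 'k::comm_ring_1) \<Rightarrow> 'v list \<Rightarrow> 'k" where
  "lcech c t = (\<Sum>i<length t. (-1) ^ i * c (take i t @ drop (Suc i) t))"

lemma lcech_Nil [simp]: "lcech c [] = 0"
  by (simp add: lcech_def)

lemma lcech_Cons: "lcech c (x # t) = c t - lcech (\<lambda>s. c (x # s)) t"
proof -
  have "lcech c (x # t) = (\<Sum>i<Suc (length t). (-1) ^ i * c (take i (x # t) @ drop (Suc i) (x # t)))"
    by (simp add: lcech_def)
  also have "\<dots> = c t + (\<Sum>i<length t. - ((-1) ^ i * c (x # take i t @ drop (Suc i) t)))"
    by (subst sum.lessThan_Suc_shift) simp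
  finally show ?thesis by (simp add: lcech_def sum_negf)
qed

lemma lcech_diff: "lcech (\<lambda>s. a s - b s) t = lcech a t - lcech b t"
  by (simp add: lcech_def right_diff_distrib sum_subtractf)

lemma lcech_uminus: "lcech (\<lambda>s. - a s) t = - lcech a t"
  by (simp add: lcech_def sum_negf)

lemma lcech_cong:
  "(\<And>s. set s \<subseteq> set t \<Longrightarrow> Suc (length s) = length t \<Longrightarrow> c s = c' s) \<Longrightarrow> lcech c t = lcech c' t"
  unfolding lcech_def
proof (intro sum.cong refl arg_cong2[where f="(*)"])
  fix i assume h: "\<And>s. set s \<subseteq> set t \<Longrightarrow> Suc (length s) = length t \<Longrightarrow> c s = c' s" and "i \<in> {..<length t}"
  then show "c (take i t @ drop (Suc i) t) = c' (take i t @ drop (Suc i) t)"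
    by (intro h) (auto dest: in_set_takeD in_set_dropD)
qed

lemma lcech_zero: "lcech (\<lambda>s. 0) t = 0"
  by (simp add: lcech_def)

lemma lcech_map: "lcech (\<lambda>s. f (map \<phi> s)) t = lcech f (map \<phi> t)"
  by (simp add: lcech_def take_map drop_map)

lemma lcech_lcech: "lcech (lcech c) t = 0"
proof (induction t arbitrary: c)
  case (Cons x t)
  have "lcech (lcech c) (x # t) = lcech c t - lcech (\<lambda>s. c s - lcech (\<lambda>u. c (x # u)) s) t"
    by (simp add: lcech_Cons)
  then show ?case using Cons.IH[of "\<lambda>u. c (x # u)"] by (simp add: lcech_diff)
qed simp

text \<open>The prism operator: the chain homotopy between the identity and the pullback along a vertex map.\<close>

primrec prism :: "('v \<Rightarrow> 'v) \<Rightarrow> 'v list \<Rightarrow> ('v list \<Rightarrow> 'k::comm_ring_1) \<Rightarrow> 'k" where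
  "prism \<phi> [] c = 0"
| "prism \<phi> (x # t) c = c (x # \<phi> x # map \<phi> t) - prism \<phi> t (\<lambda>s. c (x # s))"

lemma prism_diff: "prism \<phi> t (\<lambda>s. a s - b s) = prism \<phi> t a - prism \<phi> t b"
  by (induction t arbitrary: a b) simp_all

lemma prism_zero:
  "(\<And>s. set s \<subseteq> set t \<union> \<phi> ` set t \<Longrightarrow> length s = Suc (length t) \<Longrightarrow> c s = 0) \<Longrightarrow> prism \<phi> t c = 0"
proof (induction t arbitrary: c)
  case (Cons x t)
  have "prism \<phi> t (\<lambda>s. c (x # s)) = 0"
    by (rule Cons.IH, rule Cons.prems) auto
  moreover have "c (x # \<phi> x # map \<phi> t) = 0" by (rule Cons.prems) auto
  ultimately show ?case by simp
qed simp

lemma prism_homotopy: "lcech (\<lambda>s. prism \<phi> s c) t + prism \<phi> t (lcech c) = c (map \<phi> t) - c t"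
proof (induction t arbitrary: c)
  case (Cons x t)
  let ?cx = "\<lambda>s. c (x # s)"
  have 1: "lcech (\<lambda>s. prism \<phi> s c) (x # t) =
      prism \<phi> t c - (lcech (\<lambda>s. c (x # \<phi> x # map \<phi> s)) t - lcech (\<lambda>s. prism \<phi> s ?cx) t)"
    by (simp add: lcech_Cons lcech_diff)
  have 2: "prism \<phi> (x # t) (lcech c) = lcech c (x # \<phi> x # map \<phi> t) - (prism \<phi> t c - prism \<phi> t (lcech ?cx))"
    by (simp add: lcech_Cons prism_diff)
  have 3: "lcech (\<lambda>s. c (x # \<phi> x # map \<phi> s)) t = lcech (\<lambda>u. c (x # \<phi> x # u)) (map \<phi> t)"
    by (rule lcech_map)
  have 4: "lcech c (x # \<phi> x # map \<phi> t) = c (\<phi> x # map \<phi> t) - (c (x # map \<phi> t) - lcech (\<lambda>u. c (x # \<phi> x # u)) (map \<phi> t))"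
    by (simp add: lcech_Cons)
  have "lcech (\<lambda>s. prism \<phi> s c) (x # t) + prism \<phi> (x # t) (lcech c) =
      (lcech (\<lambda>s. prism \<phi> s ?cx) t + prism \<phi> t (lcech ?cx)) + c (\<phi> x # map \<phi> t) - c (x # map \<phi> t)"
    unfolding 1 2 3 4 by (simp add: algebra_simps)
  then show ?case unfolding Cons.IH[of ?cx] by simp
qed simp

text \<open>For \<open>N\<close> the set of variables with negative exponent, this is the condition
  that the monomial is a section over the intersection of the charts in \<open>t\<close>.\<close>

definition covers :: "(nat \<times> nat) set \<Rightarrow> (nat \<Rightarrow> nat) list \<Rightarrow> bool" where
  "covers N t \<longleftrightarrow> (\<forall>(i, j)\<in>N. \<exists>I\<in>set t. I i = j)"

text \<open>Exactness in degree \<open>p\<close> for functions supported on covering tuples. For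
  \<open>p = 0\<close> the function \<open>b\<close> lives on the empty tuple: the complex is
  augmented if \<open>N\<close> is empty, and otherwise \<open>b\<close> vanishes there because the
  empty tuple covers nothing.\<close>

definition exact_at :: "'k::field itself \<Rightarrow> (nat \<Rightarrow> nat) set \<Rightarrow> (nat \<times> nat) set \<Rightarrow> nat \<Rightarrow> bool" where
  "exact_at K X N p \<longleftrightarrow> (\<forall>c :: (nat \<Rightarrow> nat) list \<Rightarrow> 'k.
     (\<forall>t. set t \<subseteq> X \<and> length t = Suc p \<and> \<not> covers N t \<longrightarrow> c t = 0) \<and>
     (\<forall>t. set t \<subseteq> X \<and> length t = Suc (Suc p) \<longrightarrow> lcech c t = 0) \<longrightarrow>
     (\<exists>b. (\<forall>t. set t \<subseteq> X \<and> length t = p \<and> \<not> covers N t \<longrightarrow> b t = 0) \<and>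
          (\<forall>t. set t \<subseteq> X \<and> length t = Suc p \<longrightarrow> lcech b t = c t)))"

lemma exact_atD:
  fixes c :: "(nat \<Rightarrow> nat) list \<Rightarrow> 'k::field"
  assumes "exact_at (K :: 'k itself) X N p"
    and "\<And>t. set t \<subseteq> X \<Longrightarrow> length t = Suc p \<Longrightarrow> \<not> covers N t \<Longrightarrow> c t = 0"
    and "\<And>t. set t \<subseteq> X \<Longrightarrow> length t = Suc (Suc p) \<Longrightarrow> lcech c t = 0"
  obtains b where "\<And>t. set t \<subseteq> X \<Longrightarrow> length t = p \<Longrightarrow> \<not> covers N t \<Longrightarrow> b t = 0"
    "\<And>t. set t \<subseteq> X \<Longrightarrow> length t = Suc p \<Longrightarrow> lcech b t = c t"
proof -
  have "\<exists>b. (\<forall>t. set t \<subseteq> X \<and> length t = p \<and> \<not> covers N t \<longrightarrow> b t = 0) \<and>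
      (\<forall>t. set t \<subseteq> X \<and> length t = Suc p \<longrightarrow> lcech b t = c t)"
    by (rule assms(1)[unfolded exact_at_def, rule_format]) (use assms(2,3) in simp)
  then show ?thesis using that by blast
qed

lemma covers_alt: "covers N t \<longleftrightarrow> (\<forall>v\<in>N. \<exists>I\<in>set t. I (fst v) = snd v)"
  by (simp add: covers_def split_beta)

lemma covers_mono: "covers N s \<Longrightarrow> set s \<subseteq> set t \<Longrightarrow> covers N t"
  unfolding covers_alt by blast

lemma lcech_not_covers:
  assumes "\<And>s. set s \<subseteq> X \<Longrightarrow> Suc (length s) = length t \<Longrightarrow> \<not> covers N s \<Longrightarrow> b s = 0" "set t \<subseteq> X" "\<not> covers N t"
  shows "lcech b t = 0"
proof -
  have "lcech b t = lcech (\<lambda>s. 0) t"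
    using assms(1)[OF order_trans[OF _ assms(2)]] assms(3) covers_mono[of N _ t] by (intro lcech_cong) blast
  then show ?thesis by (simp add: lcech_zero)
qed

text \<open>Without support condition this is the cochain complex of a full simplex, contracted by
  prepending the vertex \<open>x0\<close>.\<close>

lemma exact_at_empty:
  assumes "x0 \<in> X" shows "exact_at K X {} p"
  unfolding exact_at_def
proof (intro allI impI, elim conjE)
  fix c :: "(nat \<Rightarrow> nat) list \<Rightarrow> 'a"
  assume c: "\<forall>t. set t \<subseteq> X \<and> length t = Suc (Suc p) \<longrightarrow> lcech c t = 0"
  have "lcech (\<lambda>s. c (x0 # s)) t = c t" if "set t \<subseteq> X" "length t = Suc p" for t
    using c[rule_format, of "x0 # t"] that assms by (simp add: lcech_Cons)
  then show "\<exists>b. (\<forall>t. set t \<subseteq> X \<and> length t = p \<and> \<not> covers {} t \<longrightarrow> b t = 0) \<and>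
          (\<forall>t. set t \<subseteq> X \<and> length t = Suc p \<longrightarrow> lcech b t = c t)"
    by (intro exI[of _ "\<lambda>s. c (x0 # s)"]) (auto simp: covers_def)
qed

text \<open>Some but not all exponents of group \<open>i\<close> are negative. Moving every vertex
  to the index \<open>j'\<close> in group \<open>i\<close> never helps to meet a condition of
  \<open>N\<close>, so the prism respects supports; after the move the condition \<open>j0\<close>
  fails, so the pullback is 0 and the prism is a contraction.\<close>

lemma exact_at_mixed:
  assumes X: "\<And>I. I \<in> X \<Longrightarrow> I(i := j') \<in> X" and N: "(i, j0) \<in> N" "(i, j') \<notin> N"
  shows "exact_at K X N p"
  unfolding exact_at_def
proof (intro allI impI, elim conjE)
  fix c :: "(nat \<Rightarrow> nat) list \<Rightarrow> 'a"
  assume c0: "\<forall>t. set t \<subseteq> X \<and> length t = Suc p \<and> \<not> covers N t \<longrightarrow> c t = 0"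
    and c: "\<forall>t. set t \<subseteq> X \<and> length t = Suc (Suc p) \<longrightarrow> lcech c t = 0"
  define \<phi> where "\<phi> = (\<lambda>I :: nat \<Rightarrow> nat. I(i := j'))"
  have \<phi>X: "\<phi> ` set t \<subseteq> X" if "set t \<subseteq> X" for t using X that by (auto simp: \<phi>_def)
  have b0: "prism \<phi> t c = 0" if t: "set t \<subseteq> X" "length t = p" "\<not> covers N t" for t
  proof (rule prism_zero)
    fix s assume s: "set s \<subseteq> set t \<union> \<phi> ` set t" "length s = Suc (length t)"
    obtain a b where ab: "(a, b) \<in> N" "\<And>I. I \<in> set t \<Longrightarrow> I a \<noteq> b" using t(3) by (auto simp: covers_def)
    have "\<phi> I a \<noteq> b" if "I \<in> set t" for I using ab(1) ab(2)[OF that] N by (auto simp: \<phi>_def)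
    then have "\<forall>I\<in>set s. I a \<noteq> b" using ab(2) s(1) by auto
    then have "\<not> covers N s" using ab(1) unfolding covers_alt by force
    moreover have "set s \<subseteq> X" using s t \<phi>X[of t] by blast
    ultimately show "c s = 0" using c0 s t by simp
  qed
  have b1: "lcech (\<lambda>s. - prism \<phi> s c) t = c t" if t: "set t \<subseteq> X" "length t = Suc p" for t
  proof -
    have "prism \<phi> t (lcech c) = 0"
    proof (rule prism_zero)
      fix s assume s: "set s \<subseteq> set t \<union> \<phi> ` set t" "length s = Suc (length t)"
      then have "set s \<subseteq> X" using t \<phi>X[of t] by blast
      then show "lcech c s = 0" using c s t by simp
    qed
    moreover have "c (map \<phi> t) = 0"
    proof -
      have "\<not> (\<exists>I\<in>set (map \<phi> t). I i = j0)" using N by (auto simp: \<phi>_def)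
      then have "\<not> covers N (map \<phi> t)" using N(1) unfolding covers_alt by force
      then show ?thesis using c0 t \<phi>X[of t] by simp
    qed
    ultimately show ?thesis using prism_homotopy[of \<phi> c t] by (simp add: lcech_uminus)
  qed
  show "\<exists>b. (\<forall>t. set t \<subseteq> X \<and> length t = p \<and> \<not> covers N t \<longrightarrow> b t = 0) \<and>
          (\<forall>t. set t \<subseteq> X \<and> length t = Suc p \<longrightarrow> lcech b t = c t)"
    using b0 b1 by (intro exI[of _ "\<lambda>s. - prism \<phi> s c"]) auto
qed

text \<open>The long exact sequence for adding the condition \<open>v\<close>: its cokernel lives on the vertices that violate it.\<close>

lemma exact_at_step:
  assumes ex: "\<And>p. exact_at K X N' p" and N: "N = insert (i, j) N'" and ne: "N' \<noteq> {}"
    and X': "X' = {I\<in>X. I i \<noteq> j}" and p: "p = 0 \<or> exact_at K X' N' (p - 1)"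
  shows "exact_at (K :: 'k::field itself) X N p"
  unfolding exact_at_def
proof (intro allI impI, elim conjE)
  fix c :: "(nat \<Rightarrow> nat) list \<Rightarrow> 'k"
  assume c0: "\<forall>t. set t \<subseteq> X \<and> length t = Suc p \<and> \<not> covers N t \<longrightarrow> c t = 0"
    and c: "\<forall>t. set t \<subseteq> X \<and> length t = Suc (Suc p) \<longrightarrow> lcech c t = 0"
  have cov: "covers N t \<longleftrightarrow> covers N' t \<and> \<not> set t \<subseteq> X'" if "set t \<subseteq> X" for t
    using that unfolding covers_def N X' by auto
  have c0': "c t = 0" if "set t \<subseteq> X" "length t = Suc p" "\<not> covers N' t" for t using c0 cov[OF that(1)] that by simp
  have c': "lcech c t = 0" if "set t \<subseteq> X" "length t = Suc (Suc p)" for t using c that by simp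
  obtain b where b0: "\<And>t. set t \<subseteq> X \<Longrightarrow> length t = p \<Longrightarrow> \<not> covers N' t \<Longrightarrow> b t = 0"
    and b: "\<And>t. set t \<subseteq> X \<Longrightarrow> length t = Suc p \<Longrightarrow> lcech b t = c t"
    using exact_atD[OF ex[of p], of c] c0' c' by blast
  \<comment> \<open>The primitive \<open>b\<close> found for \<open>N'\<close> must be made zero on
    tuples inside \<open>X'\<close>, as those do not cover \<open>N\<close>. There \<open>c\<close>
    is 0, so \<open>b\<close> is a cocycle on \<open>X'\<close>; a primitive \<open>g\<close> of it,
    extended by 0, gives the correction \<open>b - lcech g\<close>.\<close>
  have "\<exists>g. (\<forall>t. set t \<subseteq> X \<and> Suc (length t) = p \<and> \<not> covers N' t \<longrightarrow> g t = 0) \<and>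
      (\<forall>t. set t \<subseteq> X' \<and> length t = p \<longrightarrow> lcech g t = b t)"
  proof (cases p)
    case 0
    have "\<not> covers N' []" using ne by (auto simp: covers_def)
    then have "b [] = 0" using b0[of "[]"] 0 by simp
    then show ?thesis using 0 by (intro exI[of _ "\<lambda>_. 0"]) auto
  next
    case (Suc q)
    have "exact_at K X' N' q" using p Suc by simp
    moreover have "b t = 0" if "set t \<subseteq> X'" "length t = Suc q" "\<not> covers N' t" for t
      using b0[of t] that Suc X' by auto
    moreover have "lcech b t = 0" if t: "set t \<subseteq> X'" "length t = Suc (Suc q)" for t
    proof -
      have tX: "set t \<subseteq> X" using X' t by auto
      then have "c t = 0" using c0 cov[OF tX] t Suc by simp
      then show ?thesis using b[OF tX] t Suc by simp
    qed
    ultimately obtain g where g: "\<And>t. set t \<subseteq> X' \<Longrightarrow> length t = q \<Longrightarrow> \<not> covers N' t \<Longrightarrow> g t = 0"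
      "\<And>t. set t \<subseteq> X' \<Longrightarrow> length t = Suc q \<Longrightarrow> lcech g t = b t"
      using exact_atD[of K X' N' q b] by blast
    let ?g = "\<lambda>t. if set t \<subseteq> X' then g t else 0"
    have "lcech ?g t = b t" if "set t \<subseteq> X'" "length t = p" for t
    proof -
      have "lcech ?g t = lcech g t" using that by (intro lcech_cong) auto
      then show ?thesis using g(2) that Suc by simp
    qed
    then show ?thesis using g(1) Suc by (intro exI[of _ ?g]) auto
  qed
  then obtain g where g0: "\<And>t. set t \<subseteq> X \<Longrightarrow> Suc (length t) = p \<Longrightarrow> \<not> covers N' t \<Longrightarrow> g t = 0"
    and g: "\<And>t. set t \<subseteq> X' \<Longrightarrow> length t = p \<Longrightarrow> lcech g t = b t" by blast
  have "b t - lcech g t = 0" if t: "set t \<subseteq> X" "length t = p" "\<not> covers N t" for t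
  proof (cases "set t \<subseteq> X'")
    case True then show ?thesis using g t by simp
  next
    case False
    then have n: "\<not> covers N' t" using cov t by blast
    have "lcech g t = 0" by (rule lcech_not_covers[of X t N']) (use g0 t n in auto)
    then show ?thesis using b0 t n by simp
  qed
  moreover have "lcech (\<lambda>s. b s - lcech g s) t = c t" if "set t \<subseteq> X" "length t = Suc p" for t
    using b[OF that] by (simp add: lcech_diff lcech_lcech)
  ultimately show "\<exists>b. (\<forall>t. set t \<subseteq> X \<and> length t = p \<and> \<not> covers N t \<longrightarrow> b t = 0) \<and>
          (\<forall>t. set t \<subseteq> X \<and> length t = Suc p \<longrightarrow> lcech b t = c t)"
    by (intro exI[of _ "\<lambda>s. b s - lcech g s"]) auto
qed

text \<open>Monomials in which each group is entirely negative or entirely nonnegative. The excluded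
  degree, the sum of the dimensions of the negative groups, is that of the top cohomology of the
  product of these projective spaces. The induction removes one condition at a time.\<close>

lemma exact_at_product:
  fixes w :: "nat \<Rightarrow> nat set"
  assumes "finite N" "\<And>i. i \<in> S \<Longrightarrow> finite (w i) \<and> w i \<noteq> {}" "finite S" "N \<subseteq> (SIGMA i:S. w i)"
    "\<And>i. i \<in> S \<Longrightarrow> {j. (i, j) \<in> N} = {} \<or> {j. (i, j) \<in> N} = w i"
    "N = {} \<or> p \<noteq> (\<Sum>i\<in>fst ` N. card (w i) - 1)"
  shows "exact_at (K :: 'k::field itself) (PiE S w) N p"
  using assms
proof (induction "card N" arbitrary: N w p rule: less_induct)
  case less
  obtain x0 where x0: "x0 \<in> PiE S w" using less.prems(2) by (metis PiE_eq_empty_iff ex_in_conv)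
  show ?case
  proof (cases "N = {}")
    case True then show ?thesis using exact_at_empty[OF x0] by simp
  next
    case False
    then obtain i j where ij: "(i, j) \<in> N" by auto
    have iS: "i \<in> S" using ij less.prems(4) by auto
    have full: "{j. (i, j) \<in> N} = w i" using less.prems(5)[OF iS] ij by blast
    have pN: "p \<noteq> (\<Sum>i\<in>fst ` N. card (w i) - 1)" using less.prems(6) False by simp
    define N' where "N' = N - {(i, j)}"
    have N: "N = insert (i, j) N'" using ij by (auto simp: N'_def)
    have cN': "card N' < card N" unfolding N'_def by (rule card_Diff1_less[OF less.prems(1) ij])
    have fi: "finite (fst ` N)" "i \<in> fst ` N" using less.prems(1) ij by force+
    show ?thesis
    proof (cases "w i = {j}")
      case True
      have row': "{j. (i, j) \<in> N'} = {}" using full True by (auto simp: N'_def)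
      have other: "{j. (i', j) \<in> N'} = {j. (i', j) \<in> N}" if "i' \<noteq> i" for i' using that by (auto simp: N'_def)
      have f': "fst ` N' = fst ` N - {i}"
      proof (intro equalityI subsetI)
        fix a assume "a \<in> fst ` N'"
        then obtain b where "(a, b) \<in> N'" by force
        then show "a \<in> fst ` N - {i}" using row' by (force simp: N'_def)
      next
        fix a assume "a \<in> fst ` N - {i}"
        then obtain b where "(a, b) \<in> N" "a \<noteq> i" by force
        then show "a \<in> fst ` N'" by (force simp: N'_def)
      qed
      have sm: "(\<Sum>i\<in>fst ` N. card (w i) - 1) = (\<Sum>i\<in>fst ` N'. card (w i) - 1)"
        unfolding f' using fi True by (subst sum.remove[of _ i]) auto
      have IH: "exact_at K (PiE S w) N' p"
      proof (rule less.hyps[OF cN' _ less.prems(2,3)])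
        show "finite N'" "N' \<subseteq> (SIGMA i:S. w i)" using less.prems by (auto simp: N'_def)
        show "{j. (i', j) \<in> N'} = {} \<or> {j. (i', j) \<in> N'} = w i'" if "i' \<in> S" for i'
          using row' other[of i'] less.prems(5)[OF that] by (cases "i' = i") auto
        show "N' = {} \<or> p \<noteq> (\<Sum>i\<in>fst ` N'. card (w i) - 1)" using pN sm by simp
      qed auto
      have Ii: "I i = j" if "I \<in> PiE S w" for I using PiE_mem[OF that iS] True by simp
      have cov: "covers N t \<longleftrightarrow> covers N' t" if "set t \<subseteq> PiE S w" "t \<noteq> []" for t
      proof -
        have "\<exists>I\<in>set t. I i = j" using that Ii by (metis list.set_sel(1) subsetD)
        then show ?thesis unfolding covers_def N by auto
      qed
      \<comment> \<open>The empty tuple, which occurs for \<open>p = 0\<close>, contains no vertex.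
        It covers neither set, since \<open>N'\<close> is nonempty there: otherwise
        \<open>p = 0\<close> would be the excluded degree.\<close>
      have cov0: "covers N t \<longleftrightarrow> covers N' t" if "set t \<subseteq> PiE S w" "length t = p" for t
      proof (cases t)
        case Nil
        then have "p = 0" using that by simp
        then have "N' \<noteq> {}" using pN sm by auto
        then show ?thesis using Nil by (auto simp: covers_def N)
      qed (use cov that in auto)
      show ?thesis unfolding exact_at_def
      proof (intro allI impI, elim conjE)
        fix c :: "(nat \<Rightarrow> nat) list \<Rightarrow> 'k"
        assume c0: "\<forall>t. set t \<subseteq> PiE S w \<and> length t = Suc p \<and> \<not> covers N t \<longrightarrow> c t = 0"
          and c: "\<forall>t. set t \<subseteq> PiE S w \<and> length t = Suc (Suc p) \<longrightarrow> lcech c t = 0"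
        have "c t = 0" if "set t \<subseteq> PiE S w" "length t = Suc p" "\<not> covers N' t" for t
        proof -
          have "t \<noteq> []" using that by auto
          then show ?thesis using c0 cov[OF that(1)] that by simp
        qed
        moreover have "lcech c t = 0" if "set t \<subseteq> PiE S w" "length t = Suc (Suc p)" for t using c that by simp
        ultimately obtain b where "\<And>t. set t \<subseteq> PiE S w \<Longrightarrow> length t = p \<Longrightarrow> \<not> covers N' t \<Longrightarrow> b t = 0"
          "\<And>t. set t \<subseteq> PiE S w \<Longrightarrow> length t = Suc p \<Longrightarrow> lcech b t = c t"
          using exact_atD[OF IH, of c] by blast
        then show "\<exists>b. (\<forall>t. set t \<subseteq> PiE S w \<and> length t = p \<and> \<not> covers N t \<longrightarrow> b t = 0) \<and>
            (\<forall>t. set t \<subseteq> PiE S w \<and> length t = Suc p \<longrightarrow> lcech b t = c t)"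
          using cov0 by blast
      qed
    next
      case wi: False
      have jw: "j \<in> w i" using full ij by auto
      then obtain j1 where j1: "j1 \<in> w i" "j1 \<noteq> j" using wi by blast
      have j1N: "(i, j1) \<in> N'" using full j1 by (auto simp: N'_def)
      define w' where "w' = w(i := w i - {j})"
      \<comment> \<open>Without the condition \<open>(i, j)\<close> group \<open>i\<close> is mixed,
        so the complex on \<open>X\<close> is exact in all degrees. On the vertices avoiding
        \<open>j\<close> the group is entirely negative again, with one index fewer; this lowers the
        excluded degree by one, in step with \<open>p - 1\<close>.\<close>
      have ex: "exact_at K (PiE S w) N' q" for q
      proof (rule exact_at_mixed)
        show "(i, j1) \<in> N'" by (rule j1N)
        show "(i, j) \<notin> N'" by (simp add: N'_def)
        show "I(i := j) \<in> PiE S w" if "I \<in> PiE S w" for I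
          using that jw iS by (auto simp: PiE_def extensional_def)
      qed
      have X': "PiE S w' = {I\<in>PiE S w. I i \<noteq> j}"
      proof (intro equalityI subsetI)
        fix I assume I: "I \<in> PiE S w'"
        have "I k \<in> w k" if "k \<in> S" for k using PiE_mem[OF I that] by (auto simp: w'_def split: if_splits)
        moreover have "I i \<noteq> j" using PiE_mem[OF I iS] by (auto simp: w'_def)
        ultimately show "I \<in> {I\<in>PiE S w. I i \<noteq> j}" using I by (auto simp: PiE_def extensional_def)
      next
        fix I assume "I \<in> {I\<in>PiE S w. I i \<noteq> j}"
        then show "I \<in> PiE S w'" by (auto simp: w'_def PiE_def extensional_def)
      qed
      have "p = 0 \<or> exact_at K (PiE S w') N' (p - 1)"
      proof (cases "p = 0")
        case p0: False
        have "exact_at K (PiE S w') N' (p - 1)"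
        proof (rule less.hyps[OF cN'])
          show "finite N'" "finite S" using less.prems by (auto simp: N'_def)
          show "finite (w' k) \<and> w' k \<noteq> {}" if "k \<in> S" for k
            using less.prems(2)[OF that] j1 by (auto simp: w'_def)
          show "N' \<subseteq> (SIGMA i:S. w' i)"
          proof
            fix v assume "v \<in> N'"
            then have "v \<in> N" "v \<noteq> (i, j)" by (auto simp: N'_def)
            then show "v \<in> (SIGMA i:S. w' i)" using less.prems(4) by (cases v) (auto simp: w'_def)
          qed
          show "{j. (k, j) \<in> N'} = {} \<or> {j. (k, j) \<in> N'} = w' k" if "k \<in> S" for k
          proof (cases "k = i")
            case True
            have "{j'. (i, j') \<in> N'} = {j'. (i, j') \<in> N} - {j}" by (auto simp: N'_def)
            then show ?thesis using True full by (simp add: w'_def)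
          next
            case False
            then have "{j. (k, j) \<in> N'} = {j. (k, j) \<in> N}" by (auto simp: N'_def)
            then show ?thesis using less.prems(5)[OF that] False by (simp add: w'_def)
          qed
          have f': "fst ` N' = fst ` N"
            unfolding N using j1N by (auto intro: rev_image_eqI)
          have "(\<Sum>k\<in>fst ` N. card (w k) - 1) = Suc (\<Sum>k\<in>fst ` N. card (w' k) - 1)"
          proof -
            have fw: "finite (w i)" using less.prems(2)[OF iS] by simp
            have "card {j, j1} \<le> card (w i)" using jw j1 fw by (intro card_mono) auto
            then have "card (w i) - 1 = Suc (card (w' i) - 1)" using j1 jw fw by (simp add: w'_def)
            then show ?thesis using fi by (subst (1 2) sum.remove[of _ i]) (auto simp: w'_def)
          qed
          then show "N' = {} \<or> p - 1 \<noteq> (\<Sum>k\<in>fst ` N'. card (w' k) - 1)" using pN p0 f' by auto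
        qed
        then show ?thesis by simp
      qed simp
      then show ?thesis using exact_at_step[OF ex N _ X'] j1N by blast
    qed
  qed
qed

subsection \<open>Dimension of a quotient space\<close>

text \<open>The functionals \<open>L\<close> are coordinates on \<open>V\<close> that cut out
  \<open>W\<close>, and the vectors \<open>z\<close> are dual to them, so the classes of
  \<open>z\<close> form a basis. The rest of the proof shows that the number does not depend on the
  basis, as the definite description requires.\<close>

lemma quot_dim_eq:
  fixes s :: "'k::field_char_0 \<Rightarrow> 'v::ab_group_add \<Rightarrow> 'v" and L :: "'v \<Rightarrow> 'e \<Rightarrow> 'k" and z :: "'e \<Rightarrow> 'v"
  assumes vs: "vector_space s" and V: "module.subspace s V" and W: "module.subspace s W" "W \<subseteq> V"
    and E: "finite E" and L_add: "\<And>x y e. L (x + y) e = L x e + L y e" and L_scale: "\<And>c x e. L (s c x) e = c * L x e"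
    and ker: "\<And>x. x \<in> V \<Longrightarrow> (\<forall>e\<in>E. L x e = 0) \<longleftrightarrow> x \<in> W"
    and z: "\<And>e. e \<in> E \<Longrightarrow> z e \<in> V" "\<And>e e'. e \<in> E \<Longrightarrow> e' \<in> E \<Longrightarrow> L (z e) e' = (if e = e' then 1 else 0)"
  shows "quot_dim s V W = card E"
proof -
  interpret vector_space s by (rule vs)
  have L0: "L 0 e = 0" for e using L_scale[of 0 0 e] by simp
  have L_sum: "L (sum f A) e = (\<Sum>a\<in>A. L (f a) e)" for f :: "'a \<Rightarrow> 'v" and A e
    by (induction A rule: infinite_finite_induct) (auto simp: L_add L0)
  have L_diff: "L (x - y) e = L x e - L y e" for x y e using L_add[of "x - y" y e] by simp
  let ?P = "\<lambda>T. finite T \<and> T \<subseteq> V \<and> span (T \<union> W) = V \<and> (\<forall>c. (\<Sum>v\<in>T. s (c v) v) \<in> W \<longrightarrow> (\<forall>v\<in>T. c v = 0))"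
  have dec: "x - (\<Sum>e\<in>E. s (L x e) (z e)) \<in> W" if x: "x \<in> V" for x
  proof -
    have "x - (\<Sum>e\<in>E. s (L x e) (z e)) \<in> V"
      using x z V by (intro subspace_diff subspace_sum subspace_scale) auto
    moreover have "L (x - (\<Sum>e\<in>E. s (L x e) (z e))) e' = 0" if "e' \<in> E" for e'
    proof -
      have "(\<Sum>e\<in>E. L x e * L (z e) e') = (\<Sum>e\<in>E. if e = e' then L x e else 0)"
        using z(2) that by (intro sum.cong) auto
      then show ?thesis using that E by (simp add: L_diff L_sum L_scale)
    qed
    ultimately show ?thesis using ker by blast
  qed
  have "?P (z ` E)" "card (z ` E) = card E"
  proof -
    have inj: "inj_on z E"
      by (rule inj_onI) (metis z(2) zero_neq_one)
    show "card (z ` E) = card E" by (rule card_image[OF inj])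
    have "span (z ` E \<union> W) = V"
    proof (intro equalityI)
      show "span (z ` E \<union> W) \<subseteq> V" using z W V by (intro span_minimal) auto
      show "V \<subseteq> span (z ` E \<union> W)"
      proof
        fix x assume x: "x \<in> V"
        have "(x - (\<Sum>e\<in>E. s (L x e) (z e))) + (\<Sum>e\<in>E. s (L x e) (z e)) \<in> span (z ` E \<union> W)"
          using dec[OF x] by (intro span_add span_sum span_scale) (auto intro: span_base)
        then show "x \<in> span (z ` E \<union> W)" by simp
      qed
    qed
    moreover have "c v = 0" if c: "(\<Sum>v\<in>z ` E. s (c v) v) \<in> W" and v: "v \<in> z ` E" for c v
    proof -
      obtain e where e: "e \<in> E" "v = z e" using v by auto
      have "L (\<Sum>v\<in>z ` E. s (c v) v) e = 0" using c ker W e by blast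
      moreover have "L (\<Sum>v\<in>z ` E. s (c v) v) e = (\<Sum>e'\<in>E. if e' = e then c (z e') else 0)"
        using z(2) e by (simp add: L_sum L_scale sum.reindex[OF inj]) (auto intro!: sum.cong)
      ultimately show ?thesis using e E by simp
    qed
    ultimately show "?P (z ` E)" using E z by auto
  qed
  moreover have "card T = card E" if T: "?P T" for T
  proof -
    have sW: "span W = W" using W span_eq_iff by blast
    have "\<exists>A. z e - (\<Sum>t\<in>T. s (A t) t) \<in> W" if e: "e \<in> E" for e
    proof -
      have "z e \<in> span (T \<union> W)" using z e T by simp
      then obtain x y where xy: "z e = x + y" "x \<in> span T" "y \<in> W" unfolding span_Un sW by auto
      then obtain u where "x = (\<Sum>v\<in>T. s (u v) v)" using T by (auto simp: span_finite)
      then show ?thesis using xy by (intro exI[of _ u]) simp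
    qed
    \<comment> \<open>\<open>A\<close> expresses \<open>z\<close> by \<open>T\<close> modulo
      \<open>W\<close>, and \<open>L\<close> on \<open>T\<close> expresses \<open>T\<close> by
      \<open>z\<close>.\<close>
    then obtain A where A: "\<And>e. e \<in> E \<Longrightarrow> z e - (\<Sum>t\<in>T. s (A e t) t) \<in> W" by metis
    have AB: "(\<Sum>t\<in>T. A e t * L t e) = 1" if e: "e \<in> E" for e
    proof -
      have "L (z e - (\<Sum>t\<in>T. s (A e t) t)) e = 0" using A[OF e] ker W e by blast
      then show ?thesis using z(2)[OF e e] by (simp add: L_diff L_sum L_scale)
    qed
    have BA: "(\<Sum>e\<in>E. L t e * A e t) = 1" if t: "t \<in> T" for t
    proof -
      have "(t - (\<Sum>e\<in>E. s (L t e) (z e))) + (\<Sum>e\<in>E. s (L t e) (z e - (\<Sum>t'\<in>T. s (A e t') t'))) \<in> W"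
        using dec[of t] t T A W by (intro subspace_add subspace_sum subspace_scale) auto
      also have "(t - (\<Sum>e\<in>E. s (L t e) (z e))) + (\<Sum>e\<in>E. s (L t e) (z e - (\<Sum>t'\<in>T. s (A e t') t'))) =
          t - (\<Sum>t'\<in>T. s (\<Sum>e\<in>E. L t e * A e t') t')"
        by (simp add: scale_right_diff_distrib sum_subtractf scale_sum_right scale_sum_left sum.swap[of _ T E])
      also have "\<dots> = (\<Sum>t'\<in>T. s ((if t' = t then 1 else 0) - (\<Sum>e\<in>E. L t e * A e t')) t')"
      proof -
        have "(\<Sum>t'\<in>T. s (if t' = t then 1 else 0) t') = (\<Sum>t'\<in>T. if t' = t then t else 0)"
          by (intro sum.cong) auto
        then show ?thesis using t T by (simp add: scale_left_diff_distrib sum_subtractf)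
      qed
      finally have in_W: "(\<Sum>t'\<in>T. s ((if t' = t then 1 else 0) - (\<Sum>e\<in>E. L t e * A e t')) t') \<in> W" .
      have "\<forall>c. (\<Sum>v\<in>T. s (c v) v) \<in> W \<longrightarrow> (\<forall>v\<in>T. c v = 0)" using T by blast
      from this[rule_format, OF in_W t] show ?thesis by simp
    qed
    \<comment> \<open>The traces of the two products agree, and their diagonals consist of ones. In
      characteristic zero this gives equality of the two numbers.\<close>
    have "(of_nat (card E) :: 'k) = (\<Sum>e\<in>E. \<Sum>t\<in>T. A e t * L t e)" using AB by simp
    also have "\<dots> = (\<Sum>t\<in>T. \<Sum>e\<in>E. L t e * A e t)" by (subst sum.swap) (simp add: mult.commute)
    also have "\<dots> = of_nat (card T)" using BA by simp
    finally show ?thesis by simp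
  qed
  ultimately show ?thesis unfolding quot_dim_def by (intro the_equality) blast+
qed

subsection \<open>The Weyman term\<close>

lemma lookup_map_times:
  "Poly_Mapping.lookup (Poly_Mapping.map ((*) c) p) k = c * Poly_Mapping.lookup p k" for c :: "'k::field"
  by (simp add: Poly_Mapping.map.rep_eq when_def)

lemma lookup_map_map_times:
  "Poly_Mapping.lookup (Poly_Mapping.map (Poly_Mapping.map ((*) c)) z) k = Poly_Mapping.map ((*) c) (Poly_Mapping.lookup z k)"
  for c :: "'k::field"
  by (auto simp: Poly_Mapping.map.rep_eq when_def intro!: poly_mapping_eqI)

lemma vector_space_K0: "vector_space (\<lambda>c::'k::field. Poly_Mapping.map (Poly_Mapping.map ((*) c)) :: ('a \<Rightarrow>\<^sub>0 'b \<Rightarrow>\<^sub>0 'k) \<Rightarrow> _)"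
  by unfold_locales
    (auto intro!: poly_mapping_eqI simp: lookup_map_map_times lookup_map_times lookup_add algebra_simps)

definition linear_closed :: "('a \<Rightarrow>\<^sub>0 'k::field) set \<Rightarrow> bool" where
  "linear_closed Z \<longleftrightarrow> 0 \<in> Z \<and> (\<forall>x\<in>Z. \<forall>y\<in>Z. x + y \<in> Z) \<and> (\<forall>c. \<forall>x\<in>Z. Poly_Mapping.map ((*) c) x \<in> Z)"

lemma subspace_K0_sum:
  fixes Z :: "(nat \<Rightarrow> int) \<Rightarrow> nat \<Rightarrow> 'k::field cochain set"
  assumes "\<And>a p. linear_closed (Z a p)"
  shows "module.subspace (\<lambda>c::'k. Poly_Mapping.map (Poly_Mapping.map ((*) c))) (K0_sum Z n d m)"
proof -
  interpret vector_space "\<lambda>c::'k. Poly_Mapping.map (Poly_Mapping.map ((*) c)) :: ((nat \<times> nat) \<Rightarrow>\<^sub>0 'k cochain) \<Rightarrow> _"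
    by (rule vector_space_K0)
  have z: "Poly_Mapping.map ((*) c) (0 :: 'k cochain) = 0" for c
    by (rule poly_mapping_eqI) (simp add: lookup_map_times)
  show ?thesis unfolding subspace_def K0_sum_def
    using assms unfolding linear_closed_def by (auto simp: lookup_add lookup_map_map_times z)
qed

lemma cech_d_eq: "cech_d c t e = lcech (\<lambda>s. Poly_Mapping.lookup c (s, e)) t"
  by (simp add: cech_d_def lcech_def)

lemma cech_d_linear:
  "cech_d (a + b) t e = cech_d a t e + cech_d b t e" "cech_d (Poly_Mapping.map ((*) k) a) t e = k * cech_d a t e" "cech_d 0 t e = 0"
  by (auto simp: cech_d_def lookup_add lookup_map_times sum.distrib sum_distrib_left distrib_left mult_ac)

lemma linear_closed_cochains: "linear_closed (cochains r l a p :: 'k::field cochain set)"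
  unfolding linear_closed_def cochains_def
proof (intro conjI ballI allI)
  fix x y :: "'k cochain" and c :: 'k
  assume x: "x \<in> {c. Poly_Mapping.keys c \<subseteq> (SIGMA t:cover_tuples r l p. section_expos r l a t)}"
  show "Poly_Mapping.map ((*) c) x \<in> {c. Poly_Mapping.keys c \<subseteq> (SIGMA t:cover_tuples r l p. section_expos r l a t)}"
    using x by (auto simp: in_keys_iff lookup_map_times subset_iff)
  assume y: "y \<in> {c. Poly_Mapping.keys c \<subseteq> (SIGMA t:cover_tuples r l p. section_expos r l a t)}"
  show "x + y \<in> {c. Poly_Mapping.keys c \<subseteq> (SIGMA t:cover_tuples r l p. section_expos r l a t)}"
    using x y keys_add[of x y] by blast
qed simp

lemma linear_closed_cocycles: "linear_closed (cocycles r l a p)"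
  using linear_closed_cochains[of r l a p] unfolding linear_closed_def cocycles_def by (auto simp: cech_d_linear)

lemma linear_closed_coboundaries: "linear_closed (coboundaries r l a p :: 'k::field cochain set)"
proof (cases "p = 0")
  case True
  have "Poly_Mapping.map ((*) c) (0 :: 'k cochain) = 0" for c
    by (rule poly_mapping_eqI) (simp add: lookup_map_times)
  then show ?thesis using True by (simp add: linear_closed_def coboundaries_def)
next
  case False
  note lc = linear_closed_cochains[of r l a p, unfolded linear_closed_def]
    linear_closed_cochains[of r l a "p - 1", unfolded linear_closed_def]
  show ?thesis unfolding linear_closed_def
  proof (intro conjI ballI allI)
    show "0 \<in> (coboundaries r l a p :: 'k cochain set)"
      using lc False by (auto simp: coboundaries_def cech_d_linear intro!: bexI[of _ 0])
    fix x y :: "'k cochain" and c :: 'k assume "x \<in> coboundaries r l a p"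
    then obtain b where b: "x \<in> cochains r l a p" "b \<in> cochains r l a (p - 1)"
      "\<forall>t\<in>cover_tuples r l p. \<forall>e. Poly_Mapping.lookup x (t, e) = cech_d b t e"
      using False by (auto simp: coboundaries_def)
    then have "Poly_Mapping.map ((*) c) x \<in> cochains r l a p" "Poly_Mapping.map ((*) c) b \<in> cochains r l a (p - 1)"
      "\<forall>t\<in>cover_tuples r l p. \<forall>e. Poly_Mapping.lookup (Poly_Mapping.map ((*) c) x) (t, e) = cech_d (Poly_Mapping.map ((*) c) b) t e"
      using lc by (auto simp: cech_d_linear lookup_map_times)
    then show "Poly_Mapping.map ((*) c) x \<in> coboundaries r l a p" using False by (auto simp: coboundaries_def)
    assume "y \<in> coboundaries r l a p"
    then obtain b' where b': "y \<in> cochains r l a p" "b' \<in> cochains r l a (p - 1)"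
      "\<forall>t\<in>cover_tuples r l p. \<forall>e. Poly_Mapping.lookup y (t, e) = cech_d b' t e"
      using False by (auto simp: coboundaries_def)
    have "x + y \<in> cochains r l a p" "b + b' \<in> cochains r l a (p - 1)"
      "\<forall>t\<in>cover_tuples r l p. \<forall>e. Poly_Mapping.lookup (x + y) (t, e) = cech_d (b + b') t e"
      using lc b b' by (auto simp: cech_d_linear lookup_add)
    then show "x + y \<in> coboundaries r l a p" using False by (auto simp: coboundaries_def)
  qed
qed

context multihom begin

definition verts :: "(nat \<Rightarrow> nat) set" where "verts = (\<Pi>\<^sub>E i\<in>{1..r}. {0..l i})"

definition negs :: "lexpo \<Rightarrow> (nat \<times> nat) set" where "negs e = {v. Poly_Mapping.lookup e v < 0}"

definition degs :: "(nat \<Rightarrow> int) \<Rightarrow> lexpo set" where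
  "degs a = {e. Poly_Mapping.keys e \<subseteq> hom_vars r l \<and> (\<forall>i\<in>{1..r}. (\<Sum>j=0..l i. Poly_Mapping.lookup e (i, j)) = a i)}"

lemma section_expos_eq: "section_expos r l a t = {e \<in> degs a. covers (negs e) t}"
  unfolding section_expos_def degs_def covers_def negs_def by auto

lemma cover_tuples_eq: "cover_tuples r l p = {t. set t \<subseteq> verts \<and> length t = Suc p}"
  by (auto simp: cover_tuples_def verts_def)

lemma finite_verts: "finite verts" unfolding verts_def by (rule finite_PiE) auto

lemma finite_cover_tuples: "finite (cover_tuples r l p)"
  unfolding cover_tuples_eq by (rule finite_lists_length_eq[OF finite_verts])

lemma negs_subset: "e \<in> degs a \<Longrightarrow> negs e \<subseteq> (SIGMA i:{1..r}. {0..l i})"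
proof
  fix v assume "e \<in> degs a" "v \<in> negs e"
  then have "v \<in> Poly_Mapping.keys e" "Poly_Mapping.keys e \<subseteq> hom_vars r l" by (auto simp: negs_def degs_def in_keys_iff)
  then show "v \<in> (SIGMA i:{1..r}. {0..l i})" unfolding hom_vars_def by blast
qed

text \<open>In the critical case \<open>p\<close> is the sum of \<open>l i\<close> over the negative
  groups. Among these let \<open>k\<close> have the smallest \<pi>; then all of them enter the sum
  in entry \<open>k\<close> of the degree vector, so the twisted degree in group \<open>k\<close> is
  at least \<open>- l k\<close>. But \<open>l k + 1\<close> negative exponents add up to at most
  \<open>- l k - 1\<close>.\<close>

lemma exact_at_deg_vec:
  assumes p: "p \<ge> 1" and e: "e \<in> degs (\<lambda>k. deg_vec r l d \<pi> k - int p * int (d k))"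
  shows "exact_at (K :: 'k::field itself) verts (negs e) p"
proof (cases "\<forall>i\<in>{1..r}. {j. (i, j) \<in> negs e} = {} \<or> {j. (i, j) \<in> negs e} = {0..l i}")
  case False
  then obtain i where i: "i \<in> {1..r}" "{j. (i, j) \<in> negs e} \<noteq> {}" "{j. (i, j) \<in> negs e} \<noteq> {0..l i}" by blast
  have sub: "{j. (i, j) \<in> negs e} \<subseteq> {0..l i}" using negs_subset[OF e] by blast
  then obtain j' where j': "j' \<in> {0..l i}" "(i, j') \<notin> negs e" using i(3) by blast
  obtain j0 where j0: "(i, j0) \<in> negs e" using i by blast
  show ?thesis
  proof (rule exact_at_mixed[OF _ j0 j'(2)])
    show "I(i := j') \<in> verts" if "I \<in> verts" for I
      unfolding verts_def
    proof (rule PiE_I)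
      fix k assume "k \<in> {1..r}"
      then show "(I(i := j')) k \<in> {0..l k}" using that j'(1) PiE_mem[of I "{1..r}" "\<lambda>i. {0..l i}" k] by (simp add: verts_def)
    next
      fix k assume "k \<notin> {1..r}"
      then show "(I(i := j')) k = undefined" using that i(1) PiE_arb[of I "{1..r}" "\<lambda>i. {0..l i}" k] by (auto simp: verts_def)
    qed
  qed
next
  case rows: True
  have fin: "finite (negs e)" by (rule finite_subset[OF negs_subset[OF e]]) auto
  show ?thesis unfolding verts_def
  proof (rule exact_at_product[OF fin])
    show "negs e \<subseteq> (SIGMA i:{1..r}. {0..l i})" by (rule negs_subset[OF e])
    show "\<And>i. i \<in> {1..r} \<Longrightarrow> {j. (i, j) \<in> negs e} = {} \<or> {j. (i, j) \<in> negs e} = {0..l i}" using rows by blast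
    show "negs e = {} \<or> p \<noteq> (\<Sum>i\<in>fst ` negs e. card {0..l i} - 1)"
    proof (rule ccontr)
      assume "\<not> ?thesis"
      then have ne: "negs e \<noteq> {}" and pe: "p = (\<Sum>i\<in>fst ` negs e. l i)" by auto
      let ?F = "fst ` negs e"
      have F: "finite ?F" "?F \<noteq> {}" "?F \<subseteq> {1..r}" using fin ne negs_subset[OF e] by auto
      obtain k where k: "k \<in> ?F" "\<And>i. i \<in> ?F \<Longrightarrow> \<pi> k \<le> \<pi> i"
        using F ex_is_arg_min_if_finite[OF F(1,2), of \<pi>] unfolding is_arg_min_def by (meson leI)
      have kr: "k \<in> {1..r}" using F k by blast
      obtain j where "(k, j) \<in> negs e" using k by force
      then have full: "{j. (k, j) \<in> negs e} = {0..l k}" using rows kr by blast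
      have "(\<Sum>j=0..l k. Poly_Mapping.lookup e (k, j)) \<le> (\<Sum>j=0..l k. -1)"
      proof (rule sum_mono)
        fix j assume "j \<in> {0..l k}"
        then have "(k, j) \<in> negs e" using full by blast
        then show "Poly_Mapping.lookup e (k, j) \<le> -1" by (simp add: negs_def)
      qed
      moreover have "(\<Sum>j=0..l k. Poly_Mapping.lookup e (k, j)) = deg_vec r l d \<pi> k - int p * int (d k)"
        using e kr by (simp add: degs_def)
      ultimately have le: "int (d k) * (\<Sum>j | j \<in> {1..r} \<and> \<pi> j \<ge> \<pi> k. int (l j)) - int p * int (d k) \<le> -1"
        by (simp add: deg_vec_def)
      have "int p \<le> (\<Sum>j | j \<in> {1..r} \<and> \<pi> j \<ge> \<pi> k. int (l j))"
        unfolding pe of_nat_sum using F k(2) by (intro sum_mono2) auto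
      then have "int p * int (d k) \<le> int (d k) * (\<Sum>j | j \<in> {1..r} \<and> \<pi> j \<ge> \<pi> k. int (l j))"
        by (metis mult.commute mult_left_mono of_nat_0_le_iff)
      then show False using le by simp
    qed
  qed auto
qed

text \<open>Exactness is applied to each exponent separately, and the primitives are assembled over
  the finitely many exponents in the support of the cocycle.\<close>

lemma cocycles_eq_coboundaries:
  assumes p: "p \<ge> 1" and a: "a = (\<lambda>k. deg_vec r l d \<pi> k - int p * int (d k))"
  shows "cocycles r l a p = (coboundaries r l a p :: 'k::field cochain set)"
proof (intro equalityI subsetI)
  fix c :: "'k cochain" assume c: "c \<in> cocycles r l a p"
  then have cc: "c \<in> cochains r l a p" by (simp add: cocycles_def)
  then have ck: "t \<in> cover_tuples r l p \<and> e \<in> degs a \<and> covers (negs e) t" if "Poly_Mapping.lookup c (t, e) \<noteq> 0" for t e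
    using that unfolding cochains_def section_expos_eq by (auto simp: in_keys_iff subset_iff)
  define Ex where "Ex = snd ` Poly_Mapping.keys c"
  have "\<exists>b. (\<forall>t. set t \<subseteq> verts \<longrightarrow> length t = p \<longrightarrow> \<not> covers (negs e) t \<longrightarrow> b t = 0) \<and>
     (\<forall>t. set t \<subseteq> verts \<longrightarrow> length t = Suc p \<longrightarrow> lcech b t = Poly_Mapping.lookup c (t, e))" if e: "e \<in> Ex" for e
  proof -
    have "e \<in> degs a" using e ck unfolding Ex_def by (auto simp: in_keys_iff)
    then have ex: "exact_at TYPE('k) verts (negs e) p" using exact_at_deg_vec[OF p] a by blast
    show ?thesis
    proof (rule exact_atD[OF ex, of "\<lambda>s. Poly_Mapping.lookup c (s, e)"])
      show "lcech (\<lambda>s. Poly_Mapping.lookup c (s, e)) t = 0" if "set t \<subseteq> verts" "length t = Suc (Suc p)" for t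
        using c that unfolding cocycles_def cover_tuples_eq cech_d_eq by simp
      show "Poly_Mapping.lookup c (t, e) = 0" if "\<not> covers (negs e) t" for t
        using ck[of t e] that by argo
      fix b assume "\<And>t. set t \<subseteq> verts \<Longrightarrow> length t = p \<Longrightarrow> \<not> covers (negs e) t \<Longrightarrow> b t = 0"
        "\<And>t. set t \<subseteq> verts \<Longrightarrow> length t = Suc p \<Longrightarrow> lcech b t = Poly_Mapping.lookup c (t, e)"
      then show ?thesis by (intro exI[of _ b]) simp
    qed
  qed
  then obtain B where B0: "\<And>e t. e \<in> Ex \<Longrightarrow> set t \<subseteq> verts \<Longrightarrow> length t = p \<Longrightarrow> \<not> covers (negs e) t \<Longrightarrow> B e t = 0"
    and B: "\<And>e t. e \<in> Ex \<Longrightarrow> set t \<subseteq> verts \<Longrightarrow> length t = Suc p \<Longrightarrow> lcech (B e) t = Poly_Mapping.lookup c (t, e)"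
    by metis
  \<comment> \<open>Cut off outside a finite set, so that \<open>b\<close> is finitely
    supported.\<close>
  define bf where "bf = (\<lambda>(t, e). if e \<in> Ex \<and> t \<in> cover_tuples r l (p - 1) then B e t else 0)"
  define b where "b = Abs_poly_mapping bf"
  have lb: "Poly_Mapping.lookup b = bf" unfolding b_def
  proof (rule lookup_Abs_poly_mapping_finite)
    show "finite (cover_tuples r l (p - 1) \<times> Ex)" using finite_cover_tuples by (simp add: Ex_def)
    show "bf v = 0" if "v \<notin> cover_tuples r l (p - 1) \<times> Ex" for v using that by (cases v) (auto simp: bf_def)
  qed
  have "b \<in> cochains r l a (p - 1)" unfolding cochains_def
  proof (intro CollectI subsetI)
    fix v assume "v \<in> Poly_Mapping.keys b"
    then obtain t e where v: "v = (t, e)" "e \<in> Ex" "t \<in> cover_tuples r l (p - 1)" "B e t \<noteq> 0"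
      by (cases v) (auto simp: in_keys_iff lb bf_def split: if_splits)
    have "e \<in> degs a" using v(2) ck unfolding Ex_def by (auto simp: in_keys_iff)
    moreover have "covers (negs e) t" using B0[OF v(2)] v p by (auto simp: cover_tuples_eq)
    ultimately show "v \<in> (SIGMA t:cover_tuples r l (p - 1). section_expos r l a t)"
      using v by (simp add: section_expos_eq)
  qed
  moreover have "Poly_Mapping.lookup c (t, e) = cech_d b t e" if t: "t \<in> cover_tuples r l p" for t e
  proof (cases "e \<in> Ex")
    case True
    have "cech_d b t e = lcech (B e) t" unfolding cech_d_eq lb
      using t True p by (intro lcech_cong) (auto simp: bf_def cover_tuples_eq)
    then show ?thesis using B[OF True] t by (simp add: cover_tuples_eq)
  next
    case False
    then have "Poly_Mapping.lookup c (t, e) = 0" by (force simp: Ex_def in_keys_iff)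
    moreover have "cech_d b t e = 0" using False by (simp add: cech_d_eq lb bf_def lcech_zero)
    ultimately show ?thesis by simp
  qed
  ultimately show "c \<in> coboundaries r l a p" using p cc by (auto simp: coboundaries_def)
next
  fix c :: "'k cochain" assume "c \<in> coboundaries r l a p"
  then obtain b where cb: "c \<in> cochains r l a p"
    "\<forall>t\<in>cover_tuples r l p. \<forall>e. Poly_Mapping.lookup c (t, e) = cech_d b t e"
    using p by (auto simp: coboundaries_def)
  have "cech_d c t e = 0" if t: "t \<in> cover_tuples r l (p + 1)" for t e
  proof -
    have "cech_d c t e = lcech (lcech (\<lambda>s. Poly_Mapping.lookup b (s, e))) t"
      unfolding cech_d_eq using t cb(2) by (intro lcech_cong) (auto simp: cover_tuples_eq cech_d_eq)
    then show ?thesis by (simp add: lcech_lcech)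
  qed
  then show "c \<in> cocycles r l a p" using cb by (simp add: cocycles_def)
qed

text \<open>A cocycle in degree 0 has the same coefficients on every chart. A negative exponent is
  impossible, because some chart does not invert that variable.\<close>

lemma cocycles_0:
  assumes c: "(c :: 'k::field cochain) \<in> cocycles r l a 0"
  shows "I \<in> verts \<Longrightarrow> I' \<in> verts \<Longrightarrow> Poly_Mapping.lookup c ([I], e) = Poly_Mapping.lookup c ([I'], e)"
    and "Poly_Mapping.lookup c (t, e) \<noteq> 0 \<Longrightarrow> e \<in> degs a \<and> negs e = {} \<and> (\<exists>I\<in>verts. t = [I])"
proof -
  show const: "Poly_Mapping.lookup c ([I], e) = Poly_Mapping.lookup c ([I'], e)" if "I \<in> verts" "I' \<in> verts" for I I' e
  proof -
    have "[I', I] \<in> cover_tuples r l (0 + 1)" using that by (simp add: cover_tuples_eq)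
    then have "cech_d c [I', I] e = 0" using c unfolding cocycles_def by blast
    then show ?thesis by (simp add: cech_d_eq lcech_Cons)
  qed
  have ck: "t \<in> cover_tuples r l 0 \<and> e \<in> degs a \<and> covers (negs e) t" if "Poly_Mapping.lookup c (t, e) \<noteq> 0" for t e
    using that c unfolding cocycles_def cochains_def section_expos_eq by (auto simp: in_keys_iff subset_iff)
  assume nz: "Poly_Mapping.lookup c (t, e) \<noteq> 0"
  then obtain I where I: "t = [I]" "I \<in> verts" using ck[OF nz] by (auto simp: cover_tuples_eq length_Suc_conv)
  have "negs e = {}"
  proof (rule ccontr)
    assume "negs e \<noteq> {}"
    then obtain i j where ij: "(i, j) \<in> negs e" by auto
    then have i: "i \<in> {1..r}" using negs_subset[of e a] ck[OF nz] by auto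
    \<comment> \<open>A chart whose index in group \<open>i\<close> differs from \<open>j\<close>;
      index 1 exists because \<open>l i\<close> is positive.\<close>
    define I' where "I' = (\<lambda>k\<in>{1..r}. if k = i \<and> j = 0 then 1 else 0 :: nat)"
    have I': "I' \<in> verts" using l_pos by (auto simp: I'_def verts_def Suc_le_eq)
    have "Poly_Mapping.lookup c ([I'], e) \<noteq> 0" using const[OF I' I(2)] nz I by simp
    then have "covers (negs e) [I']" using ck by blast
    then have "I' i = j" using ij by (auto simp: covers_def)
    then show False using i by (auto simp: I'_def split: if_splits)
  qed
  then show "e \<in> degs a \<and> negs e = {} \<and> (\<exists>I\<in>verts. t = [I])" using ck[OF nz] I by blast
qed

definition sections :: "(nat \<Rightarrow> int) \<Rightarrow> lexpo set" where "sections a = {e \<in> degs a. negs e = {}}"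

text \<open>Homogenization: the exponent of coordinate 0 is the slack \<open>m k\<close> minus the
  degree in the affine variables.\<close>

lemma bij_sections:
  assumes m: "\<And>k. k \<in> {1..r} \<Longrightarrow> m k \<ge> 0"
  shows "\<exists>F. bij_betw F (bez_index r l m) (sections m)"
proof -
  define f where "f \<alpha> = (\<lambda>(k, j). if k \<in> {1..r} \<and> j = 0 then m k - int (\<Sum>j=1..l k. Poly_Mapping.lookup \<alpha> (k, j))
     else if (k, j) \<in> aff_vars then int (Poly_Mapping.lookup \<alpha> (k, j)) else 0)" for \<alpha> :: expo
  define g where "g e = (\<lambda>v. if v \<in> aff_vars then nat (Poly_Mapping.lookup e v) else 0)" for e :: lexpo
  define F where "F \<alpha> = Abs_poly_mapping (f \<alpha>)" for \<alpha>
  define H where "H e = Abs_poly_mapping (g e)" for e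
  have fin: "finite (hom_vars r l)" "finite aff_vars" by (auto simp: hom_vars_def aff_vars_def)
  have lF: "Poly_Mapping.lookup (F \<alpha>) = f \<alpha>" for \<alpha> unfolding F_def
  proof (rule lookup_Abs_poly_mapping_finite[OF fin(1)])
    show "f \<alpha> v = 0" if "v \<notin> hom_vars r l" for v
      using that by (cases v) (auto simp: f_def hom_vars_def aff_vars_def)
  qed
  have lH: "Poly_Mapping.lookup (H e) = g e" for e unfolding H_def
    by (rule lookup_Abs_poly_mapping_finite[OF fin(2)]) (simp add: g_def)
  have split0: "(\<Sum>j=0..l k. h j) = h 0 + (\<Sum>j=1..l k. h j)" for h :: "nat \<Rightarrow> int" and k
    by (simp add: sum.atLeast_Suc_atMost)
  have nonneg: "Poly_Mapping.lookup e v \<ge> 0" if "e \<in> sections m" for e v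
    using that unfolding sections_def negs_def by (metis (mono_tags, lifting) empty_iff mem_Collect_eq not_le)
  have "bij_betw F (bez_index r l m) (sections m)"
  proof (rule bij_betw_byWitness[where f'=H])
    show "\<forall>\<alpha>\<in>bez_index r l m. H (F \<alpha>) = \<alpha>"
    proof
      fix \<alpha> assume \<alpha>: "\<alpha> \<in> bez_index r l m"
      show "H (F \<alpha>) = \<alpha>"
      proof (rule poly_mapping_eqI)
        fix v show "Poly_Mapping.lookup (H (F \<alpha>)) v = Poly_Mapping.lookup \<alpha> v"
        proof (cases "v \<in> aff_vars")
          case True
          then show ?thesis unfolding lH g_def lF f_def by (cases v) (auto simp: aff_vars_def)
        next
          case False
          then have "v \<notin> Poly_Mapping.keys \<alpha>" using \<alpha> unfolding bez_index_def aff_vars_def by blast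
          then show ?thesis using False unfolding lH g_def by (simp add: in_keys_iff)
        qed
      qed
    qed
    show "\<forall>e\<in>sections m. F (H e) = e"
    proof
      fix e assume e: "e \<in> sections m"
      show "F (H e) = e"
      proof (rule poly_mapping_eqI)
        fix v :: var
        obtain k j where v: "v = (k, j)" by (cases v)
        consider "k \<in> {1..r}" "j = 0" | "(k, j) \<in> aff_vars" | "(k, j) \<notin> hom_vars r l"
          by (cases "j = 0"; cases "k \<in> {1..r}"; cases "j \<le> l k") (auto simp: aff_vars_def hom_vars_def)
        then show "Poly_Mapping.lookup (F (H e)) v = Poly_Mapping.lookup e v"
        proof cases
          case 1
          have "int (\<Sum>j=1..l k. Poly_Mapping.lookup (H e) (k, j)) = (\<Sum>j=1..l k. Poly_Mapping.lookup e (k, j))"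
            unfolding of_nat_sum lH g_def using 1 nonneg[OF e] by (intro sum.cong) (auto simp: aff_vars_def)
          moreover have "(\<Sum>j=0..l k. Poly_Mapping.lookup e (k, j)) = m k" using e 1 by (simp add: sections_def degs_def)
          ultimately show ?thesis using 1 unfolding lF f_def v split0 by simp
        next
          case 2
          then show ?thesis using nonneg[OF e] unfolding lF f_def v lH g_def by (auto simp: aff_vars_def)
        next
          case 3
          then have "v \<notin> Poly_Mapping.keys e" using e unfolding v sections_def degs_def by blast
          then show ?thesis using 3 unfolding lF f_def v by (auto simp: in_keys_iff aff_vars_def hom_vars_def)
        qed
      qed
    qed
    show "F ` bez_index r l m \<subseteq> sections m"
    proof (rule image_subsetI)
      fix \<alpha> assume \<alpha>: "\<alpha> \<in> bez_index r l m"
      have le: "int (\<Sum>j=1..l k. Poly_Mapping.lookup \<alpha> (k, j)) \<le> m k" if "k \<in> {1..r}" for k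
        using \<alpha> that unfolding bez_index_def by blast
      have "Poly_Mapping.keys (F \<alpha>) \<subseteq> hom_vars r l"
      proof
        fix v assume "v \<in> Poly_Mapping.keys (F \<alpha>)"
        then have "f \<alpha> v \<noteq> 0" by (simp add: in_keys_iff lF)
        then show "v \<in> hom_vars r l" by (cases v) (auto simp: f_def hom_vars_def aff_vars_def split: if_splits)
      qed
      moreover have "(\<Sum>j=0..l i. Poly_Mapping.lookup (F \<alpha>) (i, j)) = m i" if i: "i \<in> {1..r}" for i
      proof -
        have "(\<Sum>j=1..l i. Poly_Mapping.lookup (F \<alpha>) (i, j)) = int (\<Sum>j=1..l i. Poly_Mapping.lookup \<alpha> (i, j))"
          unfolding of_nat_sum lF f_def using i by (intro sum.cong) (auto simp: aff_vars_def)
        moreover have "Poly_Mapping.lookup (F \<alpha>) (i, 0) = m i - int (\<Sum>j=1..l i. Poly_Mapping.lookup \<alpha> (i, j))"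
          using i by (simp add: lF f_def)
        ultimately show ?thesis unfolding split0 by simp
      qed
      moreover have "negs (F \<alpha>) = {}"
        using le unfolding negs_def lF f_def by (fastforce split: if_splits)
      ultimately show "F \<alpha> \<in> sections m" by (simp add: sections_def degs_def)
    qed
    show "H ` sections m \<subseteq> bez_index r l m"
    proof (rule image_subsetI)
      fix e assume e: "e \<in> sections m"
      have "Poly_Mapping.keys (H e) \<subseteq> aff_vars"
      proof
        fix v assume "v \<in> Poly_Mapping.keys (H e)"
        then have "g e v \<noteq> 0" by (simp add: in_keys_iff lH)
        then show "v \<in> aff_vars" by (simp add: g_def split: if_splits)
      qed
      moreover have "int (\<Sum>j = 1..l i. Poly_Mapping.lookup (H e) (i, j)) \<le> m i" if i: "i \<in> {1..r}" for i
      proof -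
        have "int (\<Sum>j=1..l i. Poly_Mapping.lookup (H e) (i, j)) = (\<Sum>j=1..l i. Poly_Mapping.lookup e (i, j))"
          unfolding of_nat_sum lH g_def using i nonneg[OF e] by (intro sum.cong) (auto simp: aff_vars_def)
        also have "\<dots> \<le> (\<Sum>j=0..l i. Poly_Mapping.lookup e (i, j))" unfolding split0 using nonneg[OF e] by simp
        also have "\<dots> = m i" using e i by (simp add: sections_def degs_def)
        finally show ?thesis .
      qed
      ultimately show "H e \<in> bez_index r l m" unfolding bez_index_def aff_vars_def by blast
    qed
  qed
  then show ?thesis by blast
qed

text \<open>All summands with \<open>p > 0\<close> vanish, and \<open>p = 0\<close> occurs once.
  What is left is the space of global sections, with the homogenized monomials as basis.\<close>

theorem K0_dim_eq: "K0_dim TYPE('k::field_char_0) r l d (deg_vec r l d \<pi>) = card bez_cols"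
proof -
  let ?s = "\<lambda>c::'k. Poly_Mapping.map (Poly_Mapping.map ((*) c)) :: ((nat \<times> nat) \<Rightarrow>\<^sub>0 'k cochain) \<Rightarrow> _"
  let ?m = "deg_vec r l d \<pi>"
  let ?V = "K0_sum (cocycles r l) n d ?m :: ((nat \<times> nat) \<Rightarrow>\<^sub>0 'k cochain) set"
  let ?W = "K0_sum (coboundaries r l) n d ?m :: ((nat \<times> nat) \<Rightarrow>\<^sub>0 'k cochain) set"
  let ?E = "sections ?m"
  define I0 where "I0 = (\<lambda>k\<in>{1..r}. 0 :: nat)"
  have I0: "I0 \<in> verts" by (auto simp: I0_def verts_def)
  \<comment> \<open>Reading a section on the chart of the coordinates 0 loses nothing, as its
    coefficients agree on all charts.\<close>
  define L where "L z e = Poly_Mapping.lookup (Poly_Mapping.lookup z (0, 0)) ([I0], e)" for z :: "(nat \<times> nat) \<Rightarrow>\<^sub>0 'k cochain" and e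
  \<comment> \<open>The global section given by the monomial \<open>e\<close>: the same coefficient
    on every chart.\<close>
  define zc where "zc e = (\<Sum>I\<in>verts. Poly_Mapping.single ([I], e) (1::'k))" for e :: lexpo
  obtain F where F: "bij_betw F (bez_index r l ?m) ?E" using bij_sections[of ?m] deg_vec_nonneg(1) by blast
  have finE: "finite ?E" using F finite_bez_index bij_betw_finite by blast
  have lzc: "Poly_Mapping.lookup (zc e) (t, e') = (if e' = e \<and> (\<exists>I\<in>verts. t = [I]) then 1 else 0)" for e t e'
  proof -
    have "Poly_Mapping.lookup (zc e) (t, e') = (\<Sum>I\<in>verts. if t = [I] \<and> e' = e then 1 else 0)"
      unfolding zc_def lookup_sum by (intro sum.cong refl) (auto simp: lookup_single when_def)
    also have "\<dots> = (if e' = e \<and> (\<exists>I\<in>verts. t = [I]) then 1 else 0)"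
    proof (cases "e' = e \<and> (\<exists>I\<in>verts. t = [I])")
      case True
      then obtain I where I: "I \<in> verts" "t = [I]" by blast
      have "(\<Sum>I'\<in>verts. if t = [I'] \<and> e' = e then 1 else 0) = (\<Sum>I'\<in>verts. if I' = I then (1::'k) else 0)"
        using I True by (intro sum.cong) auto
      then show ?thesis using I True finite_verts by simp
    qed (auto intro!: sum.neutral)
    finally show ?thesis .
  qed
  have zc_cocycle: "zc e \<in> cocycles r l ?m 0" if e: "e \<in> ?E" for e
  proof -
    have "zc e \<in> cochains r l ?m 0" unfolding cochains_def
    proof (intro CollectI subsetI)
      fix v assume "v \<in> Poly_Mapping.keys (zc e)"
      then obtain I where "v = ([I], e)" "I \<in> verts" by (cases v) (auto simp: in_keys_iff lzc split: if_splits)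
      then show "v \<in> (SIGMA t:cover_tuples r l 0. section_expos r l ?m t)"
        using e by (auto simp: cover_tuples_eq section_expos_eq sections_def covers_def)
    qed
    moreover have "cech_d (zc e) t e' = 0" if "t \<in> cover_tuples r l (0 + 1)" for t e'
    proof -
      have t: "length t = Suc (Suc 0)" "set t \<subseteq> verts" using that by (auto simp: cover_tuples_eq)
      then obtain I I' where "t = [I, I']" by (auto simp: length_Suc_conv)
      moreover have "I \<in> verts" "I' \<in> verts" using t calculation by auto
      ultimately have "t = [I, I']" "I \<in> verts" "I' \<in> verts" by blast+
      then show ?thesis by (simp add: cech_d_eq lcech_Cons lzc)
    qed
    ultimately show ?thesis unfolding cocycles_def by blast
  qed
  have WV: "coboundaries r l (\<lambda>k. ?m k - int p * int (d k)) p \<subseteq> (cocycles r l (\<lambda>k. ?m k - int p * int (d k)) p :: 'k cochain set)" for p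
    using cocycles_eq_coboundaries[of p] linear_closed_cocycles[of r l "\<lambda>k. ?m k - int p * int (d k)" p]
    by (cases "p = 0") (auto simp: coboundaries_def linear_closed_def)
  have "quot_dim ?s ?V ?W = card ?E"
  proof (rule quot_dim_eq[where L=L and z="\<lambda>e. Poly_Mapping.single (0, 0) (zc e)"])
    show "vector_space ?s" by (rule vector_space_K0)
    show "module.subspace ?s ?V" by (rule subspace_K0_sum[OF linear_closed_cocycles])
    show "module.subspace ?s ?W" by (rule subspace_K0_sum[OF linear_closed_coboundaries])
    show "?W \<subseteq> ?V" unfolding K0_sum_def
    proof (intro subsetI CollectI allI)
      fix z p i assume "z \<in> {z. \<forall>p i. Poly_Mapping.lookup z (p, i) \<in> (if p \<le> n + 1 \<and> i < (n + 1) choose p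
            then coboundaries r l (\<lambda>k. ?m k - int p * int (d k)) p else {0 :: 'k cochain})}"
      then have "Poly_Mapping.lookup z (p, i) \<in> (if p \<le> n + 1 \<and> i < (n + 1) choose p
            then coboundaries r l (\<lambda>k. ?m k - int p * int (d k)) p else {0})" by blast
      then show "Poly_Mapping.lookup z (p, i) \<in> (if p \<le> n + 1 \<and> i < (n + 1) choose p
            then cocycles r l (\<lambda>k. ?m k - int p * int (d k)) p else {0})"
        using WV[of p] by (auto split: if_splits)
    qed
    show "finite ?E" by (rule finE)
    show "L (x + y) e = L x e + L y e" for x y e by (simp add: L_def lookup_add)
    show "L (?s c x) e = c * L x e" for c x e by (simp add: L_def lookup_map_map_times lookup_map_times)
    show "(\<forall>e\<in>?E. L x e = 0) \<longleftrightarrow> x \<in> ?W" if x: "x \<in> ?V" for x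
    proof
      have xV: "Poly_Mapping.lookup x (p, i) \<in> (if p \<le> n + 1 \<and> i < (n + 1) choose p
            then cocycles r l (\<lambda>k. ?m k - int p * int (d k)) p else {0})" for p i
        using x unfolding K0_sum_def by blast
      assume L: "\<forall>e\<in>?E. L x e = 0"
      have c0: "Poly_Mapping.lookup x (0, 0) \<in> cocycles r l ?m 0" using xV[of 0 0] by simp
      have "Poly_Mapping.lookup x (0, 0) = 0"
      proof (rule poly_mapping_eqI, rule ccontr)
        fix te assume nz: "Poly_Mapping.lookup (Poly_Mapping.lookup x (0, 0)) te \<noteq> Poly_Mapping.lookup 0 te"
        obtain t e where te: "te = (t, e)" by (cases te)
        from cocycles_0(2)[OF c0, of t e] nz te obtain I where I: "e \<in> ?E" "I \<in> verts" "t = [I]"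
          by (auto simp: sections_def)
        then have "L x e \<noteq> 0" using cocycles_0(1)[OF c0 I(2) I0, of e] nz te by (simp add: L_def)
        then show False using L I by blast
      qed
      then show "x \<in> ?W" unfolding K0_sum_def
      proof (intro CollectI allI)
        fix p i
        show "Poly_Mapping.lookup x (p, i) \<in> (if p \<le> n + 1 \<and> i < (n + 1) choose p
            then coboundaries r l (\<lambda>k. ?m k - int p * int (d k)) p else {0})"
        proof (cases "p = 0")
          case True
          then show ?thesis using xV[of p i] \<open>Poly_Mapping.lookup x (0, 0) = 0\<close> by (cases "i = 0") (auto simp: coboundaries_def)
        next
          case False
          then have "cocycles r l (\<lambda>k. ?m k - int p * int (d k)) p = (coboundaries r l (\<lambda>k. ?m k - int p * int (d k)) p :: 'k cochain set)"
            by (intro cocycles_eq_coboundaries) auto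
          then show ?thesis using xV[of p i] by (simp only:)
        qed
      qed
    next
      assume "x \<in> ?W"
      then have "Poly_Mapping.lookup x (0, 0) \<in> (if 0 \<le> n + 1 \<and> 0 < (n + 1) choose 0
            then coboundaries r l (\<lambda>k. ?m k - int 0 * int (d k)) 0 else {0})" unfolding K0_sum_def by blast
      then have "Poly_Mapping.lookup x (0, 0) = 0" by (simp add: coboundaries_def)
      then show "\<forall>e\<in>?E. L x e = 0" by (simp add: L_def)
    qed
    show "Poly_Mapping.single (0, 0) (zc e) \<in> ?V" if e: "e \<in> ?E" for e
      unfolding K0_sum_def
    proof (intro CollectI allI)
      fix p i
      have "0 \<in> (cocycles r l (\<lambda>k. ?m k - int p * int (d k)) p :: 'k cochain set)"
        using linear_closed_cocycles unfolding linear_closed_def by blast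
      then show "Poly_Mapping.lookup (Poly_Mapping.single (0, 0) (zc e)) (p, i) \<in> (if p \<le> n + 1 \<and> i < (n + 1) choose p
            then cocycles r l (\<lambda>k. ?m k - int p * int (d k)) p else {0})"
        using zc_cocycle[OF e] by (cases "(p, i) = (0, 0)") (auto simp: lookup_single when_def)
    qed
    show "L (Poly_Mapping.single (0, 0) (zc e)) e' = (if e = e' then 1 else 0)" for e e'
      using I0 by (auto simp: L_def lzc)
  qed
  also have "card ?E = card bez_cols" using bij_betw_same_card[OF F] by (simp add: bez_cols_def)
  finally show ?thesis unfolding K0_dim_def n_eq .
qed

end

subsection \<open>Homogeneity in blocks of variables\<close>

definition block_deg :: "nat \<Rightarrow> ((nat \<times> 'b) \<Rightarrow>\<^sub>0 nat) \<Rightarrow> nat" where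
  "block_deg j \<mu> = (\<Sum>g\<in>Poly_Mapping.keys \<mu>. if fst g = j then Poly_Mapping.lookup \<mu> g else 0)"

text \<open>The coefficients of form \<open>j\<close> are multiplied by an indeterminate. A
  polynomial \<open>p\<close> is homogeneous of degree \<open>e\<close> in block \<open>j\<close>
  when the result is \<open>monom p e\<close>, a condition that passes to products and
  factors.\<close>

definition block_scale :: "nat \<Rightarrow> (((nat \<times> 'b) \<Rightarrow>\<^sub>0 nat) \<Rightarrow>\<^sub>0 'a::comm_ring_1) \<Rightarrow> (((nat \<times> 'b) \<Rightarrow>\<^sub>0 nat) \<Rightarrow>\<^sub>0 'a) poly" where
  "block_scale j = mp_eval (\<lambda>c. [:Poly_Mapping.single 0 c:]) (\<lambda>g. monom (Var g) (if fst g = j then 1 else 0))"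

lemma comm_ring_hom_block_scale: "comm_ring_hom (block_scale j)"
  unfolding block_scale_def by (intro comm_ring_hom_mp_eval comm_ring_hom_as_poly_const)

lemma prod_monom: "finite S \<Longrightarrow> (\<Prod>g\<in>S. monom (a g) (e g)) = monom (\<Prod>g\<in>S. a g) (\<Sum>g\<in>S. e g)"
  for a :: "'v \<Rightarrow> 'a::comm_ring_1"
  by (induction S rule: finite_induct) (auto simp: mult_monom)

lemma block_scale_eq:
  "block_scale j p = (\<Sum>\<mu>\<in>Poly_Mapping.keys p. monom (Poly_Mapping.single \<mu> (Poly_Mapping.lookup p \<mu>)) (block_deg j \<mu>))"
  for p :: "((nat \<times> 'b) \<Rightarrow>\<^sub>0 nat) \<Rightarrow>\<^sub>0 'a::comm_ring_1"
proof -
  have "mono_ev (\<lambda>g. monom (Var g) (if fst g = j then 1 else 0)) \<mu> = monom (Poly_Mapping.single \<mu> (1::'a)) (block_deg j \<mu>)"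
    for \<mu> :: "(nat \<times> 'b) \<Rightarrow>\<^sub>0 nat"
  proof -
    have "mono_ev (\<lambda>g. monom (Var g) (if fst g = j then 1 else 0)) \<mu> =
        monom (mono_ev Var \<mu> :: ((nat \<times> 'b) \<Rightarrow>\<^sub>0 nat) \<Rightarrow>\<^sub>0 'a) (block_deg j \<mu>)"
      unfolding mono_ev_def monom_power block_deg_def
      by (subst prod_monom) (auto intro!: arg_cong2[where f=monom] sum.cong)
    then show ?thesis by (simp add: mono_ev_Var)
  qed
  then show ?thesis unfolding block_scale_def mp_eval_eq pm_hom_def
    by (intro sum.cong refl) (simp add: smult_monom mult_single)
qed

lemma block_scale_eq_monom:
  assumes "block_scale j p = monom p e" "\<mu> \<in> Poly_Mapping.keys p" shows "block_deg j \<mu> = e"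
proof (rule ccontr)
  assume ne: "block_deg j \<mu> \<noteq> e"
  have "Poly_Mapping.lookup (coeff (block_scale j p) e) \<mu> =
      (\<Sum>\<nu>\<in>Poly_Mapping.keys p. if \<nu> = \<mu> \<and> block_deg j \<nu> = e then Poly_Mapping.lookup p \<nu> else 0)"
    unfolding block_scale_eq coeff_sum lookup_sum
    by (intro sum.cong refl) (auto simp: lookup_single when_def)
  also have "\<dots> = 0" using ne by (intro sum.neutral) auto
  finally show False using assms by (simp add: in_keys_iff)
qed

lemma poly_block_scale: "poly (block_scale j p) 1 = p"
  unfolding block_scale_eq by (simp add: poly_sum poly_monom poly_mapping_sum_single[symmetric])

text \<open>Degree and order at 0 are both additive, and the order never exceeds the degree. For a
  monomial they coincide, so they coincide for each factor.\<close>

lemma monom_mult_decomp: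
  fixes p q :: "'a::idom poly"
  assumes "p * q = monom c m" "c \<noteq> 0"
  shows "\<exists>a i b j. p = monom a i \<and> q = monom b j \<and> i + j = m"
proof -
  have nz: "p \<noteq> 0" "q \<noteq> 0" using assms by auto
  have "order 0 (monom c m) = m"
  proof (rule order_unique_lemma)
    show "[:- 0, 1:] ^ m dvd monom c m" by (simp add: monom_altdef dvd_smult)
    show "\<not> [:- 0, 1:] ^ Suc m dvd monom c m"
    proof
      assume "[:- 0, 1:] ^ Suc m dvd monom c m"
      then have "degree ([:0, 1:] ^ Suc m :: 'a poly) \<le> degree (monom c m)"
        using assms(2) by (intro dvd_imp_degree_le) auto
      then show False using assms(2) by (simp add: degree_power_eq degree_monom_eq del: power_Suc)
    qed
  qed
  then have "order 0 p + order 0 q = m" using assms nz by (metis order_mult no_zero_divisors)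
  moreover have "degree p + degree q = m" using assms nz degree_mult_eq degree_monom_eq by metis
  moreover have "order 0 p \<le> degree p" "order 0 q \<le> degree q" using nz order_degree by auto
  ultimately have o: "order 0 p = degree p" "order 0 q = degree q" "degree p + degree q = m" by linarith+
  have mon: "\<exists>a. x = monom a (degree x)" if "x \<noteq> 0" "order 0 x = degree x" for x :: "'a poly"
  proof -
    have "[:0, 1:] ^ degree x dvd x" using order_1[of 0 x] that by simp
    then obtain y where y: "x = [:0, 1:] ^ degree x * y" by (auto elim: dvdE)
    then have "y \<noteq> 0" using that by auto
    then have "degree x = degree x + degree y" using arg_cong[OF y, of degree] by (simp add: degree_mult_eq degree_power_eq)
    then obtain a where "y = [:a:]" by (auto elim: degree_eq_zeroE)
    then have "x = monom a (degree x)" using y by (simp add: monom_altdef)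
    then show ?thesis by blast
  qed
  show ?thesis using mon[OF nz(1) o(1)] mon[OF nz(2) o(2)] o(3) by blast
qed

text \<open>Factors of a homogeneous polynomial are homogeneous; setting the indeterminate to 1
  identifies the leading coefficients with the factors themselves.\<close>

lemma block_scale_factor:
  fixes R Q :: "((nat \<times> 'b::linorder) \<Rightarrow>\<^sub>0 nat) \<Rightarrow>\<^sub>0 'a::idom"
  assumes "block_scale j (R * Q) = monom (R * Q) m" "R * Q \<noteq> 0"
  shows "\<exists>a e. block_scale j R = monom R a \<and> block_scale j Q = monom Q e \<and> a + e = m"
proof -
  interpret comm_ring_hom "block_scale j :: (((nat \<times> 'b) \<Rightarrow>\<^sub>0 nat) \<Rightarrow>\<^sub>0 'a) \<Rightarrow> _" by (rule comm_ring_hom_block_scale)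
  obtain x a y e where *: "block_scale j R = monom x a" "block_scale j Q = monom y e" "a + e = m"
    using monom_mult_decomp[of "block_scale j R" "block_scale j Q" "R * Q" m] assms by (auto simp: hom_mult)
  have "x = R" "y = Q" using poly_block_scale[of j R] poly_block_scale[of j Q] * by (auto simp: poly_monom)
  then show ?thesis using * by blast
qed

lemma degree_mp_eval_le:
  fixes C :: "nat \<times> 'b \<Rightarrow> 'k::idom poly" and p :: "((nat \<times> 'b) \<Rightarrow>\<^sub>0 nat) \<Rightarrow>\<^sub>0 int"
  assumes C: "\<And>g. degree (C g) \<le> (if fst g = j then 1 else 0)" and p: "\<And>\<mu>. \<mu> \<in> Poly_Mapping.keys p \<Longrightarrow> block_deg j \<mu> \<le> a"
  shows "degree (mp_eval of_int C p) \<le> a"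
  unfolding mp_eval_eq pm_hom_def
proof (rule degree_sum_le)
  fix \<mu> assume \<mu>: "\<mu> \<in> Poly_Mapping.keys p"
  have "degree (mono_ev C \<mu>) \<le> (\<Sum>g\<in>Poly_Mapping.keys \<mu>. degree (C g ^ Poly_Mapping.lookup \<mu> g))"
    unfolding mono_ev_def using degree_prod_sum_le[of "Poly_Mapping.keys \<mu>" "\<lambda>g. C g ^ Poly_Mapping.lookup \<mu> g"] by (simp add: comp_def)
  also have "\<dots> \<le> block_deg j \<mu>" unfolding block_deg_def
  proof (rule sum_mono)
    fix g
    have "degree (C g ^ Poly_Mapping.lookup \<mu> g) \<le> degree (C g) * Poly_Mapping.lookup \<mu> g" by (rule degree_power_le)
    also have "\<dots> \<le> (if fst g = j then 1 else 0) * Poly_Mapping.lookup \<mu> g" by (intro mult_right_mono C) auto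
    finally show "degree (C g ^ Poly_Mapping.lookup \<mu> g) \<le> (if fst g = j then Poly_Mapping.lookup \<mu> g else 0)" by (simp split: if_splits)
  qed
  also have "\<dots> \<le> a" by (rule p[OF \<mu>])
  finally have "degree (mono_ev C \<mu>) \<le> a" .
  moreover have "degree (of_int (Poly_Mapping.lookup p \<mu>) :: 'k poly) = 0" by (simp add: of_int_poly)
  ultimately show "degree (of_int (Poly_Mapping.lookup p \<mu>) * mono_ev C \<mu>) \<le> a"
    using degree_mult_le[of "of_int (Poly_Mapping.lookup p \<mu>)" "mono_ev C \<mu>"] by simp
qed simp

subsection \<open>Comparison with the resultant\<close>

definition slot_code :: "nat \<times> nat \<times> nat \<Rightarrow> nat" where
  "slot_code x = prod_encode (fst x, prod_encode (snd x))"

lemma slot_code_inj: "slot_code x = slot_code y \<longleftrightarrow> x = y"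
  by (auto simp: slot_code_def prod_eq_iff)

context multihom begin

text \<open>Distinct powers of the indeterminate as roots: their differences have a coefficient 1
  and hence are divisible by no prime. Integers would not do, since they may become equal modulo a
  small prime.\<close>

lemma split_system_int_poly: "j0 \<le> n \<Longrightarrow> split_system r n l d \<pi> j0 (\<lambda>x. monom (1::int) (slot_code x))"
  by unfold_locales (auto simp: inj_on_def monom_eq_iff' slot_code_inj)

lemma split_system_field: "j0 \<le> n \<Longrightarrow> split_system r n l d \<pi> j0 (\<lambda>x. of_nat (slot_code x) :: 'k::field_char_0)"
  by unfold_locales (auto simp: inj_on_def slot_code_inj)

end

context zero_defect begin

lemma bez_squareI:
  "distinct \<alpha>s \<Longrightarrow> set \<alpha>s = bez_rows \<Longrightarrow> distinct \<beta>s \<Longrightarrow> set \<beta>s = bez_cols \<Longrightarrow> bez_square r n l d \<pi> \<alpha>s \<beta>s"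
  by unfold_locales (auto simp: card_bez_eq distinct_card[symmetric])

end

locale resultant_comparison = zero_defect r n l d \<pi> + bez_square r n l d \<pi> \<alpha>s \<beta>s
  for r n :: nat and l d \<pi> :: "nat \<Rightarrow> nat" and \<alpha>s \<beta>s :: "expo list" +
  fixes K :: "'k::{alg_closed_field, field_char_0} itself" and R :: coef_ring
  assumes multires: "is_multires K r l d R"
begin

lemma card_J: "j0 \<le> n \<Longrightarrow> card ({0..n} - {j0}) = n"
  by simp

lemma bez_splitI:
  assumes "split_system r n l d \<pi> j0 (\<tau> :: _ \<Rightarrow> 'b::idom)" shows "bez_split r n l d \<pi> j0 \<tau> \<alpha>s \<beta>s"
proof -
  interpret split_system r n l d \<pi> j0 \<tau> by fact
  have "card (choices J) = N"
    using card_choices_eq[of J] card_J[OF j0] finite_J rows distinct_card[of \<alpha>s] by (simp add: J_def)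
  then show ?thesis by unfold_locales
qed

lemma D_not_dvd_prime:
  assumes p: "prime (p :: int)" shows "\<not> Poly_Mapping.single 0 p dvd D"
proof
  assume "Poly_Mapping.single 0 p dvd D"
  then obtain D' where D': "D = Poly_Mapping.single 0 p * D'" by (auto elim: dvdE)
  let ?\<tau> = "\<lambda>x :: nat \<times> nat \<times> nat. monom (1::int) (slot_code x)"
  interpret S: bez_split r n l d \<pi> 0 ?\<tau> \<alpha>s \<beta>s
    by (rule bez_splitI[OF split_system_int_poly]) simp
  have hom: "comm_ring_hom (mp_eval (\<lambda>c::int. [:c:]) S.cf :: coef_ring \<Rightarrow> int poly)"
    by (rule comm_ring_hom_mp_eval[OF comm_ring_hom_const_poly])
  interpret h: comm_ring_hom "mp_eval (\<lambda>c::int. [:c:]) S.cf :: coef_ring \<Rightarrow> int poly" by (rule hom)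
  have pe: "prime_elem [:p:]" by (subst prime_elem_const_poly_iff) (rule prime_imp_prime_elem[OF p])
  have "\<exists>u. u * mp_eval (\<lambda>c::int. [:c:]) S.cf D \<in> {x. \<not> [:p:] dvd x}"
  proof (rule S.D_multiple_in[OF hom])
    show "mp_eval (\<lambda>c::int. [:c:]) S.cf (Var g) = S.cf g" for g by (simp add: comm_ring_hom_const_poly)
    show "1 \<in> {x. \<not> [:p:] dvd x}" using prime_elem_not_unit[OF pe] by (intro CollectI)
    show "a * b \<in> {x. \<not> [:p:] dvd x}" if "a \<in> {x. \<not> [:p:] dvd x}" "b \<in> {x. \<not> [:p:] dvd x}" for a b
      using that pe by (simp add: prime_elem_dvd_mult_iff)
    show "?\<tau> a - ?\<tau> b \<in> {x. \<not> [:p:] dvd x}" if "a \<noteq> b" for a b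
    proof
      have ne: "slot_code a \<noteq> slot_code b" using that by (simp add: slot_code_inj)
      show "\<not> [:p:] dvd ?\<tau> a - ?\<tau> b"
      proof
        assume "[:p:] dvd ?\<tau> a - ?\<tau> b"
        then obtain h where "?\<tau> a - ?\<tau> b = [:p:] * h" by (elim dvdE)
        then have "coeff (?\<tau> a - ?\<tau> b) (slot_code a) = p * coeff h (slot_code a)" by simp
        then have "1 = p * coeff h (slot_code a)" using ne by simp
        then show False using p by (metis dvd_triv_left not_prime_unit)
      qed
    qed
  qed
  then obtain u where "\<not> [:p:] dvd u * mp_eval (\<lambda>c::int. [:c:]) S.cf D" by blast
  moreover have "mp_eval (\<lambda>c::int. [:c:]) S.cf D = [:p:] * mp_eval (\<lambda>c::int. [:c:]) S.cf D'"
    unfolding D' h.hom_mult by (simp add: comm_ring_hom_const_poly)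
  ultimately show False by (metis dvd_triv_left dvd_mult)
qed

lemma D_nonzero: "D \<noteq> 0"
  using D_not_dvd_prime[of 2] by auto

text \<open>The characterization of \<open>R\<close> in terms of coefficient functions
  \<open>c\<close>. Values of \<open>c\<close> outside the range of the indeterminates do not
  matter, because \<open>R\<close> involves only \<open>coef_vars\<close>.\<close>

lemma R_zero_iff:
  fixes c :: "nat \<times> expo \<Rightarrow> 'k"
  shows "mp_eval of_int c R = 0 \<longleftrightarrow> (\<exists>z. homogeneous_coords r l z \<and> (\<forall>j\<le>n. ev_form c j (mono_ev z) = 0))"
proof -
  define f where "f j = (\<Sum>\<gamma>\<in>mh_expos r l d. Poly_Mapping.single \<gamma> (c (j, \<gamma>)))" for j
  have lf: "Poly_Mapping.lookup (f j) \<gamma> = (if \<gamma> \<in> mh_expos r l d then c (j, \<gamma>) else 0)" for j \<gamma>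
  proof -
    have "Poly_Mapping.lookup (f j) \<gamma> = (\<Sum>\<gamma>'\<in>mh_expos r l d. if \<gamma>' = \<gamma> then c (j, \<gamma>') else 0)"
      unfolding f_def lookup_sum by (intro sum.cong refl) (auto simp: lookup_single when_def)
    then show ?thesis using finite_mh_expos by simp
  qed
  have kf: "Poly_Mapping.keys (f j) \<subseteq> mh_expos r l d" for j by (auto simp: in_keys_iff lf split: if_splits)
  have "R \<in> polys_in (coef_vars r l d)" using multires by (simp add: is_multires_def polys_in_def)
  then have "mp_eval of_int c R = mp_eval of_int (\<lambda>(j, \<gamma>). Poly_Mapping.lookup (f j) \<gamma>) R"
    by (rule mp_eval_cong_polys_in) (auto simp: coef_vars_def lf)
  moreover have "mp_eval of_int (\<lambda>(j, \<gamma>). Poly_Mapping.lookup (f j) \<gamma>) R = 0 \<longleftrightarrow>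
      (\<exists>z. homogeneous_coords r l z \<and> (\<forall>j\<in>{0..n}. mp_eval (\<lambda>c. c) z (f j) = 0))"
    using multires kf unfolding is_multires_def n_eq by blast
  moreover have "mp_eval (\<lambda>c. c) z (f j) = ev_form c j (mono_ev z)" for z j
  proof -
    have "ev_form (\<lambda>g. Poly_Mapping.lookup (f (fst g)) (snd g)) j (mono_ev z) = mp_eval (\<lambda>c. c) z (f j)"
      by (rule ev_form_lookup[OF comm_ring_hom_ident kf]) simp
    moreover have "ev_form (\<lambda>g. Poly_Mapping.lookup (f (fst g)) (snd g)) j (mono_ev z) = ev_form c j (mono_ev z)"
      by (rule ev_form_cong) (simp add: lf)
    ultimately show ?thesis by simp
  qed
  ultimately show ?thesis by auto
qed

lemma R_dvd_D: "R dvd D"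
proof (rule irreducible_nullstellensatz[where 'k='k])
  show "irreducible R" using multires by (simp add: is_multires_def)
  \<comment> \<open>The zero system vanishes at every point, so \<open>R\<close> has a zero, as the
    divisibility criterion requires.\<close>
  have "mp_eval of_int (\<lambda>_. 0 :: 'k) R = 0"
    unfolding R_zero_iff by (intro exI[of _ "\<lambda>_. 1"]) (auto simp: homogeneous_coords_def ev_form_def)
  then show "\<exists>\<psi> :: nat \<times> expo \<Rightarrow> 'k. mp_eval of_int \<psi> R = 0" by blast
  show "mp_eval of_int \<psi> D = 0" if "mp_eval of_int \<psi> R = 0" for \<psi> :: "nat \<times> expo \<Rightarrow> 'k"
    using that mp_eval_D_root unfolding R_zero_iff by blast
qed

lemma block_scale_D: "block_scale j D = monom D (if j \<le> n then N else 0)"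
proof -
  let ?a = "\<lambda>i. if i = j then [:0, 1:] else 1 :: coef_ring poly"
  have "block_scale j D = (\<Prod>i\<in>{0..<n+1}. ?a i) ^ N * [:D:]"
    by (rule hom_D_scale[OF comm_ring_hom_const_poly comm_ring_hom_block_scale])
      (auto simp: block_scale_def comm_ring_hom_as_poly_const monom_altdef)
  also have "(\<Prod>i\<in>{0..<n+1}. ?a i) = (if j \<le> n then [:0, 1:] else 1)" by (simp add: prod.delta)
  finally show ?thesis by (auto simp: monom_altdef)
qed

lemma block_deg_D: "\<mu> \<in> Poly_Mapping.keys D \<Longrightarrow> block_deg j \<mu> = (if j \<le> n then N else 0)"
  by (rule block_scale_eq_monom[OF block_scale_D])

text \<open>On the line spanned by the \<open>j0\<close>-th form of the split system and a product of linear forms that separates its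
  \<open>N\<close> zeros, the resultant has at least \<open>N\<close> roots.\<close>

lemma block_degree_R:
  assumes j0: "j0 \<le> n" and a: "block_scale j0 R = monom R a" shows "N \<le> a"
proof -
  let ?\<tau> = "\<lambda>x :: nat \<times> nat \<times> nat. of_nat (slot_code x) :: 'k"
  interpret S: bez_split r n l d \<pi> j0 ?\<tau> \<alpha>s \<beta>s by (rule bez_splitI[OF split_system_field[OF j0]])
  \<comment> \<open>The product of the polynomials \<open>gpoly\<close> over all groups. Its value
    at \<open>u\<close> will be the value of the second form \<open>gf\<close> of the line at the
    zero \<open>pt \<kappa>\<close>.\<close>
  define q where "q \<kappa> = (\<Prod>j\<in>S.J. [:- ?\<tau> (j, \<kappa> j), 1:])" for \<kappa> :: "nat \<Rightarrow> nat \<times> nat"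
  have q0: "q \<kappa> \<noteq> 0" for \<kappa> unfolding q_def using S.finite_J by (simp add: prod_zero_iff)
  have polyq: "poly (q \<kappa>) t = (\<Prod>j\<in>S.J. t - ?\<tau> (j, \<kappa> j))" for \<kappa> t by (simp add: q_def poly_prod)
  have q_inj: "q \<kappa> \<noteq> q \<kappa>'" if "\<kappa> \<in> choices S.J" "\<kappa>' \<in> choices S.J" "\<kappa> \<noteq> \<kappa>'" for \<kappa> \<kappa>'
  proof
    assume eq: "q \<kappa> = q \<kappa>'"
    obtain j where j: "j \<in> S.J" "\<kappa> j \<noteq> \<kappa>' j"
    proof (rule ccontr)
      assume "\<not> thesis"
      then have "\<And>j. j \<in> S.J \<Longrightarrow> \<kappa> j = \<kappa>' j" using that by blast
      then show False using \<open>\<kappa> \<noteq> \<kappa>'\<close> PiE_ext[of \<kappa> S.J "\<lambda>_. slots" \<kappa>'] \<open>\<kappa> \<in> choices S.J\<close> \<open>\<kappa>' \<in> choices S.J\<close>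
        by (auto simp: choices_def)
    qed
    have "poly (q \<kappa>) (?\<tau> (j, \<kappa> j)) = 0" unfolding polyq using j S.finite_J by (intro prod_zero) auto
    then have "(\<Prod>j'\<in>S.J. ?\<tau> (j, \<kappa> j) - ?\<tau> (j', \<kappa>' j')) = 0" unfolding eq polyq .
    then obtain j' where "j' \<in> S.J" "?\<tau> (j, \<kappa> j) = ?\<tau> (j', \<kappa>' j')" using S.finite_J by (auto simp: prod_zero_iff)
    then show False using j by (auto simp: slot_code_inj)
  qed
  \<comment> \<open>Outside this finite set the values \<open>v\<close> are nonzero and separate the
    zeros.\<close>
  define Bad where "Bad = (\<Union>\<kappa>\<in>choices S.J. {t. poly (q \<kappa>) t = 0}) \<union>
    (\<Union>\<kappa>\<in>choices S.J. \<Union>\<kappa>'\<in>choices S.J - {\<kappa>}. {t. poly (q \<kappa> - q \<kappa>') t = 0})"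
  have "finite Bad" unfolding Bad_def using S.finite_choices q0 q_inj
    by (intro finite_UnI finite_UN_I finite_Diff poly_roots_finite) auto
  then obtain u where u: "u \<notin> Bad" using ex_new_if_finite[OF infinite_UNIV_char_0] by blast
  define v where "v \<kappa> = poly (q \<kappa>) u" for \<kappa>
  have v0: "v \<kappa> \<noteq> 0" if "\<kappa> \<in> choices S.J" for \<kappa> using u that by (auto simp: Bad_def v_def)
  have v_inj: "inj_on v (choices S.J)"
    using u by (intro inj_onI) (auto simp: Bad_def v_def)
  \<comment> \<open>One linear form with parameter \<open>u\<close> per group; the power of
    coordinate 0, which is 1 at the zeros, fills up the degree to \<open>d k\<close>.\<close>
  define gf where "gf = (\<Prod>k=1..r. linform k u * Poly_Mapping.single (Poly_Mapping.single (k, 0) (d k - 1)) 1)"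
  have keys_gf: "Poly_Mapping.keys gf \<subseteq> mh_expos r l d"
  proof -
    have "mdeg_le (\<lambda>i. \<Sum>k=1..r. (if i = k then 1 else 0) + (if i = k then d k - 1 else 0)) gf"
      unfolding gf_def
    proof (rule mdeg_le_prod)
      fix k assume k: "k \<in> {1..r}"
      have "mdeg_le (\<lambda>i. if i = k then d k - 1 else 0) (Poly_Mapping.single (Poly_Mapping.single (k, 0) (d k - 1)) (1::'k))"
        unfolding mdeg_le_def
      proof (intro ballI conjI)
        fix \<gamma> i assume "\<gamma> \<in> Poly_Mapping.keys (Poly_Mapping.single (Poly_Mapping.single (k, 0::nat) (d k - 1)) (1::'k))"
        then have \<gamma>: "\<gamma> = Poly_Mapping.single (k, 0) (d k - 1)" by simp
        show "Poly_Mapping.keys \<gamma> \<subseteq> hom_vars r l" using k by (auto simp: \<gamma> hom_vars_def split: if_splits)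
        assume "i \<in> {1..r}"
        have "(\<Sum>j = 0..l i. Poly_Mapping.lookup \<gamma> (i, j)) = (\<Sum>j = 0..l i. if j = 0 then (if i = k then d k - 1 else 0) else 0)"
          by (intro sum.cong refl) (auto simp: \<gamma> lookup_single when_def)
        then show "(\<Sum>j = 0..l i. Poly_Mapping.lookup \<gamma> (i, j)) = (if i = k then d k - 1 else 0)" by simp
      qed
      then show "mdeg_le (\<lambda>i. (if i = k then 1 else 0) + (if i = k then d k - 1 else 0))
          (linform k u * Poly_Mapping.single (Poly_Mapping.single (k, 0) (d k - 1)) 1)"
        by (rule mdeg_le_mult[OF mdeg_le_linform[OF k]])
    qed simp
    moreover have "(\<Sum>k=1..r. (if i = k then 1 else 0) + (if i = k then d k - 1 else 0)) = d i" if "i \<in> {1..r}" for i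
      using that d_pos[OF that] by (simp add: sum.distrib)
    ultimately have "mdeg_le d gf" unfolding mdeg_le_def by auto
    then show ?thesis by (rule mdeg_le_keys)
  qed
  have ev_gf: "mp_eval (\<lambda>c. c) (S.pt \<kappa>) gf = v \<kappa>" if \<kappa>: "\<kappa> \<in> choices S.J" for \<kappa>
  proof -
    interpret h: comm_ring_hom "mp_eval (\<lambda>c::'k. c) (S.pt \<kappa>)" by (rule comm_ring_hom_mp_eval[OF comm_ring_hom_ident])
    have "mp_eval (\<lambda>c. c) (S.pt \<kappa>) gf = (\<Prod>k=1..r. poly (S.gpoly \<kappa> k) u)"
      unfolding gf_def h.hom_prod
    proof (intro prod.cong refl)
      fix k assume k: "k \<in> {1..r}"
      have "mp_eval (\<lambda>c. c) (S.pt \<kappa>) (linform k u) = (\<Sum>i=0..l k. u ^ (l k - i) * S.pt \<kappa> (k, i))"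
        unfolding linform_def h.hom_sum by (simp add: mp_eval_eq pm_hom_single)
      also have "\<dots> = poly (S.gpoly \<kappa> k) u" by (rule S.sum_pt[OF \<kappa> k])
      finally show "mp_eval (\<lambda>c. c) (S.pt \<kappa>) (linform k u * Poly_Mapping.single (Poly_Mapping.single (k, 0) (d k - 1)) 1) = poly (S.gpoly \<kappa> k) u"
        using S.pt_0[OF \<kappa> k] by (simp add: h.hom_mult mp_eval_eq[of _ _ "Poly_Mapping.single _ _"] pm_hom_single)
    qed
    also have "\<dots> = (\<Prod>k=1..r. \<Prod>j\<in>{j\<in>S.J. fst (\<kappa> j) = k}. u - ?\<tau> (j, \<kappa> j))" by (simp add: S.poly_gpoly)
    also have "\<dots> = v \<kappa>"
      unfolding v_def polyq using S.slot_fst[OF \<kappa>] S.finite_J by (intro prod.group) auto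
    finally show ?thesis .
  qed
  \<comment> \<open>The line in the space of systems on which form \<open>j0\<close> is 1 plus an
    indeterminate times \<open>gf\<close> on the chart, and the other forms are fixed.\<close>
  define C where "C = (\<lambda>g. [:S.cf g, if fst g = j0 then Poly_Mapping.lookup gf (snd g) else 0:])"
  define P where "P = mp_eval of_int C R"
  have polyP: "poly P t = mp_eval of_int (\<lambda>g. poly (C g) t) R" for t
    unfolding P_def by (simp add: hom_mp_eval[OF comm_ring_hom_poly])
  have "degree P \<le> a" unfolding P_def
    by (rule degree_mp_eval_le[where j=j0]) (auto simp: C_def block_scale_eq_monom[OF a])
  \<comment> \<open>At the start of the line the system is split, so \<open>D\<close> and hence its
    divisor \<open>R\<close> do not vanish, and \<open>P\<close> is not the zero polynomial.\<close>
  have "mp_eval of_int S.cf D \<noteq> 0"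
  proof -
    have "\<exists>w. w * mp_eval of_int S.cf D \<in> {x. x \<noteq> 0}"
    proof (rule S.D_multiple_in[OF comm_ring_hom_mp_eval[OF comm_ring_hom_of_int]])
      show "mp_eval of_int S.cf (Var g) = S.cf g" for g by (simp add: comm_ring_hom_of_int)
    qed (auto simp: slot_code_inj)
    then show ?thesis by auto
  qed
  moreover have "mp_eval of_int S.cf D = 0" if "mp_eval of_int S.cf R = 0"
  proof -
    interpret h: comm_ring_hom "mp_eval of_int S.cf :: coef_ring \<Rightarrow> 'k" by (rule comm_ring_hom_mp_eval[OF comm_ring_hom_of_int])
    obtain Q where "D = R * Q" using R_dvd_D by (auto elim: dvdE)
    then show ?thesis using that by (simp add: h.hom_mult)
  qed
  ultimately have "poly P 0 \<noteq> 0" unfolding polyP by (auto simp: C_def)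
  then have "P \<noteq> 0" by auto
  \<comment> \<open>At this parameter form \<open>j0\<close> takes the value
    \<open>1 - v / v = 0\<close> at the zero belonging to \<kappa>. Distinct values \<open>v\<close>
    give distinct parameters.\<close>
  have root: "poly P (- inverse (v \<kappa>)) = 0" if \<kappa>: "\<kappa> \<in> choices S.J" for \<kappa>
    unfolding polyP R_zero_iff
  proof (intro exI[of _ "S.pt \<kappa>"] conjI allI impI)
    show "homogeneous_coords r l (S.pt \<kappa>)" unfolding homogeneous_coords_def
      using S.pt_0[OF \<kappa>] by (intro ballI bexI[of _ 0]) auto
    fix j assume j: "j \<le> n"
    let ?t = "- inverse (v \<kappa>)"
    have hyb: "ev_form S.cf j (mono_ev (S.pt \<kappa>)) = ev_form S.cf j (mono_ev (hyb 0 (S.pt \<kappa>) (S.pt \<kappa>)))"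
    proof (rule ev_form_cong)
      fix \<gamma> assume "\<gamma> \<in> mh_expos r l d"
      from mono_ev_hyb_0_eq[OF this, of "S.pt \<kappa>", OF S.pt_0[OF \<kappa>]]
      show "S.cf (j, \<gamma>) * mono_ev (S.pt \<kappa>) \<gamma> = S.cf (j, \<gamma>) * mono_ev (hyb 0 (S.pt \<kappa>) (S.pt \<kappa>)) \<gamma>" by simp
    qed
    show "ev_form (\<lambda>g. poly (C g) ?t) j (mono_ev (S.pt \<kappa>)) = 0"
    proof (cases "j = j0")
      case True
      have "ev_form (\<lambda>g. poly (C g) ?t) j0 (mono_ev (S.pt \<kappa>)) =
          ev_form S.cf j0 (mono_ev (S.pt \<kappa>)) + ?t * ev_form (\<lambda>g. Poly_Mapping.lookup gf (snd g)) j0 (mono_ev (S.pt \<kappa>))"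
        unfolding ev_form_def sum_distrib_left sum.distrib[symmetric]
        by (intro sum.cong refl) (simp add: C_def algebra_simps)
      also have "ev_form (\<lambda>g. Poly_Mapping.lookup gf (snd g)) j0 (mono_ev (S.pt \<kappa>)) = v \<kappa>"
        using ev_form_lookup[OF comm_ring_hom_ident keys_gf, of "\<lambda>g. Poly_Mapping.lookup gf (snd g)" j0 "S.pt \<kappa>"] ev_gf[OF \<kappa>] by simp
      also have "ev_form S.cf j0 (mono_ev (S.pt \<kappa>)) = 1" using hyb True S.ev_form_cf_j0_pt[OF \<kappa>] by simp
      finally show ?thesis using True v0[OF \<kappa>] by simp
    next
      case False
      then have jJ: "j \<in> S.J" using j by (auto simp: S.J_def)
      have "ev_form (\<lambda>g. poly (C g) ?t) j (mono_ev (S.pt \<kappa>)) = ev_form S.cf j (mono_ev (S.pt \<kappa>))"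
        using False by (intro ev_form_cong) (simp add: C_def)
      then show ?thesis using hyb S.ev_form_cf_pt[OF \<kappa> jJ] by simp
    qed
  qed
  have "inj_on (\<lambda>\<kappa>. - inverse (v \<kappa>)) (choices S.J)" using v_inj by (auto simp: inj_on_def)
  then have "N = card ((\<lambda>\<kappa>. - inverse (v \<kappa>)) ` choices S.J)" by (simp add: card_image S.card_choices)
  also have "\<dots> \<le> card {t. poly P t = 0}" using root poly_roots_finite[OF \<open>P \<noteq> 0\<close>] by (intro card_mono) auto
  also have "\<dots> \<le> degree P" by (rule poly_roots_degree[OF \<open>P \<noteq> 0\<close>])
  also have "\<dots> \<le> a" by fact
  finally show ?thesis .
qed

lemma D_eq_R: "D = R \<or> D = - R"
proof -
  obtain Q where Q: "D = R * Q" using R_dvd_D by (auto elim: dvdE)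
  have bd: "block_deg j \<mu> = 0" if \<mu>: "\<mu> \<in> Poly_Mapping.keys Q" for j \<mu>
  proof -
    have "block_scale j (R * Q) = monom (R * Q) (if j \<le> n then N else 0)" "R * Q \<noteq> 0"
      unfolding Q[symmetric] by (rule block_scale_D, rule D_nonzero)
    from block_scale_factor[OF this] obtain a e
      where ae: "block_scale j R = monom R a" "block_scale j Q = monom Q e" "a + e = (if j \<le> n then N else 0)"
      by blast
    \<comment> \<open>The degree of \<open>R\<close> in each form already exhausts that of
      \<open>D\<close>, so the cofactor involves no coefficient of any form.\<close>
    have "e = 0"
    proof (cases "j \<le> n")
      case True
      then show ?thesis using ae(3) block_degree_R[OF True ae(1)] by simp
    next
      case False
      then show ?thesis using ae(3) by simp
    qed
    then show ?thesis using block_scale_eq_monom[OF ae(2) \<mu>] by simp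
  qed
  have "\<mu> = 0" if \<mu>: "\<mu> \<in> Poly_Mapping.keys Q" for \<mu>
  proof (rule ccontr)
    assume "\<mu> \<noteq> 0"
    then have "Poly_Mapping.keys \<mu> \<noteq> {}" by simp
    then obtain g where g: "g \<in> Poly_Mapping.keys \<mu>" by blast
    have "block_deg (fst g) \<mu> = 0" by (rule bd[OF \<mu>])
    then have "Poly_Mapping.lookup \<mu> g = 0" using g unfolding block_deg_def by (auto simp: sum_eq_0_iff)
    then show False using g by (simp add: in_keys_iff)
  qed
  then have Qc: "Q = Poly_Mapping.single 0 (Poly_Mapping.lookup Q 0)"
    by (intro poly_mapping_eqI) (auto simp: lookup_single when_def in_keys_iff)
  define q where "q = Poly_Mapping.lookup Q 0"
  have "q \<noteq> 0" using Qc D_nonzero Q by (auto simp: q_def)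
  have "is_unit q"
  proof (rule ccontr)
    assume "\<not> is_unit q"
    then obtain p where p: "prime p" "p dvd q" using \<open>q \<noteq> 0\<close> prime_divisor_exists by blast
    then obtain q' where "q = p * q'" by (auto elim: dvdE)
    then have "D = Poly_Mapping.single 0 p * (R * Poly_Mapping.single 0 q')"
      using Q Qc by (simp add: q_def[symmetric] mult_single[of 0 p 0 q', simplified, symmetric] mult_ac)
    then show False using D_not_dvd_prime[OF p(1)] by (metis dvd_triv_left)
  qed
  then have "q = 1 \<or> q = -1" by auto
  then show ?thesis using Q Qc by (auto simp: q_def[symmetric] single_uminus)
qed

lemma total_deg_D: "total_deg D = (n + 1) * N"
proof -
  have deg: "(\<Sum>g\<in>Poly_Mapping.keys \<mu>. Poly_Mapping.lookup \<mu> g) = (n + 1) * N" if \<mu>: "\<mu> \<in> Poly_Mapping.keys D" for \<mu>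
  proof -
    have le: "fst g \<le> n" if g: "g \<in> Poly_Mapping.keys \<mu>" for g
    proof (rule ccontr)
      assume "\<not> fst g \<le> n"
      then have "block_deg (fst g) \<mu> = 0" using block_deg_D[OF \<mu>] by simp
      then have "Poly_Mapping.lookup \<mu> g = 0" using g unfolding block_deg_def by (auto simp: sum_eq_0_iff)
      then show False using g by (simp add: in_keys_iff)
    qed
    have "(\<Sum>g\<in>Poly_Mapping.keys \<mu>. Poly_Mapping.lookup \<mu> g) =
        (\<Sum>g\<in>Poly_Mapping.keys \<mu>. \<Sum>j\<le>n. if fst g = j then Poly_Mapping.lookup \<mu> g else 0)"
      using le by (intro sum.cong refl) simp
    also have "\<dots> = (\<Sum>j\<le>n. block_deg j \<mu>)" unfolding block_deg_def by (rule sum.swap)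
    also have "\<dots> = (n + 1) * N" using block_deg_D[OF \<mu>] by simp
    finally show ?thesis .
  qed
  have "Poly_Mapping.keys D \<noteq> {}" using D_nonzero by simp
  then have "(\<lambda>\<gamma>. \<Sum>v\<in>Poly_Mapping.keys \<gamma>. Poly_Mapping.lookup \<gamma> v) ` Poly_Mapping.keys D =
      (\<lambda>_. (n + 1) * N) ` Poly_Mapping.keys D"
    by (intro image_cong refl deg)
  also have "\<dots> = {(n + 1) * N}" using \<open>Poly_Mapping.keys D \<noteq> {}\<close> by (simp add: image_constant_conv)
  finally have "(\<lambda>\<gamma>. \<Sum>v\<in>Poly_Mapping.keys \<gamma>. Poly_Mapping.lookup \<gamma> v) ` Poly_Mapping.keys D = {(n + 1) * N}" .
  then show ?thesis by (simp add: total_deg_def)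
qed

lemma total_deg_R: "total_deg R = (n + 1) * N"
  using D_eq_R total_deg_D by (auto simp: total_deg_def)

end

theorem theorem6p13:
  fixes r n :: nat and l d \<pi> :: "nat \<Rightarrow> nat" and R :: coef_ring
  assumes "r \<ge> 1"
    and "\<And>k. k \<in> {1..r} \<Longrightarrow> l k > 0"
    and "\<And>k. k \<in> {1..r} \<Longrightarrow> d k > 0"
    and "n = (\<Sum>k=1..r. l k)"
    and "\<And>k. k \<in> {1..r} \<Longrightarrow> defect l d k = 0"
    and "\<pi> permutes {1..r}"
    and "is_multires TYPE('k::{alg_closed_field, field_char_0}) r l d R"
  shows
    "card (bez_index r l (deg_vec r l d (dual_perm r \<pi>))) = K0_dim TYPE('k) r l d (deg_vec r l d \<pi>) \<and>
     card (bez_index r l (deg_vec r l d \<pi>)) = K0_dim TYPE('k) r l d (deg_vec r l d \<pi>) \<and>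
     real (K0_dim TYPE('k) r l d (deg_vec r l d \<pi>)) =
       fact n / (\<Prod>k=1..r. fact (l k)) * (\<Prod>k=1..r. real (d k) ^ l k) \<and>
     real (K0_dim TYPE('k) r l d (deg_vec r l d \<pi>)) = real (total_deg R) / real (n + 1) \<and>
     (\<forall>\<alpha>s \<beta>s. distinct \<alpha>s \<and> set \<alpha>s = bez_index r l (deg_vec r l d (dual_perm r \<pi>)) \<and>
              distinct \<beta>s \<and> set \<beta>s = bez_index r l (deg_vec r l d \<pi>) \<longrightarrow>
        det (bez_matrix r l d \<pi> \<alpha>s \<beta>s) = R \<or> det (bez_matrix r l d \<pi> \<alpha>s \<beta>s) = - R)"
proof -
  note r_pos = assms(1) and l_pos = assms(2) and d_pos = assms(3) and n = assms(4) and defect = assms(5) and perm = assms(6)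
  interpret zero_defect r n l d \<pi>
    by unfold_locales (use l_pos d_pos n defect perm in auto)
  have K0: "K0_dim TYPE('k) r l d (deg_vec r l d \<pi>) = card bez_cols" by (rule K0_dim_eq)
  have formula: "real (card bez_cols) = fact n / (\<Prod>k=1..r. fact (l k)) * (\<Prod>k=1..r. real (d k) ^ l k)"
  proof -
    have "real (card bez_cols) * (\<Prod>k=1..r. fact (l k)) = fact n * (\<Prod>k=1..r. real (d k) ^ l k)"
      using arg_cong[OF card_bez(2), of real] by (simp add: of_nat_prod)
    moreover have "(\<Prod>k=1..r. fact (l k) :: real) \<noteq> 0" by simp
    ultimately show ?thesis by (simp add: field_simps)
  qed
  have comparison: "resultant_comparison r n l d \<pi> \<alpha>s \<beta>s TYPE('k) R"
    if "distinct \<alpha>s" "set \<alpha>s = bez_rows" "distinct \<beta>s" "set \<beta>s = bez_cols" for \<alpha>s \<beta>s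
  proof -
    interpret bez_square r n l d \<pi> \<alpha>s \<beta>s by (rule bez_squareI[OF that])
    show ?thesis by unfold_locales (rule assms(7))
  qed
  have degree: "real (card bez_cols) = real (total_deg R) / real (n + 1)"
  proof -
    \<comment> \<open>The degree of \<open>R\<close> does not mention an enumeration, so any one
      will do.\<close>
    obtain \<alpha>s \<beta>s where lists: "distinct \<alpha>s" "set \<alpha>s = bez_rows" "distinct \<beta>s" "set \<beta>s = bez_cols"
      using finite_distinct_list[OF finite_bez_rows] finite_distinct_list[OF finite_bez_cols] by metis
    interpret resultant_comparison r n l d \<pi> \<alpha>s \<beta>s "TYPE('k)" R by (rule comparison[OF lists])
    have "total_deg R = (n + 1) * card bez_cols"
      using total_deg_R card_bez_eq distinct_card[OF lists(1)] lists(2) by simp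
    then have "real (total_deg R) = real (n + 1) * real (card bez_cols)" by (simp only: of_nat_mult)
    then show ?thesis by (simp only: nonzero_mult_div_cancel_left of_nat_eq_0_iff)
  qed
  have "det (bez_matrix r l d \<pi> \<alpha>s \<beta>s) = R \<or> det (bez_matrix r l d \<pi> \<alpha>s \<beta>s) = - R"
    if lists: "distinct \<alpha>s" "set \<alpha>s = bez_rows" "distinct \<beta>s" "set \<beta>s = bez_cols" for \<alpha>s \<beta>s
  proof -
    interpret resultant_comparison r n l d \<pi> \<alpha>s \<beta>s "TYPE('k)" R by (rule comparison[OF lists])
    show ?thesis using D_eq_R by (simp add: D_def)
  qed
  then show ?thesis
    unfolding K0 using formula degree card_bez_eq unfolding bez_rows_def bez_cols_def by auto
qed

end
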